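(* The system of vectors $\psi^{(1)}_{\lambda,j}$, $\lambda\in\sigma_{pri}(H_1^{(l)})$, $j=1,2,\dots,m_\lambda$, forms a Riesz basis of the subspace $$\mathcal H_1^{(pri)}=\overline{\operatorname{span}\{\psi^{(1)}_{\lambda,j}:\lambda\in\sigma_{pri}(H_1^{(l)}),\ j=1,2,\dots,m_\lambda\}}\subset\mathcal H_1.$$
   Context: Setting. $\mathcal H_0,\mathcal H_1$ are separable Hilbert spaces; $A_0$, $A_1$ are (possibly unbounded) self-adjoint operators in $\mathcal H_0$, $\mathcal H_1$; $B_{01}:\mathcal H_1\to\mathcal H_0$ is bounded and $B_{10}=B_{01}^*$. $\mathbf H=\begin{pmatrix} A_0 & B_{01} \\ B_{10} & A_1 \end{pmatrix}$ is the self-adjoint operator in $\mathcal H=\mathcal H_0\oplus\mathcal H_1$ with domain $\mathcal D(A_0)\oplus\mathcal D(A_1)$. $E_0$ is the spectral measure of $A_0$, $E^0(\mu)=E_0((-\infty,\mu))$, and $K_B(\mu)=B_{10}E^0(\mu)B_{01}$. Spectral assumptions. There are finitely many pairwise disjoint open intervals $\Delta_k^0=(\mu_k^{(1)},\mu_k^{(2)})$, $k=1,\dots,m$ ($1\le m<\infty$, $-\infty\le\mu_1^{(1)}$, $\mu_m^{(2)}\le+\infty$), contained in the continuous spectrum $\sigma_c(A_0)$ (no eigenvalues of $A_0$ lie in them), with $\Delta_k^0\cap\sigma(A_1)\ne\emptyset$ for all $k$ and $\sigma(A_1)\cap\sigma'(A_0)=\emptyset$, where $\sigma'(A_0)=\sigma(A_0)\setminus\bigcup_{k=1}^m\Delta_k^0$.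 Analyticity assumptions. On each $\Delta_k^0$ the function $K_B(\mu)$ is differentiable in operator norm; $K_B'$ is continuous on $\overline{\Delta_k^0}$ and has an analytic continuation from $\Delta_k^0$ to a simply connected domain $D_k^-\subset\mathbb C^-$ whose boundary contains $\Delta_k^0$ (the $D_k^-$ are mutually disjoint for different $k$), hence also to $D_k^+=\{z:\bar z\in D_k^-\}$; the continuations are still denoted $K_B'$. At finite end points $\mu_k^{(i)}$, $\|K'_B(\mu)-K'_B(\mu_k^{(i)})\|\le C|\mu-\mu_k^{(i)}|^\gamma$ for $\mu\in D_k^\pm$, with some $C,\gamma>0$. Contours. For $l=(l_1,\dots,l_m)$, $l_k=\pm1$, put $D_l=\bigcup_kD_k^{l_k}$, where $D_k^{\pm1}=D_k^\pm$. A contour $\Gamma_l=\bigcup_k\Gamma_k^{l_k}$ consists of rectifiable Jordan curves $\Gamma_k^{l_k}$ in $D_k^{l_k}$ obtained by continuous deformation of $\Delta_k^0$ with the (finite) end points kept fixed, whose closures have no points in common with $\sigma_c(A_0)$ other than end points. The modified variation is $$\mathcal V_0(B,\Gamma_l)=\sup_{\{\delta_k\}}\sum_k\|B_{10}E_0(\delta_k\cap\sigma'(A_0))B_{01}\|+\int_{\Gamma_l}|d\mu|\,\|K_B'(\mu)\|,$$ the supremum over finite or countable partitions of $\sigma(A_0)$ into disjoint Borel sets. $\Gamma_l$ is $K_B$-bounded if $\mathcal V_0(B,\Gamma_l)<\infty$. $d_0(\Gamma_l)=\operatorname{dist}\{\sigma(A_1),\sigma'(A_0)\cup\Gamma_l\}$.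 The operators $X^{(l)},H_1^{(l)}$. For $Y$ in $\mathcal H_1$ with spectrum separated from $\sigma'(A_0)\cup\Gamma_l$, put $V_1(Y,\Gamma_l)=\int_{\sigma'(A_0)}B_{10}E_0(d\mu)B_{01}(Y-\mu)^{-1}+\int_{\Gamma_l}d\mu\,K_B'(\mu)(Y-\mu)^{-1}$. It is assumed that there is a $K_B$-bounded contour $\Gamma_l\subset D_l$ with $\mathcal V_0(B,\Gamma_l)<\frac14d_0^2(\Gamma_l)$ (by reflecting components in the real axis, such contours then exist for every $l$). Then $X=V_1(A_1+X,\Gamma_l)$ has a unique bounded solution $X^{(l)}$ with $\|X^{(l)}\|\le\frac{d_0(\Gamma_l)}2-\sqrt{\frac{d_0^2(\Gamma_l)}4-\mathcal V_0(B,\Gamma_l)}$; for fixed $l$ it is the same for all such contours. $H_1^{(l)}=A_1+X^{(l)}$. Real eigenvalues. $\sigma_{pri}(H_1^{(l)})$ is the set of all real isolated eigenvalues of $H_1^{(l)}$; this set and the corresponding eigenspaces are the same for all $l$, and each such $\lambda$ lies in the resolvent set $\rho(A_0)$ or in some $\Delta_k^0$. For $\lambda\in\sigma_{pri}(H_1^{(l)})$, $m_\lambda\le\infty$ is its multiplicity (geometric and algebraic multiplicities coincide), and $\psi^{(1)}_{\lambda,j}$, $j=1,\dots,m_\lambda$, are eigenvectors of $H_1^{(l)}$ for $\lambda$ spanning the eigenspace. Put $\psi^{(0)}_{\lambda,j}=-(A_0-\lambda)^{-1}B_{01}\psi^{(1)}_{\lambda,j}$ (this exists in $\mathcal D(A_0)$)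 and $\Psi_{\lambda,j}=(\psi^{(0)}_{\lambda,j},\psi^{(1)}_{\lambda,j})$, an eigenvector of $\mathbf H$ for $\lambda$. The $\psi^{(1)}_{\lambda,j}$ are chosen so that the $\Psi_{\lambda,j}$ are orthonormal: $\langle\Psi_{\lambda,j},\Psi_{\lambda',j'}\rangle=\delta_{\lambda\lambda'}\delta_{jj'}$.
   Formalization: Where an interval has an infinite end point, the continuous deformation into the contour is also required to tend to infinity there and to have negligible closing arcs (integrals of |dμ| ‖K_B'(μ)‖/(1+|μ|) tend to 0 along some sequence of them). *)

theory Defs
  imports "HOL-Analysis.Analysis"
begin

section \<open>Complex Hilbert spaces\<close>

(* The norm and the topology are those of the real inner product Re <x, y>;
   cinner is linear in its first argument. *)
class chilbert_space = real_inner + banach +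
  fixes scaleC :: "complex \<Rightarrow> 'a \<Rightarrow> 'a"  (infixr \<open>*\<^sub>C\<close> 75)
    and cinner :: "'a \<Rightarrow> 'a \<Rightarrow> complex"
  assumes scaleC_of_real: "complex_of_real r *\<^sub>C x = r *\<^sub>R x"
    and scaleC_scaleC: "c *\<^sub>C (d *\<^sub>C x) = (c * d) *\<^sub>C x"
    and scaleC_add_left: "(c + d) *\<^sub>C x = c *\<^sub>C x + d *\<^sub>C x"
    and scaleC_add_right: "c *\<^sub>C (x + y) = c *\<^sub>C x + c *\<^sub>C y"
    and cinner_commute: "cinner x y = cnj (cinner y x)"
    and cinner_add_left: "cinner (x + y) z = cinner x z + cinner y z"
    and cinner_scaleC_left: "cinner (c *\<^sub>C x) y = c * cinner x y"
    and Re_cinner: "Re (cinner x y) = inner x y"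

lemma vector_space_scaleC: "vector_space (scaleC :: complex \<Rightarrow> 'a::chilbert_space \<Rightarrow> 'a)"
proof
  show "1 *\<^sub>C x = x" for x :: 'a
    using scaleC_of_real[of 1 x] by simp
qed (simp_all add: scaleC_scaleC scaleC_add_left scaleC_add_right)

lemma cinner_scaleC_right: "cinner x (c *\<^sub>C y) = cnj c * cinner x y"
  by (metis cinner_commute cinner_scaleC_left complex_cnj_mult)

lemma cinner_self: "cinner x x = complex_of_real ((norm x)\<^sup>2)"
proof (rule complex_eqI)
  show "Re (cinner x x) = Re (complex_of_real ((norm x)\<^sup>2))"
    by (simp add: Re_cinner dot_square_norm)
  have "Im (cinner x x) = - Im (cinner x x)"
    using arg_cong[OF cinner_commute[of x x], of Im] by simp
  then show "Im (cinner x x) = Im (complex_of_real ((norm x)\<^sup>2))"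
    by simp
qed

lemma norm_scaleC: "norm (c *\<^sub>C x) = cmod c * norm x"
proof -
  have "complex_of_real ((norm (c *\<^sub>C x))\<^sup>2) = c * cnj c * complex_of_real ((norm x)\<^sup>2)"
    by (simp only: cinner_self[symmetric] cinner_scaleC_left cinner_scaleC_right mult_ac)
  also have "\<dots> = complex_of_real ((cmod c * norm x)\<^sup>2)"
    by (simp only: power_mult_distrib of_real_mult complex_norm_square)
  finally have "(norm (c *\<^sub>C x))\<^sup>2 = (cmod c * norm x)\<^sup>2"
    using of_real_eq_iff by blast
  then show ?thesis
    by (simp add: power2_eq_iff_nonneg)
qed

instantiation prod :: (chilbert_space, chilbert_space) chilbert_space
begin

definition scaleC_prod_def: "scaleC c p = (c *\<^sub>C fst p, c *\<^sub>C snd p)"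

definition cinner_prod_def: "cinner p q = cinner (fst p) (fst q) + cinner (snd p) (snd q)"

instance
proof
  fix p q r :: "'a \<times> 'b" and c d :: complex and t :: real
  show "complex_of_real t *\<^sub>C p = t *\<^sub>R p"
    by (simp add: scaleC_prod_def scaleR_prod_def scaleC_of_real)
  show "c *\<^sub>C (d *\<^sub>C p) = (c * d) *\<^sub>C p"
    by (simp add: scaleC_prod_def scaleC_scaleC)
  show "(c + d) *\<^sub>C p = c *\<^sub>C p + d *\<^sub>C p"
    by (simp add: scaleC_prod_def scaleC_add_left)
  show "c *\<^sub>C (p + q) = c *\<^sub>C p + c *\<^sub>C q"
    by (simp add: scaleC_prod_def scaleC_add_right)
  show "cinner p q = cnj (cinner q p)"
    unfolding cinner_prod_def complex_cnj_add
    using cinner_commute[of "fst p" "fst q"] cinner_commute[of "snd p" "snd q"] by simp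
  show "cinner (p + q) r = cinner p r + cinner q r"
    by (simp add: cinner_prod_def cinner_add_left)
  show "cinner (c *\<^sub>C p) q = c * cinner p q"
    by (simp add: cinner_prod_def scaleC_prod_def cinner_scaleC_left distrib_left)
  show "Re (cinner p q) = inner p q"
    by (simp add: cinner_prod_def inner_prod_def Re_cinner)
qed

end

abbreviation cspan :: "'a::chilbert_space set \<Rightarrow> 'a set"
  where "cspan \<equiv> module.span scaleC"

abbreviation csubspace :: "'a::chilbert_space set \<Rightarrow> bool"
  where "csubspace \<equiv> module.subspace scaleC"

abbreviation cdependent :: "'a::chilbert_space set \<Rightarrow> bool"
  where "cdependent \<equiv> module.dependent scaleC"

section \<open>Bounded operators\<close>

(* Bounded operators are elements of the real type of bounded linear maps that commute with
   scaleC; the norm of that type is the operator norm. *)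
definition clinear_op :: "('a::chilbert_space \<Rightarrow>\<^sub>L 'b::chilbert_space) \<Rightarrow> bool"
  where "clinear_op T \<longleftrightarrow> (\<forall>c x. T (c *\<^sub>C x) = c *\<^sub>C T x)"

definition is_adjoint ::
  "('a::chilbert_space \<Rightarrow>\<^sub>L 'b::chilbert_space) \<Rightarrow> ('b \<Rightarrow>\<^sub>L 'a) \<Rightarrow> bool"
  where "is_adjoint T S \<longleftrightarrow> (\<forall>x y. cinner (T x) y = cinner x (S y))"

definition cscale_op ::
  "complex \<Rightarrow> ('a::chilbert_space \<Rightarrow>\<^sub>L 'b::chilbert_space) \<Rightarrow> ('a \<Rightarrow>\<^sub>L 'b)"
  where "cscale_op c T = Blinfun (\<lambda>x. c *\<^sub>C T x)"

lemma cscale_op_apply: "cscale_op c T x = c *\<^sub>C T x"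
proof -
  have "bounded_linear (\<lambda>x. c *\<^sub>C T x)"
  proof (rule bounded_linear_intro[where K = "cmod c * norm T"])
    show "c *\<^sub>C T (x + y) = c *\<^sub>C T x + c *\<^sub>C T y" for x y
      by (simp add: blinfun.add_right scaleC_add_right)
    show "c *\<^sub>C T (r *\<^sub>R x) = r *\<^sub>R (c *\<^sub>C T x)" for r x
      unfolding blinfun.scaleR_right by (simp add: scaleC_scaleC mult.commute flip: scaleC_of_real)
    show "norm (c *\<^sub>C T x) \<le> norm x * (cmod c * norm T)" for x
      using mult_left_mono[OF norm_blinfun[of T x], of "cmod c"]
      by (simp add: norm_scaleC mult_ac)
  qed
  then show ?thesis
    by (simp add: cscale_op_def bounded_linear_Blinfun_apply)
qed

(* Complex differentiability in the operator norm, near every point of S (cf. analytic_on). *)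
definition op_analytic_on ::
  "(complex \<Rightarrow> ('a::chilbert_space \<Rightarrow>\<^sub>L 'b::chilbert_space)) \<Rightarrow> complex set \<Rightarrow> bool"
  where "op_analytic_on F S \<longleftrightarrow>
    (\<forall>z\<in>S. \<exists>e>0. \<forall>w\<in>ball z e. \<exists>D. (F has_derivative (\<lambda>h. cscale_op h D)) (at w))"

section \<open>Unbounded operators\<close>

(* Values of op_app outside op_dom are irrelevant. *)
datatype 'a lop = Lop (op_dom: "'a set") (op_app: "'a \<Rightarrow> 'a")

definition adjoint_graph :: "'a::chilbert_space lop \<Rightarrow> ('a \<times> 'a) set"
  where "adjoint_graph A =
    {(y, z). \<forall>x\<in>op_dom A. cinner (op_app A x) y = cinner x z}"

definition self_adjoint :: "'a::chilbert_space lop \<Rightarrow> bool"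
  where "self_adjoint A \<longleftrightarrow>
    csubspace (op_dom A) \<and> closure (op_dom A) = UNIV \<and>
    (\<forall>x\<in>op_dom A. \<forall>y\<in>op_dom A. op_app A (x + y) = op_app A x + op_app A y) \<and>
    (\<forall>c. \<forall>x\<in>op_dom A. op_app A (c *\<^sub>C x) = c *\<^sub>C op_app A x) \<and>
    adjoint_graph A = {(x, op_app A x) | x. x \<in> op_dom A}"

definition op_plus :: "'a::chilbert_space lop \<Rightarrow> ('a \<Rightarrow>\<^sub>L 'a) \<Rightarrow> 'a lop"
  where "op_plus A X = Lop (op_dom A) (\<lambda>x. op_app A x + X x)"

definition is_resolvent :: "'a::chilbert_space lop \<Rightarrow> complex \<Rightarrow> ('a \<Rightarrow>\<^sub>L 'a) \<Rightarrow> bool"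
  where "is_resolvent A z R \<longleftrightarrow>
    (\<forall>y. R y \<in> op_dom A \<and> op_app A (R y) - z *\<^sub>C R y = y) \<and>
    (\<forall>x\<in>op_dom A. R (op_app A x - z *\<^sub>C x) = x)"

(* The bounded operator (A - z)^{-1}, for z in the resolvent set. *)
definition resolvent :: "'a::chilbert_space lop \<Rightarrow> complex \<Rightarrow> ('a \<Rightarrow>\<^sub>L 'a)"
  where "resolvent A z = (THE R. is_resolvent A z R)"

definition spectrum :: "'a::chilbert_space lop \<Rightarrow> complex set"
  where "spectrum A = {z. \<not> (\<exists>R. is_resolvent A z R)}"

definition real_spectrum :: "'a::chilbert_space lop \<Rightarrow> real set"
  where "real_spectrum A = {x. complex_of_real x \<in> spectrum A}"

definition eigenspace :: "'a::chilbert_space lop \<Rightarrow> complex \<Rightarrow> 'a set"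
  where "eigenspace A z = {x \<in> op_dom A. op_app A x = z *\<^sub>C x}"

definition continuous_spectrum :: "'a::chilbert_space lop \<Rightarrow> complex set"
  where "continuous_spectrum A =
    {z \<in> spectrum A. eigenspace A z = {0} \<and>
       closure ((\<lambda>x. op_app A x - z *\<^sub>C x) ` op_dom A) = UNIV}"

(* (A - z)^{-1} y, for A - z injective (but not necessarily onto) and y in the range of A - z. *)
definition inverse_apply :: "'a::chilbert_space lop \<Rightarrow> complex \<Rightarrow> 'a \<Rightarrow> 'a"
  where "inverse_apply A z y = (THE x. x \<in> op_dom A \<and> op_app A x - z *\<^sub>C x = y)"

definition multiplicity :: "'a::chilbert_space lop \<Rightarrow> complex \<Rightarrow> enat"
  where "multiplicity A z =
    (SUP F \<in> {F. finite F \<and> F \<subseteq> eigenspace A z \<and> \<not> cdependent F}. enat (card F))"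

definition sigma_pri :: "'a::chilbert_space lop \<Rightarrow> real set"
  where "sigma_pri A =
    {x. eigenspace A (complex_of_real x) \<noteq> {0} \<and> complex_of_real x isolated_in spectrum A}"

definition mult_index :: "'a::chilbert_space lop \<Rightarrow> real \<Rightarrow> nat set"
  where "mult_index A x = {j. 1 \<le> j \<and> enat j \<le> multiplicity A (complex_of_real x)}"

section \<open>Spectral measures\<close>

definition projection_valued_measure ::
  "(real set \<Rightarrow> ('a::chilbert_space \<Rightarrow>\<^sub>L 'a)) \<Rightarrow> bool"
  where "projection_valued_measure E \<longleftrightarrow>
    (\<forall>S\<in>sets borel. is_adjoint (E S) (E S) \<and> E S o\<^sub>L E S = E S) \<and>
    E UNIV = id_blinfun \<and>
    (\<forall>d :: nat \<Rightarrow> real set. range d \<subseteq> sets borel \<longrightarrow> disjoint_family d \<longrightarrow>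
       (\<forall>x. (\<lambda>n. E (d n) x) sums E (\<Union>n. d n) x))"

definition scalar_measure ::
  "(real set \<Rightarrow> ('a::chilbert_space \<Rightarrow>\<^sub>L 'a)) \<Rightarrow> 'a \<Rightarrow> real measure"
  where "scalar_measure E x =
    measure_of UNIV (sets borel) (\<lambda>S. ennreal (Re (cinner (E S x) x)))"

(* A is the integral of t with respect to E(dt), written for the quadratic forms
   (the operator is then determined by polarization). *)
definition spectral_measure_of ::
  "'a::chilbert_space lop \<Rightarrow> (real set \<Rightarrow> ('a \<Rightarrow>\<^sub>L 'a)) \<Rightarrow> bool"
  where "spectral_measure_of A E \<longleftrightarrow>
    projection_valued_measure E \<and>
    op_dom A = {x. (\<integral>\<^sup>+t. ennreal (t\<^sup>2) \<partial>scalar_measure E x) < \<infinity>} \<and>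
    (\<forall>x\<in>op_dom A.
       cinner (op_app A x) x = complex_of_real (\<integral>t. t \<partial>scalar_measure E x))"

section \<open>Operator-valued integrals\<close>

(* The integral of M(d mu) F(mu) over S in the operator norm: the limit of the Riemann sums
   over countable Borel partitions of S as the mesh tends to 0.  Finite partitions are padded
   with empty sets. *)
definition has_measure_integral ::
  "(real set \<Rightarrow> ('b::chilbert_space \<Rightarrow>\<^sub>L 'c::chilbert_space)) \<Rightarrow>
   (real \<Rightarrow> ('a::chilbert_space \<Rightarrow>\<^sub>L 'b)) \<Rightarrow> ('a \<Rightarrow>\<^sub>L 'c) \<Rightarrow> real set \<Rightarrow> bool"
  where "has_measure_integral M F T S \<longleftrightarrow>
    (\<forall>e>0. \<exists>r>0. \<forall>(d :: nat \<Rightarrow> real set) \<xi>.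
       range d \<subseteq> sets borel \<longrightarrow> disjoint_family d \<longrightarrow> (\<Union>n. d n) = S \<longrightarrow>
       (\<forall>n. \<forall>x\<in>d n. \<forall>y\<in>d n. dist x y < r) \<longrightarrow>
       (\<forall>n. d n \<noteq> {} \<longrightarrow> \<xi> n \<in> d n) \<longrightarrow>
       (\<exists>U. (\<lambda>n. M (d n) o\<^sub>L F (\<xi> n)) sums U \<and> norm (U - T) < e))"

(* Riemann-Stieltjes integral over [a, b]: the limit, as the mesh tends to 0, of the sums of
   f t u v over the pieces [u, v] with tags t of a tagged division. *)
definition has_RS_integral ::
  "(real \<Rightarrow> real \<Rightarrow> real \<Rightarrow> 'a::real_normed_vector) \<Rightarrow> 'a \<Rightarrow> real \<Rightarrow> real \<Rightarrow> bool"
  where "has_RS_integral f I a b \<longleftrightarrow>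
    (\<forall>e>0. \<exists>r>0. \<forall>p. p tagged_division_of {a..b} \<longrightarrow> (\<lambda>t. ball t r) fine p \<longrightarrow>
       norm ((\<Sum>(t, K)\<in>p. f t (Inf K) (Sup K)) - I) < e)"

(* The integral of G(mu) d mu along the open arc g : (0, 1) -> C. *)
definition has_arc_integral ::
  "(real \<Rightarrow> complex) \<Rightarrow> (complex \<Rightarrow> ('a::chilbert_space \<Rightarrow>\<^sub>L 'b::chilbert_space)) \<Rightarrow>
   ('a \<Rightarrow>\<^sub>L 'b) \<Rightarrow> bool"
  where "has_arc_integral g G I \<longleftrightarrow>
    (\<exists>P. (\<forall>a b. 0 < a \<and> a < b \<and> b < 1 \<longrightarrow>
            has_RS_integral (\<lambda>t u v. cscale_op (g v - g u) (G (g t))) (P a b) a b) \<and>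
         ((\<lambda>(a, b). P a b) \<longlongrightarrow> I) (at_right 0 \<times>\<^sub>F at_left 1))"

(* The integral of |d mu| f(mu), f >= 0, along the open arc g : (0, 1) -> C. *)
definition arc_length_integral :: "(real \<Rightarrow> complex) \<Rightarrow> (complex \<Rightarrow> real) \<Rightarrow> ennreal"
  where "arc_length_integral g f =
    (SUP (a, b) \<in> {(a, b). 0 < a \<and> a < b \<and> b < 1}.
       ennreal (THE I. has_RS_integral (\<lambda>t u v. dist (g u) (g v) * f (g t)) I a b))"

section \<open>The spectral and analyticity assumptions\<close>

definition Delta :: "(nat \<Rightarrow> ereal) \<Rightarrow> (nat \<Rightarrow> ereal) \<Rightarrow> nat \<Rightarrow> real set"
  where "Delta \<mu>1 \<mu>2 k = {x. \<mu>1 k < ereal x \<and> ereal x < \<mu>2 k}"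

definition sigma' ::
  "'a::chilbert_space lop \<Rightarrow> nat \<Rightarrow> (nat \<Rightarrow> ereal) \<Rightarrow> (nat \<Rightarrow> ereal) \<Rightarrow> real set"
  where "sigma' A0 m \<mu>1 \<mu>2 = real_spectrum A0 - (\<Union>k\<in>{1..m}. Delta \<mu>1 \<mu>2 k)"

definition spectral_assumptions ::
  "'a::chilbert_space lop \<Rightarrow> 'b::chilbert_space lop \<Rightarrow> nat \<Rightarrow> (nat \<Rightarrow> ereal) \<Rightarrow>
   (nat \<Rightarrow> ereal) \<Rightarrow> bool"
  where "spectral_assumptions A0 A1 m \<mu>1 \<mu>2 \<longleftrightarrow>
    1 \<le> m \<and> disjoint_family_on (Delta \<mu>1 \<mu>2) {1..m} \<and>
    (\<forall>k\<in>{1..m}. complex_of_real ` Delta \<mu>1 \<mu>2 k \<subseteq> continuous_spectrum A0 \<and>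
       Delta \<mu>1 \<mu>2 k \<inter> real_spectrum A1 \<noteq> {}) \<and>
    real_spectrum A1 \<inter> sigma' A0 m \<mu>1 \<mu>2 = {}"

definition K_B ::
  "('a::chilbert_space \<Rightarrow>\<^sub>L 'b::chilbert_space) \<Rightarrow> (real set \<Rightarrow> ('a \<Rightarrow>\<^sub>L 'a)) \<Rightarrow>
   ('b \<Rightarrow>\<^sub>L 'a) \<Rightarrow> real \<Rightarrow> ('b \<Rightarrow>\<^sub>L 'b)"
  where "K_B B10 E0 B01 \<mu> = B10 o\<^sub>L E0 {..<\<mu>} o\<^sub>L B01"

(* Dm k is the domain in the lower half-plane, cnj ` Dm k its reflection.  K' k denotes the
   derivative of K_B on the k-th interval together with its continuations and its boundary
   values at the finite end points; it is indexed by k because at a common end point of two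
   intervals these boundary values need not agree. *)
definition analyticity_assumptions ::
  "(real \<Rightarrow> ('b::chilbert_space \<Rightarrow>\<^sub>L 'b)) \<Rightarrow> nat \<Rightarrow> (nat \<Rightarrow> ereal) \<Rightarrow> (nat \<Rightarrow> ereal) \<Rightarrow>
   (nat \<Rightarrow> complex set) \<Rightarrow> (nat \<Rightarrow> complex \<Rightarrow> ('b \<Rightarrow>\<^sub>L 'b)) \<Rightarrow> bool"
  where "analyticity_assumptions KB m \<mu>1 \<mu>2 Dm K' \<longleftrightarrow>
    disjoint_family_on Dm {1..m} \<and>
    (\<forall>k\<in>{1..m}.
       open (Dm k) \<and> connected (Dm k) \<and> simply_connected (Dm k) \<and>
       Dm k \<subseteq> {z. Im z < 0} \<and>
       complex_of_real ` Delta \<mu>1 \<mu>2 k \<subseteq> frontier (Dm k) \<and>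
       (\<forall>\<mu>\<in>Delta \<mu>1 \<mu>2 k. (KB has_vector_derivative K' k (complex_of_real \<mu>)) (at \<mu>)) \<and>
       continuous_on (closure (Delta \<mu>1 \<mu>2 k)) (\<lambda>\<mu>. K' k (complex_of_real \<mu>)) \<and>
       op_analytic_on (K' k) (Dm k \<union> complex_of_real ` Delta \<mu>1 \<mu>2 k \<union> cnj ` Dm k) \<and>
       (\<forall>p. ereal p \<in> {\<mu>1 k, \<mu>2 k} \<longrightarrow>
          (\<exists>C>0. \<exists>\<gamma>>0. \<forall>\<mu>\<in>Dm k \<union> cnj ` Dm k.
             norm (K' k \<mu> - K' k (complex_of_real p))
               \<le> C * cmod (\<mu> - complex_of_real p) powr \<gamma>)))"

section \<open>Contours\<close>

definition D_sheet :: "(nat \<Rightarrow> complex set) \<Rightarrow> (nat \<Rightarrow> int) \<Rightarrow> nat \<Rightarrow> complex set"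
  where "D_sheet Dm l k = (if l k = 1 then cnj ` Dm k else Dm k)"

definition arc_image :: "(real \<Rightarrow> complex) \<Rightarrow> complex set"
  where "arc_image g = g ` {0<..<1}"

definition contour_image :: "nat \<Rightarrow> (nat \<Rightarrow> real \<Rightarrow> complex) \<Rightarrow> complex set"
  where "contour_image m \<Gamma> = (\<Union>k\<in>{1..m}. arc_image (\<Gamma> k))"

definition length_le :: "(real \<Rightarrow> complex) \<Rightarrow> real set \<Rightarrow> real \<Rightarrow> bool"
  where "length_le g S L \<longleftrightarrow>
    (\<forall>n (t :: nat \<Rightarrow> real). (\<forall>i\<le>n. t i \<in> S) \<longrightarrow> (\<forall>i<n. t i \<le> t (Suc i)) \<longrightarrow>
       (\<Sum>i<n. dist (g (t i)) (g (t (Suc i)))) \<le> L)"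

(* For an arc with finite end points this is finiteness of its length; an arc going to infinity
   has finite length in every bounded region. *)
definition rectifiable_arc :: "(real \<Rightarrow> complex) \<Rightarrow> bool"
  where "rectifiable_arc g \<longleftrightarrow>
    (\<forall>S. S \<subseteq> {0<..<1} \<longrightarrow> bounded (g ` S) \<longrightarrow> (\<exists>L. length_le g S L))"

definition end_filter :: "ereal \<Rightarrow> complex filter"
  where "end_filter p =
    (if \<bar>p\<bar> = \<infinity> then at_infinity else nhds (complex_of_real (real_of_ereal p)))"

(* The transversals s |-> h (s, t) of a deformation h, which join the initial interval to the
   final arc, do not contribute in the limit along G to contour integrals of F(mu)/(z - mu). *)
definition negligible_transversals ::
  "(complex \<Rightarrow> ('a::chilbert_space \<Rightarrow>\<^sub>L 'a)) \<Rightarrow> (real \<times> real \<Rightarrow> complex) \<Rightarrow>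
   real filter \<Rightarrow> bool"
  where "negligible_transversals F h G \<longleftrightarrow>
    (\<forall>e>0. \<exists>\<^sub>F t in G. \<exists>I<e.
       has_RS_integral (\<lambda>s u v. dist (h (u, t)) (h (v, t)) *
         (norm (F (h (s, t))) / (1 + cmod (h (s, t))))) I 0 1)"

(* Continuous deformation of the interval (a, b) into the arc g inside D.  Finite end points
   are kept fixed.  At an infinite end point "keeping the end point fixed" is not a condition on
   finite points, so the deformation is required to stay near infinity there and, as usual when
   a contour through infinity is deformed, to have negligible closing arcs: otherwise
   integrals of F(mu)/(z - mu) over the interval and over g could differ.  The last
   two conditions are void for finite end points. *)
definition deformation_of ::
  "(complex \<Rightarrow> ('a::chilbert_space \<Rightarrow>\<^sub>L 'a)) \<Rightarrow> ereal \<Rightarrow> ereal \<Rightarrow> complex set \<Rightarrow>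
   (real \<Rightarrow> complex) \<Rightarrow> bool"
  where "deformation_of F a b D g \<longleftrightarrow>
    (\<exists>h p. continuous_on ({0..1} \<times> {0<..<1}) h \<and>
       strict_mono_on {0<..<1} p \<and> p ` {0<..<1} = {x. a < ereal x \<and> ereal x < b} \<and>
       (\<forall>t\<in>{0<..<1}. h (0, t) = complex_of_real (p t)) \<and>
       (\<forall>t\<in>{0<..<1}. h (1, t) = g t) \<and>
       (\<forall>s\<in>{0<..1}. \<forall>t\<in>{0<..<1}. h (s, t) \<in> D) \<and>
       filterlim h (end_filter a) (principal {0..1} \<times>\<^sub>F at_right 0) \<and>
       filterlim h (end_filter b) (principal {0..1} \<times>\<^sub>F at_left 1) \<and>
       (\<bar>a\<bar> = \<infinity> \<longrightarrow> negligible_transversals F h (at_right 0)) \<and>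
       (\<bar>b\<bar> = \<infinity> \<longrightarrow> negligible_transversals F h (at_left 1)))"

definition is_contour ::
  "'a::chilbert_space lop \<Rightarrow> nat \<Rightarrow> (nat \<Rightarrow> ereal) \<Rightarrow> (nat \<Rightarrow> ereal) \<Rightarrow> (nat \<Rightarrow> complex set) \<Rightarrow>
   (nat \<Rightarrow> complex \<Rightarrow> ('b::chilbert_space \<Rightarrow>\<^sub>L 'b)) \<Rightarrow> (nat \<Rightarrow> int) \<Rightarrow>
   (nat \<Rightarrow> real \<Rightarrow> complex) \<Rightarrow> bool"
  where "is_contour A0 m \<mu>1 \<mu>2 Dm K' l \<Gamma> \<longleftrightarrow>
    (\<forall>k\<in>{1..m}.
       continuous_on {0<..<1} (\<Gamma> k) \<and> inj_on (\<Gamma> k) {0<..<1} \<and> rectifiable_arc (\<Gamma> k) \<and>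
       deformation_of (K' k) (\<mu>1 k) (\<mu>2 k) (D_sheet Dm l k) (\<Gamma> k) \<and>
       closure (arc_image (\<Gamma> k)) \<inter> continuous_spectrum A0
         \<subseteq> {complex_of_real x | x. ereal x \<in> {\<mu>1 k, \<mu>2 k}})"

(* As for has_measure_integral, finite partitions are padded with empty sets. *)
definition modified_variation ::
  "'a::chilbert_space lop \<Rightarrow> (real set \<Rightarrow> ('a \<Rightarrow>\<^sub>L 'a)) \<Rightarrow> ('b::chilbert_space \<Rightarrow>\<^sub>L 'a) \<Rightarrow>
   ('a \<Rightarrow>\<^sub>L 'b) \<Rightarrow> nat \<Rightarrow> (nat \<Rightarrow> ereal) \<Rightarrow> (nat \<Rightarrow> ereal) \<Rightarrow>
   (nat \<Rightarrow> complex \<Rightarrow> ('b \<Rightarrow>\<^sub>L 'b)) \<Rightarrow> (nat \<Rightarrow> real \<Rightarrow> complex) \<Rightarrow> ennreal"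
  where "modified_variation A0 E0 B01 B10 m \<mu>1 \<mu>2 K' \<Gamma> =
    (SUP d \<in> {d :: nat \<Rightarrow> real set. range d \<subseteq> sets borel \<and> disjoint_family d \<and>
                (\<Union>n. d n) = real_spectrum A0}.
       \<Sum>n. ennreal (norm (B10 o\<^sub>L E0 (d n \<inter> sigma' A0 m \<mu>1 \<mu>2) o\<^sub>L B01))) +
    (\<Sum>k\<in>{1..m}. arc_length_integral (\<Gamma> k) (\<lambda>\<mu>. norm (K' k \<mu>)))"

definition dist0 ::
  "'a::chilbert_space lop \<Rightarrow> 'b::chilbert_space lop \<Rightarrow> nat \<Rightarrow> (nat \<Rightarrow> ereal) \<Rightarrow>
   (nat \<Rightarrow> ereal) \<Rightarrow> (nat \<Rightarrow> real \<Rightarrow> complex) \<Rightarrow> real"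
  where "dist0 A0 A1 m \<mu>1 \<mu>2 \<Gamma> =
    setdist (spectrum A1) (complex_of_real ` sigma' A0 m \<mu>1 \<mu>2 \<union> contour_image m \<Gamma>)"

section \<open>The basic equation\<close>

(* V_1(Y, Gamma) is defined and equal to T. *)
definition has_V1 ::
  "'a::chilbert_space lop \<Rightarrow> (real set \<Rightarrow> ('a \<Rightarrow>\<^sub>L 'a)) \<Rightarrow> ('b::chilbert_space \<Rightarrow>\<^sub>L 'a) \<Rightarrow>
   ('a \<Rightarrow>\<^sub>L 'b) \<Rightarrow> nat \<Rightarrow> (nat \<Rightarrow> ereal) \<Rightarrow> (nat \<Rightarrow> ereal) \<Rightarrow>
   (nat \<Rightarrow> complex \<Rightarrow> ('b \<Rightarrow>\<^sub>L 'b)) \<Rightarrow> (nat \<Rightarrow> real \<Rightarrow> complex) \<Rightarrow>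
   'b lop \<Rightarrow> ('b \<Rightarrow>\<^sub>L 'b) \<Rightarrow> bool"
  where "has_V1 A0 E0 B01 B10 m \<mu>1 \<mu>2 K' \<Gamma> Y T \<longleftrightarrow>
    (\<exists>r>0. \<forall>z\<in>spectrum Y.
       \<forall>w\<in>complex_of_real ` sigma' A0 m \<mu>1 \<mu>2 \<union> contour_image m \<Gamma>. r \<le> dist z w) \<and>
    (\<exists>T0 Tk.
       has_measure_integral (\<lambda>d. B10 o\<^sub>L E0 d o\<^sub>L B01)
         (\<lambda>\<mu>. resolvent Y (complex_of_real \<mu>)) T0 (sigma' A0 m \<mu>1 \<mu>2) \<and>
       (\<forall>k\<in>{1..m}. has_arc_integral (\<Gamma> k) (\<lambda>\<mu>. K' k \<mu> o\<^sub>L resolvent Y \<mu>) (Tk k)) \<and>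
       T = T0 + (\<Sum>k\<in>{1..m}. Tk k))"

section \<open>Riesz bases\<close>

definition orthonormal_on :: "'i set \<Rightarrow> ('i \<Rightarrow> 'a::chilbert_space) \<Rightarrow> bool"
  where "orthonormal_on I e \<longleftrightarrow>
    (\<forall>i\<in>I. \<forall>j\<in>I. cinner (e i) (e j) = (if i = j then 1 else 0))"

definition orthonormal_basis_of :: "'i set \<Rightarrow> ('i \<Rightarrow> 'a::chilbert_space) \<Rightarrow> 'a set \<Rightarrow> bool"
  where "orthonormal_basis_of I e M \<longleftrightarrow> orthonormal_on I e \<and> closure (cspan (e ` I)) = M"

(* The image of an orthonormal basis of the closed subspace M under a bounded operator on M
   with bounded inverse; T and S are extensions of that operator and its inverse to the whole
   space, which always exist. *)
definition riesz_basis_of :: "'i set \<Rightarrow> ('i \<Rightarrow> 'a::chilbert_space) \<Rightarrow> 'a set \<Rightarrow> bool"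
  where "riesz_basis_of I f M \<longleftrightarrow>
    (\<exists>e T S. orthonormal_basis_of I e M \<and> clinear_op T \<and> clinear_op S \<and>
       blinfun_apply T ` M \<subseteq> M \<and> blinfun_apply S ` M \<subseteq> M \<and>
       (\<forall>x\<in>M. S (T x) = x \<and> T (S x) = x) \<and>
       (\<forall>i\<in>I. f i = T (e i)))"

section \<open>The vectors of the whole space\<close>

(* The H_0-component - (A0 - lam)^{-1} B01 x, paired with x. *)
definition lift_vector ::
  "'a::chilbert_space lop \<Rightarrow> ('b::chilbert_space \<Rightarrow>\<^sub>L 'a) \<Rightarrow> real \<Rightarrow> 'b \<Rightarrow> 'a \<times> 'b"
  where "lift_vector A0 B01 lam x = (- inverse_apply A0 (complex_of_real lam) (B01 x), x)"

end

theory Submission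
  imports Defs "HOL-Complex_Analysis.Complex_Analysis" "HOL-Probability.Distribution_Functions"
begin

text \<open>Let \<open>f = \<Sum> \<phi>\<^sub>l\<close> be a finite sum of eigenvectors of \<open>H1\<close> for real eigenvalues \<open>l\<close>, and let
  \<open>x\<^sub>l\<close> solve \<open>(A0 - l) x\<^sub>l = B01 \<phi>\<^sub>l\<close>. Since the vectors \<open>(- x, \<psi>)\<close> are orthonormal, the squared
  coefficient norm of \<open>f\<close> is \<open>\<parallel>\<Sum> x\<^sub>l\<parallel>\<^sup>2 + \<parallel>f\<parallel>\<^sup>2\<close>, and everything reduces to
  \<open>\<parallel>\<Sum> x\<^sub>l\<parallel> \<le> C \<parallel>f\<parallel>\<close> with \<open>C\<close> independent of the number of terms.

  With \<open>f(\<mu>) = (H1 - \<mu>)\<^sup>-\<^sup>1 f = \<Sum> \<phi>\<^sub>l / (l - \<mu>)\<close> one has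
  \<open>\<parallel>\<Sum> x\<^sub>l\<parallel>\<^sup>2 = \<integral> \<langle>E0(d\<mu>) B01 f(\<mu>), B01 f(\<mu>)\<rangle>\<close>, and \<open>\<parallel>f(\<mu>)\<parallel> \<le> 2/d0 \<parallel>f\<parallel>\<close> on \<open>\<sigma>'\<close> and on the
  contour; this bounds the part over \<open>\<sigma>'\<close> by the variation. Over an interval \<open>\<Delta>\<close> the density is
  \<open>\<langle>K'(\<mu>) f(\<mu>), f(cnj \<mu>)\<rangle>\<close>. The imaginary part of \<open>\<langle>X \<phi>\<^sub>l, \<phi>\<^sub>l\<rangle> = 0\<close>, computed from the basic equation,
  is a half residue and shows \<open>K'(l) \<phi>\<^sub>l = 0\<close>. So the poles of the density on \<open>\<Delta>\<close> are removable, and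
  its integral can be moved to the contour.\<close>

section \<open>Primitives along curves and Riemann-Stieltjes sums\<close>

text \<open>The constant must not depend on how close the eigenvalues are to each other. On \<Delta>
  the vectors f(\<mu>) blow up at the eigenvalues, so the mass over \<Delta> cannot be estimated
  there; distance d0 / 2 from every eigenvalue is guaranteed only on \<sigma>' and on the contour.
  The relation K'(l) \<phi> = 0 cancels one factor l - \<mu>. The diagonal terms have a double pole,
  and their second zero comes from the nonnegativity of K' on \<Delta>, for which l is a minimum.
  The same cancellation makes the solutions x exist when l lies in the continuous spectrum. The
  homotopy from \<Delta> to the contour is merely continuous: its transversals may have infinite
  length, and the domain may touch the real axis in a complicated way. Integrals are therefore
  replaced by increments of a primitive in the homotopy parameters, and the point is that this
  primitive hardly varies across the homotopy near its two ends. At a finite end this is a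
  topological argument with small circles, at infinity it is the assumed smallness of the
  transversals.\<close>

lemma uniform_on_interval_from_local:
  fixes R :: "real \<Rightarrow> real \<Rightarrow> bool"
  assumes "\<And>s. s \<in> {a..b} \<Longrightarrow> \<exists>d>0. \<forall>u\<in>{a..b}. \<forall>v\<in>{a..b}. \<bar>u - s\<bar> < d \<longrightarrow> \<bar>v - s\<bar> < d \<longrightarrow> R u v"
  obtains \<rho> where "\<rho> > 0" "\<And>u v. u \<in> {a..b} \<Longrightarrow> v \<in> {a..b} \<Longrightarrow> \<bar>u - v\<bar> < \<rho> \<Longrightarrow> R u v"
proof -
  from assms obtain d where d: "\<And>s. s \<in> {a..b} \<Longrightarrow> d s > 0 \<and> (\<forall>u\<in>{a..b}. \<forall>v\<in>{a..b}. \<bar>u - s\<bar> < d s \<longrightarrow> \<bar>v - s\<bar> < d s \<longrightarrow> R u v)"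
    by metis
  have c: "{a..b} \<subseteq> \<Union>((\<lambda>s. ball s (d s)) ` {a..b})"
  proof
    fix s assume "s \<in> {a..b}"
    then show "s \<in> \<Union>((\<lambda>s. ball s (d s)) ` {a..b})" using d[of s] by (intro UN_I[of s]) auto
  qed
  from Heine_Borel_lemma[OF compact_Icc c] obtain e where e: "e > 0" "\<And>x. x \<in> {a..b} \<Longrightarrow> \<exists>G\<in>(\<lambda>s. ball s (d s)) ` {a..b}. ball x e \<subseteq> G"
    by blast
  show thesis
  proof
    show "e > 0" by fact
    fix u v assume uv: "u \<in> {a..b}" "v \<in> {a..b}" "\<bar>u - v\<bar> < e"
    from e(2)[OF uv(1)] obtain s where s: "s \<in> {a..b}" "ball u e \<subseteq> ball s (d s)" by auto
    have "u \<in> ball s (d s)" "v \<in> ball s (d s)" using subsetD[OF s(2), of u] subsetD[OF s(2), of v] uv e(1) by (auto simp: dist_real_def)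
    then show "R u v" using d[OF s(1)] uv by (auto simp: dist_real_def abs_minus_commute)
  qed
qed

text \<open>A primitive as a function of the parameter instead of the point: c may be a curve or a
  two-parameter homotopy, and it may pass through one point with several values of P. Only
  continuity of c is required, so that differences of P can replace contour integrals that need not
  be defined.\<close>

definition prim_along :: "(complex \<Rightarrow> complex) \<Rightarrow> ('x::metric_space \<Rightarrow> complex) \<Rightarrow> ('x \<Rightarrow> complex) \<Rightarrow> 'x set \<Rightarrow> bool"
  where "prim_along F c P S \<longleftrightarrow> continuous_on S c \<and>
    (\<forall>x\<in>S. \<exists>r>0. \<exists>\<Phi>. (\<forall>w\<in>ball (c x) r. (\<Phi> has_field_derivative F w) (at w)) \<and>
        (\<exists>d>0. \<forall>y\<in>S. dist y x < d \<longrightarrow> P y = \<Phi> (c y)))"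

lemma prim_along_compose:
  assumes "prim_along F c P S" "continuous_on T \<gamma>" "\<gamma> ` T \<subseteq> S"
  shows "prim_along F (c \<circ> \<gamma>) (P \<circ> \<gamma>) T"
  unfolding prim_along_def
proof (intro conjI ballI)
  show "continuous_on T (c \<circ> \<gamma>)"
    using assms by (meson continuous_on_compose continuous_on_subset prim_along_def)
  fix x assume x: "x \<in> T"
  then have "\<gamma> x \<in> S" using assms(3) by blast
  then obtain r \<Phi> d where *: "r > 0" "\<And>w. w \<in> ball (c (\<gamma> x)) r \<Longrightarrow> (\<Phi> has_field_derivative F w) (at w)"
      "d > 0" "\<And>y. y \<in> S \<Longrightarrow> dist y (\<gamma> x) < d \<Longrightarrow> P y = \<Phi> (c y)"
    using assms(1) unfolding prim_along_def by metis
  obtain d' where d': "d' > 0" "\<And>y. y \<in> T \<Longrightarrow> dist y x < d' \<Longrightarrow> dist (\<gamma> y) (\<gamma> x) < d"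
    using assms(2) x \<open>d > 0\<close> unfolding continuous_on_iff by metis
  have "\<forall>y\<in>T. dist y x < d' \<longrightarrow> P (\<gamma> y) = \<Phi> (c (\<gamma> y))"
    using d' * assms(3) by blast
  then show "\<exists>r>0. \<exists>\<Phi>. (\<forall>w\<in>ball ((c \<circ> \<gamma>) x) r. (\<Phi> has_field_derivative F w) (at w)) \<and>
       (\<exists>d>0. \<forall>y\<in>T. dist y x < d \<longrightarrow> (P \<circ> \<gamma>) y = \<Phi> ((c \<circ> \<gamma>) y))"
    using * d' by (intro exI[of _ r] conjI exI[of _ \<Phi>] exI[of _ d']) auto
qed

lemma prim_along_subset: "prim_along F c P S \<Longrightarrow> T \<subseteq> S \<Longrightarrow> prim_along F c P T"
  using prim_along_compose[of F c P S T id] by (simp add: continuous_on_id')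

text \<open>Near c x the function F is the derivative of a holomorphic function, hence holomorphic
  itself; the estimates below use its continuity and its local factorisation.\<close>

lemma prim_along_localE:
  assumes "prim_along F c P S" "x \<in> S"
  obtains r \<Phi> d where "r > 0" "F holomorphic_on ball (c x) r"
    "\<And>w. w \<in> ball (c x) r \<Longrightarrow> (\<Phi> has_field_derivative F w) (at w)" "d > 0"
    "\<And>y. y \<in> S \<Longrightarrow> dist y x < d \<Longrightarrow> P y = \<Phi> (c y)"
    "\<And>e. e > 0 \<Longrightarrow> \<exists>d'>0. d' \<le> d \<and> (\<forall>y\<in>S. dist y x < d' \<longrightarrow> c y \<in> ball (c x) e)"
proof -
  obtain r \<Phi> d where *: "r > 0" "\<And>w. w \<in> ball (c x) r \<Longrightarrow> (\<Phi> has_field_derivative F w) (at w)"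
      "d > 0" "\<And>y. y \<in> S \<Longrightarrow> dist y x < d \<Longrightarrow> P y = \<Phi> (c y)"
    using assms unfolding prim_along_def by metis
  have "\<Phi> holomorphic_on ball (c x) r"
    using *(2) by (meson DERIV_subset holomorphic_on_def field_differentiable_def subset_UNIV)
  then have "deriv \<Phi> holomorphic_on ball (c x) r" by (intro holomorphic_deriv) auto
  then have "F holomorphic_on ball (c x) r"
    using *(2) by (metis (no_types, lifting) DERIV_imp_deriv holomorphic_transform)
  moreover have "\<exists>d'>0. d' \<le> d \<and> (\<forall>y\<in>S. dist y x < d' \<longrightarrow> c y \<in> ball (c x) e)" if e: "e > 0" for e
  proof -
    have "continuous_on S c" using assms(1) by (simp add: prim_along_def)
    then obtain d' where "d' > 0" "\<And>y. y \<in> S \<Longrightarrow> dist y x < d' \<Longrightarrow> dist (c y) (c x) < e"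
      using assms(2) e unfolding continuous_on_iff by metis
    then show ?thesis using \<open>d > 0\<close> by (intro exI[of _ "min d d'"]) (auto simp: dist_commute)
  qed
  ultimately show thesis using that * by blast
qed

text \<open>The mean value inequality is applied to \<open>\<Phi> w - F (c t) * w\<close> on a ball
  in which F varies by less than e. It compares points of the plane only, so c need not be
  differentiable.\<close>

lemma prim_along_linear_approx:
  fixes c :: "real \<Rightarrow> complex"
  assumes P: "prim_along F c P {a..b}" and e: "e > 0"
  obtains \<rho> where "\<rho> > 0"
    "\<And>u t v. u \<in> {a..b} \<Longrightarrow> v \<in> {a..b} \<Longrightarrow> t \<in> {u..v} \<Longrightarrow> v - u < \<rho> \<Longrightarrow>
       cmod (P v - P u - F (c t) * (c v - c u)) \<le> e * cmod (c v - c u)"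
proof -
  let ?R = "\<lambda>u v. \<forall>t\<in>{u..v}. cmod (P v - P u - F (c t) * (c v - c u)) \<le> e * cmod (c v - c u)"
  have "\<exists>d>0. \<forall>u\<in>{a..b}. \<forall>v\<in>{a..b}. \<bar>u - s\<bar> < d \<longrightarrow> \<bar>v - s\<bar> < d \<longrightarrow> ?R u v" if s: "s \<in> {a..b}" for s
  proof -
    from prim_along_localE[OF P s] obtain r \<Phi> d where *: "r > 0" "F holomorphic_on ball (c s) r"
      "\<And>w. w \<in> ball (c s) r \<Longrightarrow> (\<Phi> has_field_derivative F w) (at w)" "d > 0"
      "\<And>y. y \<in> {a..b} \<Longrightarrow> dist y s < d \<Longrightarrow> P y = \<Phi> (c y)"
      "\<And>e. e > 0 \<Longrightarrow> \<exists>d'>0. d' \<le> d \<and> (\<forall>y\<in>{a..b}. dist y s < d' \<longrightarrow> c y \<in> ball (c s) e)" by blast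
    have "isCont F (c s)" using *(1,2) by (meson centre_in_ball continuous_on_eq_continuous_at holomorphic_on_imp_continuous_on open_ball)
    then obtain r1 where r1: "r1 > 0" "\<And>w. dist w (c s) < r1 \<Longrightarrow> dist (F w) (F (c s)) < e / 2"
      using e unfolding continuous_at_eps_delta by (meson half_gt_zero)
    define r' where "r' = min r r1"
    have r': "r' > 0" "r' \<le> r" "r' \<le> r1" using * r1 by (auto simp: r'_def)
    obtain d' where d': "d' > 0" "d' \<le> d" "\<And>y. y \<in> {a..b} \<Longrightarrow> dist y s < d' \<Longrightarrow> c y \<in> ball (c s) r'"
      using *(6)[OF r'(1)] by blast
    show ?thesis
    proof (intro exI[of _ d'] conjI ballI impI)
      fix u v t assume u: "u \<in> {a..b}" "v \<in> {a..b}" "\<bar>u - s\<bar> < d'" "\<bar>v - s\<bar> < d'" "t \<in> {u..v}"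
      have t: "t \<in> {a..b}" "\<bar>t - s\<bar> < d'" using u by (auto simp: abs_if split: if_splits)
      have cb: "c u \<in> ball (c s) r'" "c v \<in> ball (c s) r'" "c t \<in> ball (c s) r'"
        using d'(3)[of u] d'(3)[of v] d'(3)[of t] u t by (auto simp: dist_real_def)
      have "cmod ((\<Phi> (c v) - F (c t) * c v) - (\<Phi> (c u) - F (c t) * c u)) \<le> e * cmod (c v - c u)"
      proof (rule field_differentiable_bound[of "ball (c s) r'" "\<lambda>w. \<Phi> w - F (c t) * w" "\<lambda>w. F w - F (c t)"])
        fix w assume w: "w \<in> ball (c s) r'"
        show "((\<lambda>w. \<Phi> w - F (c t) * w) has_field_derivative F w - F (c t)) (at w within ball (c s) r')"
          using *(3)[of w] w r'(2)
          by (intro has_field_derivative_at_within[OF DERIV_diff[OF _ DERIV_cmult_Id]]) auto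
        have "dist (F w) (F (c s)) < e/2" "dist (F (c t)) (F (c s)) < e/2"
          using w cb(3) r' r1(2)[of w] r1(2)[of "c t"] by (auto simp: dist_commute)
        then show "cmod (F w - F (c t)) \<le> e"
          by (metis dist_triangle_half_l dist_norm less_imp_le dist_commute)
      qed (use cb in auto)
      moreover have "P u = \<Phi> (c u)" "P v = \<Phi> (c v)" using *(5) u d' by (auto simp: dist_real_def)
      ultimately show "cmod (P v - P u - F (c t) * (c v - c u)) \<le> e * cmod (c v - c u)"
        by (simp add: algebra_simps)
    qed (use d' in auto)
  qed
  from uniform_on_interval_from_local[where R = ?R, OF this] obtain \<rho> where
    "\<rho> > 0" "\<And>u v. u \<in> {a..b} \<Longrightarrow> v \<in> {a..b} \<Longrightarrow> \<bar>u - v\<bar> < \<rho> \<Longrightarrow> ?R u v" by blast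
  then show thesis by (intro that[of \<rho>]) auto
qed

text \<open>Near a point, a holomorphic function is a power times a function of almost constant modulus.\<close>

lemma holomorphic_segment_bound:
  assumes F: "F holomorphic_on ball z r" and r: "r > 0"
  obtains r' where "r' > 0" "r' \<le> r"
    "\<And>x y w. x \<in> ball z r' \<Longrightarrow> y \<in> ball z r' \<Longrightarrow> w \<in> closed_segment x y \<Longrightarrow>
        cmod (F w) \<le> 4 * (cmod (F x) + cmod (F y))"
proof (cases "F constant_on ball z r")
  case True
  then obtain k where k: "\<And>w. w \<in> ball z r \<Longrightarrow> F w = k" unfolding constant_on_def by blast
  show thesis
  proof (rule that[of r])
    fix x y w assume "x \<in> ball z r" "y \<in> ball z r" "w \<in> closed_segment x y"
    then have "w \<in> ball z r" by (metis closed_segment_subset convex_ball in_mono)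
    then show "cmod (F w) \<le> 4 * (cmod (F x) + cmod (F y))" using k \<open>x \<in> _\<close> \<open>y \<in> _\<close> by auto
  qed (use r in auto)
next
  case False
  have "\<exists>g n r0. r0 > 0 \<and> r0 \<le> r \<and> g holomorphic_on ball z r0 \<and> (\<forall>w\<in>ball z r0. F w = (w - z) ^ n * g w) \<and> g z \<noteq> 0"
  proof (cases "F z = 0")
    case True
    obtain g r0 n where g: "0 < (n::nat)" "0 < r0" "ball z r0 \<subseteq> ball z r" "g holomorphic_on ball z r0"
         "\<And>w. w \<in> ball z r0 \<Longrightarrow> F w = (w - z)^n * g w" "\<And>w. w \<in> ball z r0 \<Longrightarrow> g w \<noteq> 0"
      using holomorphic_factor_zero_nonconstant[OF F open_ball connected_ball _ True False] r
      by (metis centre_in_ball)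
    then have "r0 \<le> r" by (simp add: ball_subset_ball_iff)
    then show ?thesis using g by (metis centre_in_ball)
  next
    case False
    then show ?thesis using F r by (intro exI[of _ F] exI[of _ 0] exI[of _ r]) auto
  qed
  then obtain g n r0 where g: "r0 > 0" "r0 \<le> r" "g holomorphic_on ball z r0"
     "\<And>w. w \<in> ball z r0 \<Longrightarrow> F w = (w - z) ^ n * g w" "g z \<noteq> 0" by blast
  have "isCont g z" using g(1,3) by (meson centre_in_ball continuous_on_eq_continuous_at holomorphic_on_imp_continuous_on open_ball)
  then obtain r1 where r1: "r1 > 0" "\<And>w. dist w z < r1 \<Longrightarrow> dist (g w) (g z) < cmod (g z) / 2"
    using g(5) unfolding continuous_at_eps_delta by (meson half_gt_zero zero_less_norm_iff)
  have gw: "cmod (g w) \<le> 2 * cmod (g z)" "cmod (g z) \<le> 2 * cmod (g w)" if "dist w z < r1" for w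
  proof -
    have "cmod (g w - g z) < cmod (g z) / 2" using r1(2)[OF that] by (simp add: dist_norm)
    then show "cmod (g w) \<le> 2 * cmod (g z)" "cmod (g z) \<le> 2 * cmod (g w)"
      using norm_triangle_ineq2[of "g w" "g z"] norm_triangle_ineq2[of "g z" "g w"]
        norm_minus_commute[of "g w" "g z"] zero_le_power2 by (auto simp: field_simps)
  qed
  show thesis
  proof (rule that[of "min r0 r1"])
    fix x y w assume xy: "x \<in> ball z (min r0 r1)" "y \<in> ball z (min r0 r1)" "w \<in> closed_segment x y"
    have w: "w \<in> ball z (min r0 r1)" using xy by (metis closed_segment_subset convex_ball in_mono)
    \<comment> \<open>The end point farther from z maximises the power \<open>(w - z) ^ n\<close>,
      and the factor g changes by at most 2 * 2 between two points of the ball: this is the constant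
      4.\<close>
    obtain q where q: "q \<in> {x, y}" "dist w z \<le> dist q z"
    proof -
      have "w \<in> cball z (max (dist x z) (dist y z))"
        using xy(3) closed_segment_subset[of x "cball z (max (dist x z) (dist y z))" y]
        by (auto simp: dist_commute)
      then show thesis using that by (auto simp: dist_commute max_def split: if_splits)
    qed
    have "cmod (F w) = cmod (w - z) ^ n * cmod (g w)" using g(4)[of w] w by (simp add: norm_mult norm_power)
    also have "\<dots> \<le> cmod (q - z) ^ n * (4 * cmod (g q))"
      using q gw[of w] gw[of q] w xy by (intro mult_mono power_mono) (auto simp: dist_norm norm_minus_commute)
    also have "\<dots> = 4 * cmod (F q)" using g(4)[of q] q xy by (auto simp: norm_mult norm_power)
    also have "\<dots> \<le> 4 * (cmod (F x) + cmod (F y))" using q by auto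
    finally show "cmod (F w) \<le> 4 * (cmod (F x) + cmod (F y))" .
  qed (use g r1 in auto)
qed

text \<open>On a curve of infinite length the error e * length of the linear approximation is
  useless. A bound by the values of F at both ends of the step, with an absolute constant, still
  adds up to Riemann-Stieltjes sums.\<close>

lemma prim_along_trapezoid_bound:
  fixes c :: "real \<Rightarrow> complex"
  assumes P: "prim_along F c P {a..b}"
  obtains \<rho> where "\<rho> > 0"
    "\<And>u v. u \<in> {a..b} \<Longrightarrow> v \<in> {a..b} \<Longrightarrow> \<bar>u - v\<bar> < \<rho> \<Longrightarrow>
       cmod (P v - P u) \<le> 4 * (cmod (F (c u)) + cmod (F (c v))) * cmod (c v - c u)"
proof -
  let ?R = "\<lambda>u v. cmod (P v - P u) \<le> 4 * (cmod (F (c u)) + cmod (F (c v))) * cmod (c v - c u)"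
  have "\<exists>d>0. \<forall>u\<in>{a..b}. \<forall>v\<in>{a..b}. \<bar>u - s\<bar> < d \<longrightarrow> \<bar>v - s\<bar> < d \<longrightarrow> ?R u v" if s: "s \<in> {a..b}" for s
  proof -
    from prim_along_localE[OF P s] obtain r \<Phi> d where *: "r > 0" "F holomorphic_on ball (c s) r"
      "\<And>w. w \<in> ball (c s) r \<Longrightarrow> (\<Phi> has_field_derivative F w) (at w)" "d > 0"
      "\<And>y. y \<in> {a..b} \<Longrightarrow> dist y s < d \<Longrightarrow> P y = \<Phi> (c y)"
      "\<And>e. e > 0 \<Longrightarrow> \<exists>d'>0. d' \<le> d \<and> (\<forall>y\<in>{a..b}. dist y s < d' \<longrightarrow> c y \<in> ball (c s) e)" by blast
    obtain r' where r': "r' > 0" "r' \<le> r"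
       "\<And>x y w. x \<in> ball (c s) r' \<Longrightarrow> y \<in> ball (c s) r' \<Longrightarrow> w \<in> closed_segment x y \<Longrightarrow>
        cmod (F w) \<le> 4 * (cmod (F x) + cmod (F y))"
      using holomorphic_segment_bound[OF *(2,1)] by metis
    obtain d' where d': "d' > 0" "d' \<le> d" "\<And>y. y \<in> {a..b} \<Longrightarrow> dist y s < d' \<Longrightarrow> c y \<in> ball (c s) r'"
      using *(6)[OF r'(1)] by blast
    show ?thesis
    proof (intro exI[of _ d'] conjI ballI impI)
      fix u v assume u: "u \<in> {a..b}" "v \<in> {a..b}" "\<bar>u - s\<bar> < d'" "\<bar>v - s\<bar> < d'"
      have cb: "c u \<in> ball (c s) r'" "c v \<in> ball (c s) r'"
        using d'(3)[of u] d'(3)[of v] u by (auto simp: dist_real_def)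
      have seg: "closed_segment (c u) (c v) \<subseteq> ball (c s) r'" using cb by (metis closed_segment_subset convex_ball)
      have "cmod (\<Phi> (c v) - \<Phi> (c u)) \<le> 4 * (cmod (F (c u)) + cmod (F (c v))) * cmod (c v - c u)"
      proof (rule field_differentiable_bound[of "closed_segment (c u) (c v)" _ F])
        fix w assume w: "w \<in> closed_segment (c u) (c v)"
        show "(\<Phi> has_field_derivative F w) (at w within closed_segment (c u) (c v))"
          using *(3)[of w] w seg r'(2) by (intro has_field_derivative_at_within[OF *(3)]) auto
        show "cmod (F w) \<le> 4 * (cmod (F (c u)) + cmod (F (c v)))"
          using r'(3) cb w by blast
      qed auto
      moreover have "P u = \<Phi> (c u)" "P v = \<Phi> (c v)" using *(5) u d' by (auto simp: dist_real_def)
      ultimately show "?R u v" by simp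
    qed (use d' in auto)
  qed
  from uniform_on_interval_from_local[where R = ?R, OF this] show thesis using that by metis
qed


section \<open>Riemann-Stieltjes sums over ordered partitions\<close>

definition partition_seq :: "real \<Rightarrow> real \<Rightarrow> real \<Rightarrow> nat \<Rightarrow> (nat \<Rightarrow> real) \<Rightarrow> bool"
  where "partition_seq a b r n x \<longleftrightarrow> a < b \<and> x 0 = a \<and> x n = b \<and> (\<forall>i<n. x i < x (Suc i) \<and> x (Suc i) - x i < r)"

lemma partition_seq_exists:
  assumes "a < b" "r > 0"
  obtains n x where "partition_seq a b r n x"
proof -
  obtain n :: nat where n: "(b - a) / r < real n" using reals_Archimedean2 by blast
  have "n > 0" using n assms by (metis diff_gt_0_iff_gt divide_pos_pos gr0I less_asym of_nat_0)
  define q where "q = (b - a) / real n"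
  have q: "0 < q" "q < r" "a + real n * q = b" using assms n \<open>n > 0\<close> by (auto simp: field_simps q_def)
  then have "partition_seq a b r n (\<lambda>i. a + real i * q)"
    using assms by (auto simp: partition_seq_def algebra_simps)
  then show thesis by (rule that)
qed

lemma partition_seq_mono:
  assumes "partition_seq a b r n x" "i \<le> j" "j \<le> n"
  shows "x i \<le> x j"
  using assms(2,3)
proof (induction j rule: dec_induct)
  case (step j)
  then show ?case using assms(1) unfolding partition_seq_def by (smt (verit) Suc_le_lessD less_imp_le_nat)
qed simp

lemma partition_seq_in:
  assumes "partition_seq a b r n x" "i \<le> n"
  shows "x i \<in> {a..b}"
  using partition_seq_mono[OF assms(1), of 0 i] partition_seq_mono[OF assms(1), of i n] assms
  by (auto simp: partition_seq_def)

lemma partition_seq_tagged_division: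
  assumes x: "partition_seq a b r n x" and tag: "\<And>i. i < n \<Longrightarrow> t i \<in> {x i..x (Suc i)}"
  shows "(\<lambda>i. (t i, {x i..x (Suc i)})) ` {..<n} tagged_division_of {a..b}"
proof (rule tagged_division_ofI)
  let ?p = "(\<lambda>i. (t i, {x i..x (Suc i)})) ` {..<n}"
  show "finite ?p" by simp
  fix s K assume "(s, K) \<in> ?p"
  then obtain i where i: "i < n" "s = t i" "K = {x i..x (Suc i)}" by auto
  show "s \<in> K" using tag i by simp
  show "K \<subseteq> {a..b}" using i partition_seq_in[OF x, of i] partition_seq_in[OF x, of "Suc i"] by auto
  show "\<exists>a b. K = cbox a b" using i by auto
  fix s' K' assume "(s', K') \<in> ?p" and ne: "(s, K) \<noteq> (s', K')"
  then obtain j where j: "j < n" "s' = t j" "K' = {x j..x (Suc j)}" by auto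
  then have "i < j \<or> j < i" using i ne by (metis linorder_neqE_nat)
  then have "x (Suc i) \<le> x j \<or> x (Suc j) \<le> x i"
    using partition_seq_mono[OF x, of "Suc i" j] partition_seq_mono[OF x, of "Suc j" i] i j by auto
  then show "interior K \<inter> interior K' = {}" using i j by auto
next
  let ?p = "(\<lambda>i. (t i, {x i..x (Suc i)})) ` {..<n}"
  have "(\<Union>i<k. {x i..x (Suc i)}) = {x 0..x k}" if "k \<le> n" "k > 0" for k
    using that(2,1)
  proof (induction k rule: nat_induct_non_zero)
    case (Suc k)
    have "x 0 \<le> x k" "x k \<le> x (Suc k)" using partition_seq_mono[OF x] Suc by auto
    then show ?case using Suc by (auto simp: lessThan_Suc)
  qed auto
  moreover have "\<Union> {K. \<exists>s. (s, K) \<in> ?p} = (\<Union>i<n. {x i..x (Suc i)})" by auto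
  ultimately show "\<Union> {K. \<exists>s. (s, K) \<in> ?p} = {a..b}"
    using x by (cases "n = 0") (auto simp: partition_seq_def)
qed

lemma has_RS_integral_partition_seq:
  assumes "has_RS_integral f I a b" "e > 0"
  obtains r where "r > 0" "\<And>n x t. partition_seq a b r n x \<Longrightarrow> (\<And>i. i < n \<Longrightarrow> t i \<in> {x i..x (Suc i)}) \<Longrightarrow>
     norm ((\<Sum>i<n. f (t i) (x i) (x (Suc i))) - I) < e"
proof -
  obtain r where r: "r > 0" "\<And>p. p tagged_division_of {a..b} \<Longrightarrow> (\<lambda>t. ball t r) fine p \<Longrightarrow>
       norm ((\<Sum>(t, K)\<in>p. f t (Inf K) (Sup K)) - I) < e"
    using assms(1)[unfolded has_RS_integral_def, rule_format, OF assms(2)] by blast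
  show thesis
  proof
    show "r > 0" by fact
    fix n x t assume x: "partition_seq a b r n x" and t: "\<And>i. i < n \<Longrightarrow> t i \<in> {x i..x (Suc i)}"
    let ?p = "(\<lambda>i. (t i, {x i..x (Suc i)})) ` {..<n}"
    have lt: "x i < x (Suc i)" "x (Suc i) - x i < r" if "i < n" for i using x that by (auto simp: partition_seq_def)
    have inj: "inj_on (\<lambda>i. (t i, {x i..x (Suc i)})) {..<n}"
    proof (rule inj_onI)
      fix i j assume ij: "i \<in> {..<n}" "j \<in> {..<n}" "(t i, {x i..x (Suc i)}) = (t j, {x j..x (Suc j)})"
      then have "x i = x j" using lt(1)[of i] lt(1)[of j] by (auto simp: Icc_eq_Icc)
      moreover have "x i < x j" if "i < j" "j < n" for i j
        using lt(1)[of i] partition_seq_mono[OF x, of "Suc i" j] that by auto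
      ultimately show "i = j" using ij by (metis lessThan_iff linorder_neqE_nat less_irrefl)
    qed
    have "(\<Sum>(t, K)\<in>?p. f t (Inf K) (Sup K)) = (\<Sum>i<n. f (t i) (x i) (x (Suc i)))"
      by (subst sum.reindex[OF inj]) (auto intro!: sum.cong simp: less_imp_le[OF lt(1)])
    moreover have "(\<lambda>t. ball t r) fine ?p"
    proof (rule fineI)
      fix s K assume "(s, K) \<in> ?p"
      then obtain i where i: "i < n" "s = t i" "K = {x i..x (Suc i)}" by auto
      show "K \<subseteq> ball s r" using t[OF i(1)] lt[OF i(1)] i by (auto simp: dist_real_def)
    qed
    ultimately show "norm ((\<Sum>i<n. f (t i) (x i) (x (Suc i))) - I) < e"
      using r(2)[OF partition_seq_tagged_division[OF x t]] by simp
  qed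
qed

lemma has_RS_integral_unique:
  assumes "has_RS_integral f I a b" "has_RS_integral f J a b" "a < b"
  shows "I = J"
proof (rule ccontr)
  assume ne: "I \<noteq> J"
  define e where "e = norm (I - J) / 2"
  have e: "e > 0" using ne by (simp add: e_def)
  obtain r1 where r1: "r1 > 0" "\<And>n x t. partition_seq a b r1 n x \<Longrightarrow> (\<And>i. i < n \<Longrightarrow> t i \<in> {x i..x (Suc i)}) \<Longrightarrow>
     norm ((\<Sum>i<n. f (t i) (x i) (x (Suc i))) - I) < e"
    using has_RS_integral_partition_seq[OF assms(1) e] by blast
  obtain r2 where r2: "r2 > 0" "\<And>n x t. partition_seq a b r2 n x \<Longrightarrow> (\<And>i. i < n \<Longrightarrow> t i \<in> {x i..x (Suc i)}) \<Longrightarrow>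
     norm ((\<Sum>i<n. f (t i) (x i) (x (Suc i))) - J) < e"
    using has_RS_integral_partition_seq[OF assms(2) e] by blast
  obtain n x where x: "partition_seq a b (min r1 r2) n x"
    using partition_seq_exists[OF assms(3), of "min r1 r2"] r1 r2 by auto
  then have x12: "partition_seq a b r1 n x" "partition_seq a b r2 n x" by (auto simp: partition_seq_def)
  have xx: "x i \<in> {x i..x (Suc i)}" if "i < n" for i using x that by (auto simp: partition_seq_def intro: less_imp_le)
  have "norm ((\<Sum>i<n. f (x i) (x i) (x (Suc i))) - I) < e" using r1(2)[OF x12(1), of x] xx by blast
  moreover have "norm ((\<Sum>i<n. f (x i) (x i) (x (Suc i))) - J) < e" using r2(2)[OF x12(2), of x] xx by blast
  ultimately have "dist I J < e + e"
    by (metis dist_commute dist_norm dist_triangle_lt add_strict_mono order_le_less_trans dist_triangle)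
  then show False by (simp add: e_def dist_norm)
qed

lemma length_le_partition_seq:
  assumes "length_le c {a..b} L" "partition_seq a b r n x"
  shows "(\<Sum>i<n. cmod (c (x (Suc i)) - c (x i))) \<le> L"
proof -
  have "(\<Sum>i<n. dist (c (x i)) (c (x (Suc i)))) \<le> L"
    using assms(1) partition_seq_in[OF assms(2)] assms(2) unfolding length_le_def partition_seq_def
    by (metis less_imp_le)
  then show ?thesis by (simp add: dist_norm norm_minus_commute)
qed

lemma partition_seq_mono_mesh: "partition_seq a b r n x \<Longrightarrow> r \<le> r' \<Longrightarrow> partition_seq a b r' n x"
  by (auto simp: partition_seq_def)

lemma prim_along_telescope:
  fixes P :: "real \<Rightarrow> 'v::ab_group_add"
  assumes "partition_seq a b r n x"
  shows "(\<Sum>i<n. P (x (Suc i)) - P (x i)) = P b - P a"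
  using assms sum_lessThan_telescope[of "\<lambda>i. P (x i)" n] by (simp add: partition_seq_def)

text \<open>The errors of the linear approximation add up to e' times the length of the curve;
  finiteness of the length enters here.\<close>

lemma prim_along_Riemann_sum:
  assumes P: "prim_along F c P {a..b}" and L: "length_le c {a..b} L" and e: "e > 0"
  obtains r where "r > 0" "\<And>n x. partition_seq a b r n x \<Longrightarrow>
     cmod ((\<Sum>i<n. F (c (x i)) * (c (x (Suc i)) - c (x i))) - (P b - P a)) < e"
proof -
  define e' where "e' = e / (\<bar>L\<bar> + 1)"
  have e': "e' > 0" using e by (simp add: e'_def)
  obtain r where r: "r > 0" "\<And>u t v. u \<in> {a..b} \<Longrightarrow> v \<in> {a..b} \<Longrightarrow> t \<in> {u..v} \<Longrightarrow> v - u < r \<Longrightarrow>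
       cmod (P v - P u - F (c t) * (c v - c u)) \<le> e' * cmod (c v - c u)"
    using prim_along_linear_approx[OF P e'] by blast
  show thesis
  proof (rule that[OF r(1)])
    fix n x assume x: "partition_seq a b r n x"
    have "cmod ((\<Sum>i<n. F (c (x i)) * (c (x (Suc i)) - c (x i))) - (P b - P a))
       = cmod (\<Sum>i<n. P (x (Suc i)) - P (x i) - F (c (x i)) * (c (x (Suc i)) - c (x i)))"
      using prim_along_telescope[OF x, of P] by (simp add: sum_subtractf norm_minus_commute)
    also have "\<dots> \<le> (\<Sum>i<n. e' * cmod (c (x (Suc i)) - c (x i)))"
    proof (rule sum_norm_le)
      fix i assume i: "i \<in> {..<n}"
      then have "x i < x (Suc i)" "x (Suc i) - x i < r" using x by (auto simp: partition_seq_def)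
      then show "cmod (P (x (Suc i)) - P (x i) - F (c (x i)) * (c (x (Suc i)) - c (x i))) \<le> e' * cmod (c (x (Suc i)) - c (x i))"
        using partition_seq_in[OF x, of i] partition_seq_in[OF x, of "Suc i"] i by (intro r(2)) auto
    qed
    also have "\<dots> = e' * (\<Sum>i<n. cmod (c (x (Suc i)) - c (x i)))" by (simp add: sum_distrib_left)
    also have "\<dots> \<le> e' * \<bar>L\<bar>" using length_le_partition_seq[OF L x] e' by (intro mult_left_mono) auto
    also have "\<dots> < e" using e by (simp add: e'_def field_simps)
    finally show "cmod ((\<Sum>i<n. F (c (x i)) * (c (x (Suc i)) - c (x i))) - (P b - P a)) < e" .
  qed
qed

lemma prim_along_bound_length:
  assumes P: "prim_along F c P {a..b}" and L: "length_le c {a..b} L" and ab: "a < b"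
    and M: "\<And>t. t \<in> {a..b} \<Longrightarrow> cmod (F (c t)) \<le> M"
  shows "cmod (P b - P a) \<le> M * L"
proof (rule field_le_epsilon)
  fix e :: real assume e: "e > 0"
  obtain r where r: "r > 0" "\<And>n x. partition_seq a b r n x \<Longrightarrow>
     cmod ((\<Sum>i<n. F (c (x i)) * (c (x (Suc i)) - c (x i))) - (P b - P a)) < e"
    using prim_along_Riemann_sum[OF P L e] by blast
  obtain n x where x: "partition_seq a b r n x" using partition_seq_exists[OF ab r(1)] by blast
  have M0: "M \<ge> 0" using order_trans[OF norm_ge_zero M[of a]] ab by simp
  have "cmod (\<Sum>i<n. F (c (x i)) * (c (x (Suc i)) - c (x i))) \<le> (\<Sum>i<n. M * cmod (c (x (Suc i)) - c (x i)))"
    using M partition_seq_in[OF x] by (intro sum_norm_le) (auto simp: norm_mult intro!: mult_right_mono)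
  also have "\<dots> \<le> M * L"
    using length_le_partition_seq[OF L x] M0 by (simp add: sum_distrib_left[symmetric] mult_left_mono)
  finally show "cmod (P b - P a) \<le> M * L + e"
    using r(2)[OF x] norm_triangle_ineq2[of "P b - P a" "\<Sum>i<n. F (c (x i)) * (c (x (Suc i)) - c (x i))"]
      norm_minus_commute[of "P b - P a" "\<Sum>i<n. F (c (x i)) * (c (x (Suc i)) - c (x i))"] by linarith
qed

lemma prim_along_RS_integral:
  assumes P: "prim_along F c P {a..b}" and L: "length_le c {a..b} L" and ab: "a < b"
    and I: "has_RS_integral (\<lambda>t u v. (c v - c u) * F (c t)) I a b"
  shows "I = P b - P a"
proof (rule ccontr)
  assume ne: "I \<noteq> P b - P a"
  define e where "e = cmod (I - (P b - P a)) / 2"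
  have e: "e > 0" using ne by (simp add: e_def)
  obtain r1 where r1: "r1 > 0" "\<And>n x. partition_seq a b r1 n x \<Longrightarrow>
     cmod ((\<Sum>i<n. F (c (x i)) * (c (x (Suc i)) - c (x i))) - (P b - P a)) < e"
    using prim_along_Riemann_sum[OF P L e] by blast
  obtain r2 where r2: "r2 > 0" "\<And>n x t. partition_seq a b r2 n x \<Longrightarrow> (\<And>i. i < n \<Longrightarrow> t i \<in> {x i..x (Suc i)}) \<Longrightarrow>
     cmod ((\<Sum>i<n. (c (x (Suc i)) - c (x i)) * F (c (t i))) - I) < e"
    using has_RS_integral_partition_seq[OF I e] by blast
  obtain n x where x: "partition_seq a b (min r1 r2) n x"
    using partition_seq_exists[OF ab, of "min r1 r2"] r1 r2 by auto
  have xx: "x i \<in> {x i..x (Suc i)}" if "i < n" for i using x that by (auto simp: partition_seq_def intro: less_imp_le)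
  let ?S = "\<Sum>i<n. F (c (x i)) * (c (x (Suc i)) - c (x i))"
  have "cmod (?S - (P b - P a)) < e" using r1(2)[OF partition_seq_mono_mesh[OF x]] by simp
  moreover have "cmod (?S - I) < e" using r2(2)[OF partition_seq_mono_mesh[OF x], of x] xx by (simp add: mult.commute)
  ultimately have "cmod (I - (P b - P a)) < e + e"
    using norm_triangle_ineq4[of "?S - (P b - P a)" "?S - I"] by (simp add: algebra_simps)
  then show False by (simp add: e_def)
qed

text \<open>The first bound has the sharp constant and requires finite length; it serves the
  contour. The second uses the trapezoid bound, with the Riemann-Stieltjes sums tagged once at the
  left and once at the right ends, and holds without any length; it serves the transversals of a
  homotopy.\<close>

lemma prim_along_bound_RS:
  assumes P: "prim_along F c P {a..b}" and ab: "a < b"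
    and I: "has_RS_integral (\<lambda>t u v. dist (c u) (c v) * N t) I a b"
    and N: "\<And>t. t \<in> {a..b} \<Longrightarrow> cmod (F (c t)) \<le> C * N t" and C: "C \<ge> 0"
  shows "length_le c {a..b} L \<Longrightarrow> cmod (P b - P a) \<le> C * I"
    and "cmod (P b - P a) \<le> 8 * C * I"
proof -
  assume L: "length_le c {a..b} L"
  show "cmod (P b - P a) \<le> C * I"
  proof (rule field_le_epsilon)
    fix e :: real assume e: "e > 0"
    define e' where "e' = e / (C + 1)"
    have "(C + 1) * e' = e" using C by (simp add: e'_def)
    then have e': "e' > 0" "C * e' + e' = e" using e C by (simp add: e'_def, simp add: distrib_right)
    obtain r1 where r1: "r1 > 0" "\<And>n x. partition_seq a b r1 n x \<Longrightarrow>
       cmod ((\<Sum>i<n. F (c (x i)) * (c (x (Suc i)) - c (x i))) - (P b - P a)) < e'"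
      using prim_along_Riemann_sum[OF P L e'(1)] by blast
    obtain r2 where r2: "r2 > 0" "\<And>n x t. partition_seq a b r2 n x \<Longrightarrow> (\<And>i. i < n \<Longrightarrow> t i \<in> {x i..x (Suc i)}) \<Longrightarrow>
       norm ((\<Sum>i<n. dist (c (x i)) (c (x (Suc i))) * N (t i)) - I) < e'"
      using has_RS_integral_partition_seq[OF I e'(1)] by blast
    obtain n x where x: "partition_seq a b (min r1 r2) n x"
      using partition_seq_exists[OF ab, of "min r1 r2"] r1 r2 by auto
    have xx: "x i \<in> {x i..x (Suc i)}" if "i < n" for i using x that by (auto simp: partition_seq_def intro: less_imp_le)
    let ?S = "\<Sum>i<n. F (c (x i)) * (c (x (Suc i)) - c (x i))"
    let ?T = "\<Sum>i<n. dist (c (x i)) (c (x (Suc i))) * N (x i)"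
    have S: "cmod (?S - (P b - P a)) < e'" using r1(2)[OF partition_seq_mono_mesh[OF x]] by simp
    have T: "norm (?T - I) < e'" using r2(2)[OF partition_seq_mono_mesh[OF x], of x] xx by simp
    have "cmod ?S \<le> (\<Sum>i<n. C * (dist (c (x i)) (c (x (Suc i))) * N (x i)))"
    proof (rule sum_norm_le)
      fix i assume "i \<in> {..<n}"
      then have "cmod (F (c (x i))) \<le> C * N (x i)" using N partition_seq_in[OF x] by auto
      then have "cmod (F (c (x i))) * cmod (c (x (Suc i)) - c (x i)) \<le> (C * N (x i)) * cmod (c (x (Suc i)) - c (x i))"
        by (rule mult_right_mono) simp
      then show "cmod (F (c (x i)) * (c (x (Suc i)) - c (x i))) \<le> C * (dist (c (x i)) (c (x (Suc i))) * N (x i))"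
        by (simp add: norm_mult dist_norm norm_minus_commute mult_ac)
    qed
    also have "\<dots> = C * ?T" by (simp add: sum_distrib_left)
    also have "\<dots> \<le> C * (I + e')" using T C by (intro mult_left_mono) (auto simp: abs_if split: if_splits)
    finally have "cmod ?S \<le> C * I + C * e'" by (simp add: algebra_simps)
    then show "cmod (P b - P a) \<le> C * I + e" using S norm_triangle_ineq2[of "P b - P a" ?S] 
       norm_minus_commute[of "P b - P a" ?S] e'(2) by linarith
  qed
next
  show "cmod (P b - P a) \<le> 8 * C * I"
  proof (rule field_le_epsilon)
    fix e :: real assume e: "e > 0"
    define e' where "e' = e / (8 * C + 1)"
    have e': "e' > 0" "8 * C * e' \<le> e" using e C by (auto simp: e'_def field_simps)
    obtain r1 where r1: "r1 > 0" "\<And>u v. u \<in> {a..b} \<Longrightarrow> v \<in> {a..b} \<Longrightarrow> \<bar>u - v\<bar> < r1 \<Longrightarrow>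
       cmod (P v - P u) \<le> 4 * (cmod (F (c u)) + cmod (F (c v))) * cmod (c v - c u)"
      using prim_along_trapezoid_bound[OF P] by blast
    obtain r2 where r2: "r2 > 0" "\<And>n x t. partition_seq a b r2 n x \<Longrightarrow> (\<And>i. i < n \<Longrightarrow> t i \<in> {x i..x (Suc i)}) \<Longrightarrow>
       norm ((\<Sum>i<n. dist (c (x i)) (c (x (Suc i))) * N (t i)) - I) < e'"
      using has_RS_integral_partition_seq[OF I e'(1)] by blast
    obtain n x where x: "partition_seq a b (min r1 r2) n x"
      using partition_seq_exists[OF ab, of "min r1 r2"] r1 r2 by auto
    have x1: "x i < x (Suc i)" "x (Suc i) - x i < r1" if "i < n" for i using x that by (auto simp: partition_seq_def)
    let ?T = "\<lambda>t. \<Sum>i<n. dist (c (x i)) (c (x (Suc i))) * N (t i)"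
    have T: "norm (?T x - I) < e'" using r2(2)[OF partition_seq_mono_mesh[OF x], of x] x1(1) less_imp_le by fastforce
    have T': "norm (?T (x \<circ> Suc) - I) < e'" using r2(2)[OF partition_seq_mono_mesh[OF x], of "x \<circ> Suc"] x1(1) less_imp_le by fastforce
    have "cmod (P b - P a) = cmod (\<Sum>i<n. P (x (Suc i)) - P (x i))" using prim_along_telescope[OF x, of P] by simp
    also have "\<dots> \<le> (\<Sum>i<n. (4 * C) * (dist (c (x i)) (c (x (Suc i))) * N (x i)) + (4 * C) * (dist (c (x i)) (c (x (Suc i))) * N (x (Suc i))))"
    proof (rule sum_norm_le)
      fix i assume "i \<in> {..<n}"
      then have i: "x i \<in> {a..b}" "x (Suc i) \<in> {a..b}" "\<bar>x i - x (Suc i)\<bar> < r1" using partition_seq_in[OF x] x1[of i] by auto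
      have "cmod (P (x (Suc i)) - P (x i)) \<le> 4 * (cmod (F (c (x i))) + cmod (F (c (x (Suc i))))) * cmod (c (x (Suc i)) - c (x i))"
        using r1(2)[OF i] .
      also have "\<dots> \<le> 4 * (C * N (x i) + C * N (x (Suc i))) * cmod (c (x (Suc i)) - c (x i))"
        using N[OF i(1)] N[OF i(2)] by (intro mult_right_mono mult_left_mono) auto
      finally show "cmod (P (x (Suc i)) - P (x i)) \<le> (4 * C) * (dist (c (x i)) (c (x (Suc i))) * N (x i)) + (4 * C) * (dist (c (x i)) (c (x (Suc i))) * N (x (Suc i)))"
        by (simp add: dist_norm norm_minus_commute algebra_simps)
    qed
    also have "\<dots> = 4 * C * (?T x + ?T (x \<circ> Suc))"
      by (simp only: sum.distrib sum_distrib_left[symmetric] distrib_left o_def)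
    also have "\<dots> \<le> 4 * C * (2 * I + 2 * e')" using T T' C by (intro mult_left_mono) (auto simp: abs_if split: if_splits)
    also have "\<dots> \<le> 8 * C * I + e" using e' by (simp add: algebra_simps)
    finally show "cmod (P b - P a) \<le> 8 * C * I + e" .
  qed
qed


subsection \<open>Existence of the arc length integral\<close>

text \<open>The length function of g. Chords \<open>dist (g u) (g v)\<close> are not additive; this
  increasing function dominates them and is a proper integrator.\<close>

definition arc_var :: "(real \<Rightarrow> complex) \<Rightarrow> real \<Rightarrow> real \<Rightarrow> real"
  where "arc_var g a t = Sup {\<Sum>i<n. dist (g (x i)) (g (x (Suc i))) | n x.
     (\<forall>i\<le>n. x i \<in> {a..t}) \<and> (\<forall>i<n. x i \<le> x (Suc i))}"

lemma arc_var_bdd: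
  assumes "length_le g {a..b} L" "t \<le> b"
  shows "bdd_above {\<Sum>i<n. dist (g (x i)) (g (x (Suc i))) | n x.
     (\<forall>i\<le>n. x i \<in> {a..t}) \<and> (\<forall>i<n. x i \<le> x (Suc (i::nat)))}"
proof (rule bdd_aboveI)
  fix y assume "y \<in> {\<Sum>i<n. dist (g (x i)) (g (x (Suc i))) | n x.
     (\<forall>i\<le>n. x i \<in> {a..t}) \<and> (\<forall>i<n. x i \<le> x (Suc (i::nat)))}"
  then obtain n x where y: "y = (\<Sum>i<n. dist (g (x i)) (g (x (Suc i))))"
     "\<forall>i\<le>n. x i \<in> {a..t}" "\<forall>i<n. x i \<le> x (Suc i)" by blast
  have "\<forall>i\<le>n. x i \<in> {a..b}" using y(2) assms(2) by auto
  then show "y \<le> L" using assms(1) y unfolding length_le_def by blast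
qed

lemma arc_var_upper:
  assumes "length_le g {a..b} L" "t \<le> b" "\<And>i. i \<le> n \<Longrightarrow> x i \<in> {a..t}" "\<And>i. i < n \<Longrightarrow> x i \<le> x (Suc i)"
  shows "(\<Sum>i<n. dist (g (x i)) (g (x (Suc i)))) \<le> arc_var g a t"
  unfolding arc_var_def using assms(3,4)
  by (intro cSup_upper[OF _ arc_var_bdd[OF assms(1,2)]]) blast

lemma arc_var_le:
  assumes "a \<le> t" "\<And>n x. \<lbrakk>\<And>i. i \<le> n \<Longrightarrow> x i \<in> {a..t}; \<And>i. i < n \<Longrightarrow> x i \<le> x (Suc i)\<rbrakk>
     \<Longrightarrow> (\<Sum>i<n. dist (g (x i)) (g (x (Suc i)))) \<le> B"
  shows "arc_var g a t \<le> B"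
  unfolding arc_var_def
proof (rule cSup_least)
  have "0 \<in> {\<Sum>i<n. dist (g (x i)) (g (x (Suc i))) | n x.
     (\<forall>i\<le>n. x i \<in> {a..t}) \<and> (\<forall>i<n. x i \<le> x (Suc (i::nat)))}"
    using assms(1) by (auto intro!: exI[of _ "0::nat"] exI[of _ "\<lambda>_. a"])
  then show "{\<Sum>i<n. dist (g (x i)) (g (x (Suc i))) | n x.
     (\<forall>i\<le>n. x i \<in> {a..t}) \<and> (\<forall>i<n. x i \<le> x (Suc (i::nat)))} \<noteq> {}" by blast
qed (use assms(2) in blast)

lemma arc_var_dist:
  assumes L: "length_le g {a..b} L" and uv: "a \<le> u" "u \<le> v" "v \<le> b"
  shows "arc_var g a u + dist (g u) (g v) \<le> arc_var g a v"
proof -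
  have "arc_var g a u \<le> arc_var g a v - dist (g u) (g v)"
  proof (rule arc_var_le)
    fix n x assume x: "\<And>i. i \<le> n \<Longrightarrow> x i \<in> {a..u}" "\<And>i. i < n \<Longrightarrow> x i \<le> x (Suc i)"
    define y where "y i = (if i \<le> n then x i else if i = Suc n then u else v)" for i
    have "(\<Sum>i<Suc (Suc n). dist (g (y i)) (g (y (Suc i)))) \<le> arc_var g a v"
    proof (rule arc_var_upper[OF L uv(3)])
      show "y i \<in> {a..v}" for i using x(1)[of i] uv by (auto simp: y_def)
      show "y i \<le> y (Suc i)" if "i < Suc (Suc n)" for i
        using x(1)[of i] x(2)[of i] uv that by (auto simp: y_def not_le less_Suc_eq)
    qed
    moreover have "(\<Sum>i<n. dist (g (y i)) (g (y (Suc i)))) = (\<Sum>i<n. dist (g (x i)) (g (x (Suc i))))"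
      by (intro sum.cong) (auto simp: y_def)
    ultimately have "(\<Sum>i<n. dist (g (x i)) (g (x (Suc i)))) + dist (g (x n)) (g u) + dist (g u) (g v) \<le> arc_var g a v"
      by (simp add: y_def)
    then show "(\<Sum>i<n. dist (g (x i)) (g (x (Suc i)))) \<le> arc_var g a v - dist (g u) (g v)"
      using zero_le_dist[of "g (x n)" "g u"] by linarith
  qed fact
  then show ?thesis by simp
qed

lemma arc_var_self: "arc_var g a a = 0"
proof (rule antisym)
  have l: "length_le g {a..a} 0"
    unfolding length_le_def
  proof (intro allI impI)
    fix n :: nat and x assume "\<forall>i\<le>n. x i \<in> {a..a}"
    then have "(\<Sum>i<n. dist (g (x i)) (g (x (Suc i)))) = 0" by (intro sum.neutral) auto
    then show "(\<Sum>i<n. dist (g (x i)) (g (x (Suc i)))) \<le> 0" by simp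
  qed
  then show "arc_var g a a \<le> 0" by (intro arc_var_le) (auto simp: length_le_def)
  show "0 \<le> arc_var g a a" using arc_var_upper[OF l, of a 0 "\<lambda>_. a"] by simp
qed

text \<open>Clamping to the cells of a partition splits the increment of a function over an interval
  into the contributions of the single cells.\<close>

abbreviation clampR :: "real \<Rightarrow> real \<Rightarrow> real \<Rightarrow> real" where "clampR u v y \<equiv> max u (min y v)"

lemma clamp_telescope:
  fixes f :: "real \<Rightarrow> 'v::ab_group_add"
  assumes "\<And>i. i < n \<Longrightarrow> x i \<le> x (Suc i)" "x 0 \<le> y"
  shows "(\<Sum>i<n. f (clampR (x i) (x (Suc i)) y) - f (x i)) = f (min y (x n)) - f (x 0)"
  using assms(1)
proof (induction n)
  case 0
  then show ?case using assms(2) by (simp add: min_def)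
next
  case (Suc n)
  then have IH: "(\<Sum>i<n. f (clampR (x i) (x (Suc i)) y) - f (x i)) = f (min y (x n)) - f (x 0)" by simp
  have "x n \<le> x (Suc n)" using Suc by simp
  then show ?case using IH by (simp add: min_def max_def)
qed

lemma tagged_division_interval:
  assumes "p tagged_division_of {a..b::real}" "(t, K) \<in> p"
  obtains u v where "K = {u..v}" "a \<le> u" "u \<le> t" "t \<le> v" "v \<le> b" "Inf K = u" "Sup K = v"
proof -
  obtain u v where K: "K = cbox u v" using tagged_division_ofD(4)[OF assms] by blast
  have "t \<in> K" "K \<subseteq> {a..b}" using tagged_division_ofD(2,3)[OF assms] by auto
  then have "u \<le> v" "a \<le> u" "v \<le> b" "u \<le> t" "t \<le> v" using K by auto
  then show thesis using K that[of u v] by simp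
qed

lemma tagged_division_interior_count:
  assumes "p tagged_division_of {a..b::real}"
  shows "(\<Sum>(t, K)\<in>p. if Inf K < z \<and> z < Sup K then (1::real) else 0) \<le> 1"
proof -
  have fin: "finite p" using assms by blast
  have "(\<Sum>(t, K)\<in>p. if Inf K < z \<and> z < Sup K then (1::real) else 0)
      = (\<Sum>x\<in>p. if Inf (snd x) < z \<and> z < Sup (snd x) then 1 else 0)" by (simp add: case_prod_unfold)
  also have "\<dots> = real (card {x\<in>p. Inf (snd x) < z \<and> z < Sup (snd x)})"
    using fin by (simp add: sum.If_cases Int_def)
  also have "card {x\<in>p. Inf (snd x) < z \<and> z < Sup (snd x)} \<le> 1"
  proof (subst One_nat_def, subst card_le_Suc0_iff_eq, use fin in simp, intro ballI)
    fix k k' assume k: "k \<in> {x\<in>p. Inf (snd x) < z \<and> z < Sup (snd x)}" "k' \<in> {x\<in>p. Inf (snd x) < z \<and> z < Sup (snd x)}"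
    obtain t K t' K' where kk: "k = (t, K)" "k' = (t', K')" by (metis surj_pair)
    have p: "(t, K) \<in> p" "(t', K') \<in> p" using k kk by auto
    have "z \<in> interior K" if "(t, K) \<in> p" "Inf K < z" "z < Sup K" for t K
      using tagged_division_interval[OF assms that(1)] that by (metis interior_atLeastAtMost_real greaterThanLessThan_iff)
    then have "z \<in> interior K" "z \<in> interior K'" using k kk p by auto
    then show "k = k'" using tagged_division_ofD(5)[OF assms p] kk by auto
  qed
  finally show ?thesis by simp
qed

text \<open>A nearly longest inscribed polygon has finitely many nodes. Each node lies inside at
  most one piece of a division, where uniform continuity makes the loss small; a piece without a
  node in its interior meets only one cell effectively and loses nothing.\<close>

lemma arc_var_fine_chords:
  assumes L: "length_le g {a..b} L" and g: "continuous_on {a..b} g" and ab: "a < b" and e: "e > 0"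
  obtains r where "r > 0" "\<And>p. p tagged_division_of {a..b} \<Longrightarrow> (\<lambda>t. ball t r) fine p \<Longrightarrow>
     (\<Sum>(t, K)\<in>p. dist (g (Inf K)) (g (Sup K))) > arc_var g a b - e"
proof -
  obtain n x where x: "\<And>i. i \<le> n \<Longrightarrow> x i \<in> {a..b}" "\<And>i. i < n \<Longrightarrow> x i \<le> x (Suc i)"
    and xs: "(\<Sum>i<n. dist (g (x i)) (g (x (Suc i)))) > arc_var g a b - e / 2"
  proof (rule ccontr)
    assume *: "\<not> thesis"
    have "arc_var g a b \<le> arc_var g a b - e / 2"
    proof (rule arc_var_le)
      fix n x assume "\<And>i. i \<le> n \<Longrightarrow> x i \<in> {a..b}" "\<And>i. i < n \<Longrightarrow> x i \<le> x (Suc i)"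
      then show "(\<Sum>i<n. dist (g (x i)) (g (x (Suc i)))) \<le> arc_var g a b - e / 2"
        using * that by (meson not_le)
    qed (use ab in simp)
    then show False using e by simp
  qed
  \<comment> \<open>There are n + 1 nodes, and a piece containing one costs at most n * \<omega>;
    the total loss stays below e / 4.\<close>
  define \<omega> where "\<omega> = e / (4 * (real n + 1) * (real n + 1))"
  have \<omega>: "\<omega> > 0" using e by (simp add: \<omega>_def)
  have "uniformly_continuous_on {a..b} g" using g compact_uniformly_continuous by blast
  then obtain r where r: "r > 0" "\<And>s t. s \<in> {a..b} \<Longrightarrow> t \<in> {a..b} \<Longrightarrow> dist s t < r \<Longrightarrow> dist (g s) (g t) < \<omega>"
    using \<omega> unfolding uniformly_continuous_on_def by metis
  define G where "G i y = g (clampR (x i) (x (Suc i)) y)" for i y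
  show thesis
  proof (rule that[of "r / 2"])
    fix p assume p: "p tagged_division_of {a..b}" and fine: "(\<lambda>t. ball t (r / 2)) fine p"
    have key: "(\<Sum>i<n. dist (G i (Inf K)) (G i (Sup K))) \<le> dist (g (Inf K)) (g (Sup K)) +
        (\<Sum>j\<le>n. (if Inf K < x j \<and> x j < Sup K then 1 else 0) * (real n * \<omega>))" (is "?A \<le> ?B + ?C")
      if tK: "(t, K) \<in> p" for t K
    proof -
      obtain u v where K: "K = {u..v}" "a \<le> u" "u \<le> t" "t \<le> v" "v \<le> b" "Inf K = u" "Sup K = v"
        using tagged_division_interval[OF p tK] by blast
      have C0: "?C \<ge> 0" using \<omega> by (intro sum_nonneg) auto
      have "K \<subseteq> ball t (r / 2)" using fine tK by (auto simp: fine_def)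
      moreover have "u \<in> K" "v \<in> K" using K by auto
      ultimately have "u \<in> ball t (r/2)" "v \<in> ball t (r/2)" by blast+
      then have uv: "v - u < r" using K by (auto simp: dist_real_def)
      show ?thesis
      proof (cases "\<exists>j\<le>n. u < x j \<and> x j < v")
        case True
        then obtain j where j: "j \<le> n" "u < x j" "x j < v" by blast
        have "?A \<le> (\<Sum>i<n. \<omega>)"
        proof (rule sum_mono)
          fix i assume i: "i \<in> {..<n}"
          have xi: "x i \<in> {a..b}" "x (Suc i) \<in> {a..b}" "x i \<le> x (Suc i)" using x i by auto
          have "dist (G i u) (G i v) < \<omega>" unfolding G_def
          proof (rule r(2))
            show "dist (clampR (x i) (x (Suc i)) u) (clampR (x i) (x (Suc i)) v) < r"
              using uv r(1) K(3,4) xi(3) by (auto simp: dist_real_def max_def min_def)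
          qed (use xi K in auto)
          then show "dist (G i (Inf K)) (G i (Sup K)) \<le> \<omega>" using K by simp
        qed
        also have "\<dots> = real n * \<omega>" by simp
        also have "\<dots> \<le> ?C"
          using member_le_sum[of j "{..n}" "\<lambda>j. (if Inf K < x j \<and> x j < Sup K then 1 else 0) * (real n * \<omega>)"] j K \<omega> by auto
        finally show ?thesis using zero_le_dist[of "g (Inf K)" "g (Sup K)"] by linarith
      next
        case False
        have "?A \<le> ?B"
        proof (cases "\<exists>i<n. G i u \<noteq> G i v")
          case True
          then obtain i where i: "i < n" "G i u \<noteq> G i v" by blast
          have xi: "x i \<le> x (Suc i)" using x i by auto
          have "\<not> (u < x i \<and> x i < v)" "\<not> (u < x (Suc i) \<and> x (Suc i) < v)" using False i by auto
          moreover have "u \<noteq> v" using i(2) by auto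
          ultimately have in1: "x i \<le> u" "v \<le> x (Suc i)" "u < v"
            using i(2) K(3,4) xi unfolding G_def by (auto simp: max_def min_def split: if_splits)
          have mono: "x j \<le> x k" if "j \<le> k" "k \<le> n" for j k
            using that by (induction k rule: dec_induct) (auto intro: order_trans[OF _ x(2)])
          have "G j u = G j v" if j: "j < n" "j \<noteq> i" for j
          proof -
            have "x (Suc j) \<le> u \<or> v \<le> x j" using mono[of "Suc j" i] mono[of "Suc i" j] j i in1
              by (meson Suc_leI leI less_imp_le_nat linorder_neqE_nat order_trans)
            then show ?thesis using x(2)[OF j(1)] in1 unfolding G_def by (auto simp: max_def min_def)
          qed
          then have "?A = (\<Sum>j\<in>{i}. dist (G j u) (G j v))" using i unfolding K(6,7)
            by (intro sum.mono_neutral_right) auto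
          also have "\<dots> = ?B" using in1 K unfolding G_def by (simp add: max_def min_def)
          finally show ?thesis by simp
        next
          case False
          then show ?thesis using K by simp
        qed
        then show ?thesis using C0 by simp
      qed
    qed
    have fin: "finite p" using p by blast
    have "(\<Sum>i<n. dist (g (x i)) (g (x (Suc i)))) \<le> (\<Sum>i<n. \<Sum>(t,K)\<in>p. dist (G i (Inf K)) (G i (Sup K)))"
    proof (rule sum_mono)
      fix i assume i: "i \<in> {..<n}"
      have xi: "x i \<in> {a..b}" "x (Suc i) \<in> {a..b}" "x i \<le> x (Suc i)" using x i by auto
      have "g (x (Suc i)) - g (x i) = G i b - G i a" using xi by (auto simp: G_def max_def min_def)
      also have "\<dots> = (\<Sum>(t,K)\<in>p. G i (Sup K) - G i (Inf K))" using additive_tagged_division_1[OF less_imp_le[OF ab] p, of "G i"] by simp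
      finally have "dist (g (x i)) (g (x (Suc i))) = norm (\<Sum>(t,K)\<in>p. G i (Sup K) - G i (Inf K))" by (metis dist_commute dist_norm)
      also have "\<dots> \<le> (\<Sum>(t,K)\<in>p. dist (G i (Inf K)) (G i (Sup K)))"
        by (intro sum_norm_le) (auto simp: dist_norm norm_minus_commute)
      finally show "dist (g (x i)) (g (x (Suc i))) \<le> (\<Sum>(t,K)\<in>p. dist (G i (Inf K)) (G i (Sup K)))" .
    qed
    also have "\<dots> = (\<Sum>(t,K)\<in>p. \<Sum>i<n. dist (G i (Inf K)) (G i (Sup K)))"
      unfolding case_prod_unfold by (rule sum.swap)
    also have "\<dots> \<le> (\<Sum>(t,K)\<in>p. dist (g (Inf K)) (g (Sup K)) +
        (\<Sum>j\<le>n. (if Inf K < x j \<and> x j < Sup K then 1 else 0) * (real n * \<omega>)))"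
      using key by (intro sum_mono) auto
    also have "\<dots> = (\<Sum>(t,K)\<in>p. dist (g (Inf K)) (g (Sup K))) +
        (\<Sum>j\<le>n. (\<Sum>(t,K)\<in>p. if Inf K < x j \<and> x j < Sup K then 1 else 0) * (real n * \<omega>))"
      unfolding case_prod_unfold sum.distrib sum_distrib_right by (subst (2) sum.swap) (rule refl)
    also have "(\<Sum>j\<le>n. (\<Sum>(t,K)\<in>p. if Inf K < x j \<and> x j < Sup K then 1 else 0) * (real n * \<omega>)) \<le> (\<Sum>j\<le>n. 1 * (real n * \<omega>))"
      using \<omega> by (intro sum_mono mult_right_mono tagged_division_interior_count[OF p]) auto
    also have "\<dots> = (real n + 1) * real n * \<omega>" by simp
    also have "\<dots> \<le> (real n + 1) * (real n + 1) * \<omega>" using \<omega> by (intro mult_right_mono mult_left_mono) auto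
    finally have bnd: "(\<Sum>i<n. dist (g (x i)) (g (x (Suc i)))) \<le> (\<Sum>(t, K)\<in>p. dist (g (Inf K)) (g (Sup K))) + (real n + 1) * (real n + 1) * \<omega>" by simp
    have "k * k * (e / (4 * k * k)) = e / 4" if "k \<noteq> 0" for k :: real using that by simp
    from this[of "real n + 1"] have "(real n + 1) * (real n + 1) * \<omega> = e / 4" by (simp add: \<omega>_def)
    with bnd show "(\<Sum>(t, K)\<in>p. dist (g (Inf K)) (g (Sup K))) > arc_var g a b - e" using xs e by linarith
  qed (use r in simp)
qed


text \<open>The number S may depend on e. Two such numbers are close because both fineness
  conditions are met by a common division, so they converge.\<close>

lemma has_RS_integral_Cauchy:
  fixes f :: "real \<Rightarrow> real \<Rightarrow> real \<Rightarrow> real"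
  assumes "\<And>e. e > 0 \<Longrightarrow> \<exists>S. \<exists>r>0. \<forall>p. p tagged_division_of {a..b} \<longrightarrow> (\<lambda>t. ball t r) fine p \<longrightarrow>
     \<bar>(\<Sum>(t, K)\<in>p. f t (Inf K) (Sup K)) - S\<bar> \<le> e"
  shows "\<exists>I. has_RS_integral f I a b"
proof -
  let ?F = "\<lambda>p. \<Sum>(t, K)\<in>p. f t (Inf K) (Sup K)"
  have "\<forall>k. \<exists>S r. r > 0 \<and> (\<forall>p. p tagged_division_of {a..b} \<longrightarrow> (\<lambda>t. ball t r) fine p \<longrightarrow>
     \<bar>?F p - S\<bar> \<le> inverse (real (Suc k)))"
  proof
    fix k
    have "inverse (real (Suc k)) > 0" by simp
    from assms[OF this] show "\<exists>S r. r > 0 \<and> (\<forall>p. p tagged_division_of {a..b} \<longrightarrow> (\<lambda>t. ball t r) fine p \<longrightarrow>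
     \<bar>?F p - S\<bar> \<le> inverse (real (Suc k)))" by blast
  qed
  then obtain S r where Sr: "\<And>k. r k > 0" "\<And>k p. p tagged_division_of {a..b} \<Longrightarrow> (\<lambda>t. ball t (r k)) fine p \<Longrightarrow>
     \<bar>?F p - S k\<bar> \<le> inverse (real (Suc k))"
    unfolding choice_iff by blast
  have SS: "\<bar>S j - S k\<bar> \<le> inverse (real (Suc j)) + inverse (real (Suc k))" for j k
  proof -
    have "gauge (\<lambda>t::real. ball t (min (r j) (r k)))" using Sr(1) by (intro gauge_ball) simp
    then obtain p where p: "p tagged_division_of {a..b}" "(\<lambda>t. ball t (min (r j) (r k))) fine p"
      using fine_division_exists_real by blast
    then have "(\<lambda>t. ball t (r j)) fine p" "(\<lambda>t. ball t (r k)) fine p" by (auto simp: fine_def subset_iff)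
    then show ?thesis using Sr(2)[OF p(1), of j] Sr(2)[OF p(1), of k] by linarith
  qed
  have "Cauchy S"
  proof (rule metric_CauchyI)
    fix e :: real assume "e > 0"
    then obtain M where M: "inverse (real (Suc M)) < e / 2" using reals_Archimedean[of "e / 2"] by auto
    show "\<exists>M. \<forall>m\<ge>M. \<forall>n\<ge>M. dist (S m) (S n) < e"
    proof (intro exI[of _ M] allI impI)
      fix m n assume mn: "m \<ge> M" "n \<ge> M"
      have "inverse (real (Suc m)) \<le> inverse (real (Suc M))" "inverse (real (Suc n)) \<le> inverse (real (Suc M))"
        using mn by (auto intro!: le_imp_inverse_le)
      then show "dist (S m) (S n) < e" using SS[of m n] M unfolding dist_real_def by linarith
    qed
  qed
  then obtain I where I: "S \<longlonglongrightarrow> I" using Cauchy_convergent convergent_def by blast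
  have SI: "\<bar>S k - I\<bar> \<le> inverse (real (Suc k))" for k
  proof (rule LIMSEQ_le)
    show "(\<lambda>j. \<bar>S k - S j\<bar>) \<longlonglongrightarrow> \<bar>S k - I\<bar>" using I by (intro tendsto_intros)
    show "(\<lambda>j. inverse (real (Suc k)) + inverse (real (Suc j))) \<longlonglongrightarrow> inverse (real (Suc k))"
      using tendsto_add[OF tendsto_const LIMSEQ_inverse_real_of_nat] by simp
  qed (use SS in auto)
  have "has_RS_integral f I a b" unfolding has_RS_integral_def
  proof (intro allI impI)
    fix e :: real assume "e > 0"
    then obtain k where k: "inverse (real (Suc k)) < e / 2" using reals_Archimedean[of "e / 2"] by auto
    show "\<exists>r>0. \<forall>p. p tagged_division_of {a..b} \<longrightarrow> (\<lambda>t. ball t r) fine p \<longrightarrow> norm (?F p - I) < e"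
    proof (intro exI[of _ "r k"] conjI allI impI Sr(1))
      fix p assume "p tagged_division_of {a..b}" "(\<lambda>t. ball t (r k)) fine p"
      then show "norm (?F p - I) < e" using Sr(2)[of p k] SI[of k] k unfolding real_norm_def by linarith
    qed
  qed
  then show ?thesis by blast
qed

text \<open>The chord is replaced by the increment of the length function, at the cost e1 times the
  bound M of N. The resulting sum has an additive integrator and is compared with one fixed
  partition by the uniform continuity of N.\<close>

lemma has_RS_integral_arc_exists:
  assumes L: "length_le g {a..b} L" and g: "continuous_on {a..b} g" and N: "continuous_on {a..b} N" and ab: "a < b"
  shows "\<exists>I. has_RS_integral (\<lambda>t u v. dist (g u) (g v) * N t) I a b"
proof (rule has_RS_integral_Cauchy)
  fix e :: real assume e: "e > 0"
  define V where "V = arc_var g a"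
  have Vd: "V u + dist (g u) (g v) \<le> V v" if "a \<le> u" "u \<le> v" "v \<le> b" for u v
    unfolding V_def using arc_var_dist[OF L that] .
  then have Vm: "V u \<le> V v" if "a \<le> u" "u \<le> v" "v \<le> b" for u v
    using Vd[OF that] zero_le_dist[of "g u" "g v"] by linarith
  have Va: "V a = 0" by (simp add: V_def arc_var_self)
  have V0: "V b \<ge> 0" using Vm[of a b] Va ab by simp
  obtain M where M: "\<And>t. t \<in> {a..b} \<Longrightarrow> \<bar>N t\<bar> \<le> M"
    using compact_imp_bounded[OF compact_continuous_image[OF N compact_Icc]] unfolding bounded_iff real_norm_def by blast
  have M0: "M \<ge> 0" using M[of a] ab by auto
  define e1 where "e1 = e / (2 * (M + 1))"
  define e2 where "e2 = e / (2 * (V b + 1))"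
  have "e1 > 0" using e M0 by (simp add: e1_def)
  then have "M * e1 \<le> (M + 1) * e1" by (intro mult_right_mono) auto
  also have "\<dots> = e / 2" using M0 by (simp add: e1_def field_simps)
  finally have e1: "e1 > 0" "M * e1 \<le> e / 2" using e M0 by (auto simp: e1_def)
  have "e2 > 0" using e V0 by (simp add: e2_def)
  then have "e2 * V b \<le> e2 * (V b + 1)" by (intro mult_left_mono) auto
  also have "\<dots> = e / 2" using V0 by (simp add: e2_def field_simps)
  finally have e2: "e2 > 0" "e2 * V b \<le> e / 2" using e V0 by (auto simp: e2_def)
  obtain r1 where r1: "r1 > 0" "\<And>p. p tagged_division_of {a..b} \<Longrightarrow> (\<lambda>t. ball t r1) fine p \<Longrightarrow>
     (\<Sum>(t, K)\<in>p. dist (g (Inf K)) (g (Sup K))) > V b - e1"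
    using arc_var_fine_chords[OF L g ab e1(1)] unfolding V_def by blast
  have "uniformly_continuous_on {a..b} N" using N compact_uniformly_continuous by blast
  then obtain r2 where r2: "r2 > 0" "\<And>s t. s \<in> {a..b} \<Longrightarrow> t \<in> {a..b} \<Longrightarrow> dist s t < r2 \<Longrightarrow> dist (N s) (N t) < e2"
    using e2(1) unfolding uniformly_continuous_on_def by metis
  obtain n x where x: "partition_seq a b (r2 / 2) n x" using partition_seq_exists[OF ab, of "r2 / 2"] r2 by auto
  have x0: "x 0 = a" "x n = b" using x by (auto simp: partition_seq_def)
  have x1: "x i \<in> {a..b}" "x (Suc i) \<in> {a..b}" "x i \<le> x (Suc i)" "x (Suc i) - x i < r2 / 2" if "i < n" for i
    using x that partition_seq_in[OF x, of i] partition_seq_in[OF x, of "Suc i"] by (auto simp: partition_seq_def intro: less_imp_le)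
  \<comment> \<open>\<open>W i\<close> carries the part of the length function that belongs to the
    i-th cell of the reference partition, so that a piece overlapping several cells can be compared
    with each of them.\<close>
  define W where "W i y = V (clampR (x i) (x (Suc i)) y)" for i y
  define S where "S = (\<Sum>i<n. N (x i) * (W i b - W i a))"
  show "\<exists>S. \<exists>r>0. \<forall>p. p tagged_division_of {a..b} \<longrightarrow> (\<lambda>t. ball t r) fine p \<longrightarrow>
     \<bar>(\<Sum>(t, K)\<in>p. dist (g (Inf K)) (g (Sup K)) * N t) - S\<bar> \<le> e"
  proof (rule exI[of _ S], rule exI[of _ "min r1 (r2 / 4)"], intro conjI allI impI)
    fix p assume p: "p tagged_division_of {a..b}" and fine: "(\<lambda>t. ball t (min r1 (r2 / 4))) fine p"
    have f1: "(\<lambda>t. ball t r1) fine p" using fine by (auto simp: fine_def subset_iff)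
    have f2: "(\<lambda>t. ball t (r2/4)) fine p" using fine by (auto simp: fine_def subset_iff)
    have fin: "finite p" using p by blast
    have tel: "(\<Sum>(t,K)\<in>p. f (Sup K) - f (Inf K)) = f b - f a" for f :: "real \<Rightarrow> real"
      using additive_tagged_division_1[OF less_imp_le[OF ab] p, of f] .
    let ?S1 = "\<Sum>(t, K)\<in>p. dist (g (Inf K)) (g (Sup K)) * N t"
    let ?S2 = "\<Sum>(t, K)\<in>p. (V (Sup K) - V (Inf K)) * N t"
    have "\<bar>?S2 - ?S1\<bar> = \<bar>\<Sum>(t, K)\<in>p. (V (Sup K) - V (Inf K) - dist (g (Inf K)) (g (Sup K))) * N t\<bar>"
      unfolding case_prod_unfold by (simp add: sum_subtractf[symmetric] algebra_simps)
    also have "\<dots> \<le> (\<Sum>(t, K)\<in>p. (V (Sup K) - V (Inf K) - dist (g (Inf K)) (g (Sup K))) * M)"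
    proof (rule order_trans[OF sum_abs], rule sum_mono, clarify)
      fix t K assume tK: "(t, K) \<in> p"
      obtain u v where K: "K = {u..v}" "a \<le> u" "u \<le> t" "t \<le> v" "v \<le> b" "Inf K = u" "Sup K = v"
        using tagged_division_interval[OF p tK] by blast
      show "\<bar>(V (Sup K) - V (Inf K) - dist (g (Inf K)) (g (Sup K))) * N t\<bar> \<le> (V (Sup K) - V (Inf K) - dist (g (Inf K)) (g (Sup K))) * M"
        using Vd[of u v] M[of t] K M0 unfolding abs_mult K(6,7)
        by (intro mult_mono) auto
    qed
    also have "\<dots> = (V b - V a - (\<Sum>(t, K)\<in>p. dist (g (Inf K)) (g (Sup K)))) * M"
      unfolding tel[of V, symmetric] by (simp add: case_prod_unfold sum_distrib_right[symmetric] sum_subtractf)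
    also have "\<dots> \<le> e1 * M" using r1(2)[OF p f1] Va M0 by (intro mult_right_mono) auto
    finally have d1: "\<bar>?S2 - ?S1\<bar> \<le> e / 2" using e1(2) by (simp add: mult.commute)
    have dec: "V v - V u = (\<Sum>i<n. W i v - W i u)" if "a \<le> u" "u \<le> v" "v \<le> b" for u v
    proof -
      have "(\<Sum>i<n. W i v - V (x i)) = V v - V a" "(\<Sum>i<n. W i u - V (x i)) = V u - V a"
        using clamp_telescope[of n x v V] clamp_telescope[of n x u V] x0 x1 that unfolding W_def by (auto simp: min_def)
      then show ?thesis by (simp add: sum_subtractf)
    qed
    have S_eq: "S = (\<Sum>(t, K)\<in>p. \<Sum>i<n. N (x i) * (W i (Sup K) - W i (Inf K)))"
    proof -
      have "S = (\<Sum>i<n. \<Sum>(t, K)\<in>p. N (x i) * (W i (Sup K) - W i (Inf K)))"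
        unfolding S_def tel[of "W _", symmetric] by (simp add: case_prod_unfold sum_distrib_left)
      then show ?thesis unfolding case_prod_unfold by (subst sum.swap) simp
    qed
    have S2_eq: "?S2 = (\<Sum>(t, K)\<in>p. \<Sum>i<n. N t * (W i (Sup K) - W i (Inf K)))"
    proof (rule sum.cong[OF refl], clarify)
      fix t K assume tK: "(t, K) \<in> p"
      show "(V (Sup K) - V (Inf K)) * N t = (\<Sum>i<n. N t * (W i (Sup K) - W i (Inf K)))"
      proof -
        obtain u v where K: "a \<le> u" "u \<le> t" "t \<le> v" "v \<le> b" "Inf K = u" "Sup K = v"
          using tagged_division_interval[OF p tK] by blast
        then have "V v - V u = (\<Sum>i<n. W i v - W i u)" by (intro dec) auto
        then show ?thesis using K by (simp add: sum_distrib_left[symmetric] mult.commute)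
      qed
    qed
    have "\<bar>?S2 - S\<bar> = \<bar>\<Sum>(t, K)\<in>p. \<Sum>i<n. (N t - N (x i)) * (W i (Sup K) - W i (Inf K))\<bar>"
      unfolding S_eq S2_eq unfolding case_prod_unfold by (simp only: sum_subtractf left_diff_distrib)
    also have "\<dots> \<le> (\<Sum>(t, K)\<in>p. \<Sum>i<n. e2 * (W i (Sup K) - W i (Inf K)))"
    proof (rule order_trans[OF sum_abs], rule sum_mono, clarify, rule order_trans[OF sum_abs], rule sum_mono)
      fix t K i assume tK: "(t, K) \<in> p" and "i \<in> {..<n}"
      then have i: "i < n" by simp
      obtain u v where K: "K = {u..v}" "a \<le> u" "u \<le> t" "t \<le> v" "v \<le> b" "Inf K = u" "Sup K = v"
        using tagged_division_interval[OF p tK] by blast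
      have "K \<subseteq> ball t (r2/4)" using f2 tK by (auto simp: fine_def)
      moreover have "u \<in> K" "v \<in> K" using K by auto
      ultimately have "u \<in> ball t (r2/4)" "v \<in> ball t (r2/4)" by blast+
      then have uv: "t - u < r2/4" "v - t < r2/4" by (auto simp: dist_real_def abs_if split: if_splits)
      have le: "W i u \<le> W i v" unfolding W_def using K x1[OF i] by (intro Vm) auto
      \<comment> \<open>Either the piece misses the i-th cell and \<open>W i\<close> does not change
        on it, or its tag is within r2 of the node.\<close>
      have "\<bar>N t - N (x i)\<bar> \<le> e2 \<or> W i v = W i u"
      proof (cases "v \<le> x i \<or> x (Suc i) \<le> u")
        case True
        then have "clampR (x i) (x (Suc i)) v = clampR (x i) (x (Suc i)) u" using K x1[OF i] by (auto simp: max_def min_def)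
        then show ?thesis unfolding W_def by simp
      next
        case False
        then have "dist t (x i) < r2" using uv x1[OF i] K by (auto simp: dist_real_def)
        then show ?thesis using r2(2)[of t "x i"] K x1[OF i] by (auto simp: dist_real_def)
      qed
      then show "\<bar>(N t - N (x i)) * (W i (Sup K) - W i (Inf K))\<bar> \<le> e2 * (W i (Sup K) - W i (Inf K))"
        using le unfolding abs_mult K(6,7) by (auto intro: mult_right_mono)
    qed
    also have "\<dots> = (\<Sum>(t, K)\<in>p. e2 * (V (Sup K) - V (Inf K)))"
    proof (rule sum.cong[OF refl], clarify)
      fix t K assume tK: "(t, K) \<in> p"
      show "(\<Sum>i<n. e2 * (W i (Sup K) - W i (Inf K))) = e2 * (V (Sup K) - V (Inf K))"
      proof -
        obtain u v where K: "a \<le> u" "u \<le> t" "t \<le> v" "v \<le> b" "Inf K = u" "Sup K = v"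
          using tagged_division_interval[OF p tK] by blast
        then have "V v - V u = (\<Sum>i<n. W i v - W i u)" by (intro dec) auto
        then show ?thesis using K by (simp add: sum_distrib_left[symmetric])
      qed
    qed
    also have "\<dots> = e2 * (V b - V a)"
      unfolding tel[of V, symmetric] by (simp add: case_prod_unfold sum_distrib_left)
    also have "\<dots> \<le> e / 2" using e2 Va by simp
    finally show "\<bar>?S1 - S\<bar> \<le> e" using d1 by linarith
  qed (use r1 r2 in auto)
qed

text \<open>\<open>arc_length_integral\<close> is built from a definite description, which denotes
  the integral only after existence and uniqueness are known. Through this lemma a bound for the
  variation becomes a bound for an actual integral.\<close>

lemma arc_length_integral_ge:
  assumes L: "length_le g {a..b} L" and g: "continuous_on {a..b} g" and N: "continuous_on {a..b} (\<lambda>t. f (g t))"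
    and ab: "0 < a" "a < b" "b < 1"
  obtains I where "has_RS_integral (\<lambda>t u v. dist (g u) (g v) * f (g t)) I a b" "ennreal I \<le> arc_length_integral g f"
proof -
  obtain I where I: "has_RS_integral (\<lambda>t u v. dist (g u) (g v) * f (g t)) I a b"
    using has_RS_integral_arc_exists[OF L g N ab(2)] by blast
  then have "(THE I. has_RS_integral (\<lambda>t u v. dist (g u) (g v) * f (g t)) I a b) = I"
    using has_RS_integral_unique ab(2) by blast
  then have "ennreal I \<le> arc_length_integral g f"
    unfolding arc_length_integral_def using ab
    by (intro SUP_upper2[of "(a, b)"]) auto
  with I show thesis by (rule that)
qed

section \<open>Deformation of contours\<close>

text \<open>Choose a polygon whose length is within e of the supremum. Any polygon that ends before
  its first node can be put in front of it, so it cannot be longer than e.\<close>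

lemma length_le_small_near_end:
  assumes L: "length_le g {0<..t1} L" and t1: "t1 > (0::real)" and e: "e > 0"
  obtains \<tau> where "\<tau> > 0" "\<tau> \<le> t1" "length_le g {0<..\<tau>} e"
proof -
  define A where "A = {\<Sum>i<n. dist (g (x i)) (g (x (Suc i))) | n x. (\<forall>i\<le>n. x i \<in> {0<..t1}) \<and> (\<forall>i<n. x i \<le> x (Suc (i::nat)))}"
  have bdd: "bdd_above A"
  proof (rule bdd_aboveI)
    fix y assume "y \<in> A"
    then obtain n x where "y = (\<Sum>i<n. dist (g (x i)) (g (x (Suc i))))" "\<forall>i\<le>n. x i \<in> {0<..t1}" "\<forall>i<n. x i \<le> x (Suc i)"
      unfolding A_def by blast
    then show "y \<le> L" using L unfolding length_le_def by blast
  qed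
  have "(\<Sum>i<0. dist (g t1) (g t1)) \<in> A" unfolding A_def using t1 by (auto intro!: exI[of _ "0::nat"] exI[of _ "\<lambda>_. t1"])
  then have ne: "A \<noteq> {}" by blast
  have "Sup A - e < Sup A" using e by simp
  then obtain y where y: "y \<in> A" "Sup A - e < y" using less_cSup_iff[OF ne bdd] by blast
  then obtain n x where x: "y = (\<Sum>i<n. dist (g (x i)) (g (x (Suc i))))" "\<forall>i\<le>n. x i \<in> {0<..t1}" "\<forall>i<n. x i \<le> x (Suc i)"
    unfolding A_def by blast
  show thesis
  proof (rule that[of "x 0"])
    show "length_le g {0<..x 0} e" unfolding length_le_def
    proof (intro allI impI)
      fix k z assume z: "\<forall>i\<le>k. z i \<in> {0<..x 0}" "\<forall>i<k. z i \<le> z (Suc i)"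
      define w where "w i = (if i \<le> k then z i else x (i - Suc k))" for i
      have "(\<Sum>i<Suc k + n. dist (g (w i)) (g (w (Suc i)))) \<in> A"
      proof -
        have "w i \<in> {0<..t1}" if "i \<le> Suc k + n" for i
        proof (cases "i \<le> k")
          case True
          then have "z i \<in> {0<..x 0}" "x 0 \<in> {0<..t1}" using z x by auto
          then show ?thesis using True by (auto simp: w_def)
        next
          case False
          then have "i - Suc k \<le> n" using that by simp
          then show ?thesis using False x by (auto simp: w_def)
        qed
        moreover have "w i \<le> w (Suc i)" if "i < Suc k + n" for i
        proof -
          consider "i < k" | "i = k" | "i > k" by linarith
          then show ?thesis
          proof cases
            case 3
            then have "i - Suc k < n" "Suc (i - Suc k) = i - k" using that by auto
            then have "x (i - Suc k) \<le> x (i - k)" using x(3) by metis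
            then show ?thesis using 3 by (simp add: w_def)
          qed (use z in \<open>auto simp: w_def\<close>)
        qed
        ultimately show ?thesis unfolding A_def by blast
      qed
      then have mem: "(\<Sum>i<Suc k + n. dist (g (w i)) (g (w (Suc i)))) \<le> Sup A" using cSup_upper bdd by blast
      have spl: "(\<Sum>i<m + n. f i) = (\<Sum>i<m. f i) + (\<Sum>i<n. f (m + i))" for f :: "nat \<Rightarrow> real" and m n
        by (induction n) auto
      have "(\<Sum>i<Suc k. dist (g (w i)) (g (w (Suc i)))) + (\<Sum>i<n. dist (g (w (Suc k + i))) (g (w (Suc (Suc k + i))))) \<le> Sup A"
        using mem by (simp only: spl)
      moreover have "(\<Sum>i<n. dist (g (w (Suc k + i))) (g (w (Suc (Suc k + i))))) = y"
        unfolding x(1) by (intro sum.cong) (auto simp: w_def Suc_diff_le)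
      moreover have "(\<Sum>i<k. dist (g (w i)) (g (w (Suc i)))) = (\<Sum>i<k. dist (g (z i)) (g (z (Suc i))))"
        by (intro sum.cong) (auto simp: w_def)
      ultimately show "(\<Sum>i<k. dist (g (z i)) (g (z (Suc i)))) \<le> e"
        using y(2) zero_le_dist[of "g (w k)" "g (w (Suc k))"] unfolding sum.lessThan_Suc by linarith
    qed
  qed (use x in auto)
qed

lemma length_le_subset: "length_le g S L \<Longrightarrow> T \<subseteq> S \<Longrightarrow> length_le g T L"
  unfolding length_le_def by (meson subsetD)

text \<open>A has countably many components, all of them intervals. The image of a component lies
  within B times its length of one value, hence in an interval of twice that length; this is the
  factor 2. Countable subadditivity of Lebesgue measure finishes.\<close>

lemma differentiable_image_length_bound:
  fixes f :: "real \<Rightarrow> real"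
  assumes A: "open A" "A \<subseteq> {\<alpha>..\<beta>}" and f: "\<And>x. x \<in> A \<Longrightarrow> (f has_real_derivative f' x) (at x)"
    and B: "\<And>x. x \<in> A \<Longrightarrow> \<bar>f' x\<bar> \<le> B" "B \<ge> 0" and cover: "{c<..<d} \<subseteq> f ` A" and cd: "c < d" and ab: "\<alpha> \<le> \<beta>"
  shows "d - c \<le> 2 * B * (\<beta> - \<alpha>)"
proof -
  let ?C = "components A"
  have opn: "open C" if "C \<in> ?C" for C using that A(1) open_components by blast
  have cnt: "countable ?C"
    using countable_disjoint_open_subsets[of ?C] opn pairwise_disjoint_components[of A]
    by (auto simp: disjoint_def pairwise_def disjnt_def)
  define idx where "idx = to_nat_on ?C"
  have inj: "inj_on idx ?C" using cnt inj_on_to_nat_on unfolding idx_def by blast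
  define X where "X n = (if n \<in> idx ` ?C then from_nat_into ?C n else {})" for n
  have X_idx: "X (idx C) = C" if "C \<in> ?C" for C using that cnt by (simp add: X_def idx_def)
  have X_cases: "X n = {} \<or> X n \<in> ?C" for n using X_idx by (auto simp: X_def)
  have UX: "(\<Union>n. X n) = A"
  proof -
    have "(\<Union>n. X n) = \<Union> ?C"
    proof
      show "(\<Union>n. X n) \<subseteq> \<Union> ?C" using X_cases by blast
      show "\<Union> ?C \<subseteq> (\<Union>n. X n)"
      proof
        fix x assume "x \<in> \<Union> ?C"
        then obtain C where "C \<in> ?C" "x \<in> C" by (rule UnionE)
        then have "x \<in> X (idx C)" using X_idx by simp
        then show "x \<in> (\<Union>n. X n)" by blast
      qed
    qed
    also have "\<dots> = A" by simp
    finally show ?thesis .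
  qed
  have disj: "disjoint_family X"
    unfolding disjoint_family_on_def
  proof (intro ballI impI)
    fix m n :: nat assume "m \<noteq> n"
    show "X m \<inter> X n = {}"
    proof (cases "X m = {} \<or> X n = {}")
      case False
      then have mn: "m \<in> idx ` ?C" "n \<in> idx ` ?C" by (auto simp: X_def split: if_splits)
      then obtain C C' where "C \<in> ?C" "C' \<in> ?C" "m = idx C" "n = idx C'" by blast
      then show ?thesis using X_idx \<open>m \<noteq> n\<close> components_nonoverlap by metis
    qed auto
  qed
  have Xm: "X n \<in> sets lborel" for n using X_cases[of n] opn by auto
  define len where "len n = measure lborel (X n)" for n
  have fin: "emeasure lborel (X n) = ennreal (len n)" for n
  proof -
    have "X n \<subseteq> {\<alpha>..\<beta>}" using UX A(2) by blast
    then have "emeasure lborel (X n) \<le> emeasure lborel {\<alpha>..\<beta>}" by (intro emeasure_mono) auto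
    also have "\<dots> < \<infinity>" using ab by simp
    finally show ?thesis unfolding len_def by (intro emeasure_eq_ennreal_measure) auto
  qed
  have dist_le: "\<bar>x - y\<bar> \<le> len n" if xy: "x \<in> X n" "y \<in> X n" for x y n
  proof -
    have *: "y - x \<le> len n" if "x \<in> X n" "y \<in> X n" "x \<le> y" for x y
    proof -
      have "X n \<in> ?C" using X_cases[of n] that by auto
      then have "connected (X n)" by (rule in_components_connected)
      then have "{x..y} \<subseteq> X n" using that connected_contains_Icc by blast
      then have "emeasure lborel {x..y} \<le> emeasure lborel (X n)" using Xm by (intro emeasure_mono) auto
      then show ?thesis using that fin by (simp add: len_def)
    qed
    show ?thesis using *[of x y] *[of y x] xy by linarith
  qed
  define J where "J n = (if X n = {} then {} else {f (SOME x. x \<in> X n) - B * len n .. f (SOME x. x \<in> X n) + B * len n})" for n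
  have fJ: "f ` X n \<subseteq> J n" for n
  proof (cases "X n = {}")
    case False
    define x0 where "x0 = (SOME x. x \<in> X n)"
    have x0: "x0 \<in> X n" unfolding x0_def using False by (simp add: some_in_eq)
    have C: "X n \<in> ?C" using X_cases[of n] False by auto
    then have cvx: "convex (X n)" using in_components_connected connected_convex_1 by blast
    have XA: "X n \<subseteq> A" using UX by blast
    have "\<bar>f x - f x0\<bar> \<le> B * len n" if x: "x \<in> X n" for x
    proof -
      have "norm (f x - f x0) \<le> B * norm (x - x0)"
        by (rule field_differentiable_bound[OF cvx, of f f'])
          (use XA B(1) x x0 in \<open>auto intro: has_field_derivative_at_within[OF f]\<close>)
      also have "\<dots> \<le> B * len n" using dist_le[OF x x0] B(2) by (auto intro: mult_left_mono)
      finally show ?thesis by simp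
    qed
    then show ?thesis using False by (auto simp: J_def x0_def abs_le_iff algebra_simps)
  qed simp
  have len0: "len n \<ge> 0" for n by (simp add: len_def)
  have "ennreal (d - c) = emeasure lborel {c<..<d}" using cd by simp
  also have "\<dots> \<le> emeasure lborel (\<Union>n. J n)"
  proof (rule emeasure_mono)
    have "f ` A \<subseteq> (\<Union>n. J n)" using fJ UX by blast
    with cover show "{c<..<d} \<subseteq> (\<Union>n. J n)" by (rule order_trans)
  qed (auto simp: J_def)
  also have "\<dots> \<le> (\<Sum>n. emeasure lborel (J n))" by (intro emeasure_subadditive_countably) (auto simp: J_def)
  also have "\<dots> \<le> (\<Sum>n. ennreal (2 * B) * emeasure lborel (X n))"
  proof (intro suminf_le summableI)
    fix n
    show "emeasure lborel (J n) \<le> ennreal (2 * B) * emeasure lborel (X n)"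
      using len0[of n] B(2) by (auto simp: J_def fin ennreal_mult[symmetric])
  qed
  also have "\<dots> = ennreal (2 * B) * (\<Sum>n. emeasure lborel (X n))" by simp
  also have "(\<Sum>n. emeasure lborel (X n)) = emeasure lborel A"
    using suminf_emeasure[OF _ disj, of lborel] Xm UX by auto
  also have "emeasure lborel A \<le> emeasure lborel {\<alpha>..\<beta>}" using A by (intro emeasure_mono) auto
  also have "\<dots> = ennreal (\<beta> - \<alpha>)" using ab by simp
  finally have "ennreal (d - c) \<le> ennreal (2 * B) * ennreal (\<beta> - \<alpha>)" by (simp add: mult_left_mono)
  then show ?thesis using B(2) ab by (simp add: ennreal_mult[symmetric] ennreal_le_iff)
qed

text \<open>Brouwer's theorem for the map p - (f p, g p) cut back to the rectangle. At a fixed point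
  with f or g nonzero, the cut must be active, which puts the point on a side where that function
  has the opposite sign.\<close>

lemma poincare_miranda:
  fixes f g :: "real \<times> real \<Rightarrow> real"
  assumes le: "a \<le> c" "b \<le> d" and f: "continuous_on (cbox (a, b) (c, d)) f" and g: "continuous_on (cbox (a, b) (c, d)) g"
    and f0: "\<And>y. y \<in> {b..d} \<Longrightarrow> f (a, y) < 0" and f1: "\<And>y. y \<in> {b..d} \<Longrightarrow> f (c, y) > 0"
    and g0: "\<And>x. x \<in> {a..c} \<Longrightarrow> g (x, b) < 0" and g1: "\<And>x. x \<in> {a..c} \<Longrightarrow> g (x, d) > 0"
  obtains x y where "x \<in> {a..c}" "y \<in> {b..d}" "f (x, y) = 0" "g (x, y) = 0"
proof -
  let ?S = "cbox (a, b) (c, d)"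
  define \<Psi> where "\<Psi> p = (clampR a c (fst p - f p), clampR b d (snd p - g p))" for p
  have S: "(x, y) \<in> ?S \<longleftrightarrow> x \<in> {a..c} \<and> y \<in> {b..d}" for x y by (auto simp: cbox_Pair_eq)
  have "continuous_on ?S \<Psi>" unfolding \<Psi>_def using f g
    by (intro continuous_on_Pair continuous_on_max continuous_on_min continuous_intros) auto
  moreover have "\<Psi> \<in> ?S \<rightarrow> ?S" using le by (auto simp: \<Psi>_def S)
  moreover have "?S \<noteq> {}"
  proof -
    have "(a, b) \<in> ?S" unfolding S using le by simp
    then show ?thesis by blast
  qed
  ultimately obtain p where p: "p \<in> ?S" "\<Psi> p = p" using brouwer[OF compact_cbox convex_box(1)] by blast
  obtain x y where xy: "p = (x, y)" by (metis surj_pair)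
  have in_: "x \<in> {a..c}" "y \<in> {b..d}" using p(1) S xy by auto
  have fx: "clampR a c (x - f (x, y)) = x" "clampR b d (y - g (x, y)) = y" using p(2) xy by (auto simp: \<Psi>_def)
  have "f (x, y) = 0"
  proof (rule ccontr)
    assume "f (x, y) \<noteq> 0"
    then have "(f (x, y) > 0 \<and> x = a) \<or> (f (x, y) < 0 \<and> x = c)" using fx(1) in_(1) by (auto simp: max_def min_def split: if_splits)
    then show False using f0[OF in_(2)] f1[OF in_(2)] by auto
  qed
  moreover have "g (x, y) = 0"
  proof (rule ccontr)
    assume "g (x, y) \<noteq> 0"
    then have "(g (x, y) > 0 \<and> y = b) \<or> (g (x, y) < 0 \<and> y = d)" using fx(2) in_(2) by (auto simp: max_def min_def split: if_splits)
    then show False using g0[OF in_(1)] g1[OF in_(1)] by auto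
  qed
  ultimately show thesis using that in_ by blast
qed

text \<open>C itself need not be open; the component of V that contains it is.\<close>

lemma zero_derivative_constant_on_connected:
  fixes W :: "complex \<Rightarrow> complex"
  assumes V: "open V" and W: "\<And>w. w \<in> V \<Longrightarrow> (W has_field_derivative 0) (at w)" and C: "connected C" "C \<subseteq> V"
    and xy: "x \<in> C" "y \<in> C"
  shows "W x = W y"
proof -
  let ?K = "connected_component_set V x"
  have CK: "C \<subseteq> ?K" using C xy by (intro connected_component_maximal) auto
  have "open ?K" using V by (rule open_connected_component)
  have KV: "?K \<subseteq> V" by (rule connected_component_subset)
  have "W constant_on ?K"
    by (rule has_field_derivative_0_imp_constant_on) (use KV W \<open>open ?K\<close> in auto)
  then show ?thesis using CK xy unfolding constant_on_def by (metis subsetD)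
qed

text \<open>Near a boundary point D may have infinitely many components, so \<Phi> and a local
  primitive need not differ by a single constant there. The image of a half ball in parameter space
  is connected, and on it the difference is constant. Hence \<Phi> extends to s = 0 as a function of
  the parameter, though perhaps not as a function of the point.\<close>

lemma prim_along_homotopy:
  fixes h :: "real \<times> real \<Rightarrow> complex"
  assumes U: "open U" and D: "open D" "D \<subseteq> U" and F: "F holomorphic_on U"
    and h: "continuous_on ({0..1} \<times> {0<..<1}) h"
    and hD: "\<And>s t. s \<in> {0<..1} \<Longrightarrow> t \<in> {0<..<1} \<Longrightarrow> h (s, t) \<in> D"
    and h0: "\<And>t. t \<in> {0<..<1} \<Longrightarrow> h (0, t) \<in> U"
    and \<Phi>: "\<And>w. w \<in> D \<Longrightarrow> (\<Phi> has_field_derivative F w) (at w)"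
  obtains P where "prim_along F h P ({0..1} \<times> {0<..<1})"
    "\<And>s t. s \<in> {0<..1} \<Longrightarrow> t \<in> {0<..<1} \<Longrightarrow> P (s, t) = \<Phi> (h (s, t))"
proof -
  let ?S = "{0..1} \<times> {0<..<1::real}"
  \<comment> \<open>The limit exists: close to s = 0 the values of \<Phi> along the homotopy agree
    with a local primitive up to a constant.\<close>
  define P where "P p = (if fst p = 0 then Lim (at_right 0) (\<lambda>s. \<Phi> (h (s, snd p))) else \<Phi> (h p))" for p
  have loc: "\<exists>r>0. \<exists>\<Psi>. (\<forall>w\<in>ball (h x) r. (\<Psi> has_field_derivative F w) (at w)) \<and>
        (\<exists>d>0. \<forall>y\<in>?S. dist y x < d \<longrightarrow> P y = \<Psi> (h y))" if x: "x \<in> ?S" for x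
  proof (cases "fst x = 0")
    case False
    then have sx: "fst x \<in> {0<..1}" "snd x \<in> {0<..<1}" using x by (auto simp: mem_Times_iff)
    then have "h x \<in> D" using hD[of "fst x" "snd x"] by simp
    then obtain r where r: "r > 0" "ball (h x) r \<subseteq> D" using D(1) open_contains_ball by blast
    have "P y = \<Phi> (h y)" if "y \<in> ?S" "dist y x < fst x" for y
    proof -
      have "dist (fst y) (fst x) < fst x" using dist_fst_le[of y x] that by linarith
      then have "fst y \<noteq> 0" by (auto simp: dist_real_def)
      then show ?thesis by (simp add: P_def)
    qed
    then show ?thesis using r \<Phi> sx by (intro exI[of _ r] conjI exI[of _ \<Phi>] exI[of _ "fst x"]) auto
  next
    case True
    define t0 where "t0 = snd x"
    have t0: "t0 \<in> {0<..<1}" "x = (0, t0)" using x True by (auto simp: t0_def mem_Times_iff prod_eq_iff)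
    obtain r where r: "r > 0" "ball (h x) r \<subseteq> U" using U h0[OF t0(1)] t0(2) open_contains_ball by metis
    have "F holomorphic_on ball (h x) r" using F r(2) holomorphic_on_subset by blast
    then obtain \<Psi>0 where \<Psi>0: "\<And>w. w \<in> ball (h x) r \<Longrightarrow> (\<Psi>0 has_field_derivative F w) (at w)"
      using holomorphic_convex_primitive'[OF convex_ball open_ball]
      by (metis at_within_open open_ball)
    obtain d1 where d1: "d1 > 0" "\<And>y. y \<in> ?S \<Longrightarrow> dist y x < d1 \<Longrightarrow> dist (h y) (h x) < r"
      using h x r(1) unfolding continuous_on_iff by metis
    define d where "d = min d1 (min t0 (1 - t0))"
    have d: "d > 0" "d \<le> d1" "d \<le> t0" "d \<le> 1 - t0" using d1 t0 by (auto simp: d_def)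
    define Q where "Q = ball x d \<inter> ({0<..1} \<times> {0<..<1})"
    have QS: "Q \<subseteq> ?S" by (auto simp: Q_def)
    have "connected Q" unfolding Q_def by (intro convex_connected convex_Int convex_ball convex_Times) auto
    then have hQ: "connected (h ` Q)" using h QS by (meson connected_continuous_image continuous_on_subset)
    have hQD: "h ` Q \<subseteq> D \<inter> ball (h x) r"
    proof
      fix w assume "w \<in> h ` Q"
      then obtain y where y: "y \<in> Q" "w = h y" by blast
      have "dist (h y) (h x) < r" using y d QS by (intro d1) (auto simp: Q_def dist_commute)
      moreover have "h y \<in> D" using hD[of "fst y" "snd y"] y by (auto simp: Q_def)
      ultimately show "w \<in> D \<inter> ball (h x) r" using y by (auto simp: dist_commute)
    qed
    define s0 where "s0 = min d 1 / 2"
    have "dist (s0, t0) (0, t0) = s0" using d by (auto simp: s0_def dist_Pair_Pair dist_real_def)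
    then have s0: "(s0, t0) \<in> Q" using d t0 by (auto simp: Q_def s0_def dist_commute)
    define c where "c = \<Phi> (h (s0, t0)) - \<Psi>0 (h (s0, t0))"
    have const: "\<Phi> (h y) = \<Psi>0 (h y) + c" if "y \<in> Q" for y
    proof -
      have "\<Phi> (h y) - \<Psi>0 (h y) = \<Phi> (h (s0, t0)) - \<Psi>0 (h (s0, t0))"
      proof (rule zero_derivative_constant_on_connected[OF _ _ hQ hQD, where W = "\<lambda>w. \<Phi> w - \<Psi>0 w"])
        show "open (D \<inter> ball (h x) r)" using D(1) by blast
        fix w assume "w \<in> D \<inter> ball (h x) r"
        then show "((\<lambda>w. \<Phi> w - \<Psi>0 w) has_field_derivative 0) (at w)"
          using DERIV_diff[OF \<Phi>[of w] \<Psi>0[of w]] by simp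
      qed (use that s0 in auto)
      then show ?thesis by (simp add: c_def algebra_simps)
    qed
    have "P y = \<Psi>0 (h y) + c" if y: "y \<in> ?S" "dist y x < d" for y
    proof (cases "fst y = 0")
      case False
      then have "y \<in> Q" using y by (auto simp: Q_def dist_commute mem_Times_iff)
      then show ?thesis using const False by (simp add: P_def)
    next
      case True
      define t where "t = snd y"
      have yt: "y = (0, t)" "t \<in> {0<..<1}" using True y by (auto simp: t_def mem_Times_iff prod_eq_iff)
      have cont: "((\<lambda>s. h (s, t)) \<longlongrightarrow> h (0, t)) (at_right 0)"
      proof -
        have "continuous_on {0..1} (\<lambda>s. h (s, t))"
          using yt by (intro continuous_on_compose2[OF h] continuous_intros) auto
        then have "((\<lambda>s. h (s, t)) \<longlongrightarrow> h (0, t)) (at 0 within {0..1})" by (simp add: continuous_on)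
        then show ?thesis by (simp add: at_within_Icc_at_right)
      qed
      have "h y \<in> ball (h x) r" using d1(2)[OF y(1)] y(2) d by (auto simp: dist_commute)
      then have "isCont \<Psi>0 (h (0, t))" using \<Psi>0 yt DERIV_isCont by blast
      then have "((\<lambda>s. \<Psi>0 (h (s, t)) + c) \<longlongrightarrow> \<Psi>0 (h (0, t)) + c) (at_right 0)"
        by (intro tendsto_add tendsto_const isCont_tendsto_compose[OF _ cont])
      moreover have "\<forall>\<^sub>F s in at_right 0. \<Phi> (h (s, t)) = \<Psi>0 (h (s, t)) + c"
      proof -
        have "((\<lambda>s. dist (s, t) x) \<longlongrightarrow> dist (0, t) x) (at_right 0)" by (intro tendsto_intros)
        then have "\<forall>\<^sub>F s in at_right 0. dist (s, t) x < d" using y yt by (intro order_tendstoD) auto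
        moreover have "\<forall>\<^sub>F s in at_right 0. s \<in> {0<..<1::real}" using eventually_at_right_real[of 0 1] by simp
        ultimately show ?thesis
        proof eventually_elim
          case (elim s)
          then have "(s, t) \<in> Q" using yt by (auto simp: Q_def dist_commute)
          then show ?case using const by blast
        qed
      qed
      ultimately have "((\<lambda>s. \<Phi> (h (s, t))) \<longlongrightarrow> \<Psi>0 (h (0, t)) + c) (at_right 0)"
        by (rule Lim_transform_eventually[OF _ eventually_mono]) auto
      then have "Lim (at_right 0) (\<lambda>s. \<Phi> (h (s, t))) = \<Psi>0 (h (0, t)) + c"
        by (intro tendsto_Lim) auto
      then show ?thesis by (simp add: P_def yt)
    qed
    moreover have "((\<lambda>w. \<Psi>0 w + c) has_field_derivative F w) (at w)" if "w \<in> ball (h x) r" for w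
      using DERIV_add[OF \<Psi>0[OF that] DERIV_const] by simp
    ultimately show ?thesis using r(1) d(1) by (intro exI[of _ r] conjI exI[of _ "\<lambda>w. \<Psi>0 w + c"] exI[of _ d]) auto
  qed
  show thesis
  proof (rule that[of P])
    show "prim_along F h P ?S" using h loc by (simp add: prim_along_def)
    show "P (s, t) = \<Phi> (h (s, t))" if "s \<in> {0<..1}" for s t using that by (auto simp: P_def)
  qed
qed


text \<open>If the two sides of the homotopy gave different limits at the end point \<open>p\<close>, then by the
  Poincare-Miranda theorem the image under the primitive of \<open>D\<close> intersected with a small circle
  around \<open>p\<close> would have a projection of length bounded below.\<close>

lemma prim_along_finite_end:
  fixes h :: "real \<times> real \<Rightarrow> complex"
  assumes P: "prim_along F h P ({0..1} \<times> {0<..t1})" and t1: "t1 > 0"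
    and D: "open D" and \<Phi>: "\<And>w. w \<in> D \<Longrightarrow> (\<Phi> has_field_derivative F w) (at w)"
    and hD: "\<And>s t. s \<in> {0<..1} \<Longrightarrow> t \<in> {0<..t1} \<Longrightarrow> h (s, t) \<in> D \<and> P (s, t) = \<Phi> (h (s, t))"
    and r0: "r0 > 0" and M: "\<And>w. w \<in> D \<Longrightarrow> cmod (w - p) < r0 \<Longrightarrow> cmod (F w) \<le> M"
      "\<And>t. t \<in> {0<..t1} \<Longrightarrow> cmod (h (0, t) - p) < r0 \<Longrightarrow> cmod (F (h (0, t))) \<le> M"
    and p: "\<And>s t. s \<in> {0..1} \<Longrightarrow> t \<in> {0<..t1} \<Longrightarrow> h (s, t) \<noteq> p"
    and lim: "\<And>\<epsilon>. \<epsilon> > 0 \<Longrightarrow> \<exists>\<tau>>0. \<forall>s\<in>{0..1}. \<forall>t\<in>{0<..<\<tau>}. cmod (h (s, t) - p) < \<epsilon>"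
    and L0: "length_le (\<lambda>t. h (0, t)) {0<..t1} L0" and L1: "length_le (\<lambda>t. h (1, t)) {0<..t1} L1"
    and e: "e > 0"
  shows "\<exists>\<tau>>0. \<tau> \<le> t1 \<and> (\<forall>t\<in>{0<..<\<tau>}. cmod (P (1, t) - P (0, t)) < e)"
proof -
  define M' where "M' = \<bar>M\<bar> + 1"
  have M': "M' > 0" "M \<le> M'" by (auto simp: M'_def)
  define \<delta> where "\<delta> = e / 4"
  have \<delta>: "\<delta> > 0" using e by (simp add: \<delta>_def)
  obtain \<tau>0 where \<tau>0: "\<tau>0 > 0" "\<tau>0 \<le> t1" "length_le (\<lambda>t. h (0, t)) {0<..\<tau>0} (\<delta> / M')"
    using length_le_small_near_end[OF L0 t1, of "\<delta> / M'"] \<delta> M' by auto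
  obtain \<tau>1 where \<tau>1: "\<tau>1 > 0" "\<tau>1 \<le> t1" "length_le (\<lambda>t. h (1, t)) {0<..\<tau>1} (\<delta> / M')"
    using length_le_small_near_end[OF L1 t1, of "\<delta> / M'"] \<delta> M' by auto
  obtain \<tau>2 where \<tau>2: "\<tau>2 > 0" "\<And>s t. s \<in> {0..1} \<Longrightarrow> t \<in> {0<..<\<tau>2} \<Longrightarrow> cmod (h (s, t) - p) < r0"
    using lim[OF r0] by blast
  define \<tau> where "\<tau> = min \<tau>0 (min \<tau>1 \<tau>2)"
  have \<tau>: "\<tau> > 0" "\<tau> \<le> \<tau>0" "\<tau> \<le> \<tau>1" "\<tau> \<le> \<tau>2" "\<tau> \<le> t1" using \<tau>0 \<tau>1 \<tau>2 by (auto simp: \<tau>_def)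
  \<comment> \<open>The sides s = 0 and s = 1 have finite length, so P varies little along them near
    the end; only the transversals are uncontrolled.\<close>
  have side: "cmod (P (\<sigma>, t) - P (\<sigma>, t')) \<le> \<delta>" if \<sigma>: "\<sigma> = 0 \<or> \<sigma> = 1" and t: "0 < t'" "t' \<le> t" "t < \<tau>" for \<sigma> t t'
  proof (cases "t' = t")
    case False
    have a1: "prim_along F (h \<circ> (\<lambda>t. (\<sigma>, t))) (P \<circ> (\<lambda>t. (\<sigma>, t))) {t'..t}"
      using \<sigma> t \<tau> by (intro prim_along_compose[OF P] continuous_intros) auto
    have a2: "length_le (h \<circ> (\<lambda>t. (\<sigma>, t))) {t'..t} (\<delta> / M')"
      using \<sigma> \<tau>0(3) \<tau>1(3) t \<tau> by (auto simp: o_def intro: length_le_subset)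
    have a3: "cmod (F ((h \<circ> (\<lambda>t. (\<sigma>, t))) u)) \<le> M'" if "u \<in> {t'..t}" for u
    proof -
      have "cmod (h (\<sigma>, u) - p) < r0" using that t \<tau> \<sigma> by (intro \<tau>2(2)) auto
      moreover have "u \<in> {0<..t1}" using that t \<tau> by auto
      ultimately have "cmod (F (h (\<sigma>, u))) \<le> M"
        using \<sigma> M(2)[of u] M(1)[of "h (1, u)"] hD[of 1 u] by auto
      then show ?thesis using M' by simp
    qed
    have "cmod ((P \<circ> (\<lambda>t. (\<sigma>, t))) t - (P \<circ> (\<lambda>t. (\<sigma>, t))) t') \<le> M' * (\<delta> / M')"
      using t False by (intro prim_along_bound_length[OF a1 a2 _ a3]) auto
    then show ?thesis using M' by simp
  qed (use \<delta> in simp)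
  have "cmod (P (1, t) - P (0, t)) < e" if t: "t \<in> {0<..<\<tau>}" for t
  proof (rule ccontr)
    assume "\<not> ?thesis"
    then have big: "cmod (P (1, t) - P (0, t)) \<ge> 4 * \<delta>" by (simp add: \<delta>_def)
    \<comment> \<open>Rotating the difference onto the positive real axis makes the gap a real one:
      the projection \<rho> of P is at most \<delta> on the side s = 0 and at least 3 * \<delta> on
      the side s = 1.\<close>
    define \<omega> where "\<omega> = cnj (P (1, t) - P (0, t)) / complex_of_real (cmod (P (1, t) - P (0, t)))"
    have nz: "cmod (P (1, t) - P (0, t)) > 0" using big \<delta> by linarith
    have \<omega>1: "cmod \<omega> = 1" using nz unfolding \<omega>_def norm_divide norm_of_real complex_mod_cnj by simp
    have \<omega>2: "\<omega> * (P (1, t) - P (0, t)) = complex_of_real (cmod (P (1, t) - P (0, t)))"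
      unfolding \<omega>_def using nz complex_norm_square[of "P (1, t) - P (0, t)"]
      by (simp add: field_simps power2_eq_square)
    define \<rho> where "\<rho> z = Re (\<omega> * (z - P (0, t)))" for z
    have \<rho>_diff: "\<bar>\<rho> z - \<rho> z'\<bar> \<le> cmod (z - z')" for z z'
    proof -
      have "\<rho> z - \<rho> z' = Re (\<omega> * (z - z'))" by (simp add: \<rho>_def algebra_simps)
      also have "\<bar>\<dots>\<bar> \<le> cmod (\<omega> * (z - z'))" by (rule abs_Re_le_cmod)
      finally show ?thesis using \<omega>1 by (simp add: norm_mult)
    qed
    have left: "\<rho> (P (0, t')) \<le> \<delta>" if "0 < t'" "t' \<le> t" for t'
      using side[of 0 t' t] that t \<rho>_diff[of "P (0, t')" "P (0, t)"] norm_minus_commute[of "P (0, t)" "P (0, t')"]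
      by (auto simp: \<rho>_def)
    have right: "\<rho> (P (1, t')) \<ge> 3 * \<delta>" if "0 < t'" "t' \<le> t" for t'
    proof -
      have "\<rho> (P (1, t)) = cmod (P (1, t) - P (0, t))" unfolding \<rho>_def \<omega>2 by simp
      then show ?thesis using side[of 1 t' t] that t \<rho>_diff[of "P (1, t)" "P (1, t')"] big by auto
    qed
    have hc: "continuous_on ({0..1} \<times> {0<..t1}) h" using P by (simp add: prim_along_def)
    have Pc: "continuous_on ({0..1} \<times> {0<..t1}) P"
      unfolding continuous_on_eq_continuous_within
    proof
      fix x :: "real \<times> real" assume x: "x \<in> {0..1} \<times> {0<..t1}"
      obtain r \<Psi> d where *: "r > 0" "\<And>w. w \<in> ball (h x) r \<Longrightarrow> (\<Psi> has_field_derivative F w) (at w)"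
        "d > 0" "\<And>y. y \<in> {0..1} \<times> {0<..t1} \<Longrightarrow> dist y x < d \<Longrightarrow> P y = \<Psi> (h y)"
        using P x unfolding prim_along_def by blast
      have hcx: "continuous (at x within {0..1} \<times> {0<..t1}) h"
        using hc x unfolding continuous_on_eq_continuous_within by blast
      have "isCont \<Psi> (h x)" using *(2)[of "h x"] *(1) by (auto intro: DERIV_isCont)
      then have "continuous (at x within {0..1} \<times> {0<..t1}) (\<lambda>y. \<Psi> (h y))"
        by (rule continuous_within_compose3[OF _ hcx])
      then show "continuous (at x within {0..1} \<times> {0<..t1}) P"
        using continuous_transform_within[OF _ *(3) x] *(4) by metis
    qed
    obtain \<eta> where \<eta>: "\<eta> > 0" "\<And>s. s \<in> {0..1} \<Longrightarrow> \<eta> \<le> cmod (h (s, t) - p)"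
    proof -
      have "continuous_on {0..1} (\<lambda>s. cmod (h (s, t) - p))"
        using t \<tau> by (intro continuous_intros continuous_on_compose2[OF hc]) auto
      then obtain s0 where s0: "s0 \<in> {0..1}" "\<And>s. s \<in> {0..1} \<Longrightarrow> cmod (h (s0, t) - p) \<le> cmod (h (s, t) - p)"
        using continuous_attains_inf[of "{0..1}" "\<lambda>s. cmod (h (s, t) - p)"] by auto
      have "cmod (h (s0, t) - p) > 0" using p[of s0 t] s0 t \<tau> by auto
      then show thesis using s0 that by blast
    qed
    \<comment> \<open>The circle of radius \<epsilon> separates the transversal at t from those
      close to the end. The last bound makes 2 * M' * \<epsilon> * 8 at most \<delta>, where 8 is
      the length of \<open>{-1..7}\<close>.\<close>
    define \<epsilon> where "\<epsilon> = min (min (\<eta> / 2) (r0 / 2)) (\<delta> / (16 * M'))"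
    have \<epsilon>: "\<epsilon> > 0" "\<epsilon> < \<eta>" "\<epsilon> < r0" "\<epsilon> \<le> \<delta> / (16 * M')" using \<eta> r0 \<delta> M' by (auto simp: \<epsilon>_def)
    obtain \<tau>3 where \<tau>3: "\<tau>3 > 0" "\<And>s t. s \<in> {0..1} \<Longrightarrow> t \<in> {0<..<\<tau>3} \<Longrightarrow> cmod (h (s, t) - p) < \<epsilon>"
      using lim[OF \<epsilon>(1)] by blast
    define t2 where "t2 = min (t / 2) (\<tau>3 / 2)"
    have t2: "0 < t2" "t2 \<le> t" "t2 < \<tau>3" using t \<tau>3 by (auto simp: t2_def)
    have sub: "cbox (0::real, t2) (1, t) \<subseteq> {0..1} \<times> {0<..t1}" using t2 t \<tau> by (auto simp: cbox_Pair_eq)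
    \<comment> \<open>The open interval of angles contains [0, 2 * pi) and keeps A open.\<close>
    define A where "A = {\<theta> \<in> {-1<..<7}. p + of_real \<epsilon> * exp (\<i> * of_real \<theta>) \<in> D}"
    define f where "f \<theta> = \<rho> (\<Phi> (p + of_real \<epsilon> * exp (\<i> * of_real \<theta>)))" for \<theta>
    have "{\<delta><..<3 * \<delta>} \<subseteq> f ` A"
    proof
      fix c assume c: "c \<in> {\<delta><..<3 * \<delta>}"
      \<comment> \<open>On the rectangle between the parameters t2 and t, \<rho> passes the value c
        from left to right and the distance to p passes \<epsilon> from bottom to top, so both
        happen at a common point. It is not on the side s = 0, where \<rho> is at most \<delta>;
        hence its image lies in D and on the circle.\<close>
      obtain s u where su: "s \<in> {0..1}" "u \<in> {t2..t}" "\<rho> (P (s, u)) - c = 0" "cmod (h (s, u) - p) - \<epsilon> = 0"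
      proof (rule poincare_miranda[of 0 1 t2 t "\<lambda>q. \<rho> (P q) - c" "\<lambda>q. cmod (h q - p) - \<epsilon>"])
        show "continuous_on (cbox (0, t2) (1, t)) (\<lambda>q. \<rho> (P q) - c)"
          unfolding \<rho>_def using Pc sub by (intro continuous_intros) (rule continuous_on_subset)
        show "continuous_on (cbox (0, t2) (1, t)) (\<lambda>q. cmod (h q - p) - \<epsilon>)"
          using hc sub by (intro continuous_intros) (rule continuous_on_subset)
        show "\<rho> (P (0, y)) - c < 0" if "y \<in> {t2..t}" for y using left[of y] that t2 c by auto
        show "\<rho> (P (1, y)) - c > 0" if "y \<in> {t2..t}" for y using right[of y] that t2 c by auto
        show "cmod (h (x, t2) - p) - \<epsilon> < 0" if "x \<in> {0..1}" for x using \<tau>3(2)[of x t2] that t2 by auto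
        show "0 < cmod (h (x, t) - p) - \<epsilon>" if "x \<in> {0..1}" for x using \<eta>(2)[OF that] \<epsilon> by simp
      qed (use t2 in auto)
      have "s \<noteq> 0" using su(2,3) left[of u] c t2 by auto
      then have hs: "h (s, u) \<in> D" "P (s, u) = \<Phi> (h (s, u))" using hD[of s u] su t2 t \<tau> by auto
      define \<theta> where "\<theta> = Arg2pi (h (s, u) - p)"
      have \<theta>: "0 \<le> \<theta>" "\<theta> < 2 * pi" "h (s, u) - p = of_real (cmod (h (s, u) - p)) * exp (\<i> * of_real \<theta>)"
        using Arg2pi[of "h (s, u) - p"] unfolding \<theta>_def is_Arg_def by auto
      then have eq: "h (s, u) = p + of_real \<epsilon> * exp (\<i> * of_real \<theta>)" using su(4) by (simp add: algebra_simps)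
      have "\<theta> < 7" using \<theta>(2) pi_less_4 pi_approx by simp
      then have "\<theta> \<in> A" using \<theta> hs eq by (auto simp: A_def)
      moreover have "f \<theta> = c" using su(3) hs eq by (simp add: f_def)
      ultimately show "c \<in> f ` A" by blast
    qed
    moreover have "open A"
    proof -
      have "A = {-1<..<7} \<inter> (\<lambda>\<theta>. p + of_real \<epsilon> * exp (\<i> * of_real \<theta>)) -` D" by (auto simp: A_def)
      moreover have "open ((\<lambda>\<theta>::real. p + of_real \<epsilon> * exp (\<i> * of_real \<theta>)) -` D)"
        by (intro open_vimage D continuous_intros)
      ultimately show ?thesis by auto
    qed
    moreover have "(f has_real_derivative Re (\<omega> * (F (p + of_real \<epsilon> * exp (\<i> * of_real \<theta>)) * (of_real \<epsilon> * (exp (\<i> * of_real \<theta>) * \<i>))))) (at \<theta>)"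
      if "\<theta> \<in> A" for \<theta>
    proof -
      have "((\<lambda>\<theta>. p + of_real \<epsilon> * exp (\<i> * \<theta>)) has_field_derivative of_real \<epsilon> * (exp (\<i> * of_real \<theta>) * \<i>)) (at (of_real \<theta>))"
        by (auto intro!: derivative_eq_intros)
      then have "((\<lambda>\<theta>. \<Phi> (p + of_real \<epsilon> * exp (\<i> * \<theta>))) has_field_derivative F (p + of_real \<epsilon> * exp (\<i> * of_real \<theta>)) * (of_real \<epsilon> * (exp (\<i> * of_real \<theta>) * \<i>))) (at (of_real \<theta>))"
        using that by (intro DERIV_chain2[OF \<Phi>]) (auto simp: A_def)
      then have "((\<lambda>\<theta>. \<omega> * (\<Phi> (p + of_real \<epsilon> * exp (\<i> * \<theta>)) - P (0, t))) has_field_derivative \<omega> * (F (p + of_real \<epsilon> * exp (\<i> * of_real \<theta>)) * (of_real \<epsilon> * (exp (\<i> * of_real \<theta>) * \<i>)))) (at (of_real \<theta>))"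
        using DERIV_cmult[OF DERIV_diff[OF _ DERIV_const[of "P (0, t)"]]] by fastforce
      then have "((\<lambda>\<theta>. Re (\<omega> * (\<Phi> (p + of_real \<epsilon> * exp (\<i> * of_real \<theta>)) - P (0, t)))) has_field_derivative Re (\<omega> * (F (p + of_real \<epsilon> * exp (\<i> * of_real \<theta>)) * (of_real \<epsilon> * (exp (\<i> * of_real \<theta>) * \<i>))))) (at \<theta>)"
        by (rule has_field_derivative_Re[OF has_vector_derivative_real_field])
      then show ?thesis by (simp add: f_def[abs_def] \<rho>_def)
    qed
    moreover have "\<bar>Re (\<omega> * (F (p + of_real \<epsilon> * exp (\<i> * of_real \<theta>)) * (of_real \<epsilon> * (exp (\<i> * of_real \<theta>) * \<i>))))\<bar> \<le> M' * \<epsilon>"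
      if \<theta>: "\<theta> \<in> A" for \<theta>
    proof -
      have "cmod (p + of_real \<epsilon> * exp (\<i> * of_real \<theta>) - p) < r0" using \<epsilon> by (simp add: norm_mult)
      then have "cmod (F (p + of_real \<epsilon> * exp (\<i> * of_real \<theta>))) \<le> M'" using M(1) \<theta> M' by (force simp: A_def)
      then have "cmod (\<omega> * (F (p + of_real \<epsilon> * exp (\<i> * of_real \<theta>)) * (of_real \<epsilon> * (exp (\<i> * of_real \<theta>) * \<i>)))) \<le> M' * \<epsilon>"
        using \<epsilon> \<omega>1 by (simp add: norm_mult)
      then show ?thesis using abs_Re_le_cmod order_trans by blast
    qed
    moreover have "A \<subseteq> {-1..7}" by (auto simp: A_def)
    ultimately have "3 * \<delta> - \<delta> \<le> 2 * (M' * \<epsilon>) * (7 - (-1))"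
      using \<epsilon> M' \<delta> by (intro differentiable_image_length_bound[of A "-1" 7 f]) auto
    then have "2 * \<delta> \<le> 16 * (M' * \<epsilon>)" by simp
    moreover have "16 * (M' * \<epsilon>) \<le> \<delta>" using \<epsilon>(4) M' by (simp add: field_simps)
    ultimately show False using \<delta> by simp
  qed
  then show ?thesis using \<tau> by (intro exI[of _ \<tau>]) auto
qed

text \<open>For fixed t the transversal is a curve in s that may have no length, so the trapezoid
  version of the bound is applied; its factor explains \<open>8 * C + 1\<close>. The transversals
  are small only for arbitrarily late t, and so is the conclusion.\<close>

lemma prim_along_infinite_end:
  assumes P: "\<And>t. t \<in> T \<Longrightarrow> prim_along F (\<lambda>s. h (s, t)) (\<lambda>s. P (s, t)) {0..1}" and C: "C \<ge> 0"
    and T: "\<forall>\<^sub>F t in G. t \<in> T"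
    and bound: "\<forall>\<^sub>F t in G. \<forall>s\<in>{0..1}. cmod (F (h (s, t))) \<le> C * N (s, t)"
    and neg: "\<And>e. e > 0 \<Longrightarrow> \<exists>\<^sub>F t in G. \<exists>I<e. has_RS_integral (\<lambda>s u v. dist (h (u, t)) (h (v, t)) * N (s, t)) I 0 1"
    and e: "e > 0"
  shows "\<exists>\<^sub>F t in G. cmod (P (1, t) - P (0, t)) < e"
proof -
  have "e / (8 * C + 1) > 0" using e C by simp
  from neg[OF this] show ?thesis
  proof (rule frequently_rev_mp)
    show "\<forall>\<^sub>F t in G. (\<exists>I<e / (8 * C + 1). has_RS_integral (\<lambda>s u v. dist (h (u, t)) (h (v, t)) * N (s, t)) I 0 1) \<longrightarrow>
       cmod (P (1, t) - P (0, t)) < e"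
      using T bound
    proof eventually_elim
      case (elim t)
      show ?case
      proof
        assume "\<exists>I<e / (8 * C + 1). has_RS_integral (\<lambda>s u v. dist (h (u, t)) (h (v, t)) * N (s, t)) I 0 1"
        then obtain I where I: "I < e / (8 * C + 1)" "has_RS_integral (\<lambda>s u v. dist (h (u, t)) (h (v, t)) * N (s, t)) I 0 1" by blast
        have "cmod (P (1, t) - P (0, t)) \<le> 8 * C * I"
          by (rule prim_along_bound_RS(2)[OF P[OF elim(1)] _ I(2)]) (use elim(2) C in auto)
        also have "\<dots> \<le> 8 * C * (e / (8 * C + 1))" using I(1) C by (intro mult_left_mono) auto
        also have "\<dots> < e" using e C by (simp add: field_simps)
        finally show "cmod (P (1, t) - P (0, t)) < e" .
      qed
    qed
  qed
qed

section \<open>Hilbert space geometry\<close>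

interpretation cvs: vector_space "scaleC :: complex \<Rightarrow> 'a::chilbert_space \<Rightarrow> 'a"
  by (rule vector_space_scaleC)

lemma cinner_add_right: "cinner x (y + z) = cinner x y + cinner x z"
  by (metis cinner_add_left cinner_commute complex_cnj_add)

lemma cinner_minus_left: "cinner (- x) y = - cinner x y"
  using cinner_scaleC_left[of "-1" x y] by simp

lemma cinner_minus_right: "cinner x (- y) = - cinner x y"
  by (metis cinner_commute cinner_minus_left complex_cnj_minus)

lemma cinner_diff_left: "cinner (x - y) z = cinner x z - cinner y z"
  using cinner_add_left[of x "- y" z] by (simp add: cinner_minus_left)

lemma cinner_diff_right: "cinner x (y - z) = cinner x y - cinner x z"
  using cinner_add_right[of x y "- z"] by (simp add: cinner_minus_right)

lemma cinner_zero_left [simp]: "cinner 0 y = 0"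
  using cinner_diff_left[of 0 0 y] by simp

lemma cinner_zero_right [simp]: "cinner x 0 = 0"
  using cinner_diff_right[of x 0 0] by simp

lemma cinner_sum_left: "cinner (\<Sum>i\<in>A. f i) y = (\<Sum>i\<in>A. cinner (f i) y)"
  by (induction A rule: infinite_finite_induct) (auto simp: cinner_add_left)

lemma cinner_sum_right: "cinner x (\<Sum>i\<in>A. f i) = (\<Sum>i\<in>A. cinner x (f i))"
  by (induction A rule: infinite_finite_induct) (auto simp: cinner_add_right)

lemma cinner_eq_zero_iff: "cinner x x = 0 \<longleftrightarrow> x = 0"
  by (simp add: cinner_self)

lemma cmod_cinner_le: "cmod (cinner x y) \<le> norm x * norm y"
proof (cases "cinner x y = 0")
  case False
  define u where "u = cnj (cinner x y) / complex_of_real (cmod (cinner x y))"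
  have u: "cmod u = 1" using False unfolding u_def by (simp add: norm_divide)
  have "u * cinner x y = complex_of_real (cmod (cinner x y))"
    unfolding u_def using False complex_norm_square[of "cinner x y"] by (simp add: field_simps power2_eq_square)
  then have "cmod (cinner x y) = Re (cinner (u *\<^sub>C x) y)" by (simp add: cinner_scaleC_left)
  also have "\<dots> \<le> norm (u *\<^sub>C x) * norm y" unfolding Re_cinner by (rule norm_cauchy_schwarz)
  finally show ?thesis by (simp add: norm_scaleC u)
qed simp

lemma bounded_bilinear_cinner: "bounded_bilinear (cinner :: 'a::chilbert_space \<Rightarrow> 'a \<Rightarrow> complex)"
proof
  fix r :: real and a b :: 'a
  show "cinner (r *\<^sub>R a) b = r *\<^sub>R cinner a b"
    unfolding scaleC_of_real[symmetric] by (simp add: cinner_scaleC_left scaleR_conv_of_real)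
  show "cinner a (r *\<^sub>R b) = r *\<^sub>R cinner a b"
    unfolding scaleC_of_real[symmetric] by (simp add: cinner_scaleC_right scaleR_conv_of_real)
  show "\<exists>K. \<forall>a b :: 'a. norm (cinner a b) \<le> norm a * norm b * K"
    by (rule exI[of _ 1]) (simp add: cmod_cinner_le)
qed (auto simp: cinner_add_left cinner_add_right)

lemmas tendsto_cinner [tendsto_intros] = bounded_bilinear.tendsto[OF bounded_bilinear_cinner]
lemmas continuous_on_cinner [continuous_intros] = bounded_bilinear.continuous_on[OF bounded_bilinear_cinner]

lemma bounded_linear_scaleC: "bounded_linear (\<lambda>x :: 'a::chilbert_space. c *\<^sub>C x)"
proof (rule bounded_linear_intro[where K = "cmod c"])
  show "c *\<^sub>C (r *\<^sub>R x) = r *\<^sub>R (c *\<^sub>C x)" for r and x :: 'a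
    by (simp add: scaleC_scaleC mult.commute flip: scaleC_of_real)
qed (auto simp: scaleC_add_right norm_scaleC mult.commute)

lemma norm_sq_add: "(norm (x + y :: 'a::chilbert_space))\<^sup>2 = (norm x)\<^sup>2 + 2 * Re (cinner x y) + (norm y)\<^sup>2"
  unfolding Re_cinner power2_norm_eq_inner by (simp add: inner_add_left inner_add_right inner_commute)

lemma norm_sq_add_orthogonal: "cinner x y = 0 \<Longrightarrow> (norm (x + y))\<^sup>2 = (norm x)\<^sup>2 + (norm y)\<^sup>2"
  by (simp add: norm_sq_add)

lemma clinear_op_sum:
  assumes "clinear_op T"
  shows "T (\<Sum>i\<in>F. c i *\<^sub>C x i) = (\<Sum>i\<in>F. c i *\<^sub>C T (x i))"
  using assms by (simp add: blinfun.sum_right clinear_op_def)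

lemma norm_orthonormal_sum:
  assumes "finite F" "\<And>i j. i \<in> F \<Longrightarrow> j \<in> F \<Longrightarrow> cinner (e i) (e j) = (if i = j then 1 else 0)"
  shows "(norm (\<Sum>i\<in>F. a i *\<^sub>C e i))\<^sup>2 = (\<Sum>i\<in>F. (cmod (a i))\<^sup>2)"
proof -
  have "complex_of_real ((norm (\<Sum>i\<in>F. a i *\<^sub>C e i))\<^sup>2) = (\<Sum>j\<in>F. \<Sum>i\<in>F. a i * (cnj (a j) * cinner (e i) (e j)))"
    unfolding cinner_self[symmetric] by (simp add: cinner_sum_left cinner_sum_right cinner_scaleC_left cinner_scaleC_right sum_distrib_left mult_ac)
  also have "\<dots> = (\<Sum>j\<in>F. \<Sum>i\<in>F. if i = j then a j * cnj (a j) else 0)"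
    using assms(2) by (intro sum.cong) auto
  also have "\<dots> = (\<Sum>j\<in>F. a j * cnj (a j))" using assms(1) by simp
  also have "\<dots> = complex_of_real (\<Sum>i\<in>F. (cmod (a i))\<^sup>2)" by (simp only: complex_norm_square of_real_sum)
  finally show ?thesis using of_real_eq_iff by blast
qed

lemma real_projection_exists:
  fixes M :: "'a::{real_inner, complete_space} set"
  assumes M: "closed M" "subspace M"
  obtains p where "p \<in> M" "\<And>m. m \<in> M \<Longrightarrow> inner (x - p) m = 0"
proof -
  define d where "d = Inf ((\<lambda>m. norm (x - m)) ` M)"
  have M0: "0 \<in> M" using M(2) subspace_0 by blast
  have bdd: "bdd_below ((\<lambda>m. norm (x - m)) ` M)" by (rule bdd_belowI[of _ 0]) auto
  have d_le: "d \<le> norm (x - m)" if "m \<in> M" for m unfolding d_def using that bdd by (intro cInf_lower) auto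
  have d0: "d \<ge> 0" unfolding d_def using M0 by (intro cInf_greatest) auto
  have "\<exists>m\<in>M. norm (x - m) < d + inverse (real (Suc n))" for n
  proof -
    have "Inf ((\<lambda>m. norm (x - m)) ` M) < d + inverse (real (Suc n))" by (simp add: d_def)
    then show ?thesis using cInf_less_iff[OF _ bdd] M0 by auto
  qed
  then obtain m where m: "\<And>n. m n \<in> M" "\<And>n. norm (x - m n) < d + inverse (real (Suc n))" by metis
  have par: "(norm (m j - m k))\<^sup>2 \<le> 2 * (norm (x - m j))\<^sup>2 + 2 * (norm (x - m k))\<^sup>2 - 4 * d\<^sup>2" for j k
  proof -
    have "(1/2) *\<^sub>R (m j + m k) \<in> M" using m(1) M(2) by (simp add: subspace_add subspace_scale)
    then have "d\<^sup>2 \<le> (norm (x - (1/2) *\<^sub>R (m j + m k)))\<^sup>2" using d_le d0 by (simp add: power_mono)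
    moreover have "(norm (m j - m k))\<^sup>2 = 2 * (norm (x - m j))\<^sup>2 + 2 * (norm (x - m k))\<^sup>2 - 4 * (norm (x - (1/2) *\<^sub>R (m j + m k)))\<^sup>2"
      unfolding power2_norm_eq_inner by (simp add: inner_diff_left inner_diff_right inner_add_left inner_add_right inner_commute algebra_simps)
    ultimately show ?thesis by simp
  qed
  have lim: "(\<lambda>n. norm (x - m n)) \<longlonglongrightarrow> d"
  proof (rule tendsto_sandwich[of "\<lambda>_. d" _ _ "\<lambda>n. d + inverse (real (Suc n))"])
    show "(\<lambda>n. d + inverse (real (Suc n))) \<longlonglongrightarrow> d" using tendsto_add[OF tendsto_const LIMSEQ_inverse_real_of_nat] by simp
  qed (use d_le m in \<open>auto intro!: less_imp_le eventuallyI\<close>)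
  have "Cauchy m"
  proof (rule metric_CauchyI)
    fix e :: real assume e: "e > 0"
    have "(\<lambda>n. (norm (x - m n))\<^sup>2) \<longlonglongrightarrow> d\<^sup>2" using lim by (intro tendsto_intros)
    then have "\<forall>\<^sub>F n in sequentially. (norm (x - m n))\<^sup>2 < d\<^sup>2 + e\<^sup>2 / 4" using e by (intro order_tendstoD) auto
    then obtain N where N: "\<And>n. n \<ge> N \<Longrightarrow> (norm (x - m n))\<^sup>2 < d\<^sup>2 + e\<^sup>2 / 4" unfolding eventually_sequentially by blast
    show "\<exists>M. \<forall>j\<ge>M. \<forall>k\<ge>M. dist (m j) (m k) < e"
    proof (intro exI[of _ N] allI impI)
      fix j k assume "j \<ge> N" "k \<ge> N"
      then have "(norm (m j - m k))\<^sup>2 < e\<^sup>2" using par[of j k] N[of j] N[of k] by linarith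
      then show "dist (m j) (m k) < e" using e by (simp add: dist_norm power2_less_imp_less)
    qed
  qed
  then obtain p where p: "m \<longlonglongrightarrow> p" using Cauchy_convergent convergent_def by blast
  have pM: "p \<in> M" using closed_sequentially[OF M(1) _ p] m(1) by blast
  have "(\<lambda>n. norm (x - m n)) \<longlonglongrightarrow> norm (x - p)" using p by (intro tendsto_intros)
  then have dp: "norm (x - p) = d" using lim LIMSEQ_unique by blast
  show thesis
  proof (rule that[OF pM])
    fix k assume k: "k \<in> M"
    show "inner (x - p) k = 0"
    proof (cases "k = 0")
      case False
      define t where "t = inner (x - p) k / inner k k"
      have kk: "inner k k > 0" using False by simp
      have "p + t *\<^sub>R k \<in> M" using pM k M(2) by (simp add: subspace_add subspace_scale)
      then have "norm (x - p) \<le> norm (x - (p + t *\<^sub>R k))" using d_le dp by simp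
      then have "(norm (x - p))\<^sup>2 \<le> (norm (x - (p + t *\<^sub>R k)))\<^sup>2" by (simp add: power_mono)
      also have "x - (p + t *\<^sub>R k) = (x - p) - t *\<^sub>R k" by simp
      also have "(norm ((x - p) - t *\<^sub>R k))\<^sup>2 = (norm (x - p))\<^sup>2 - 2 * t * inner (x - p) k + t * t * inner k k"
        unfolding power2_norm_eq_inner by (simp only: inner_diff_left inner_diff_right inner_scaleR_left inner_scaleR_right) (simp add: inner_commute algebra_simps)
      also have "2 * t * inner (x - p) k = 2 * (t * t * inner k k)" using kk by (simp add: t_def)
      finally have "t * t * inner k k \<le> 0" by simp
      then have "t = 0" using kk by (metis mult_le_0_iff not_le zero_le_square mult_eq_0_iff order_antisym)
      then show ?thesis using kk by (simp add: t_def)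
    qed simp
  qed
qed

lemma csubspace_imp_subspace: "csubspace M \<Longrightarrow> subspace M"
  unfolding subspace_def using cvs.subspace_0 cvs.subspace_add cvs.subspace_scale scaleC_of_real by metis

lemma csubspace_closure:
  assumes "csubspace M" shows "csubspace (closure M)"
proof (rule cvs.subspaceI)
  show "0 \<in> closure M" using assms cvs.subspace_0 closure_subset by blast
  fix x y assume xy: "x \<in> closure M" "y \<in> closure M"
  obtain f where f: "\<And>n. f n \<in> M" "f \<longlonglongrightarrow> x" using xy(1) unfolding closure_sequential by blast
  obtain g where g: "\<And>n. g n \<in> M" "g \<longlonglongrightarrow> y" using xy(2) unfolding closure_sequential by blast
  have "(\<lambda>n. f n + g n) \<longlonglongrightarrow> x + y" using f(2) g(2) by (rule tendsto_add)
  moreover have "f n + g n \<in> M" for n using f(1) g(1) assms cvs.subspace_add by blast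
  ultimately show "x + y \<in> closure M" unfolding closure_sequential by (intro exI[of _ "\<lambda>n. f n + g n"]) auto
next
  fix c x assume x: "x \<in> closure M"
  then obtain f where f: "\<And>n. f n \<in> M" "f \<longlonglongrightarrow> x" unfolding closure_sequential by blast
  have "(\<lambda>n. c *\<^sub>C f n) \<longlonglongrightarrow> c *\<^sub>C x" using f(2) by (rule bounded_linear.tendsto[OF bounded_linear_scaleC])
  moreover have "c *\<^sub>C f n \<in> M" for n using f(1) assms cvs.subspace_scale by blast
  ultimately show "c *\<^sub>C x \<in> closure M" unfolding closure_sequential by (intro exI[of _ "\<lambda>n. c *\<^sub>C f n"]) auto
qed

text \<open>Real orthogonality to both m and \<open>\<i> *\<^sub>C m\<close> is complex
  orthogonality to m.\<close>

lemma projection_exists: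
  fixes M :: "'a::chilbert_space set"
  assumes M: "closed M" "csubspace M"
  obtains p where "p \<in> M" "\<And>m. m \<in> M \<Longrightarrow> cinner (x - p) m = 0"
proof -
  obtain p where p: "p \<in> M" "\<And>m. m \<in> M \<Longrightarrow> inner (x - p) m = 0"
    using real_projection_exists[OF M(1) csubspace_imp_subspace[OF M(2)]] by blast
  show thesis
  proof (rule that[OF p(1)])
    fix m assume m: "m \<in> M"
    then have "\<i> *\<^sub>C m \<in> M" using M(2) cvs.subspace_scale by blast
    then have "Re (cinner (x - p) (\<i> *\<^sub>C m)) = 0" "Re (cinner (x - p) m) = 0" using p(2) m by (auto simp: Re_cinner)
    then show "cinner (x - p) m = 0" by (simp add: cinner_scaleC_right complex_eq_iff)
  qed
qed

lemma projection_operator_exists: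
  fixes M :: "'a::chilbert_space set"
  assumes M: "closed M" "csubspace M"
  obtains Pr :: "'a \<Rightarrow>\<^sub>L 'a" where "clinear_op Pr" "\<And>x. Pr x \<in> M" "\<And>x. x \<in> M \<Longrightarrow> Pr x = x"
    "\<And>x m. m \<in> M \<Longrightarrow> cinner (x - Pr x) m = 0"
proof -
  have "\<exists>p. p \<in> M \<and> (\<forall>m\<in>M. cinner (x - p) m = 0)" for x using projection_exists[OF M] by metis
  then obtain f where f: "\<And>x. f x \<in> M" "\<And>x m. m \<in> M \<Longrightarrow> cinner (x - f x) m = 0" by metis
  have uniq: "f x = p" if "p \<in> M" "\<And>m. m \<in> M \<Longrightarrow> cinner (x - p) m = 0" for x p
  proof -
    have "p - f x \<in> M" using that(1) f(1) M(2) cvs.subspace_diff by blast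
    then have "cinner (x - f x) (p - f x) = 0" "cinner (x - p) (p - f x) = 0" using f(2) that(2) by auto
    moreover have "cinner (p - f x) (p - f x) = cinner (x - f x) (p - f x) - cinner (x - p) (p - f x)"
      by (simp flip: cinner_diff_left)
    ultimately have "cinner (p - f x) (p - f x) = 0" by simp
    then show ?thesis by (simp add: cinner_eq_zero_iff)
  qed
  have add: "f (x + y) = f x + f y" for x y
  proof (rule uniq)
    show "f x + f y \<in> M" using f(1) M(2) cvs.subspace_add by blast
    fix m assume "m \<in> M"
    then have "cinner ((x - f x) + (y - f y)) m = 0" using f(2)[of m] by (simp add: cinner_add_left)
    then show "cinner (x + y - (f x + f y)) m = 0" by (simp add: algebra_simps)
  qed
  have scale: "f (c *\<^sub>C x) = c *\<^sub>C f x" for c x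
  proof (rule uniq)
    show "c *\<^sub>C f x \<in> M" using f(1) M(2) cvs.subspace_scale by blast
    fix m assume "m \<in> M"
    then have "cinner (c *\<^sub>C (x - f x)) m = 0" using f(2) unfolding cinner_scaleC_left by simp
    then show "cinner (c *\<^sub>C x - c *\<^sub>C f x) m = 0" by (simp add: cvs.scale_right_diff_distrib)
  qed
  have nrm: "norm (f x) \<le> norm x * 1" for x
  proof -
    have "cinner (x - f x) (f x) = 0" using f by blast
    then have "(norm ((x - f x) + f x))\<^sup>2 = (norm (x - f x))\<^sup>2 + (norm (f x))\<^sup>2" by (rule norm_sq_add_orthogonal)
    then have "(norm (f x))\<^sup>2 \<le> (norm x)\<^sup>2" by simp
    then have "norm (f x) \<le> norm x" by (rule power2_le_imp_le) simp
    then show ?thesis by simp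
  qed
  have bl: "bounded_linear f"
  proof (rule bounded_linear_intro[where K = 1])
    show "f (r *\<^sub>R x) = r *\<^sub>R f x" for r x using scale[of "of_real r" x] by (simp add: scaleC_of_real)
  qed (use add nrm in auto)
  then have app: "blinfun_apply (Blinfun f) = f" by (rule bounded_linear_Blinfun_apply)
  show thesis
  proof (rule that[of "Blinfun f"])
    show "clinear_op (Blinfun f)" using scale by (simp add: clinear_op_def app)
  qed (use f uniq app in auto)
qed

lemma orthogonal_dense_zero:
  assumes "closure M = (UNIV :: 'a::chilbert_space set)" "\<And>m. m \<in> M \<Longrightarrow> cinner x m = 0"
  shows "x = 0"
proof -
  have "closed {m. cinner x m = 0}" by (intro closed_Collect_eq continuous_intros)
  then have "closure M \<subseteq> {m. cinner x m = 0}" using assms(2) by (intro closure_minimal) auto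
  then have "cinner x x = 0" using assms(1) by blast
  then show ?thesis by (simp add: cinner_eq_zero_iff)
qed

text \<open>The bound passes to the closure of the graph and makes it single-valued, with a closed
  domain. Composition with the orthogonal projection onto this domain gives an operator on the whole
  space, the form in which Riesz bases are defined here.\<close>

lemma bounded_graph_extension:
  fixes G :: "('a::chilbert_space \<times> 'b::chilbert_space) set"
  assumes G: "csubspace G" and bound: "\<And>x y. (x, y) \<in> G \<Longrightarrow> norm y \<le> C * norm x"
  obtains T :: "'a \<Rightarrow>\<^sub>L 'b" where "clinear_op T" "\<And>x y. (x, y) \<in> G \<Longrightarrow> T x = y" "\<And>x. T x \<in> closure (snd ` G)"
proof -
  define M where "M = closure (fst ` G)"
  define H where "H = closure G"
  have H: "csubspace H" unfolding H_def by (rule csubspace_closure[OF G])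
  have zero: "(0, 0) \<in> G" using G cvs.subspace_0 by (metis zero_prod_def)
  have "csubspace (fst ` G)"
  proof (rule cvs.subspaceI)
    show "0 \<in> fst ` G" using zero by force
    fix x y assume "x \<in> fst ` G" "y \<in> fst ` G"
    then obtain p q where pq: "p \<in> G" "q \<in> G" "x = fst p" "y = fst q" by blast
    then have "p + q \<in> G" using G cvs.subspace_add by blast
    then have "fst (p + q) \<in> fst ` G" by (rule imageI)
    then show "x + y \<in> fst ` G" using pq by simp
  next
    fix c x assume "x \<in> fst ` G"
    then obtain p where p: "p \<in> G" "x = fst p" by blast
    then have "c *\<^sub>C p \<in> G" using G cvs.subspace_scale by blast
    then have "fst (c *\<^sub>C p) \<in> fst ` G" by (rule imageI)
    then show "c *\<^sub>C x \<in> fst ` G" using p by (simp add: scaleC_prod_def)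
  qed
  then have M: "csubspace M" "closed M" unfolding M_def by (auto intro: csubspace_closure)
  have boundH: "norm y \<le> C * norm x" if "(x, y) \<in> H" for x y
  proof -
    have "closed {p::'a \<times> 'b. norm (snd p) \<le> C * norm (fst p)}" by (intro closed_Collect_le continuous_intros)
    then have "closure G \<subseteq> {p. norm (snd p) \<le> C * norm (fst p)}" using bound by (intro closure_minimal) auto
    then show ?thesis using that by (auto simp: H_def)
  qed
  have uniq: "y = y'" if "(x, y) \<in> H" "(x, y') \<in> H" for x y y'
  proof -
    have "(x, y) - (x, y') \<in> H" using that H cvs.subspace_diff by blast
    then have "(0, y - y') \<in> H" by simp
    then show ?thesis using boundH by fastforce
  qed
  have ex: "\<exists>y. (x, y) \<in> H" if "x \<in> M" for x
  proof -
    from that[unfolded M_def closure_sequential] obtain u where u: "\<And>n. u n \<in> fst ` G" "u \<longlonglongrightarrow> x" by blast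
    then have "\<forall>n. \<exists>v. (u n, v) \<in> G" by force
    then obtain v where v: "\<And>n. (u n, v n) \<in> G" by metis
    have vv: "norm (v j - v k) \<le> C * norm (u j - u k)" for j k
    proof -
      have "(u j, v j) - (u k, v k) \<in> G" using v G cvs.subspace_diff by blast
      then show ?thesis using bound by simp
    qed
    have vv': "dist (v j) (v k) \<le> (\<bar>C\<bar> + 1) * dist (u j) (u k)" for j k
    proof -
      have "C * norm (u j - u k) \<le> (\<bar>C\<bar> + 1) * norm (u j - u k)" by (intro mult_right_mono) auto
      then show ?thesis using vv[of j k] by (simp add: dist_norm)
    qed
    have "Cauchy u" using u(2) by (rule LIMSEQ_imp_Cauchy)
    have "Cauchy v"
    proof (rule metric_CauchyI)
      fix e :: real assume "e > 0"
      then have "e / (\<bar>C\<bar> + 1) > 0" by simp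
      then obtain N where N: "\<And>j k. j \<ge> N \<Longrightarrow> k \<ge> N \<Longrightarrow> dist (u j) (u k) < e / (\<bar>C\<bar> + 1)"
        using metric_CauchyD[OF \<open>Cauchy u\<close>] by meson
      have "dist (v j) (v k) < e" if "j \<ge> N" "k \<ge> N" for j k
        using vv'[of j k] N[OF that] by (simp add: pos_less_divide_eq mult.commute) 
      then show "\<exists>M. \<forall>m\<ge>M. \<forall>n\<ge>M. dist (v m) (v n) < e" by blast
    qed
    then obtain y where "v \<longlonglongrightarrow> y" using Cauchy_convergent convergent_def by blast
    then have "(\<lambda>n. (u n, v n)) \<longlonglongrightarrow> (x, y)" using u(2) by (intro tendsto_Pair)
    then have "(x, y) \<in> H" unfolding H_def closure_sequential using v by (intro exI[of _ "\<lambda>n. (u n, v n)"]) auto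
    then show ?thesis by blast
  qed
  obtain Pr :: "'a \<Rightarrow>\<^sub>L 'a" where Pr: "clinear_op Pr" "\<And>x. Pr x \<in> M" "\<And>x. x \<in> M \<Longrightarrow> Pr x = x"
    "\<And>x m. m \<in> M \<Longrightarrow> cinner (x - Pr x) m = 0"
    using projection_operator_exists[OF M(2,1)] by blast
  have "\<exists>y. (Pr x, y) \<in> H" for x using ex Pr(2) by blast
  then obtain f where f: "\<And>x. (Pr x, f x) \<in> H" by metis
  have add: "f (x + y) = f x + f y" for x y
  proof -
    have "(Pr x, f x) + (Pr y, f y) \<in> H" using f H cvs.subspace_add by blast
    then have "(Pr (x + y), f x + f y) \<in> H" by (simp add: blinfun.add_right)
    then show ?thesis using uniq f by blast
  qed
  have scale: "f (c *\<^sub>C x) = c *\<^sub>C f x" for c x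
  proof -
    have "c *\<^sub>C (Pr x, f x) \<in> H" using f H cvs.subspace_scale by blast
    then have "(Pr (c *\<^sub>C x), c *\<^sub>C f x) \<in> H" using Pr(1) by (simp add: scaleC_prod_def clinear_op_def)
    then show ?thesis using uniq f by blast
  qed
  have nrm: "norm (f x) \<le> norm x * (\<bar>C\<bar> * norm Pr)" for x
  proof -
    have "norm (f x) \<le> C * norm (Pr x)" using boundH f by blast
    also have "\<dots> \<le> \<bar>C\<bar> * norm (Pr x)" by (intro mult_right_mono) auto
    also have "\<dots> \<le> \<bar>C\<bar> * (norm Pr * norm x)" by (intro mult_left_mono norm_blinfun) auto
    finally show ?thesis by (simp add: mult_ac)
  qed
  have bl: "bounded_linear f"
  proof (rule bounded_linear_intro[where K = "\<bar>C\<bar> * norm Pr"])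
    show "f (r *\<^sub>R x) = r *\<^sub>R f x" for r x using scale[of "of_real r" x] by (simp add: scaleC_of_real)
  qed (use add nrm in auto)
  then have app: "blinfun_apply (Blinfun f) = f" by (rule bounded_linear_Blinfun_apply)
  show thesis
  proof (rule that[of "Blinfun f"])
    show "clinear_op (Blinfun f)" using scale by (simp add: clinear_op_def app)
    show "blinfun_apply (Blinfun f) x = y" if "(x, y) \<in> G" for x y
    proof -
      have "x \<in> fst ` G" using that by force
      then have "x \<in> M" unfolding M_def by (rule closure_subset[THEN subsetD])
      then have "(x, f x) \<in> H" using f[of x] Pr(3) by simp
      moreover have "(x, y) \<in> H" using that unfolding H_def by (rule closure_subset[THEN subsetD])
      ultimately show ?thesis using uniq app by auto
    qed
    show "blinfun_apply (Blinfun f) x \<in> closure (snd ` G)" for x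
    proof -
      have "snd ` closure G \<subseteq> closure (snd ` G)"
        by (rule image_closure_subset) (auto intro: continuous_on_snd continuous_on_id closure_subset[THEN subsetD] rev_image_eqI)
      moreover have "f x \<in> snd ` closure G" using imageI[OF f[of x], of snd] by (simp add: H_def)
      ultimately show ?thesis unfolding app by blast
    qed
  qed
qed

section \<open>Extension of maps between families of vectors, and Riesz bases\<close>

lemma cspan_image_sum:
  assumes "x \<in> cspan (f ` J)"
  obtains F a where "finite F" "F \<subseteq> J" "x = (\<Sum>i\<in>F. a i *\<^sub>C f i)"
proof -
  obtain t r where t: "finite t" "t \<subseteq> f ` J" "x = (\<Sum>v\<in>t. r v *\<^sub>C v)"
    using assms unfolding cvs.span_explicit by blast
  define g where "g v = (SOME i. i \<in> J \<and> f i = v)" for v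
  have g: "g v \<in> J \<and> f (g v) = v" if "v \<in> t" for v
  proof -
    from t(2) that obtain i where "i \<in> J \<and> f i = v" by blast
    then show ?thesis unfolding g_def by (rule someI)
  qed
  have inj: "inj_on g t" by (rule inj_onI) (metis g)
  have "x = (\<Sum>i\<in>g ` t. r (f i) *\<^sub>C f i)" unfolding t(3) using g by (subst sum.reindex[OF inj]) auto
  then show thesis using that[of "g ` t" "\<lambda>i. r (f i)"] t(1) g by blast
qed

lemma sum_in_cspan: "(\<Sum>i\<in>F. a i *\<^sub>C f i) \<in> cspan (f ` J)" if "F \<subseteq> J"
  using that by (intro cvs.span_sum cvs.span_scale cvs.span_base) auto

text \<open>The inequality alone makes the relation spanned by the pairs (a i, b i) single-valued,
  so no independence has to be checked.\<close>

lemma bounded_extension_of_families: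
  fixes a :: "'i \<Rightarrow> 'a::chilbert_space" and b :: "'i \<Rightarrow> 'b::chilbert_space"
  assumes "\<And>F c. finite F \<Longrightarrow> F \<subseteq> I \<Longrightarrow> norm (\<Sum>i\<in>F. c i *\<^sub>C b i) \<le> C * norm (\<Sum>i\<in>F. c i *\<^sub>C a i)"
  obtains T :: "'a \<Rightarrow>\<^sub>L 'b" where "clinear_op T" "\<And>i. i \<in> I \<Longrightarrow> T (a i) = b i" "\<And>x. T x \<in> closure (cspan (b ` I))"
proof -
  define G where "G = cspan ((\<lambda>i. (a i, b i)) ` I)"
  have sum_eq: "(\<Sum>i\<in>F. c i *\<^sub>C (a i, b i)) = (\<Sum>i\<in>F. c i *\<^sub>C a i, \<Sum>i\<in>F. c i *\<^sub>C b i)" for F c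
    by (induction F rule: infinite_finite_induct) (auto simp: scaleC_prod_def zero_prod_def)
  have "norm y \<le> C * norm x" if xy: "(x, y) \<in> G" for x y
  proof -
    obtain F c where F: "finite F" "F \<subseteq> I" "(x, y) = (\<Sum>i\<in>F. c i *\<^sub>C (a i, b i))"
      by (rule cspan_image_sum[OF xy[unfolded G_def]])
    then have "x = (\<Sum>i\<in>F. c i *\<^sub>C a i)" "y = (\<Sum>i\<in>F. c i *\<^sub>C b i)" unfolding sum_eq by auto
    then show ?thesis using assms[OF F(1,2)] by simp
  qed
  moreover have "csubspace G" unfolding G_def by (rule cvs.subspace_span)
  ultimately obtain T :: "'a \<Rightarrow>\<^sub>L 'b" where T: "clinear_op T" "\<And>x y. (x, y) \<in> G \<Longrightarrow> T x = y" "\<And>x. T x \<in> closure (snd ` G)"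
    by (metis bounded_graph_extension)
  have "snd ` G \<subseteq> cspan (b ` I)"
  proof
    fix y assume "y \<in> snd ` G"
    then obtain x where "(x, y) \<in> G" by force
    then have "(x, y) \<in> cspan ((\<lambda>i. (a i, b i)) ` I)" by (simp add: G_def)
    then obtain F c where "F \<subseteq> I" "(x, y) = (\<Sum>i\<in>F. c i *\<^sub>C (a i, b i))" by (rule cspan_image_sum)
    then show "y \<in> cspan (b ` I)" unfolding sum_eq using sum_in_cspan[of F I c b] by simp
  qed
  then have "T x \<in> closure (cspan (b ` I))" for x using T(3) closure_mono by blast
  moreover have "T (a i) = b i" if "i \<in> I" for i using that by (intro T(2)) (auto simp: G_def intro: cvs.span_base)
  ultimately show thesis using that T(1) by blast
qed

text \<open>The orthonormal basis must be indexed by the same arbitrary set I. It is produced by the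
  Gram-Schmidt process along a well-order of I, with projections onto the closed span of the
  predecessors. The lower bound keeps each f i away from that span, and both bounds make the change
  of basis and its inverse bounded.\<close>

lemma riesz_basis_of_bounds:
  fixes f :: "'i \<Rightarrow> 'a::chilbert_space"
  assumes c: "c > 0" and C: "C > 0"
    and lower: "\<And>F a. finite F \<Longrightarrow> F \<subseteq> I \<Longrightarrow> (\<Sum>i\<in>F. (cmod (a i))\<^sup>2) \<le> c * (norm (\<Sum>i\<in>F. a i *\<^sub>C f i))\<^sup>2"
    and upper: "\<And>F a. finite F \<Longrightarrow> F \<subseteq> I \<Longrightarrow> (norm (\<Sum>i\<in>F. a i *\<^sub>C f i))\<^sup>2 \<le> C * (\<Sum>i\<in>F. (cmod (a i))\<^sup>2)"
  shows "riesz_basis_of I f (closure (cspan (f ` I)))"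
proof -
  define M where "M = closure (cspan (f ` I))"
  obtain r where r: "well_order_on I r" using well_order_on by blast
  define less where "less i j \<longleftrightarrow> (i, j) \<in> r - Id" for i j
  have wfr: "wf (r - Id)" using r by (simp add: well_order_on_def)
  have tot: "less i j \<or> less j i" if "i \<in> I" "j \<in> I" "i \<noteq> j" for i j
    using r that by (auto simp: less_def well_order_on_def linear_order_on_def total_on_def)
  have trans: "less i k" if "less i j" "less j k" for i j k
  proof -
    have r': "trans r" "antisym r"
      using r by (auto simp: well_order_on_def linear_order_on_def partial_order_on_def preorder_on_def)
    have "(i, k) \<in> r" using r'(1) that by (auto simp: less_def dest: transD)
    moreover have "i \<noteq> k" using r'(2) that by (auto simp: less_def dest: antisymD)
    ultimately show ?thesis by (simp add: less_def)
  qed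
  define V where "V i = closure (cspan (f ` {j \<in> I. less j i}))" for i
  have V: "closed (V i)" "csubspace (V i)" for i unfolding V_def by (auto intro: csubspace_closure cvs.subspace_span)
  have "\<exists>p. p \<in> V i \<and> (\<forall>m\<in>V i. cinner (f i - p) m = 0)" for i using projection_exists[OF V] by metis
  then obtain p where p: "\<And>i. p i \<in> V i" "\<And>i m. m \<in> V i \<Longrightarrow> cinner (f i - p i) m = 0" by metis
  define v where "v i = f i - p i" for i
  have v0: "v i \<noteq> 0" if i: "i \<in> I" for i
  proof -
    \<comment> \<open>In f i - s the vector f i has coefficient 1, so the lower bound gives a
      distance that survives the passage to the closure.\<close>
    have far: "1 \<le> c * (norm (f i - s))\<^sup>2" if s: "s \<in> cspan (f ` {j \<in> I. less j i})" for s
    proof -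
      obtain F a where F: "finite F" "F \<subseteq> {j \<in> I. less j i}" "s = (\<Sum>i\<in>F. a i *\<^sub>C f i)" by (rule cspan_image_sum[OF s])
      have iF: "i \<notin> F" using F(2) by (auto simp: less_def)
      have "f i - s = (\<Sum>j\<in>insert i F. (if j = i then 1 else - a j) *\<^sub>C f j)"
      proof -
        have "(\<Sum>j\<in>F. (if j = i then 1 else - a j) *\<^sub>C f j) = (\<Sum>j\<in>F. - (a j *\<^sub>C f j))"
          using iF by (intro sum.cong) auto
        then show ?thesis using F(1,3) iF by (simp add: sum_negf)
      qed
      moreover have "(\<Sum>j\<in>insert i F. (cmod (if j = i then 1 else - a j))\<^sup>2) \<le> c * (norm (\<Sum>j\<in>insert i F. (if j = i then 1 else - a j) *\<^sub>C f j))\<^sup>2"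
        using F i by (intro lower) auto
      moreover have "1 \<le> (\<Sum>j\<in>insert i F. (cmod (if j = i then 1 else - a j))\<^sup>2)"
        using F(1) iF by (simp add: sum_nonneg)
      ultimately show ?thesis by simp
    qed
    have "closed {s. 1 \<le> c * (norm (f i - s))\<^sup>2}" by (intro closed_Collect_le continuous_intros)
    then have "V i \<subseteq> {s. 1 \<le> c * (norm (f i - s))\<^sup>2}" unfolding V_def using far by (intro closure_minimal) auto
    then have "1 \<le> c * (norm (v i))\<^sup>2" using p(1) by (auto simp: v_def)
    then show ?thesis by auto
  qed
  define e where "e i = complex_of_real (1 / norm (v i)) *\<^sub>C v i" for i
  have V_mono: "V j \<subseteq> V i" if "less j i" for i j
    unfolding V_def using that trans by (intro closure_mono cvs.span_mono image_mono) auto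
  have fV: "f j \<in> V i" if "less j i" "j \<in> I" for i j
    unfolding V_def using that by (intro closure_subset[THEN subsetD] cvs.span_base) auto
  have eV: "e j \<in> V i" if "less j i" "j \<in> I" for i j
    unfolding e_def v_def using fV[OF that] V_mono[OF that(1)] p(1)[of j] V(2)[of i]
    by (intro cvs.subspace_scale cvs.subspace_diff) auto
  have orth: "cinner (e i) (e j) = 0" if "less j i" "j \<in> I" for i j
    using p(2)[OF eV[OF that]] by (simp add: e_def[of i] v_def cinner_scaleC_left)
  have on: "orthonormal_on I e"
    unfolding orthonormal_on_def
  proof (intro ballI)
    fix i j assume ij: "i \<in> I" "j \<in> I"
    show "cinner (e i) (e j) = (if i = j then 1 else 0)"
    proof (cases "i = j")
      case True
      have "norm (e i) = 1" using v0[OF ij(1)] by (simp add: e_def norm_scaleC norm_divide)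
      then show ?thesis using True by (simp add: cinner_self)
    next
      case False
      then have "less i j \<or> less j i" using tot ij by blast
      then show ?thesis using orth[of j i] orth[of i j] ij False cinner_commute[of "e i" "e j"] by auto
    qed
  qed
  have VM: "V i \<subseteq> M" for i unfolding V_def M_def by (intro closure_mono cvs.span_mono image_mono) auto
  have Msub: "csubspace M" unfolding M_def by (intro csubspace_closure cvs.subspace_span)
  have fM: "f i \<in> M" if "i \<in> I" for i unfolding M_def using that by (intro closure_subset[THEN subsetD] cvs.span_base) auto
  have eM: "e i \<in> M" if "i \<in> I" for i
    unfolding e_def v_def using fM[OF that] VM[of i] p(1)[of i] Msub by (intro cvs.subspace_scale cvs.subspace_diff) auto
  define E where "E = closure (cspan (e ` I))"
  have Esub: "csubspace E" "closed E" unfolding E_def by (auto intro: csubspace_closure cvs.subspace_span)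
  have eE: "e i \<in> E" if "i \<in> I" for i unfolding E_def using that by (intro closure_subset[THEN subsetD] cvs.span_base) auto
  \<comment> \<open>Transfinite induction: the predecessors of i lie in E, hence so does their
    closed span, which contains p i.\<close>
  have fE: "i \<in> I \<longrightarrow> f i \<in> E" for i
  proof (induction i rule: wf_induct_rule[OF wfr])
    case (1 i)
    show ?case
    proof
      assume i: "i \<in> I"
      have "f ` {j \<in> I. less j i} \<subseteq> E" using 1 by (auto simp: less_def)
      then have "V i \<subseteq> E" unfolding V_def using Esub by (intro closure_minimal cvs.span_minimal) auto
      then have "p i \<in> E" using p(1) by blast
      moreover have "complex_of_real (norm (v i)) *\<^sub>C e i = v i" using v0[OF i] by (simp add: e_def scaleC_scaleC)
      then have "v i \<in> E" using eE[OF i] Esub(1) cvs.subspace_scale by metis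
      ultimately have "v i + p i \<in> E" using Esub(1) cvs.subspace_add by blast
      then show "f i \<in> E" by (simp add: v_def)
    qed
  qed
  have EM: "E = M"
  proof
    show "E \<subseteq> M" unfolding E_def using eM Msub by (intro closure_minimal cvs.span_minimal) (auto simp: M_def)
    show "M \<subseteq> E" unfolding M_def using fE Esub by (intro closure_minimal cvs.span_minimal) auto
  qed
  have en: "(norm (\<Sum>i\<in>F. a i *\<^sub>C e i))\<^sup>2 = (\<Sum>i\<in>F. (cmod (a i))\<^sup>2)" if "finite F" "F \<subseteq> I" for F a
  proof (rule norm_orthonormal_sum[OF that(1)])
    fix i j assume "i \<in> F" "j \<in> F"
    then have "i \<in> I" "j \<in> I" using that(2) by auto
    then show "cinner (e i) (e j) = (if i = j then 1 else 0)" using on unfolding orthonormal_on_def by blast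
  qed
  have b1: "norm (\<Sum>i\<in>F. a i *\<^sub>C f i) \<le> sqrt C * norm (\<Sum>i\<in>F. a i *\<^sub>C e i)" if "finite F" "F \<subseteq> I" for F a
  proof (rule power2_le_imp_le)
    show "(norm (\<Sum>i\<in>F. a i *\<^sub>C f i))\<^sup>2 \<le> (sqrt C * norm (\<Sum>i\<in>F. a i *\<^sub>C e i))\<^sup>2"
      using upper[OF that] C by (simp add: power_mult_distrib en[OF that])
  qed (use C in simp)
  have b2: "norm (\<Sum>i\<in>F. a i *\<^sub>C e i) \<le> sqrt c * norm (\<Sum>i\<in>F. a i *\<^sub>C f i)" if "finite F" "F \<subseteq> I" for F a
  proof (rule power2_le_imp_le)
    show "(norm (\<Sum>i\<in>F. a i *\<^sub>C e i))\<^sup>2 \<le> (sqrt c * norm (\<Sum>i\<in>F. a i *\<^sub>C f i))\<^sup>2"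
      using lower[OF that] c by (simp add: power_mult_distrib en[OF that])
  qed (use c in simp)
  obtain T :: "'a \<Rightarrow>\<^sub>L 'a" where T: "clinear_op T" "\<And>i. i \<in> I \<Longrightarrow> T (e i) = f i" "\<And>x. T x \<in> closure (cspan (f ` I))"
    using bounded_extension_of_families[OF b1] by blast
  obtain S :: "'a \<Rightarrow>\<^sub>L 'a" where S: "clinear_op S" "\<And>i. i \<in> I \<Longrightarrow> S (f i) = e i" "\<And>x. S x \<in> closure (cspan (e ` I))"
    using bounded_extension_of_families[OF b2] by blast
  have inv: "\<forall>x\<in>closure (cspan (g ` I)). A (B x) = x"
    if AB: "clinear_op A" "clinear_op B" "\<And>i. i \<in> I \<Longrightarrow> A (B (g i)) = g i" for A B :: "'a \<Rightarrow>\<^sub>L 'a" and g :: "'i \<Rightarrow> 'a"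
  proof -
    have "closed {x. A (B x) = x}" by (intro closed_Collect_eq continuous_intros)
    moreover have "csubspace {x. A (B x) = x}"
      using AB(1,2) by (intro cvs.subspaceI) (auto simp: blinfun.add_right blinfun.zero_right clinear_op_def)
    then have "cspan (g ` I) \<subseteq> {x. A (B x) = x}" using AB(3) by (intro cvs.span_minimal) auto
    ultimately have "closure (cspan (g ` I)) \<subseteq> {x. A (B x) = x}" by (intro closure_minimal)
    then show ?thesis by blast
  qed
  have "\<forall>x\<in>M. S (T x) = x" using inv[OF S(1) T(1), of e] S(2) T(2) EM E_def by auto
  moreover have "\<forall>x\<in>M. T (S x) = x" using inv[OF T(1) S(1), of f] S(2) T(2) M_def by auto
  moreover have "orthonormal_basis_of I e M" using on EM by (simp add: orthonormal_basis_of_def E_def)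
  moreover have "blinfun_apply T ` M \<subseteq> M" "blinfun_apply S ` M \<subseteq> M"
    using T(3) S(3) by (auto simp: M_def E_def[symmetric] EM)
  ultimately have "riesz_basis_of I f M"
    unfolding riesz_basis_of_def using T(1,2) S(1) by (intro exI[of _ e] exI[of _ T] exI[of _ S]) auto
  then show ?thesis by (simp add: M_def)
qed

section \<open>Self-adjoint operators\<close>

lemma self_adjoint_csubspace: "self_adjoint A \<Longrightarrow> csubspace (op_dom A)"
  by (simp add: self_adjoint_def)

lemma self_adjoint_add: "self_adjoint A \<Longrightarrow> x \<in> op_dom A \<Longrightarrow> y \<in> op_dom A \<Longrightarrow> op_app A (x + y) = op_app A x + op_app A y"
  by (simp add: self_adjoint_def)

lemma self_adjoint_scale: "self_adjoint A \<Longrightarrow> x \<in> op_dom A \<Longrightarrow> op_app A (c *\<^sub>C x) = c *\<^sub>C op_app A x"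
  by (simp add: self_adjoint_def)

lemma self_adjoint_diff:
  assumes A: "self_adjoint A" and x: "x \<in> op_dom A" and y: "y \<in> op_dom A"
  shows "op_app A (x - y) = op_app A x - op_app A y"
proof -
  have "(-1) *\<^sub>C y \<in> op_dom A" using self_adjoint_csubspace[OF A] y cvs.subspace_scale by blast
  then have "op_app A (x + (-1) *\<^sub>C y) = op_app A x + (-1) *\<^sub>C op_app A y"
    using self_adjoint_add[OF A x, of "(-1) *\<^sub>C y"] self_adjoint_scale[OF A y, of "-1"] by simp
  then show ?thesis by simp
qed

lemma self_adjoint_sum:
  assumes A: "self_adjoint A" and x: "\<And>i. i \<in> F \<Longrightarrow> x i \<in> op_dom A"
  shows "op_app A (\<Sum>i\<in>F. x i) = (\<Sum>i\<in>F. op_app A (x i))"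
  using x
proof (induction F rule: infinite_finite_induct)
  case (insert i F)
  have "(\<Sum>i\<in>F. x i) \<in> op_dom A" using self_adjoint_csubspace[OF A] insert by (intro cvs.subspace_sum) auto
  then show ?case using insert self_adjoint_add[OF A] by simp
qed (use self_adjoint_diff[OF A, of 0 0] cvs.subspace_0[OF self_adjoint_csubspace[OF A]] in auto)

lemma self_adjoint_graph:
  assumes "self_adjoint A" "\<And>x. x \<in> op_dom A \<Longrightarrow> cinner (op_app A x) y = cinner x z"
  shows "y \<in> op_dom A" "op_app A y = z"
proof -
  have "(y, z) \<in> adjoint_graph A" using assms(2) by (simp add: adjoint_graph_def)
  then have "(y, z) \<in> {(x, op_app A x) | x. x \<in> op_dom A}" using assms(1) by (simp add: self_adjoint_def)
  then show "y \<in> op_dom A" "op_app A y = z" by auto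
qed

lemma self_adjoint_symmetric:
  assumes "self_adjoint A" "x \<in> op_dom A" "y \<in> op_dom A"
  shows "cinner (op_app A x) y = cinner x (op_app A y)"
proof -
  have "(y, op_app A y) \<in> adjoint_graph A" using assms by (auto simp: self_adjoint_def)
  then show ?thesis using assms(2) by (simp add: adjoint_graph_def)
qed

lemma self_adjoint_closed:
  assumes A: "self_adjoint A" and x: "\<And>n. x n \<in> op_dom A" "x \<longlonglongrightarrow> y" "(\<lambda>n. op_app A (x n)) \<longlonglongrightarrow> z"
  shows "y \<in> op_dom A" "op_app A y = z"
proof -
  have "cinner (op_app A u) y = cinner u z" if u: "u \<in> op_dom A" for u
  proof (rule LIMSEQ_unique)
    show "(\<lambda>n. cinner (op_app A u) (x n)) \<longlonglongrightarrow> cinner (op_app A u) y" using x(2) by (intro tendsto_intros)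
    have "(\<lambda>n. cinner u (op_app A (x n))) \<longlonglongrightarrow> cinner u z" using x(3) by (intro tendsto_intros)
    then show "(\<lambda>n. cinner (op_app A u) (x n)) \<longlonglongrightarrow> cinner u z" using self_adjoint_symmetric[OF A u x(1)] by simp
  qed
  then show "y \<in> op_dom A" "op_app A y = z" using self_adjoint_graph[OF A] by auto
qed

lemma Im_zero_if_cnj_eq: "w = cnj w \<Longrightarrow> Im w = 0"
  by (simp add: complex_eq_iff)

lemma self_adjoint_shift_norm:
  assumes A: "self_adjoint A" and u: "u \<in> op_dom A"
  shows "(norm (op_app A u - Complex x y *\<^sub>C u))\<^sup>2 = (norm (op_app A u - of_real x *\<^sub>C u))\<^sup>2 + y\<^sup>2 * (norm u)\<^sup>2"
proof -
  let ?v = "op_app A u - of_real x *\<^sub>C u"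
  have "cinner ?v u = cinner u ?v"
    using self_adjoint_symmetric[OF A u u] by (simp add: cinner_diff_left cinner_diff_right cinner_scaleC_left cinner_scaleC_right)
  then have "cinner ?v u = cnj (cinner ?v u)" using cinner_commute[of ?v u] by simp
  then have "Im (cinner ?v u) = 0" by (rule Im_zero_if_cnj_eq)
  then have "Re (cinner ?v ((- \<i> * of_real y) *\<^sub>C u)) = 0" unfolding cinner_scaleC_right by simp
  then have "(norm (?v + (- \<i> * of_real y) *\<^sub>C u))\<^sup>2 = (norm ?v)\<^sup>2 + (norm ((- \<i> * of_real y) *\<^sub>C u))\<^sup>2"
    unfolding norm_sq_add by simp
  moreover have "Complex x y = of_real x + \<i> * of_real y" by (simp add: complex_eq_iff)
  then have "op_app A u - Complex x y *\<^sub>C u = ?v + (- \<i> * of_real y) *\<^sub>C u"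
    by (simp add: scaleC_add_left)
  ultimately show ?thesis by (simp only: norm_scaleC norm_mult power_mult_distrib) simp
qed

lemma self_adjoint_shift_norm_cnj:
  assumes A: "self_adjoint A" and u: "u \<in> op_dom A"
  shows "norm (op_app A u - cnj z *\<^sub>C u) = norm (op_app A u - z *\<^sub>C u)"
proof -
  have "cnj z = Complex (Re z) (- Im z)" "z = Complex (Re z) (Im z)" by (simp_all add: complex_eq_iff)
  then have "(norm (op_app A u - cnj z *\<^sub>C u))\<^sup>2 = (norm (op_app A u - z *\<^sub>C u))\<^sup>2"
    by (metis self_adjoint_shift_norm[OF A u] power2_minus)
  then show ?thesis by (simp add: power2_eq_iff_nonneg)
qed

text \<open>If \<open>m\<close> is the lower bound of \<open>A - z\<close> and \<open>m < d\<close>, then the real points \<open>x \<plusminus> s\<close>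
  at distance \<open>m\<close> from \<open>z = x + i y\<close> lie in the resolvent set, and the nonnegative quadratic form
  \<open>\<parallel>(A - x)u\<parallel>\<^sup>2 - s\<^sup>2\<parallel>u\<parallel>\<^sup>2\<close>, which comes from \<open>(A - x - s)(A - x + s)\<close>, is bounded below.\<close>

lemma self_adjoint_lower_bound:
  assumes A: "self_adjoint A" and d: "\<And>w. w \<in> spectrum A \<Longrightarrow> d \<le> dist w z" and u: "u \<in> op_dom A"
  shows "d * norm u \<le> norm (op_app A u - z *\<^sub>C u)"
proof (rule ccontr)
  assume neg: "\<not> ?thesis"
  let ?D = "op_dom A"
  have Dsub: "csubspace ?D" by (rule self_adjoint_csubspace[OF A])
  define x y where "x = Re z" and "y = Im z"
  have z: "z = Complex x y" by (simp add: x_def y_def)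
  define B where "B v = op_app A v - of_real x *\<^sub>C v" for v
  have Nz: "(norm (op_app A v - z *\<^sub>C v))\<^sup>2 = (norm (B v))\<^sup>2 + y\<^sup>2 * (norm v)\<^sup>2" if "v \<in> ?D" for v
    unfolding z B_def by (rule self_adjoint_shift_norm[OF A that])
  have u0: "u \<noteq> 0"
  proof
    assume "u = 0"
    then have "op_app A u = 0" using self_adjoint_diff[OF A u u] by simp
    then show False using neg \<open>u = 0\<close> by simp
  qed
  define N where "N v = (norm (B v))\<^sup>2 + y\<^sup>2 * (norm v)\<^sup>2" for v
  define U where "U = {v \<in> ?D. norm v = 1}"
  \<comment> \<open>The square of the best lower bound of A - z, since N v is the squared norm of (A
    - z) v.\<close>
  define \<mu> where "\<mu> = Inf (N ` U)"
  define u1 where "u1 = complex_of_real (1 / norm u) *\<^sub>C u"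
  have u1D: "u1 \<in> ?D" unfolding u1_def using Dsub u cvs.subspace_scale by blast
  have u1: "u1 \<in> U" using u1D u0 by (auto simp: U_def u1_def norm_scaleC norm_divide)
  have bdd: "bdd_below (N ` U)" by (rule bdd_belowI[of _ 0]) (auto simp: N_def)
  have "norm (op_app A u1 - z *\<^sub>C u1) = norm (op_app A u - z *\<^sub>C u) / norm u"
  proof -
    have "op_app A u1 - z *\<^sub>C u1 = complex_of_real (1 / norm u) *\<^sub>C (op_app A u - z *\<^sub>C u)"
      unfolding u1_def self_adjoint_scale[OF A u] by (simp add: cvs.scale_right_diff_distrib scaleC_scaleC mult.commute)
    then show ?thesis by (simp add: norm_scaleC norm_divide)
  qed
  then have "norm (op_app A u1 - z *\<^sub>C u1) < d" using neg u0 by (simp add: pos_divide_less_eq)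
  then have "N u1 < d\<^sup>2" using Nz[OF u1D] unfolding N_def by (metis norm_ge_zero power_strict_mono zero_less_numeral)
  moreover have "\<mu> \<le> N u1" unfolding \<mu>_def using u1 bdd by (intro cInf_lower) auto
  ultimately have \<mu>d: "\<mu> < d\<^sup>2" by simp
  have \<mu>y: "y\<^sup>2 \<le> \<mu>" unfolding \<mu>_def using u1 by (intro cInf_greatest) (auto simp: N_def U_def)
  have d0: "d > 0" using neg u0 by (metis mult_nonpos_nonneg not_le norm_ge_zero order_trans)
  \<comment> \<open>With this s the real points x + s and x - s have distance sqrt \<mu> from z,
    which is less than d.\<close>
  define s where "s = sqrt (\<mu> - y\<^sup>2)"
  have s2: "s\<^sup>2 = \<mu> - y\<^sup>2" using \<mu>y by (simp add: s_def)
  have lowN: "\<mu> * (norm v)\<^sup>2 \<le> N v" if v: "v \<in> ?D" for v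
  proof (cases "v = 0")
    case False
    define v1 where "v1 = complex_of_real (1 / norm v) *\<^sub>C v"
    have v1D: "v1 \<in> ?D" unfolding v1_def using Dsub v cvs.subspace_scale by blast
    then have "v1 \<in> U" using False by (auto simp: U_def v1_def norm_scaleC norm_divide)
    then have "\<mu> \<le> N v1" unfolding \<mu>_def using bdd by (intro cInf_lower) auto
    moreover have "B v1 = complex_of_real (1 / norm v) *\<^sub>C B v"
      unfolding B_def v1_def self_adjoint_scale[OF A v] by (simp add: cvs.scale_right_diff_distrib scaleC_scaleC mult.commute)
    then have "N v1 = N v / (norm v)\<^sup>2" using False
      by (simp add: N_def v1_def norm_scaleC norm_divide power_divide add_divide_distrib)
    ultimately show ?thesis using False by (simp add: field_simps)
  qed (simp add: N_def)
  define Q where "Q v = (norm (B v))\<^sup>2 - s\<^sup>2 * (norm v)\<^sup>2" for v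
  have Q0: "Q v \<ge> 0" if "v \<in> ?D" for v using lowN[OF that] by (simp add: Q_def N_def s2 algebra_simps)
  have res: "\<exists>R. is_resolvent A (of_real a) R" if "a = x + s \<or> a = x - s" for a
  proof (rule ccontr)
    assume "\<not> ?thesis"
    then have "of_real a \<in> spectrum A" by (simp add: spectrum_def)
    then have "d \<le> dist (of_real a) z" by (rule d)
    moreover have "(dist (of_real a) z)\<^sup>2 = s\<^sup>2 + y\<^sup>2"
      using that unfolding z dist_norm cmod_power2 by (elim disjE) simp_all
    then have "(dist (of_real a) z)\<^sup>2 < d\<^sup>2" using \<mu>d s2 by simp
    then have "dist (of_real a) z < d" using d0 power2_less_imp_less less_imp_le by blast
    ultimately show False by simp
  qed
  obtain Ra where Ra: "is_resolvent A (of_real (x + s)) Ra" using res by blast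
  obtain Rb where Rb: "is_resolvent A (of_real (x - s)) Rb" using res by blast
  define \<kappa> where "\<kappa> = norm Ra + \<bar>s\<bar> * (norm Rb * norm Ra)"
  \<comment> \<open>\<kappa> will bound B k for every unit vector v below; t is small enough for the
    quadratic term in t to lose against the linear one, and it is fixed before v is chosen.\<close>
  define t where "t = 1 / (\<kappa>\<^sup>2 + 1)"
  have t: "t > 0" "t * \<kappa>\<^sup>2 \<le> 1" by (auto simp: t_def add_nonneg_pos pos_divide_le_eq)
  have "Inf (N ` U) < \<mu> + t" using t by (simp add: \<mu>_def)
  then obtain v where v: "v \<in> U" "N v < \<mu> + t" using cInf_less_iff[OF _ bdd] u1 by blast
  have vD: "v \<in> ?D" "norm v = 1" using v(1) by (auto simp: U_def)
  have Qv: "Q v < t" using v(2) vD by (simp add: Q_def N_def s2)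
  \<comment> \<open>Two resolvents in a row give (B - s) (B + s) k = v. The form Q belongs to the
    operator on the left, so its mixed value at v and k is the squared norm of v, which is
    1.\<close>
  define w where "w = Ra v"
  define k where "k = Rb w"
  have w: "w \<in> ?D" "op_app A w - of_real (x + s) *\<^sub>C w = v" using Ra unfolding is_resolvent_def w_def by auto
  have k: "k \<in> ?D" "op_app A k - of_real (x - s) *\<^sub>C k = w" using Rb unfolding is_resolvent_def k_def by auto
  have Bk: "B k = w - of_real s *\<^sub>C k" using k(2) unfolding B_def
    by (simp add: cvs.scale_left_diff_distrib algebra_simps)
  have Bw: "B w = v + of_real s *\<^sub>C w" using w(2) unfolding B_def by (simp add: scaleC_add_left algebra_simps)
  have BkD: "B k \<in> ?D" unfolding Bk using w(1) k(1) Dsub by (intro cvs.subspace_diff cvs.subspace_scale) auto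
  have skD: "of_real s *\<^sub>C k \<in> ?D" using k(1) Dsub cvs.subspace_scale by blast
  have BBk: "B (B k) = v + (of_real (s\<^sup>2)) *\<^sub>C k"
  proof -
    have "B (w - of_real s *\<^sub>C k) = B w - of_real s *\<^sub>C B k"
      unfolding B_def self_adjoint_diff[OF A w(1) skD] self_adjoint_scale[OF A k(1)]
      by (simp add: cvs.scale_right_diff_distrib scaleC_scaleC mult.commute)
    also have "\<dots> = v + (of_real (s\<^sup>2)) *\<^sub>C k" unfolding Bw Bk
      by (simp add: cvs.scale_right_diff_distrib scaleC_scaleC power2_eq_square)
    finally show ?thesis using Bk by simp
  qed
  have Bsym: "cinner (B p) q = cinner p (B q)" if "p \<in> ?D" "q \<in> ?D" for p q
    using self_adjoint_symmetric[OF A that] by (simp add: B_def cinner_diff_left cinner_diff_right cinner_scaleC_left cinner_scaleC_right)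
  have cross: "cinner (B v) (B k) - of_real (s\<^sup>2) * cinner v k = 1"
    unfolding Bsym[OF vD(1) BkD] BBk using vD(2) by (simp add: cinner_add_right cinner_scaleC_right cinner_self)
  have nB: "norm (B k) \<le> \<kappa>"
  proof -
    have "norm w \<le> norm Ra" using norm_blinfun[of Ra v] vD by (simp add: w_def)
    moreover have "norm k \<le> norm Rb * norm w" unfolding k_def by (rule norm_blinfun)
    ultimately have "norm k \<le> norm Rb * norm Ra" by (meson mult_left_mono norm_ge_zero order_trans)
    then have "\<bar>s\<bar> * norm k \<le> \<bar>s\<bar> * (norm Rb * norm Ra)" by (intro mult_left_mono) auto
    moreover have "norm (B k) \<le> norm w + \<bar>s\<bar> * norm k" unfolding Bk using norm_triangle_ineq4[of w "of_real s *\<^sub>C k"] by (simp add: norm_scaleC)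
    ultimately show ?thesis using \<open>norm w \<le> norm Ra\<close> by (simp add: \<kappa>_def)
  qed
  \<comment> \<open>Moving from v in the direction - k lowers Q at rate 2 * t, while Q v is less
    than t and the second-order term is at most t: Q becomes negative.\<close>
  define q where "q = v + of_real (- t) *\<^sub>C k"
  have tkD: "of_real (- t) *\<^sub>C k \<in> ?D" using k(1) Dsub cvs.subspace_scale by blast
  have qD: "q \<in> ?D" unfolding q_def using vD(1) tkD Dsub cvs.subspace_add by blast
  have Bq: "B q = B v + of_real (- t) *\<^sub>C B k"
    unfolding B_def q_def self_adjoint_add[OF A vD(1) tkD] self_adjoint_scale[OF A k(1)]
    by (simp add: cvs.scale_right_diff_distrib scaleC_scaleC scaleC_add_right mult.commute)
  have "Q q = Q v - 2 * t * Re (cinner (B v) (B k) - of_real (s\<^sup>2) * cinner v k) + t\<^sup>2 * Q k"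
    unfolding Q_def Bq unfolding q_def norm_sq_add
    by (simp add: cinner_scaleC_right cinner_minus_right norm_scaleC power_mult_distrib algebra_simps)
  also have "\<dots> = Q v - 2 * t + t\<^sup>2 * Q k" unfolding cross by simp
  also have "\<dots> \<le> Q v - 2 * t + t\<^sup>2 * \<kappa>\<^sup>2"
  proof -
    have "Q k \<le> (norm (B k))\<^sup>2" by (simp add: Q_def)
    also have "\<dots> \<le> \<kappa>\<^sup>2" using nB by (simp add: power_mono)
    finally show ?thesis by (simp add: mult_left_mono)
  qed
  also have "\<dots> \<le> Q v - 2 * t + t * 1" using t mult_left_mono[OF t(2), of t] by (simp add: power2_eq_square mult_ac)
  also have "\<dots> < 0" using Qv by simp
  finally show False using Q0[OF qD] by simp
qed


section \<open>Projection valued measures\<close>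

locale pvm =
  fixes E :: "real set \<Rightarrow> ('a::chilbert_space \<Rightarrow>\<^sub>L 'a)"
  assumes pvm: "projection_valued_measure E"
begin

lemma sym: "S \<in> sets borel \<Longrightarrow> cinner (E S x) y = cinner x (E S y)"
  using pvm by (simp add: projection_valued_measure_def is_adjoint_def)

lemma idem: "S \<in> sets borel \<Longrightarrow> E S (E S x) = E S x"
  using pvm unfolding projection_valued_measure_def by (metis blinfun_apply_blinfun_compose)

lemma UNIV_id: "E UNIV x = x"
  using pvm by (simp add: projection_valued_measure_def)

lemma sums: "range d \<subseteq> sets borel \<Longrightarrow> disjoint_family d \<Longrightarrow> (\<lambda>n. E (d n) x) sums E (\<Union>n. d n) x"
  using pvm by (simp add: projection_valued_measure_def)

lemma norm_sq: "S \<in> sets borel \<Longrightarrow> cinner (E S x) x = complex_of_real ((norm (E S x))\<^sup>2)"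
  using sym[of S "E S x" x] by (simp add: idem cinner_self)

lemma norm_le: "S \<in> sets borel \<Longrightarrow> norm (E S x) \<le> norm x"
proof -
  assume S: "S \<in> sets borel"
  have "(norm (E S x))\<^sup>2 = cmod (cinner (E S x) x)" unfolding norm_sq[OF S] norm_of_real by simp
  also have "\<dots> \<le> norm (E S x) * norm x" by (rule cmod_cinner_le)
  finally show ?thesis by (cases "norm (E S x) = 0") (auto simp: power2_eq_square)
qed

lemma scaleC: "S \<in> sets borel \<Longrightarrow> E S (c *\<^sub>C x) = c *\<^sub>C E S x"
proof -
  assume S: "S \<in> sets borel"
  have "cinner (E S (c *\<^sub>C x) - c *\<^sub>C E S x) y = 0" for y
    by (simp add: cinner_diff_left cinner_scaleC_left sym[OF S])
  then show ?thesis using cinner_eq_zero_iff by (metis eq_iff_diff_eq_0)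
qed

lemma empty: "E {} x = 0"
proof -
  have "(\<lambda>n::nat. E {} x) sums E {} x" using sums[of "\<lambda>_. {}" x] by (simp add: disjoint_family_on_def)
  then have "(\<lambda>n::nat. E {} x) \<longlonglongrightarrow> 0" using summable_LIMSEQ_zero sums_summable by blast
  then show ?thesis using LIMSEQ_unique tendsto_const by blast
qed

lemma Un: 
  assumes "S \<in> sets borel" "T \<in> sets borel" "S \<inter> T = {}"
  shows "E (S \<union> T) x = E S x + E T x"
proof -
  have r: "range (binaryset S T) \<subseteq> sets borel" using assms by (auto simp: range_binaryset_eq)
  have d: "disjoint_family (binaryset S T)" using assms(3) by (auto simp: disjoint_family_on_def binaryset_def)
  have "(\<lambda>n. E (binaryset S T n) x) sums E (S \<union> T) x" using sums[OF r d, of x] by (simp add: UN_binaryset_eq)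
  moreover have "(\<lambda>n. E (binaryset S T n) x) sums (\<Sum>n\<in>{0, 1}. E (binaryset S T n) x)"
    by (rule sums_finite) (auto simp: binaryset_def empty)
  ultimately have "E (S \<union> T) x = (\<Sum>n\<in>{0, 1}. E (binaryset S T n) x)" by (rule sums_unique2)
  then show ?thesis by (simp add: binaryset_def)
qed

text \<open>For z = E T x additivity makes the squared norm of E (S \<union> T) z equal to that of E
  S z plus that of z, but E (S \<union> T) is a contraction.\<close>

lemma disjoint_zero:
  assumes S: "S \<in> sets borel" and T: "T \<in> sets borel" and "S \<inter> T = {}"
  shows "E S (E T x) = 0"
proof -
  let ?z = "E T x"
  have "cinner (E (S \<union> T) ?z) ?z = cinner (E S ?z) ?z + cinner ?z ?z"
    by (simp add: Un[OF assms] idem[OF T] cinner_add_left)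
  then have "complex_of_real ((norm (E (S \<union> T) ?z))\<^sup>2) = complex_of_real ((norm (E S ?z))\<^sup>2 + (norm ?z)\<^sup>2)"
    using S T by (simp add: norm_sq cinner_self)
  then have "(norm (E (S \<union> T) ?z))\<^sup>2 = (norm (E S ?z))\<^sup>2 + (norm ?z)\<^sup>2" using of_real_eq_iff by blast
  moreover have "(norm (E (S \<union> T) ?z))\<^sup>2 \<le> (norm ?z)\<^sup>2" using S T norm_le by (intro power_mono) auto
  ultimately show ?thesis by simp
qed

lemma Int:
  assumes S: "S \<in> sets borel" and T: "T \<in> sets borel"
  shows "E S (E T x) = E (S \<inter> T) x"
proof -
  have m: "S \<inter> T \<in> sets borel" "T - S \<in> sets borel" "S - T \<in> sets borel" using S T by auto
  have "T = (S \<inter> T) \<union> (T - S)" by auto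
  then have "E T x = E (S \<inter> T) x + E (T - S) x" using Un[OF m(1,2), of x] by auto
  then have "E S (E T x) = E S (E (S \<inter> T) x) + E S (E (T - S) x)" by (simp add: blinfun.add_right)
  also have "E S (E (T - S) x) = 0" using S m by (intro disjoint_zero) auto
  also have "E S (E (S \<inter> T) x) = E (S \<inter> T) (E (S \<inter> T) x) + E (S - T) (E (S \<inter> T) x)"
  proof -
    have "S = (S \<inter> T) \<union> (S - T)" by auto
    then show ?thesis using Un[OF m(1,3), of "E (S \<inter> T) x"] by auto
  qed
  also have "E (S - T) (E (S \<inter> T) x) = 0" using m by (intro disjoint_zero) auto
  finally show ?thesis using idem[OF m(1)] by simp
qed

lemma Compl_add: "S \<in> sets borel \<Longrightarrow> E S x + E (- S) x = x"
  using Un[of S "- S" x] by (simp add: UNIV_id)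

lemma norm_mono:
  assumes "S \<in> sets borel" "T \<in> sets borel" "S \<subseteq> T"
  shows "norm (E S x) \<le> norm (E T x)"
proof -
  have "E S x = E S (E T x)" using assms by (simp add: Int inf_absorb1)
  then show ?thesis using norm_le[OF assms(1)] by metis
qed

lemma norm_sums:
  assumes "range d \<subseteq> sets borel" "disjoint_family d"
  shows "(\<lambda>n. (norm (E (d n) x))\<^sup>2) sums (norm (E (\<Union>n. d n) x))\<^sup>2"
proof -
  have "(\<Union>n. d n) \<in> sets borel" using assms(1) by auto
  have "(\<lambda>n. cinner (E (d n) x) x) sums cinner (E (\<Union>n. d n) x) x"
    by (rule bounded_linear.sums[OF bounded_bilinear.bounded_linear_left[OF bounded_bilinear_cinner] sums[OF assms]])
  moreover have "d n \<in> sets borel" for n using assms(1) by auto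
  ultimately have "(\<lambda>n. complex_of_real ((norm (E (d n) x))\<^sup>2)) sums complex_of_real ((norm (E (\<Union>n. d n) x))\<^sup>2)"
    using \<open>(\<Union>n. d n) \<in> sets borel\<close> by (simp only: norm_sq)
  then show ?thesis by (simp only: sums_of_real_iff)
qed

lemma norm_sq_Un:
  assumes "S \<in> sets borel" "T \<in> sets borel" "S \<inter> T = {}"
  shows "(norm (E (S \<union> T) x))\<^sup>2 = (norm (E S x))\<^sup>2 + (norm (E T x))\<^sup>2"
proof -
  have "cinner (E S x) (E T x) = cinner x (E S (E T x))" by (rule sym[OF assms(1)])
  also have "\<dots> = 0" using disjoint_zero[OF assms] by simp
  finally show ?thesis unfolding Un[OF assms] by (rule norm_sq_add_orthogonal)
qed

abbreviation \<nu> :: "'a \<Rightarrow> real measure" where "\<nu> x \<equiv> scalar_measure E x"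

lemma sets_nu [simp, measurable_cong]: "sets (\<nu> x) = sets borel"
  unfolding scalar_measure_def using sets_measure_of[of "sets borel" "UNIV :: real set"] sets.sigma_sets_eq[of borel]
  by simp

lemma space_nu [simp]: "space (\<nu> x) = UNIV"
  using sets_eq_imp_space_eq[OF sets_nu] by simp

lemma emeasure_nu: "S \<in> sets borel \<Longrightarrow> emeasure (\<nu> x) S = ennreal ((norm (E S x))\<^sup>2)"
proof -
  assume S: "S \<in> sets borel"
  have "emeasure (\<nu> x) S = ennreal (Re (cinner (E S x) x))"
  proof (rule emeasure_measure_of[OF scalar_measure_def])
    show "positive (sets (\<nu> x)) (\<lambda>S. ennreal (Re (cinner (E S x) x)))" by (simp add: positive_def empty)
    show "countably_additive (sets (\<nu> x)) (\<lambda>S. ennreal (Re (cinner (E S x) x)))"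
    proof (rule countably_additiveI)
      fix d :: "nat \<Rightarrow> real set" assume d: "range d \<subseteq> sets (\<nu> x)" "disjoint_family d" "(\<Union>n. d n) \<in> sets (\<nu> x)"
      then have "d n \<in> sets borel" for n by auto
      then show "(\<Sum>n. ennreal (Re (cinner (E (d n) x) x))) = ennreal (Re (cinner (E (\<Union>n. d n) x) x))"
        using norm_sums[of d x] d by (simp only: norm_sq Re_complex_of_real sets_nu) (intro suminf_ennreal_eq, auto)
    qed
  qed (use S in auto)
  then show ?thesis using S by (simp add: norm_sq)
qed

lemma finite_nu: "finite_measure (\<nu> x)"
  by (rule finite_measureI) (simp add: emeasure_nu)

lemma measure_nu: "S \<in> sets borel \<Longrightarrow> measure (\<nu> x) S = (norm (E S x))\<^sup>2"
  using emeasure_nu[of S x] by (simp add: measure_def)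

lemma nu_restrict:
  assumes S: "S \<in> sets borel"
  shows "\<nu> (E S x) = density (\<nu> x) (\<lambda>t. ennreal (indicator S t))"
proof (rule measure_eqI)
  fix T assume "T \<in> sets (\<nu> (E S x))"
  then have T: "T \<in> sets borel" by simp
  have "emeasure (density (\<nu> x) (\<lambda>t. ennreal (indicator S t))) T = (\<integral>\<^sup>+t. ennreal (indicator S t) * indicator T t \<partial>\<nu> x)"
    using S T by (intro emeasure_density) auto
  also have "\<dots> = (\<integral>\<^sup>+t. indicator (S \<inter> T) t \<partial>\<nu> x)"
    by (intro nn_integral_cong) (auto simp: indicator_def)
  also have "\<dots> = emeasure (\<nu> x) (S \<inter> T)" using S T by simp
  also have "\<dots> = emeasure (\<nu> (E S x)) T" using S T by (simp add: emeasure_nu Int Int_commute)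
  finally show "emeasure (\<nu> (E S x)) T = emeasure (density (\<nu> x) (\<lambda>t. ennreal (indicator S t))) T" by simp
qed simp

end

text \<open>Polarisation with y in the direction of T x and with the norm of x, followed by the
  parallelogram law. T is not assumed bounded, which is what makes the lemma applicable to
  restrictions of A - a.\<close>

lemma symmetric_form_bound:
  assumes V: "csubspace V" and TV: "\<And>x. x \<in> V \<Longrightarrow> T x \<in> V"
    and add: "\<And>x y. x \<in> V \<Longrightarrow> y \<in> V \<Longrightarrow> T (x + y) = T x + T y"
    and scale: "\<And>c x. x \<in> V \<Longrightarrow> T (c *\<^sub>C x) = c *\<^sub>C T x"
    and sym: "\<And>x y. x \<in> V \<Longrightarrow> y \<in> V \<Longrightarrow> cinner (T x) y = cinner x (T y)"
    and q: "\<And>x. x \<in> V \<Longrightarrow> \<bar>Re (cinner (T x) x)\<bar> \<le> r * (norm x)\<^sup>2"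
    and x: "x \<in> V"
  shows "norm (T x) \<le> r * norm (x :: 'a::chilbert_space)"
proof (cases "T x = 0 \<or> x = 0")
  case True
  show ?thesis
  proof (cases "x = 0")
    case True
    have "T (0 *\<^sub>C x) = 0 *\<^sub>C T x" by (rule scale[OF x])
    then show ?thesis using True by simp
  next
    case False
    have "0 \<le> r * (norm x)\<^sup>2" using q[OF x] by (meson abs_ge_zero order_trans)
    then have "0 \<le> r" using False by (simp add: zero_le_mult_iff)
    then show ?thesis using True False by simp
  qed
next
  case False
  define c where "c = norm x / norm (T x)"
  define y where "y = of_real c *\<^sub>C T x"
  have y: "y \<in> V" unfolding y_def using V TV x cvs.subspace_scale by blast
  have ny: "norm y = norm x" using False by (simp add: y_def norm_scaleC c_def norm_divide)
  have my: "of_real (-1) *\<^sub>C y \<in> V" using V y cvs.subspace_scale by blast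
  have Txy: "Re (cinner (T x) y) = norm x * norm (T x)"
  proof -
    have "Re (cinner (T x) y) = c * (norm (T x))\<^sup>2" by (simp add: y_def cinner_scaleC_right cinner_self)
    then show ?thesis using False by (simp add: c_def power2_eq_square)
  qed
  have "Re (cinner (T y) x) = Re (cinner (T x) y)"
    using sym[OF y x] cinner_commute[of y "T x"] by simp
  then have "4 * Re (cinner (T x) y) = Re (cinner (T (x + y)) (x + y)) - Re (cinner (T (x + of_real (-1) *\<^sub>C y)) (x + of_real (-1) *\<^sub>C y))"
    unfolding add[OF x y] add[OF x my] scale[OF y]
    by (simp add: cinner_add_left cinner_add_right cinner_minus_left cinner_minus_right cinner_diff_left cinner_diff_right)
  also have "\<dots> \<le> r * (norm (x + y))\<^sup>2 + r * (norm (x + of_real (-1) *\<^sub>C y))\<^sup>2"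
  proof -
    have "x + y \<in> V" "x + of_real (-1) *\<^sub>C y \<in> V" using V x y my cvs.subspace_add by blast+
    then show ?thesis using q[of "x + y"] q[of "x + of_real (-1) *\<^sub>C y"] by (simp add: abs_le_iff)
  qed
  also have "\<dots> = r * (2 * (norm x)\<^sup>2 + 2 * (norm y)\<^sup>2)"
  proof -
    have "(norm (x + y))\<^sup>2 + (norm (x + of_real (-1) *\<^sub>C y))\<^sup>2 = 2 * (norm x)\<^sup>2 + 2 * (norm y)\<^sup>2"
      using norm_sq_add[of x y] norm_sq_add[of x "- y"] by (simp add: cinner_minus_right)
    then show ?thesis by (simp only: distrib_left[symmetric])
  qed
  finally have "norm x * norm (T x) \<le> norm x * (r * norm x)" unfolding Txy ny by (simp add: power2_eq_square algebra_simps)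
  then show ?thesis using False by simp
qed

text \<open>\<open>int_decode\<close> arranges the cells in a sequence, as countable additivity and
  the partitions of the variation require.\<close>

definition grid_cell :: "real \<Rightarrow> nat \<Rightarrow> real set"
  where "grid_cell \<delta> n = {t. \<lfloor>t / \<delta>\<rfloor> = int_decode n}"

lemma grid_cell:
  assumes "\<delta> > 0"
  shows "grid_cell \<delta> n \<in> sets borel" "disjoint_family (grid_cell \<delta>)" "(\<Union>n. grid_cell \<delta> n) = UNIV"
    "x \<in> grid_cell \<delta> n \<Longrightarrow> y \<in> grid_cell \<delta> n \<Longrightarrow> \<bar>x - y\<bar> < \<delta>"
proof -
  have "(\<lambda>t::real. real_of_int \<lfloor>t / \<delta>\<rfloor>) \<in> borel_measurable borel" by measurable
  then have "(\<lambda>t::real. real_of_int \<lfloor>t / \<delta>\<rfloor>) -` {real_of_int (int_decode n)} \<inter> space borel \<in> sets borel"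
    by (rule measurable_sets) auto
  moreover have "(\<lambda>t::real. real_of_int \<lfloor>t / \<delta>\<rfloor>) -` {real_of_int (int_decode n)} \<inter> space borel = grid_cell \<delta> n"
    by (auto simp: grid_cell_def)
  ultimately show "grid_cell \<delta> n \<in> sets borel" by simp
  show "disjoint_family (grid_cell \<delta>)"
    by (auto simp: disjoint_family_on_def grid_cell_def inj_eq[OF bij_is_inj[OF bij_int_decode]])
  have "t \<in> grid_cell \<delta> (int_encode \<lfloor>t / \<delta>\<rfloor>)" for t by (simp add: grid_cell_def)
  then show "(\<Union>n. grid_cell \<delta> n) = UNIV" by blast
  assume "x \<in> grid_cell \<delta> n" "y \<in> grid_cell \<delta> n"
  then have "\<lfloor>x / \<delta>\<rfloor> = \<lfloor>y / \<delta>\<rfloor>" by (simp add: grid_cell_def)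
  then have "\<bar>x / \<delta> - y / \<delta>\<bar> < 1" by linarith
  then show "\<bar>x - y\<bar> < \<delta>" using assms by (simp add: diff_divide_distrib[symmetric] pos_divide_less_eq)
qed

section \<open>Spectral calculus, recovered from the quadratic form of the operator\<close>

locale spectral_operator = pvm E for E :: "real set \<Rightarrow> ('a::chilbert_space \<Rightarrow>\<^sub>L 'a)" +
  fixes A :: "'a lop"
  assumes sa: "self_adjoint A" and spec: "spectral_measure_of A E"
begin

lemmas dom_sub = self_adjoint_csubspace[OF sa]

lemma dom_iff: "x \<in> op_dom A \<longleftrightarrow> (\<integral>\<^sup>+t. ennreal (t\<^sup>2) \<partial>\<nu> x) < \<infinity>"
  using spec by (simp add: spectral_measure_of_def)

lemma quad: "x \<in> op_dom A \<Longrightarrow> cinner (op_app A x) x = complex_of_real (\<integral>t. t \<partial>\<nu> x)"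
  using spec by (simp add: spectral_measure_of_def)

lemma nn_integral_restrict:
  assumes "S \<in> sets borel" "f \<in> borel_measurable borel"
  shows "(\<integral>\<^sup>+t. f t \<partial>\<nu> (E S x)) = (\<integral>\<^sup>+t. ennreal (indicator S t) * f t \<partial>\<nu> x)"
  unfolding nu_restrict[OF assms(1)] using assms by (intro nn_integral_density) auto

lemma restrict_dom: "S \<in> sets borel \<Longrightarrow> x \<in> op_dom A \<Longrightarrow> E S x \<in> op_dom A"
proof -
  assume S: "S \<in> sets borel" and x: "x \<in> op_dom A"
  have "(\<integral>\<^sup>+t. ennreal (t\<^sup>2) \<partial>\<nu> (E S x)) \<le> (\<integral>\<^sup>+t. ennreal (t\<^sup>2) \<partial>\<nu> x)"
    by (subst nn_integral_restrict[OF S]) (auto intro!: nn_integral_mono simp: indicator_def)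
  also have "\<dots> < \<infinity>" using x dom_iff by simp
  finally show ?thesis using dom_iff by simp
qed

lemma bounded_dom:
  assumes S: "S \<in> sets borel" and b: "\<And>t. t \<in> S \<Longrightarrow> \<bar>t\<bar> \<le> C"
  shows "E S x \<in> op_dom A"
proof -
  have "(\<integral>\<^sup>+t. ennreal (t\<^sup>2) \<partial>\<nu> (E S x)) \<le> (\<integral>\<^sup>+t. ennreal (C\<^sup>2) \<partial>\<nu> x)"
  proof (subst nn_integral_restrict[OF S], measurable, rule nn_integral_mono)
    fix t
    have "t\<^sup>2 \<le> C\<^sup>2" if "t \<in> S" using b[OF that] by (metis abs_ge_zero power2_abs power_mono)
    then show "ennreal (indicator S t) * ennreal (t\<^sup>2) \<le> ennreal (C\<^sup>2)" by (auto simp: indicator_def ennreal_leI)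
  qed
  also have "\<dots> < \<infinity>" by (simp add: emeasure_nu ennreal_mult_less_top)
  finally show ?thesis using dom_iff by simp
qed

lemma integrable_id: "x \<in> op_dom A \<Longrightarrow> integrable (\<nu> x) (\<lambda>t. t)"
proof (rule integrableI_bounded)
  assume x: "x \<in> op_dom A"
  have "(\<integral>\<^sup>+t. ennreal (norm t) \<partial>\<nu> x) \<le> (\<integral>\<^sup>+t. ennreal 1 + ennreal (t\<^sup>2) \<partial>\<nu> x)"
  proof (rule nn_integral_mono)
    fix t :: real
    have "0 \<le> (\<bar>t\<bar> - 1)\<^sup>2" by simp
    then have "2 * \<bar>t\<bar> \<le> 1 + t\<^sup>2" by (simp add: power2_diff)
    then have "\<bar>t\<bar> \<le> 1 + t\<^sup>2" by linarith
    then have "norm t \<le> 1 + t\<^sup>2" by simp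
    then have "ennreal (norm t) \<le> ennreal (1 + t\<^sup>2)" by (rule ennreal_leI)
    also have "\<dots> = ennreal 1 + ennreal (t\<^sup>2)" by (rule ennreal_plus) auto
    finally show "ennreal (norm t) \<le> ennreal 1 + ennreal (t\<^sup>2)" .
  qed
  also have "\<dots> = (\<integral>\<^sup>+t. ennreal 1 \<partial>\<nu> x) + (\<integral>\<^sup>+t. ennreal (t\<^sup>2) \<partial>\<nu> x)" by (intro nn_integral_add) auto
  also have "\<dots> < \<infinity>" using x dom_iff by (simp add: emeasure_nu)
  finally show "(\<integral>\<^sup>+t. ennreal (norm t) \<partial>\<nu> x) < \<infinity>" .
qed simp

lemma integral_restrict:
  assumes S: "S \<in> sets borel" and f: "f \<in> borel_measurable borel"
  shows "(\<integral>t. f t \<partial>\<nu> (E S x)) = (\<integral>t. indicator S t * (f t :: real) \<partial>\<nu> x)"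
  unfolding nu_restrict[OF S] using S f by (subst integral_density) auto

text \<open>The spectral measure is tied to A only through quadratic forms. The measure of u + v
  splits into its parts on S and on the complement, so the form of the sum is the sum of the forms
  and the mixed terms cancel in the real part. Using \<i> y instead of y removes the imaginary
  part.\<close>

lemma cross_zero:
  assumes S: "S \<in> sets borel" and x: "x \<in> op_dom A" and y: "y \<in> op_dom A"
  shows "cinner (op_app A (E S x)) (E (- S) y) = 0"
proof -
  have mS: "- S \<in> sets borel" using S by auto
  have re: "Re (cinner (op_app A (E S x)) (E (- S) y)) = 0" if y: "y \<in> op_dom A" for y
  proof -
    define u v where "u = E S x" and "v = E (- S) y"
    have uv: "u \<in> op_dom A" "v \<in> op_dom A" unfolding u_def v_def using restrict_dom S mS x y by auto
    define z where "z = u + v"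
    have z: "z \<in> op_dom A" unfolding z_def using uv dom_sub cvs.subspace_add by blast
    have Ez: "E S z = u" "E (- S) z = v"
      unfolding z_def u_def v_def using disjoint_zero[OF S mS] disjoint_zero[OF mS S]
      by (auto simp: blinfun.add_right idem S mS)
    have "(\<integral>t. t \<partial>\<nu> z) = (\<integral>t. indicator S t * t + indicator (- S) t * t \<partial>\<nu> z)"
      by (intro Bochner_Integration.integral_cong) (auto simp: indicator_def)
    also have "\<dots> = (\<integral>t. indicator S t * t \<partial>\<nu> z) + (\<integral>t. indicator (- S) t * t \<partial>\<nu> z)"
      using integrable_id[OF z] S mS
      by (intro Bochner_Integration.integral_add) (auto intro!: integrable_real_mult_indicator simp: mult.commute)
    also have "\<dots> = (\<integral>t. t \<partial>\<nu> u) + (\<integral>t. t \<partial>\<nu> v)"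
      using integral_restrict[OF S, of "\<lambda>t. t" z] integral_restrict[OF mS, of "\<lambda>t. t" z] Ez by simp
    finally have "cinner (op_app A z) z = cinner (op_app A u) u + cinner (op_app A v) v"
      unfolding quad[OF z] quad[OF uv(1)] quad[OF uv(2)] by simp
    moreover have "op_app A z = op_app A u + op_app A v" unfolding z_def by (rule self_adjoint_add[OF sa uv])
    ultimately have "cinner (op_app A u) v + cinner (op_app A v) u = 0" unfolding z_def
      by (simp add: cinner_add_left cinner_add_right add.commute)
    moreover have "cinner (op_app A v) u = cnj (cinner (op_app A u) v)"
      unfolding self_adjoint_symmetric[OF sa uv(2,1)] by (rule cinner_commute)
    ultimately have "cinner (op_app A u) v + cnj (cinner (op_app A u) v) = 0" by simp
    then have "Re (cinner (op_app A u) v + cnj (cinner (op_app A u) v)) = 0" by simp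
    then show ?thesis by (simp add: u_def v_def)
  qed
  have "\<i> *\<^sub>C y \<in> op_dom A" using y dom_sub cvs.subspace_scale by blast
  from re[OF this] have "Im (cinner (op_app A (E S x)) (E (- S) y)) = 0"
    by (simp add: scaleC mS cinner_scaleC_right)
  then show ?thesis using re[OF y] by (simp add: complex_eq_iff)
qed

text \<open>The mixed terms vanish against a dense set of vectors y, so A maps the range of E T into
  the range of E T; this is used for S and for its complement.\<close>

lemma commutes:
  assumes S: "S \<in> sets borel" and x: "x \<in> op_dom A"
  shows "op_app A (E S x) = E S (op_app A x)"
proof -
  have mS: "- S \<in> sets borel" using S by auto
  have zero: "E (- T) (op_app A (E T x)) = 0" if T: "T \<in> sets borel" for T
  proof -
    have mT: "- T \<in> sets borel" using T by auto
    have dense: "closure (op_dom A) = UNIV" using sa by (simp add: self_adjoint_def)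
    show ?thesis by (rule orthogonal_dense_zero[OF dense]) (simp add: sym[OF mT] cross_zero[OF T x])
  qed
  have "E S (op_app A (E (- S) x)) = 0" using zero[OF mS] by simp
  moreover have "op_app A x = op_app A (E S x) + op_app A (E (- S) x)"
    using self_adjoint_add[OF sa restrict_dom[OF S x] restrict_dom[OF mS x]] Compl_add[OF S] by simp
  ultimately have "E S (op_app A x) = E S (op_app A (E S x))" by (simp add: blinfun.add_right)
  also have "\<dots> = op_app A (E S x)" using Compl_add[OF S, of "op_app A (E S x)"] zero[OF S] by simp
  finally show ?thesis by simp
qed

abbreviation shift :: "real \<Rightarrow> 'a \<Rightarrow> 'a" where "shift a x \<equiv> op_app A x - complex_of_real a *\<^sub>C x"

lemma shift_commutes: "S \<in> sets borel \<Longrightarrow> x \<in> op_dom A \<Longrightarrow> shift a (E S x) = E S (shift a x)"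
  by (simp add: commutes blinfun.diff_right scaleC)

lemma shift_symmetric: "x \<in> op_dom A \<Longrightarrow> y \<in> op_dom A \<Longrightarrow> cinner (shift a x) y = cinner x (shift a y)"
  using self_adjoint_symmetric[OF sa] by (simp add: cinner_diff_left cinner_diff_right cinner_scaleC_left cinner_scaleC_right)

lemma shift_diff: "x \<in> op_dom A \<Longrightarrow> y \<in> op_dom A \<Longrightarrow> shift a (x - y) = shift a x - shift a y"
  by (simp add: self_adjoint_diff[OF sa] cvs.scale_right_diff_distrib)

lemma shift_add: "x \<in> op_dom A \<Longrightarrow> y \<in> op_dom A \<Longrightarrow> shift a (x + y) = shift a x + shift a y"
  by (simp add: self_adjoint_add[OF sa] scaleC_add_right)

lemma shift_scale: "x \<in> op_dom A \<Longrightarrow> shift a (c *\<^sub>C x) = c *\<^sub>C shift a x"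
  by (simp add: self_adjoint_scale[OF sa] cvs.scale_right_diff_distrib scaleC_scaleC mult.commute)

text \<open>For vectors in the range of E S the form of A - a is an average of t - a over S, and a
  symmetric operator is bounded by its form.\<close>

lemma shift_bound:
  assumes S: "S \<in> sets borel" and r: "\<And>t. t \<in> S \<Longrightarrow> \<bar>t - a\<bar> \<le> r" and r0: "r \<ge> 0" and x: "E S x = x"
  shows "norm (shift a x) \<le> r * norm x"
proof (rule symmetric_form_bound[where T = "shift a" and V = "{y. E S y = y}"])
  have dom: "y \<in> op_dom A" if "E S y = y" for y
  proof -
    have "\<bar>t\<bar> \<le> \<bar>a\<bar> + r" if "t \<in> S" for t using r[OF that] by linarith
    then show ?thesis using bounded_dom[OF S, of "\<bar>a\<bar> + r" y] that by simp
  qed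
  show "csubspace {y. E S y = y}" by (rule cvs.subspaceI) (auto simp: blinfun.zero_right blinfun.add_right scaleC S)
  show "shift a y \<in> {y. E S y = y}" if "y \<in> {y. E S y = y}" for y
    using shift_commutes[OF S, of y a] dom that by simp
  show "shift a (y + z) = shift a y + shift a z" if "y \<in> {y. E S y = y}" "z \<in> {y. E S y = y}" for y z
    using shift_add dom that by simp
  show "shift a (c *\<^sub>C y) = c *\<^sub>C shift a y" if "y \<in> {y. E S y = y}" for y c
    using shift_scale dom that by simp
  show "cinner (shift a y) z = cinner y (shift a z)" if "y \<in> {y. E S y = y}" "z \<in> {y. E S y = y}" for y z
    using shift_symmetric dom that by simp
  show "\<bar>Re (cinner (shift a y) y)\<bar> \<le> r * (norm y)\<^sup>2" if "y \<in> {y. E S y = y}" for y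
  proof -
    interpret N: finite_measure "\<nu> y" by (rule finite_nu)
    have y: "E S y = y" "y \<in> op_dom A" using that dom by auto
    have total: "measure (\<nu> y) UNIV = (norm y)\<^sup>2" by (simp add: measure_nu UNIV_id)
    have AE: "AE t in \<nu> y. t \<in> S"
    proof (rule AE_I[of _ _ "- S"])
      have "E (- S) (E S y) = 0" using S by (intro disjoint_zero) auto
      then show "emeasure (\<nu> y) (- S) = 0" using S y(1) by (simp add: emeasure_nu)
    qed (use S in auto)
    have int: "integrable (\<nu> y) (\<lambda>t. t - a)" using integrable_id[OF y(2)] by simp
    have "Re (cinner (shift a y) y) = (\<integral>t. t \<partial>\<nu> y) - a * (norm y)\<^sup>2"
      using quad[OF y(2)] by (simp add: cinner_diff_left cinner_scaleC_left cinner_self)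
    also have "\<dots> = (\<integral>t. t - a \<partial>\<nu> y)"
      using integrable_id[OF y(2)] by (subst Bochner_Integration.integral_diff) (auto simp: total)
    also have "\<bar>\<dots>\<bar> \<le> (\<integral>t. \<bar>t - a\<bar> \<partial>\<nu> y)" by (rule integral_abs_bound)
    also have "\<dots> \<le> (\<integral>t. r \<partial>\<nu> y)"
      using AE int r by (intro integral_mono_AE) auto
    also have "\<dots> = r * (norm y)\<^sup>2" by (simp add: total mult.commute)
    finally show ?thesis .
  qed
qed (use x in simp)

lemma norm_grid:
  assumes S: "S \<in> sets borel" and \<delta>: "\<delta> > 0"
  shows "(\<lambda>n. (norm (E (S \<inter> grid_cell \<delta> n) x))\<^sup>2) sums (norm (E S x))\<^sup>2"
proof -
  have "(\<Union>n. S \<inter> grid_cell \<delta> n) = S" using grid_cell(3)[OF \<delta>] by blast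
  moreover have "disjoint_family (\<lambda>n. S \<inter> grid_cell \<delta> n)" using grid_cell(2)[OF \<delta>] by (auto simp: disjoint_family_on_def)
  moreover have "range (\<lambda>n. S \<inter> grid_cell \<delta> n) \<subseteq> sets borel" using S grid_cell(1)[OF \<delta>] by auto
  ultimately show ?thesis using norm_sums[of "\<lambda>n. S \<inter> grid_cell \<delta> n" x] by simp
qed

text \<open>On the part of S in a cell of width \<delta>, A differs by at most \<delta> from a
  number b of S, and b has distance at least r from a. The squares of the pieces add up, and
  \<delta> tends to 0.\<close>

lemma shift_lower_bound:
  assumes S: "S \<in> sets borel" and r: "\<And>t. t \<in> S \<Longrightarrow> r \<le> \<bar>t - a\<bar>" and x: "x \<in> op_dom A" "E S x = x"
  shows "r * norm x \<le> norm (shift a x)"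
proof (cases "r \<le> 0")
  case True
  then show ?thesis by (meson mult_nonpos_nonneg norm_ge_zero order_trans)
next
  case False
  have approx: "(r - \<delta>) * norm x \<le> norm (shift a x)" if \<delta>: "0 < \<delta>" "\<delta> < r" for \<delta>
  proof -
    let ?d = "\<lambda>n. S \<inter> grid_cell \<delta> n"
    have dm: "?d n \<in> sets borel" for n using S grid_cell(1)[OF \<delta>(1)] by auto
    have piece: "((r - \<delta>) * norm (E (?d n) x))\<^sup>2 \<le> (norm (E (?d n) (shift a x)))\<^sup>2" for n
    proof (cases "?d n = {}")
      case False
      then obtain b where b: "b \<in> ?d n" by blast
      let ?y = "E (?d n) x"
      have "norm (shift b ?y) \<le> \<delta> * norm ?y"
        using grid_cell(4)[OF \<delta>(1), of _ n b] b \<delta> dm by (intro shift_bound[OF dm[of n]]) (auto simp: idem less_imp_le)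
      moreover have "shift a ?y = shift b ?y + complex_of_real (b - a) *\<^sub>C ?y"
        by (simp add: cvs.scale_left_diff_distrib)
      then have "norm (complex_of_real (b - a) *\<^sub>C ?y) \<le> norm (shift a ?y) + norm (shift b ?y)"
        by (metis add_diff_cancel_left' norm_triangle_ineq4)
      then have "\<bar>b - a\<bar> * norm ?y \<le> norm (shift a ?y) + norm (shift b ?y)"
        unfolding norm_scaleC norm_of_real .
      moreover have "r * norm ?y \<le> \<bar>b - a\<bar> * norm ?y" using r[of b] b by (intro mult_right_mono) auto
      ultimately have "(r - \<delta>) * norm ?y \<le> norm (shift a ?y)" by (simp add: algebra_simps)
      then show ?thesis unfolding shift_commutes[OF dm x(1)] using \<delta> by (intro power_mono) auto
    qed (simp add: empty)
    have "(\<lambda>n. ((r - \<delta>) * norm (E (?d n) x))\<^sup>2) sums ((r - \<delta>)\<^sup>2 * (norm (E S x))\<^sup>2)"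
      unfolding power_mult_distrib by (intro sums_mult norm_grid[OF S \<delta>(1)])
    moreover have "(\<lambda>n. (norm (E (?d n) (shift a x)))\<^sup>2) sums (norm (E S (shift a x)))\<^sup>2" by (rule norm_grid[OF S \<delta>(1)])
    ultimately have "(r - \<delta>)\<^sup>2 * (norm (E S x))\<^sup>2 \<le> (norm (E S (shift a x)))\<^sup>2" by (rule sums_le[OF piece])
    then have "((r - \<delta>) * norm x)\<^sup>2 \<le> (norm (shift a x))\<^sup>2"
      using x shift_commutes[OF S x(1), of a] by (simp add: power_mult_distrib)
    then show ?thesis by (rule power2_le_imp_le) simp
  qed
  show ?thesis
  proof (rule field_le_epsilon)
    fix e :: real assume e: "e > 0"
    define \<delta> where "\<delta> = min (r / 2) (e / (norm x + 1))"
    have \<delta>: "0 < \<delta>" "\<delta> < r" "\<delta> \<le> e / (norm x + 1)" using False e by (auto simp: \<delta>_def add_nonneg_pos)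
    have "\<delta> * norm x \<le> e / (norm x + 1) * norm x" using \<delta>(3) by (intro mult_right_mono) auto
    also have "\<dots> \<le> e"
    proof -
      have "norm x + 1 > 0" by (simp add: add_nonneg_pos)
      moreover have "e * norm x \<le> e * (norm x + 1)" using e by simp
      ultimately show ?thesis by (simp add: pos_divide_le_eq)
    qed
    finally show "r * norm x \<le> norm (shift a x) + e" using approx[OF \<delta>(1,2)] by (simp add: left_diff_distrib)
  qed
qed


text \<open>The lower bound off the gap makes the range of A - a on the range of E S closed. A
  vector in the range of E S that is orthogonal to it would be an eigenvector for a by
  self-adjointness, which the lower bound excludes.\<close>

lemma shift_solve:
  assumes r: "r > 0" and S: "S = - {a - r<..<a + r}"
  obtains v where "v \<in> op_dom A" "E S v = v" "shift a v = E S u" "r * norm v \<le> norm u"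
proof -
  have Sm: "S \<in> sets borel" and low: "\<And>t. t \<in> S \<Longrightarrow> r \<le> \<bar>t - a\<bar>" using S by auto
  define W where "W = {v \<in> op_dom A. E S v = v}"
  have W: "csubspace W" unfolding W_def using dom_sub
    by (intro cvs.subspaceI) (auto simp: blinfun.zero_right blinfun.add_right scaleC Sm cvs.subspace_0 cvs.subspace_add cvs.subspace_scale)
  have lb: "r * norm v \<le> norm (shift a v)" if "v \<in> W" for v
    using that by (intro shift_lower_bound[OF Sm low]) (auto simp: W_def)
  define R where "R = shift a ` W"
  have "csubspace R"
  proof (rule cvs.subspaceI)
    have "shift a 0 = 0" using shift_diff[of 0 0 a] cvs.subspace_0[OF dom_sub] by simp
    then show "0 \<in> R" unfolding R_def using cvs.subspace_0[OF W] by force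
    fix y z assume "y \<in> R" "z \<in> R"
    then obtain p q where "p \<in> W" "q \<in> W" "y = shift a p" "z = shift a q" by (auto simp: R_def)
    then show "y + z \<in> R" unfolding R_def using W shift_add[of p q a]
      by (intro image_eqI[of _ _ "p + q"]) (auto simp: W_def cvs.subspace_add blinfun.add_right dom_sub)
  next
    fix c y assume "y \<in> R"
    then obtain p where "p \<in> W" "y = shift a p" by (auto simp: R_def)
    then show "c *\<^sub>C y \<in> R" unfolding R_def using W shift_scale[where x = p and a = a and c = c] cvs.subspace_scale
      by (intro image_eqI[of _ _ "c *\<^sub>C p"]) (auto simp: W_def)
  qed
  moreover have "closed R"
    unfolding closed_sequential_limits
  proof (intro allI impI, elim conjE)
    fix y l assume y: "\<forall>n. y n \<in> R" "y \<longlonglongrightarrow> l"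
    then have "\<forall>n. \<exists>v. v \<in> W \<and> y n = shift a v" by (auto simp: R_def)
    then obtain v where v: "\<And>n. v n \<in> W" "\<And>n. y n = shift a (v n)" by metis
    have vd: "v n \<in> op_dom A" for n using v(1) by (auto simp: W_def)
    have dist_v: "r * dist (v i) (v j) \<le> dist (y i) (y j)" for i j
      using lb[of "v i - v j"] cvs.subspace_diff[OF W v(1)[of i] v(1)[of j]] shift_diff[OF vd[of i] vd[of j], of a]
      by (simp add: dist_norm v(2))
    have "Cauchy v"
    proof (rule metric_CauchyI)
      fix e :: real assume "e > 0"
      then have "r * e > 0" using r by simp
      then obtain N where N: "\<And>i j. i \<ge> N \<Longrightarrow> j \<ge> N \<Longrightarrow> dist (y i) (y j) < r * e"
        using metric_CauchyD[OF LIMSEQ_imp_Cauchy[OF y(2)]] by blast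
      have "dist (v i) (v j) < e" if "i \<ge> N" "j \<ge> N" for i j
      proof -
        have "r * dist (v i) (v j) < r * e" using dist_v[of i j] N[OF that] by linarith
        then show ?thesis using r by simp
      qed
      then show "\<exists>M. \<forall>m\<ge>M. \<forall>n\<ge>M. dist (v m) (v n) < e" by blast
    qed
    then obtain w where w: "v \<longlonglongrightarrow> w" using Cauchy_convergent convergent_def by blast
    have "(\<lambda>n. complex_of_real a *\<^sub>C v n) \<longlonglongrightarrow> complex_of_real a *\<^sub>C w"
      using w by (rule bounded_linear.tendsto[OF bounded_linear_scaleC])
    then have "(\<lambda>n. y n + complex_of_real a *\<^sub>C v n) \<longlonglongrightarrow> l + complex_of_real a *\<^sub>C w"
      using y(2) by (intro tendsto_add)
    then have "(\<lambda>n. op_app A (v n)) \<longlonglongrightarrow> l + complex_of_real a *\<^sub>C w" by (simp add: v(2))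
    then have wA: "w \<in> op_dom A" "op_app A w = l + complex_of_real a *\<^sub>C w"
      using self_adjoint_closed[OF sa vd w] by auto
    have "(\<lambda>n. E S (v n)) \<longlonglongrightarrow> E S w" using w by (intro tendsto_intros)
    then have "v \<longlonglongrightarrow> E S w" using v(1) by (simp add: W_def)
    then have "E S w = w" using w LIMSEQ_unique by blast
    then show "l \<in> R" unfolding R_def W_def using wA by (intro image_eqI[of _ _ w]) auto
  qed
  ultimately obtain p where p: "p \<in> R" "\<And>m. m \<in> R \<Longrightarrow> cinner (E S u - p) m = 0"
    using projection_exists by metis
  obtain v where v: "v \<in> W" "p = shift a v" using p(1) by (auto simp: R_def)
  have vW: "v \<in> op_dom A" "E S v = v" using v(1) by (auto simp: W_def)
  define w where "w = E S u - p"
  have "E S p = p" using shift_commutes[OF Sm vW(1), of a] vW(2) v(2) by simp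
  then have Ew: "E S w = w" by (simp add: w_def blinfun.diff_right idem Sm)
  \<comment> \<open>Orthogonality is known only for vectors in the range of E S; since w lies there
    too, commutation with E S extends it to the whole domain and puts w into the domain of the
    adjoint.\<close>
  have "cinner (op_app A y) w = cinner y (complex_of_real a *\<^sub>C w)" if y: "y \<in> op_dom A" for y
  proof -
    have "cinner (shift a y) w = cinner (E S (shift a y)) w" using sym[OF Sm, of "shift a y" w] Ew by simp
    also have "\<dots> = cinner (shift a (E S y)) w" using shift_commutes[OF Sm y] by simp
    also have "\<dots> = cnj (cinner w (shift a (E S y)))" by (rule cinner_commute)
    also have "shift a (E S y) \<in> R" unfolding R_def W_def using restrict_dom[OF Sm y] idem[OF Sm] by auto
    then have "cinner w (shift a (E S y)) = 0" using p(2) by (simp add: w_def)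
    finally show ?thesis by (simp add: cinner_diff_left cinner_scaleC_left cinner_scaleC_right)
  qed
  then have "w \<in> op_dom A" "op_app A w = complex_of_real a *\<^sub>C w" using self_adjoint_graph[OF sa] by auto
  then have "r * norm w \<le> 0" using lb[of w] Ew by (simp add: W_def)
  then have "norm w \<le> 0" using r by (simp add: mult_le_0_iff)
  then have "shift a v = E S u" using v(2) by (simp add: w_def)
  moreover have "r * norm v \<le> norm u" using lb[OF v(1)] norm_le[OF Sm, of u] calculation by simp
  ultimately show thesis using that vW by blast
qed

lemma resolvent_of_gap:
  assumes r: "r > 0" and gap: "\<And>x. E {a - r<..<a + r} x = 0"
  shows "complex_of_real a \<notin> spectrum A"
proof -
  define S where "S = - {a - r<..<a + r}"
  have Sm: "S \<in> sets borel" and low: "\<And>t. t \<in> S \<Longrightarrow> r \<le> \<bar>t - a\<bar>" unfolding S_def by auto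
  have id: "E S x = x" for x using Compl_add[of "{a - r<..<a + r}" x] gap by (simp add: S_def)
  have lb: "r * norm x \<le> norm (shift a x)" if "x \<in> op_dom A" for x
    using shift_lower_bound[OF Sm low that id] .
  have "\<exists>v. v \<in> op_dom A \<and> shift a v = u" for u
    using shift_solve[OF r S_def, of u] id by metis
  then obtain f where f: "\<And>u. f u \<in> op_dom A" "\<And>u. shift a (f u) = u" by metis
  have uniq: "f u = x" if "x \<in> op_dom A" "shift a x = u" for u x
  proof -
    have "f u - x \<in> op_dom A" using f(1) that dom_sub cvs.subspace_diff by blast
    then have "r * norm (f u - x) \<le> norm (shift a (f u) - shift a x)" using lb shift_diff[OF f(1) that(1), where a = a] by metis
    then have "r * norm (f u - x) \<le> 0" using f(2) that(2) by simp
    then show ?thesis using r by (simp add: mult_le_0_iff)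
  qed
  have add: "f (x + y) = f x + f y" for x y
    using f(2) cvs.subspace_add[OF dom_sub f(1) f(1)] shift_add[OF f(1) f(1), where a = a] by (intro uniq) auto
  have scale: "f (c *\<^sub>C x) = c *\<^sub>C f x" for c x
    using f(2) cvs.subspace_scale[OF dom_sub f(1)] shift_scale[OF f(1), where a = a] by (intro uniq) auto
  have bl: "bounded_linear f"
  proof (rule bounded_linear_intro[where K = "1 / r"])
    show "f (s *\<^sub>R x) = s *\<^sub>R f x" for s x using scale[of "of_real s" x] by (simp add: scaleC_of_real)
    show "norm (f x) \<le> norm x * (1 / r)" for x using lb[OF f(1), of x] f(2) r by (simp add: field_simps)
  qed (rule add)
  then have app: "blinfun_apply (Blinfun f) = f" by (rule bounded_linear_Blinfun_apply)
  have "is_resolvent A (complex_of_real a) (Blinfun f)"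
    unfolding is_resolvent_def app using f uniq by auto
  then show ?thesis by (auto simp: spectrum_def)
qed

lemma gap_of_resolvent:
  assumes "complex_of_real a \<notin> spectrum A"
  obtains r where "r > 0" "\<And>x. E {a - r<..<a + r} x = 0"
proof -
  obtain R where R: "is_resolvent A (complex_of_real a) R" using assms by (auto simp: spectrum_def)
  \<comment> \<open>On the spectral subspace of the interval of radius r, A - a has norm at most r
    and its inverse at most norm R; a product of at most 1 / 2 leaves only the zero space.\<close>
  define r where "r = 1 / (2 * (norm R + 1))"
  have r: "r > 0" "norm R * r \<le> 1 / 2" by (auto simp: r_def add_nonneg_pos pos_divide_le_eq)
  show thesis
  proof (rule that[OF r(1)])
    fix x
    let ?S = "{a - r<..<a + r}"
    let ?y = "E ?S x"
    have Sm: "?S \<in> sets borel" by simp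
    have "\<bar>t\<bar> \<le> \<bar>a\<bar> + r" if "t \<in> ?S" for t using that by auto
    then have y: "?y \<in> op_dom A" by (rule bounded_dom[OF Sm])
    have "norm (shift a ?y) \<le> r * norm ?y" using r(1) by (intro shift_bound[OF Sm]) (auto simp: idem)
    moreover have "R (shift a ?y) = ?y" using R y unfolding is_resolvent_def by auto
    then have "norm ?y \<le> norm R * norm (shift a ?y)" using norm_blinfun[of R "shift a ?y"] by simp
    ultimately have "norm ?y \<le> norm R * (r * norm ?y)" by (meson mult_left_mono norm_ge_zero order_trans)
    also have "\<dots> \<le> (1 / 2) * norm ?y" using mult_right_mono[OF r(2), of "norm ?y"] by (simp add: mult_ac)
    finally show "?y = 0" by simp
  qed
qed

lemma real_spectrum_closed: "closed (real_spectrum A)"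
proof -
  have "open (- real_spectrum A)" unfolding open_dist
  proof
    fix a assume "a \<in> - real_spectrum A"
    then have "complex_of_real a \<notin> spectrum A" by (simp add: real_spectrum_def)
    then obtain r where r: "r > 0" "\<And>x. E {a - r<..<a + r} x = 0" by (rule gap_of_resolvent) blast
    have "b \<in> - real_spectrum A" if b: "dist b a < r / 2" for b
    proof -
      have "E {b - r / 2<..<b + r / 2} x = 0" for x
      proof -
        have "{b - r / 2<..<b + r / 2} \<subseteq> {a - r<..<a + r}" using b by (auto simp: dist_real_def abs_if split: if_splits)
        then have "norm (E {b - r / 2<..<b + r / 2} x) \<le> norm (E {a - r<..<a + r} x)" by (intro norm_mono) auto
        then show ?thesis using r(2) by simp
      qed
      then have "complex_of_real b \<notin> spectrum A" using r(1) by (intro resolvent_of_gap[of "r / 2"]) auto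
      then show ?thesis by (simp add: real_spectrum_def)
    qed
    then show "\<exists>e>0. \<forall>y. dist y a < e \<longrightarrow> y \<in> - real_spectrum A" using r(1) by (intro exI[of _ "r / 2"]) auto
  qed
  then show ?thesis by (simp add: closed_def)
qed

text \<open>Every point off the spectrum has a neighbourhood on which E vanishes. By Lindelof
  countably many of them suffice, and null sets are stable under countable unions.\<close>

lemma off_spectrum_zero: "E (- real_spectrum A) x = 0"
proof -
  define F where "F = {{a - r<..<a + r} | a r. r > 0 \<and> (\<forall>x. E {a - r<..<a + r} x = 0)}"
  have "\<And>S. S \<in> F \<Longrightarrow> open S" by (auto simp: F_def)
  then obtain F' where F': "F' \<subseteq> F" "countable F'" "\<Union>F' = \<Union>F" by (rule Lindelof)
  have "- real_spectrum A \<subseteq> \<Union>F"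
  proof
    fix a assume "a \<in> - real_spectrum A"
    then have "complex_of_real a \<notin> spectrum A" by (simp add: real_spectrum_def)
    then obtain r where r: "r > 0" "\<And>x. E {a - r<..<a + r} x = 0" by (rule gap_of_resolvent) blast
    then have "{a - r<..<a + r} \<in> F" unfolding F_def by blast
    moreover have "a \<in> {a - r<..<a + r}" using r(1) by simp
    ultimately show "a \<in> \<Union>F" by blast
  qed
  moreover have "\<Union>F' \<in> null_sets (\<nu> x)"
  proof -
    have "S \<in> null_sets (\<nu> x)" if "S \<in> F'" for S
      using that F'(1) by (intro null_setsI) (auto simp: F_def emeasure_nu)
    then have "(\<Union>S\<in>F'. S) \<in> null_sets (\<nu> x)" using F'(2) by (intro null_sets_UN') auto
    then show ?thesis by simp
  qed
  moreover have m: "- real_spectrum A \<in> sets borel" using real_spectrum_closed by auto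
  ultimately have "emeasure (\<nu> x) (- real_spectrum A) = 0" using F'(3)
    by (metis null_sets_subset null_setsD1 sets_nu)
  then show ?thesis using m by (simp add: emeasure_nu)
qed

lemma no_atom:
  assumes "eigenspace A (complex_of_real a) = {0}"
  shows "E {a} x = 0"
proof -
  have y: "E {a} x \<in> op_dom A" by (rule bounded_dom[where C = "\<bar>a\<bar>"]) auto
  have "norm (shift a (E {a} x)) \<le> 0 * norm (E {a} x)" by (rule shift_bound[of "{a}"]) (auto simp: idem)
  then have "E {a} x \<in> eigenspace A (complex_of_real a)" using y by (simp add: eigenspace_def)
  then show ?thesis using assms by simp
qed

text \<open>K_B uses open half-lines, distribution functions use closed ones; both agree where there
  is no atom.\<close>

lemma norm_lessThan_continuous:
  assumes "E {a} x = 0"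
  shows "isCont (cdf (\<nu> x)) a" "cdf (\<nu> x) a = (norm (E {..<a} x))\<^sup>2"
proof -
  interpret N: finite_borel_measure "\<nu> x"
    by (intro finite_borel_measure.intro finite_nu finite_borel_measure_axioms.intro sets_nu)
  show "isCont (cdf (\<nu> x)) a" using assms by (simp add: N.isCont_cdf measure_nu)
  have "{..a} = {..<a} \<union> {a}" by auto
  moreover have "(norm (E ({..<a} \<union> {a}) x))\<^sup>2 = (norm (E {..<a} x))\<^sup>2 + (norm (E {a} x))\<^sup>2"
    by (rule norm_sq_Un) auto
  ultimately have "(norm (E {..a} x))\<^sup>2 = (norm (E {..<a} x))\<^sup>2 + (norm (E {a} x))\<^sup>2" by (simp only:)
  then show "cdf (\<nu> x) a = (norm (E {..<a} x))\<^sup>2" using assms by (simp add: cdf_def measure_nu)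
qed

lemma norm_interval:
  assumes "a \<le> b"
  shows "(norm (E {..<b} x))\<^sup>2 - (norm (E {..<a} x))\<^sup>2 = (norm (E {a..<b} x))\<^sup>2"
proof -
  have "{..<b} = {..<a} \<union> {a..<b}" using assms by auto
  moreover have "(norm (E ({..<a} \<union> {a..<b}) x))\<^sup>2 = (norm (E {..<a} x))\<^sup>2 + (norm (E {a..<b} x))\<^sup>2"
    by (rule norm_sq_Un) auto
  ultimately show ?thesis by (simp only:)
qed

text \<open>On a spectral piece close to \<open>t\<close> the operator \<open>A\<close> is almost \<open>t\<close>, so that solutions of
  \<open>(A - \<lambda>) x\<^sub>\<lambda> = g\<^sub>\<lambda>\<close> satisfy \<open>\<Sum> x\<^sub>\<lambda> \<approx> - \<Sum> g\<^sub>\<lambda> / (\<lambda> - t)\<close> there.\<close>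

lemma piece_estimate:
  assumes S: "S \<in> sets borel" and St: "\<And>s. s \<in> S \<Longrightarrow> \<bar>s - t\<bar> \<le> r" and r: "r \<ge> 0" and \<rho>: "\<rho> > 0"
    and far: "\<And>l. l \<in> \<Lambda> \<Longrightarrow> \<rho> \<le> \<bar>l - t\<bar>"
    and x: "\<And>l. l \<in> \<Lambda> \<Longrightarrow> x l \<in> op_dom A" "\<And>l. l \<in> \<Lambda> \<Longrightarrow> E S (shift l (x l)) = E S (g l)"
  shows "norm (E S (\<Sum>l\<in>\<Lambda>. x l) + E S (\<Sum>l\<in>\<Lambda>. (1 / complex_of_real (l - t)) *\<^sub>C g l)) \<le> (r / \<rho>) * (\<Sum>l\<in>\<Lambda>. norm (E S (x l)))"
proof -
  have one: "norm (E S (x l) + (1 / complex_of_real (l - t)) *\<^sub>C E S (g l)) \<le> (r / \<rho>) * norm (E S (x l))" if l: "l \<in> \<Lambda>" for l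
  proof -
    have nz: "l - t \<noteq> 0" using far[OF l] \<rho> by auto
    have "norm (shift t (E S (x l))) \<le> r * norm (E S (x l))" using shift_bound[OF S St r] idem[OF S] by blast
    moreover have "E S (g l) = shift l (E S (x l))" using shift_commutes[OF S x(1)[OF l], of l] x(2)[OF l] by simp
    then have "E S (g l) = shift t (E S (x l)) - complex_of_real (l - t) *\<^sub>C E S (x l)"
      by (simp add: cvs.scale_left_diff_distrib)
    then have "E S (x l) + (1 / complex_of_real (l - t)) *\<^sub>C E S (g l) = (1 / complex_of_real (l - t)) *\<^sub>C shift t (E S (x l))"
      using nz by (simp add: cvs.scale_right_diff_distrib scaleC_scaleC flip: of_real_diff)
    then have "norm (E S (x l) + (1 / complex_of_real (l - t)) *\<^sub>C E S (g l)) = norm (shift t (E S (x l))) / \<bar>l - t\<bar>"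
      by (simp add: norm_scaleC norm_divide flip: of_real_diff)
    ultimately have "norm (E S (x l) + (1 / complex_of_real (l - t)) *\<^sub>C E S (g l)) \<le> (r * norm (E S (x l))) / \<rho>"
      using far[OF l] \<rho> r by (simp only:) (intro frac_le mult_nonneg_nonneg norm_ge_zero, auto)
    then show ?thesis by simp
  qed
  have "E S (\<Sum>l\<in>\<Lambda>. x l) + E S (\<Sum>l\<in>\<Lambda>. (1 / complex_of_real (l - t)) *\<^sub>C g l) = (\<Sum>l\<in>\<Lambda>. E S (x l) + (1 / complex_of_real (l - t)) *\<^sub>C E S (g l))"
    by (simp add: blinfun.sum_right sum.distrib scaleC[OF S])
  also have "norm \<dots> \<le> (\<Sum>l\<in>\<Lambda>. (r / \<rho>) * norm (E S (x l)))" by (rule sum_norm_le[OF one])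
  finally show ?thesis by (simp add: sum_distrib_left)
qed


text \<open>Between \<tau> and \<sigma> the masses of y and f differ by at most \<bar>\<sigma> -
  \<tau>\<bar> times a multiple of the square root of the increment of K plus a term of order
  \<bar>\<sigma> - \<tau>\<bar>. As K is continuous at \<tau>, this is o(\<bar>\<sigma> -
  \<tau>\<bar>). The equation for x is asked for only near \<tau>, so that truncated solutions are
  covered.\<close>

lemma norm_lessThan_derivative:
  assumes \<Lambda>: "finite \<Lambda>" "\<tau> \<notin> \<Lambda>" and \<tau>: "\<alpha> < \<tau>" "\<tau> < \<beta>"
    and x: "\<And>l. l \<in> \<Lambda> \<Longrightarrow> x l \<in> op_dom A" "\<And>l. l \<in> \<Lambda> \<Longrightarrow> E {\<alpha><..<\<beta>} (shift l (x l)) = E {\<alpha><..<\<beta>} (g l)"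
    and k: "((\<lambda>\<sigma>. (norm (E {..<\<sigma>} (\<Sum>l\<in>\<Lambda>. (1 / complex_of_real (l - \<tau>)) *\<^sub>C g l)))\<^sup>2) has_real_derivative L) (at \<tau>)"
  shows "((\<lambda>\<sigma>. (norm (E {..<\<sigma>} (\<Sum>l\<in>\<Lambda>. x l)))\<^sup>2) has_real_derivative L) (at \<tau>)"
proof -
  define f y where "f = (\<Sum>l\<in>\<Lambda>. (1 / complex_of_real (l - \<tau>)) *\<^sub>C g l)" and "y = (\<Sum>l\<in>\<Lambda>. x l)"
  define K G where "K \<sigma> = (norm (E {..<\<sigma>} f))\<^sup>2" and "G \<sigma> = (norm (E {..<\<sigma>} y))\<^sup>2" for \<sigma>
  obtain \<rho> where \<rho>: "\<rho> > 0" "\<And>l. l \<in> \<Lambda> \<Longrightarrow> \<rho> \<le> \<bar>l - \<tau>\<bar>"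
    using finite_set_avoid[OF \<Lambda>(1), of \<tau>] \<Lambda>(2) by (metis dist_commute dist_real_def)
  define C where "C = (\<Sum>l\<in>\<Lambda>. norm (x l)) / \<rho>"
  have C0: "C \<ge> 0" using \<rho>(1) by (simp add: C_def sum_nonneg)
  have key: "\<bar>(norm (E S y))\<^sup>2 - (norm (E S f))\<^sup>2\<bar> \<le> r * C * (2 * norm (E S f) + r * C)"
    if S: "S \<in> sets borel" "S \<subseteq> {\<alpha><..<\<beta>}" "\<And>s. s \<in> S \<Longrightarrow> \<bar>s - \<tau>\<bar> \<le> r" and r: "r \<ge> 0" for S r
  proof -
    have restr: "E S (E {\<alpha><..<\<beta>} z) = E S z" for z using Int[OF S(1), of "{\<alpha><..<\<beta>}" z] S(2) by (simp add: inf_absorb1)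
    have "E S (shift l (x l)) = E S (g l)" if "l \<in> \<Lambda>" for l
      using restr[of "shift l (x l)"] restr[of "g l"] x(2)[OF that] by simp
    then have "norm (E S y + E S f) \<le> (r / \<rho>) * (\<Sum>l\<in>\<Lambda>. norm (E S (x l)))"
      unfolding y_def f_def using x(1) \<rho> by (intro piece_estimate[OF S(1,3) r]) auto
    also have "\<dots> \<le> (r / \<rho>) * (\<Sum>l\<in>\<Lambda>. norm (x l))"
      using r \<rho>(1) norm_le[OF S(1)] by (intro mult_left_mono sum_mono) auto
    finally have e: "norm (E S y + E S f) \<le> r * C" by (simp add: C_def)
    have 1: "\<bar>norm (E S y) - norm (E S f)\<bar> \<le> r * C"
      using norm_triangle_ineq3[of "E S y" "- E S f"] e by simp
    then have 2: "norm (E S y) + norm (E S f) \<le> 2 * norm (E S f) + r * C" by linarith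
    have "\<bar>(norm (E S y))\<^sup>2 - (norm (E S f))\<^sup>2\<bar> = \<bar>norm (E S y) - norm (E S f)\<bar> * (norm (E S y) + norm (E S f))"
    proof -
      have "(norm (E S y))\<^sup>2 - (norm (E S f))\<^sup>2 = (norm (E S y) - norm (E S f)) * (norm (E S y) + norm (E S f))"
        by (simp add: power2_eq_square algebra_simps)
      then show ?thesis by (simp add: abs_mult)
    qed
    also have "\<dots> \<le> (r * C) * (2 * norm (E S f) + r * C)" using 1 2 C0 r by (intro mult_mono) auto
    finally show ?thesis .
  qed
  have bound: "\<bar>(G \<sigma> - G \<tau>) - (K \<sigma> - K \<tau>)\<bar> \<le> \<bar>\<sigma> - \<tau>\<bar> * C * (2 * sqrt \<bar>K \<sigma> - K \<tau>\<bar> + \<bar>\<sigma> - \<tau>\<bar> * C)"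
    if \<sigma>: "\<alpha> < \<sigma>" "\<sigma> < \<beta>" for \<sigma>
  proof (cases "\<tau> \<le> \<sigma>")
    case True
    have "G \<sigma> - G \<tau> = (norm (E {\<tau>..<\<sigma>} y))\<^sup>2" "K \<sigma> - K \<tau> = (norm (E {\<tau>..<\<sigma>} f))\<^sup>2"
      unfolding G_def K_def using norm_interval[OF True] by auto
    moreover have "\<bar>(norm (E {\<tau>..<\<sigma>} y))\<^sup>2 - (norm (E {\<tau>..<\<sigma>} f))\<^sup>2\<bar> \<le> (\<sigma> - \<tau>) * C * (2 * norm (E {\<tau>..<\<sigma>} f) + (\<sigma> - \<tau>) * C)"
      using \<sigma> \<tau> True by (intro key) auto
    ultimately show ?thesis using True by simp
  next
    case False
    then have le: "\<sigma> \<le> \<tau>" by simp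
    have "G \<tau> - G \<sigma> = (norm (E {\<sigma>..<\<tau>} y))\<^sup>2" "K \<tau> - K \<sigma> = (norm (E {\<sigma>..<\<tau>} f))\<^sup>2"
      unfolding G_def K_def using norm_interval[OF le] by auto
    moreover have "\<bar>(norm (E {\<sigma>..<\<tau>} y))\<^sup>2 - (norm (E {\<sigma>..<\<tau>} f))\<^sup>2\<bar> \<le> (\<tau> - \<sigma>) * C * (2 * norm (E {\<sigma>..<\<tau>} f) + (\<tau> - \<sigma>) * C)"
      using \<sigma> \<tau> le by (intro key) auto
    moreover have "\<bar>K \<sigma> - K \<tau>\<bar> = K \<tau> - K \<sigma>" "\<bar>(G \<sigma> - G \<tau>) - (K \<sigma> - K \<tau>)\<bar> = \<bar>(G \<tau> - G \<sigma>) - (K \<tau> - K \<sigma>)\<bar>"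
    proof -
      have "0 \<le> K \<tau> - K \<sigma>" using calculation(2) by simp
      then show "\<bar>K \<sigma> - K \<tau>\<bar> = K \<tau> - K \<sigma>" "\<bar>(G \<sigma> - G \<tau>) - (K \<sigma> - K \<tau>)\<bar> = \<bar>(G \<tau> - G \<sigma>) - (K \<tau> - K \<sigma>)\<bar>"
        by linarith+
    qed
    ultimately show ?thesis using le by simp
  qed
  have Kd: "(K has_real_derivative L) (at \<tau>)" using k unfolding K_def[abs_def] f_def .
  have Klim: "((\<lambda>\<sigma>. sqrt \<bar>K \<sigma> - K \<tau>\<bar>) \<longlongrightarrow> 0) (at \<tau>)"
  proof -
    have "K \<midarrow>\<tau>\<rightarrow> K \<tau>" using DERIV_isCont[OF Kd] by (simp add: isCont_def)
    then have "((\<lambda>\<sigma>. sqrt \<bar>K \<sigma> - K \<tau>\<bar>) \<longlongrightarrow> sqrt \<bar>K \<tau> - K \<tau>\<bar>) (at \<tau>)" by (intro tendsto_intros)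
    then show ?thesis by simp
  qed
  have "((\<lambda>\<sigma>. (G \<sigma> - G \<tau>) / (\<sigma> - \<tau>) - (K \<sigma> - K \<tau>) / (\<sigma> - \<tau>)) \<longlongrightarrow> 0) (at \<tau>)"
  proof (rule Lim_null_comparison)
    have "((\<lambda>\<sigma>. C * (2 * sqrt \<bar>K \<sigma> - K \<tau>\<bar> + \<bar>\<sigma> - \<tau>\<bar> * C)) \<longlongrightarrow> C * (2 * 0 + \<bar>\<tau> - \<tau>\<bar> * C)) (at \<tau>)"
      using Klim by (intro tendsto_intros)
    then show "((\<lambda>\<sigma>. C * (2 * sqrt \<bar>K \<sigma> - K \<tau>\<bar> + \<bar>\<sigma> - \<tau>\<bar> * C)) \<longlongrightarrow> 0) (at \<tau>)" by simp
    have "\<forall>\<^sub>F \<sigma> in at \<tau>. \<alpha> < \<sigma>" "\<forall>\<^sub>F \<sigma> in at \<tau>. \<sigma> < \<beta>"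
      using \<tau> by (auto intro: order_tendstoD[OF tendsto_ident_at])
    moreover have "\<forall>\<^sub>F \<sigma> in at \<tau>. \<sigma> \<noteq> \<tau>" by (simp add: eventually_at_filter)
    ultimately show "\<forall>\<^sub>F \<sigma> in at \<tau>. norm ((G \<sigma> - G \<tau>) / (\<sigma> - \<tau>) - (K \<sigma> - K \<tau>) / (\<sigma> - \<tau>)) \<le> C * (2 * sqrt \<bar>K \<sigma> - K \<tau>\<bar> + \<bar>\<sigma> - \<tau>\<bar> * C)"
    proof eventually_elim
      case (elim \<sigma>)
      have "norm ((G \<sigma> - G \<tau>) / (\<sigma> - \<tau>) - (K \<sigma> - K \<tau>) / (\<sigma> - \<tau>)) = \<bar>(G \<sigma> - G \<tau>) - (K \<sigma> - K \<tau>)\<bar> / \<bar>\<sigma> - \<tau>\<bar>"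
        by (simp add: diff_divide_distrib[symmetric])
      also have "\<dots> \<le> (\<bar>\<sigma> - \<tau>\<bar> * C * (2 * sqrt \<bar>K \<sigma> - K \<tau>\<bar> + \<bar>\<sigma> - \<tau>\<bar> * C)) / \<bar>\<sigma> - \<tau>\<bar>"
        using bound[OF elim(1,2)] by (intro divide_right_mono) auto
      also have "\<dots> = C * (2 * sqrt \<bar>K \<sigma> - K \<tau>\<bar> + \<bar>\<sigma> - \<tau>\<bar> * C)" using elim(3) by (simp add: mult.assoc)
      finally show ?case .
    qed
  qed
  moreover have "((\<lambda>\<sigma>. (K \<sigma> - K \<tau>) / (\<sigma> - \<tau>)) \<longlongrightarrow> L) (at \<tau>)" using Kd by (simp add: has_field_derivative_iff)
  ultimately have "((\<lambda>\<sigma>. ((G \<sigma> - G \<tau>) / (\<sigma> - \<tau>) - (K \<sigma> - K \<tau>) / (\<sigma> - \<tau>)) + (K \<sigma> - K \<tau>) / (\<sigma> - \<tau>)) \<longlongrightarrow> 0 + L) (at \<tau>)"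
    by (rule tendsto_add)
  then have "(G has_real_derivative L) (at \<tau>)" by (simp add: has_field_derivative_iff)
  then show ?thesis unfolding G_def[abs_def] y_def .
qed

text \<open>On a piece d n of mesh \<delta> the sum y is close to - B v, where v is the resolvent
  vector at a point of the piece. The squared norm of E (d n) (B v) is the form of B' E (d n) B at
  v, hence at most \<kappa> squared times its norm. The factor 2 is that of (a + b)^2 <= 2 a^2 + 2
  b^2.\<close>

lemma norm_bound_by_variation:
  fixes B :: "'b::chilbert_space \<Rightarrow>\<^sub>L 'a"
  assumes S: "S \<in> sets borel" and \<Lambda>: "finite \<Lambda>" and \<rho>: "\<rho> > 0" "\<And>t l. t \<in> S \<Longrightarrow> l \<in> \<Lambda> \<Longrightarrow> \<rho> \<le> \<bar>l - t\<bar>"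
    and B: "clinear_op B" "is_adjoint B B'"
    and x: "\<And>l. l \<in> \<Lambda> \<Longrightarrow> x l \<in> op_dom A" "\<And>l. l \<in> \<Lambda> \<Longrightarrow> shift l (x l) = B (\<phi> l)"
    and \<kappa>: "\<And>t. t \<in> S \<Longrightarrow> norm (\<Sum>l\<in>\<Lambda>. (1 / complex_of_real (l - t)) *\<^sub>C \<phi> l) \<le> \<kappa>"
    and V0: "V \<ge> 0" and V: "\<And>d :: nat \<Rightarrow> real set. range d \<subseteq> sets borel \<Longrightarrow> disjoint_family d \<Longrightarrow> (\<Union>n. d n) = S \<Longrightarrow>
      (\<Sum>n. ennreal (norm (B' o\<^sub>L E (d n) o\<^sub>L B))) \<le> ennreal V"
  shows "(norm (E S (\<Sum>l\<in>\<Lambda>. x l)))\<^sup>2 \<le> 2 * \<kappa>\<^sup>2 * V"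
proof -
  define y where "y = (\<Sum>l\<in>\<Lambda>. x l)"
  \<comment> \<open>The coefficient of the discretisation error. It may depend on \<Lambda> and x
    because it is multiplied by the square of \<delta>, which tends to 0.\<close>
  define Q where "Q = 2 * (1 / \<rho>)\<^sup>2 * real (card \<Lambda>) * (\<Sum>l\<in>\<Lambda>. (norm (E S (x l)))\<^sup>2)"
  have Q0: "Q \<ge> 0" by (simp add: Q_def sum_nonneg)
  have main: "(norm (E S y))\<^sup>2 \<le> 2 * \<kappa>\<^sup>2 * V + \<delta>\<^sup>2 * Q" if \<delta>: "\<delta> > 0" for \<delta>
  proof -
    define d where "d n = S \<inter> grid_cell \<delta> n" for n
    have dm: "d n \<in> sets borel" for n using S grid_cell(1)[OF \<delta>] by (auto simp: d_def)
    have dU: "(\<Union>n. d n) = S" using grid_cell(3)[OF \<delta>] unfolding d_def by blast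
    have dd: "disjoint_family d" using grid_cell(2)[OF \<delta>] by (auto simp: disjoint_family_on_def d_def)
    define a where "a n = norm (B' o\<^sub>L E (d n) o\<^sub>L B)" for n
    have aV: "(\<Sum>n. ennreal (a n)) \<le> ennreal V" unfolding a_def using dm dd dU by (intro V) auto
    then have sa': "summable a"
      by (intro summable_suminf_not_top) (auto simp: a_def top_unique)
    have "ennreal (suminf a) = (\<Sum>n. ennreal (a n))" by (rule suminf_ennreal2[symmetric, OF _ sa']) (simp add: a_def)
    then have sumV: "suminf a \<le> V" using aV V0 by (metis ennreal_le_iff)
    have piece: "(norm (E (d n) y))\<^sup>2 \<le> 2 * \<kappa>\<^sup>2 * a n + 2 * (\<delta> / \<rho>)\<^sup>2 * real (card \<Lambda>) * (\<Sum>l\<in>\<Lambda>. (norm (E (d n) (x l)))\<^sup>2)" for n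
    proof (cases "d n = {}")
      case True
      then show ?thesis by (simp add: empty a_def sum_nonneg)
    next
      case False
      then obtain t where t: "t \<in> d n" by blast
      define v where "v = (\<Sum>l\<in>\<Lambda>. (1 / complex_of_real (l - t)) *\<^sub>C \<phi> l)"
      have tS: "t \<in> S" using t by (simp add: d_def)
      have Bv: "B v = (\<Sum>l\<in>\<Lambda>. (1 / complex_of_real (l - t)) *\<^sub>C B (\<phi> l))"
        unfolding v_def by (rule clinear_op_sum[OF B(1)])
      have "norm (E (d n) y + E (d n) (B v)) \<le> (\<delta> / \<rho>) * (\<Sum>l\<in>\<Lambda>. norm (E (d n) (x l)))"
        unfolding y_def Bv
      proof (rule piece_estimate[OF dm])
        show "\<bar>s - t\<bar> \<le> \<delta>" if "s \<in> d n" for s using grid_cell(4)[OF \<delta>, of s n t] that t by (auto simp: d_def)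
      qed (use \<delta> \<rho> tS x in auto)
      then have e: "norm (E (d n) y + E (d n) (B v)) \<le> (\<delta> / \<rho>) * (\<Sum>l\<in>\<Lambda>. norm (E (d n) (x l)))" .
      have "(norm (E (d n) (B v)))\<^sup>2 \<le> \<kappa>\<^sup>2 * a n"
      proof -
        have "complex_of_real ((norm (E (d n) (B v)))\<^sup>2) = cinner (E (d n) (B v)) (B v)" by (rule norm_sq[symmetric, OF dm])
        also have "\<dots> = cinner (B v) (E (d n) (B v))" by (rule sym[OF dm])
        also have "\<dots> = cinner v ((B' o\<^sub>L E (d n) o\<^sub>L B) v)" using B(2) by (simp add: is_adjoint_def)
        finally have "(norm (E (d n) (B v)))\<^sup>2 = cmod (cinner v ((B' o\<^sub>L E (d n) o\<^sub>L B) v))"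
          by (metis abs_power2 norm_of_real)
        also have "\<dots> \<le> norm v * norm ((B' o\<^sub>L E (d n) o\<^sub>L B) v)" by (rule cmod_cinner_le)
        also have "\<dots> \<le> norm v * (a n * norm v)" unfolding a_def by (intro mult_left_mono norm_blinfun) auto
        also have "\<dots> = (norm v)\<^sup>2 * a n" by (simp add: power2_eq_square)
        also have "\<dots> \<le> \<kappa>\<^sup>2 * a n" using \<kappa>[OF tS] by (intro mult_right_mono power_mono) (auto simp: v_def a_def)
        finally show ?thesis .
      qed
      moreover have "(norm (E (d n) y + E (d n) (B v)))\<^sup>2 \<le> (\<delta> / \<rho>)\<^sup>2 * ((\<Sum>l\<in>\<Lambda>. (norm (E (d n) (x l)))\<^sup>2) * real (card \<Lambda>))"
      proof -
        have "(norm (E (d n) y + E (d n) (B v)))\<^sup>2 \<le> ((\<delta> / \<rho>) * (\<Sum>l\<in>\<Lambda>. norm (E (d n) (x l))))\<^sup>2"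
          using e by (intro power_mono) auto
        also have "\<dots> = (\<delta> / \<rho>)\<^sup>2 * (\<Sum>l\<in>\<Lambda>. norm (E (d n) (x l)))\<^sup>2" by (rule power_mult_distrib)
        also have "\<dots> \<le> (\<delta> / \<rho>)\<^sup>2 * ((\<Sum>l\<in>\<Lambda>. (norm (E (d n) (x l)))\<^sup>2) * real (card \<Lambda>))"
          using \<Lambda> sum_squared_le_sum_of_squares[of "\<lambda>l. norm (E (d n) (x l))" \<Lambda>] by (intro mult_left_mono) auto
        finally show ?thesis .
      qed
      moreover have "(norm (E (d n) y))\<^sup>2 \<le> 2 * (norm (E (d n) (B v)))\<^sup>2 + 2 * (norm (E (d n) y + E (d n) (B v)))\<^sup>2"
      proof -
        have "norm (E (d n) y) \<le> norm (E (d n) (B v)) + norm (E (d n) y + E (d n) (B v))"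
          using norm_triangle_ineq4[of "E (d n) y + E (d n) (B v)" "E (d n) (B v)"] by simp
        then have "(norm (E (d n) y))\<^sup>2 \<le> (norm (E (d n) (B v)) + norm (E (d n) y + E (d n) (B v)))\<^sup>2" by (intro power_mono) auto
        also have "\<dots> \<le> 2 * (norm (E (d n) (B v)))\<^sup>2 + 2 * (norm (E (d n) y + E (d n) (B v)))\<^sup>2"
          using zero_le_power2[of "norm (E (d n) (B v)) - norm (E (d n) y + E (d n) (B v))"]
          unfolding power2_sum power2_diff by linarith
        finally show ?thesis .
      qed
      ultimately show ?thesis by (simp add: mult_ac)
    qed
    have "(\<lambda>n. (norm (E (d n) y))\<^sup>2) sums (norm (E S y))\<^sup>2" unfolding d_def by (rule norm_grid[OF S \<delta>])
    moreover have "(\<lambda>n. 2 * \<kappa>\<^sup>2 * a n + 2 * (\<delta> / \<rho>)\<^sup>2 * real (card \<Lambda>) * (\<Sum>l\<in>\<Lambda>. (norm (E (d n) (x l)))\<^sup>2)) sums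
        (2 * \<kappa>\<^sup>2 * suminf a + 2 * (\<delta> / \<rho>)\<^sup>2 * real (card \<Lambda>) * (\<Sum>l\<in>\<Lambda>. (norm (E S (x l)))\<^sup>2))"
      unfolding d_def using sa' by (intro sums_add sums_mult sums_sum norm_grid[OF S \<delta>] summable_sums)
    ultimately have "(norm (E S y))\<^sup>2 \<le> 2 * \<kappa>\<^sup>2 * suminf a + 2 * (\<delta> / \<rho>)\<^sup>2 * real (card \<Lambda>) * (\<Sum>l\<in>\<Lambda>. (norm (E S (x l)))\<^sup>2)"
      by (rule sums_le[OF piece])
    also have "2 * \<kappa>\<^sup>2 * suminf a \<le> 2 * \<kappa>\<^sup>2 * V" using sumV by (intro mult_left_mono) auto
    also have "2 * (\<delta> / \<rho>)\<^sup>2 * real (card \<Lambda>) * (\<Sum>l\<in>\<Lambda>. (norm (E S (x l)))\<^sup>2) = \<delta>\<^sup>2 * Q" by (simp add: Q_def power_divide)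
    finally show ?thesis by simp
  qed
  have "(norm (E S y))\<^sup>2 \<le> 2 * \<kappa>\<^sup>2 * V"
  proof (rule field_le_epsilon)
    fix e :: real assume e: "e > 0"
    define \<delta> where "\<delta> = sqrt (e / (Q + 1))"
    have \<delta>: "\<delta> > 0" "\<delta>\<^sup>2 = e / (Q + 1)" using e Q0 by (auto simp: \<delta>_def)
    have "\<delta>\<^sup>2 * Q \<le> e" unfolding \<delta>(2) using e Q0 by (simp add: field_simps)
    then show "(norm (E S y))\<^sup>2 \<le> 2 * \<kappa>\<^sup>2 * V + e" using main[OF \<delta>(1)] by linarith
  qed
  then show ?thesis by (simp add: y_def)
qed

end

section \<open>Real parametrisation, removable singularities and the ends of a homotopy\<close>

lemma prim_along_add:
  assumes P: "prim_along F c P S" and V: "open V" "c ` S \<subseteq> V"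
    and \<Psi>: "\<And>w. w \<in> V \<Longrightarrow> (\<Psi> has_field_derivative G w) (at w)" and H: "\<And>w. w \<in> V \<Longrightarrow> H w = F w + G w"
  shows "prim_along H c (\<lambda>x. P x + \<Psi> (c x)) S"
  unfolding prim_along_def
proof (intro conjI ballI)
  show "continuous_on S c" using P by (simp add: prim_along_def)
  fix x assume x: "x \<in> S"
  obtain r \<Phi> d where *: "r > 0" "\<And>w. w \<in> ball (c x) r \<Longrightarrow> (\<Phi> has_field_derivative F w) (at w)"
      "d > 0" "\<And>y. y \<in> S \<Longrightarrow> dist y x < d \<Longrightarrow> P y = \<Phi> (c y)"
    using P x unfolding prim_along_def by blast
  obtain r' where r': "r' > 0" "ball (c x) r' \<subseteq> V" using V x open_contains_ball by (metis image_subset_iff)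
  have "((\<lambda>w. \<Phi> w + \<Psi> w) has_field_derivative H w) (at w)" if "w \<in> ball (c x) (min r r')" for w
  proof -
    have w: "w \<in> ball (c x) r" "w \<in> V" using that r' by auto
    show ?thesis using DERIV_add[OF *(2)[OF w(1)] \<Psi>[OF w(2)]] H[OF w(2)] by simp
  qed
  then show "\<exists>r>0. \<exists>\<Phi>. (\<forall>w\<in>ball (c x) r. (\<Phi> has_field_derivative H w) (at w)) \<and>
        (\<exists>d>0. \<forall>y\<in>S. dist y x < d \<longrightarrow> P y + \<Psi> (c y) = \<Phi> (c y))"
    using * r' by (intro exI[of _ "min r r'"] conjI exI[of _ "\<lambda>w. \<Phi> w + \<Psi> w"] exI[of _ d]) auto
qed

text \<open>Read as a function of the point p t, the primitive becomes an ordinary antiderivative on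
  an interval, which can be compared with spectral masses by real calculus.\<close>

lemma prim_along_real_parametrization:
  fixes p :: "real \<Rightarrow> real"
  assumes P: "prim_along F (\<lambda>t. complex_of_real (p t)) P {0<..<1}" and p: "strict_mono_on {0<..<1} p"
  obtains \<beta> where "\<And>t. t \<in> {0<..<1} \<Longrightarrow> \<beta> (p t) = P t"
    "\<And>t. t \<in> {0<..<1} \<Longrightarrow> p ` {0<..<1} = I \<Longrightarrow> open I \<Longrightarrow> (\<beta> has_vector_derivative F (complex_of_real (p t))) (at (p t))"
proof -
  define \<beta> where "\<beta> x = P (the_inv_into {0<..<1} p x)" for x
  have inj: "inj_on p {0<..<1}" using p by (rule strict_mono_on_imp_inj_on)
  have \<beta>: "\<beta> (p t) = P t" if "t \<in> {0<..<1}" for t using the_inv_into_f_f[OF inj that] by (simp add: \<beta>_def)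
  have "(\<beta> has_vector_derivative F (complex_of_real (p t))) (at (p t))"
    if t: "t \<in> {0<..<1}" and I: "p ` {0<..<1} = I" "open I" for t
  proof -
    obtain r \<Phi> d where *: "r > 0" "\<And>w. w \<in> ball (complex_of_real (p t)) r \<Longrightarrow> (\<Phi> has_field_derivative F w) (at w)"
      "d > 0" "\<And>y. y \<in> {0<..<1} \<Longrightarrow> dist y t < d \<Longrightarrow> P y = \<Phi> (complex_of_real (p y))"
      using P t unfolding prim_along_def by blast
    define d' where "d' = min d (min t (1 - t)) / 2"
    have "d' > 0" "d' \<le> t / 2" "d' \<le> (1 - t) / 2" "d' \<le> d / 2" using *(3) t by (auto simp: d'_def)
    then have d': "d' > 0" "t - d' \<in> {0<..<1}" "t + d' \<in> {0<..<1}" "d' < d" using *(3) t by auto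
    have lt: "p (t - d') < p t" "p t < p (t + d')" using p t d' by (auto simp: strict_mono_on_def)
    define J where "J = {p (t - d')<..<p (t + d')} \<inter> I"
    have J: "open J" "p t \<in> J" using I lt t by (auto simp: J_def)
    have eq: "\<beta> x = \<Phi> (complex_of_real x)" if "x \<in> J" for x
    proof -
      have "x \<in> p ` {0<..<1}" using that I(1) by (simp add: J_def)
      then obtain y where y: "y \<in> {0<..<1}" "x = p y" by (rule imageE) simp
      have "t - d' < y" "y < t + d'"
        using y that d' strict_mono_on_leD[OF p, of y "t - d'"] strict_mono_on_leD[OF p, of "t + d'" y]
        by (auto simp: J_def not_le[symmetric])
      then show ?thesis using \<beta> *(4)[OF y(1)] y d'(4) by (auto simp: dist_real_def)
    qed
    have "(\<Phi> has_field_derivative F (complex_of_real (p t))) (at (complex_of_real (p t)))" using *(1,2) by simp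
    then have "((\<lambda>x. \<Phi> (complex_of_real x)) has_vector_derivative F (complex_of_real (p t))) (at (p t))"
      by (rule has_vector_derivative_real_field)
    then show ?thesis by (rule has_vector_derivative_transform_within_open[OF _ J]) (simp add: eq)
  qed
  then show thesis using that \<beta> by blast
qed

lemma has_RS_integral_bounded_linear:
  assumes I: "has_RS_integral f I a b" and L: "bounded_linear L"
    and eq: "\<And>t u v. t \<in> {a..b} \<Longrightarrow> u \<in> {a..b} \<Longrightarrow> v \<in> {a..b} \<Longrightarrow> g t u v = L (f t u v)"
  shows "has_RS_integral g (L I) a b"
  unfolding has_RS_integral_def
proof (intro allI impI)
  fix e :: real assume e: "e > 0"
  obtain K where K: "K > 0" "\<And>x. norm (L x) \<le> norm x * K" using bounded_linear.pos_bounded[OF L] by blast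
  have "e / K > 0" using e K by simp
  then obtain r where r: "r > 0" "\<And>p. p tagged_division_of {a..b} \<Longrightarrow> (\<lambda>t. ball t r) fine p \<Longrightarrow>
       norm ((\<Sum>(t, K)\<in>p. f t (Inf K) (Sup K)) - I) < e / K"
    using I unfolding has_RS_integral_def by blast
  show "\<exists>r>0. \<forall>p. p tagged_division_of {a..b} \<longrightarrow> (\<lambda>t. ball t r) fine p \<longrightarrow>
       norm ((\<Sum>(t, K)\<in>p. g t (Inf K) (Sup K)) - L I) < e"
  proof (intro exI[of _ r] conjI allI impI r(1))
    fix p assume p: "p tagged_division_of {a..b}" "(\<lambda>t. ball t r) fine p"
    have "(\<Sum>(t, K)\<in>p. g t (Inf K) (Sup K)) = (\<Sum>(t, K)\<in>p. L (f t (Inf K) (Sup K)))"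
    proof (rule sum.cong[OF refl], clarify)
      fix t K assume "(t, K) \<in> p"
      then obtain u v where "K = {u..v}" "a \<le> u" "u \<le> t" "t \<le> v" "v \<le> b" "Inf K = u" "Sup K = v"
        using tagged_division_interval[OF p(1)] by blast
      then show "g t (Inf K) (Sup K) = L (f t (Inf K) (Sup K))" by (intro eq) auto
    qed
    also have "\<dots> = L (\<Sum>(t, K)\<in>p. f t (Inf K) (Sup K))"
      unfolding case_prod_unfold by (rule linear_sum[symmetric, OF bounded_linear.linear[OF L]])
    finally have "norm ((\<Sum>(t, K)\<in>p. g t (Inf K) (Sup K)) - L I) = norm (L ((\<Sum>(t, K)\<in>p. f t (Inf K) (Sup K)) - I))"
      by (simp add: linear_diff[OF bounded_linear.linear[OF L]])
    also have "\<dots> \<le> norm ((\<Sum>(t, K)\<in>p. f t (Inf K) (Sup K)) - I) * K" by (rule K(2))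
    also have "\<dots> < e" using r(2)[OF p] K(1) by (simp add: pos_less_divide_eq)
    finally show "norm ((\<Sum>(t, K)\<in>p. g t (Inf K) (Sup K)) - L I) < e" .
  qed
qed

lemma holomorphic_divide_zero:
  assumes q: "q holomorphic_on U" and U: "open U" and z: "a \<in> U \<Longrightarrow> q a = 0"
  obtains g where "g holomorphic_on U" "\<And>w. w \<in> U \<Longrightarrow> w \<noteq> a \<Longrightarrow> g w = q w / (w - a)" "a \<in> U \<Longrightarrow> g a = deriv q a"
proof (cases "a \<in> U")
  case True
  show thesis
    by (rule that[OF pole_lemma_open[OF q U, of a]]) (use z[OF True] in auto)
next
  case False
  have "(\<lambda>w. q w / (w - a)) holomorphic_on U" using q False by (intro holomorphic_intros) auto
  then show thesis using False by (intro that[of "\<lambda>w. q w / (w - a)"]) auto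
qed

text \<open>Two successive divisions. If a = b, the first quotient takes the value deriv q a at a,
  so the vanishing derivative allows the second one.\<close>

lemma holomorphic_divide_two_zeros:
  assumes q: "q holomorphic_on U" and U: "open U" and z: "a \<in> U \<Longrightarrow> q a = 0" "b \<in> U \<Longrightarrow> q b = 0"
    and d: "a = b \<Longrightarrow> a \<in> U \<Longrightarrow> deriv q a = 0"
  obtains g where "g holomorphic_on U" "\<And>w. w \<in> U \<Longrightarrow> w \<noteq> a \<Longrightarrow> w \<noteq> b \<Longrightarrow> g w = q w / ((a - w) * (b - w))"
proof -
  obtain g1 where g1: "g1 holomorphic_on U" "\<And>w. w \<in> U \<Longrightarrow> w \<noteq> a \<Longrightarrow> g1 w = q w / (w - a)" "a \<in> U \<Longrightarrow> g1 a = deriv q a"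
    using holomorphic_divide_zero[OF q U z(1)] by blast
  have g1b: "b \<in> U \<Longrightarrow> g1 b = 0" using g1(2)[of b] g1(3) z(2) d by (cases "a = b") auto
  obtain g where g: "g holomorphic_on U" "\<And>w. w \<in> U \<Longrightarrow> w \<noteq> b \<Longrightarrow> g w = g1 w / (w - b)"
    by (rule holomorphic_divide_zero[OF g1(1) U g1b]) (assumption, rule that, assumption, blast)
  have "g w = q w / ((a - w) * (b - w))" if "w \<in> U" "w \<noteq> a" "w \<noteq> b" for w
  proof -
    have "(a - w) * (b - w) = (w - a) * (w - b)" by (simp add: algebra_simps)
    then show ?thesis using g(2)[OF that(1,3)] g1(2)[OF that(1,2)] by simp
  qed
  then show thesis using that g(1) by blast
qed

text \<open>The reflection of t at 1 / 2 carries the right end of an arc to the left one, so that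
  only the left end needs a detailed argument.\<close>

lemma eventually_at_left_one_iff: "eventually P (at_left (1::real)) \<longleftrightarrow> eventually (\<lambda>t. P (1 - t)) (at_right 0)"
proof -
  have "eventually P (at_left (1::real)) \<longleftrightarrow> (\<exists>b<1. \<forall>y>b. y < 1 \<longrightarrow> P y)" by (rule eventually_at_left_field)
  also have "\<dots> \<longleftrightarrow> (\<exists>b>0. \<forall>y>0. y < b \<longrightarrow> P (1 - y))"
  proof safe
    fix b :: real assume "b < 1" "\<forall>y>b. y < 1 \<longrightarrow> P y"
    then show "\<exists>b>0. \<forall>y>0. y < b \<longrightarrow> P (1 - y)" by (intro exI[of _ "1 - b"]) auto
  next
    fix b :: real assume b: "b > 0" "\<forall>y>0. y < b \<longrightarrow> P (1 - y)"
    show "\<exists>b<1. \<forall>y>b. y < 1 \<longrightarrow> P y"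
    proof (intro exI[of _ "1 - b"] conjI allI impI)
      fix y :: real assume "1 - b < y" "y < 1"
      then show "P y" using b(2)[rule_format, of "1 - y"] by simp
    qed (use b in simp)
  qed
  also have "\<dots> \<longleftrightarrow> eventually (\<lambda>t. P (1 - t)) (at_right 0)" by (rule eventually_at_right_field[symmetric])
  finally show ?thesis .
qed

lemma frequently_at_left_one_iff: "frequently P (at_left (1::real)) \<longleftrightarrow> frequently (\<lambda>t. P (1 - t)) (at_right 0)"
  by (simp add: frequently_def eventually_at_left_one_iff)

lemma filterlim_end_filter_right:
  assumes "filterlim h (end_filter a) (principal {0..1} \<times>\<^sub>F at_right (0::real))"
  shows "\<bar>a\<bar> \<noteq> \<infinity> \<Longrightarrow> \<epsilon> > 0 \<Longrightarrow> \<exists>\<tau>>0. \<forall>s\<in>{0..1::real}. \<forall>t\<in>{0<..<\<tau>}. cmod (h (s, t) - complex_of_real (real_of_ereal a)) < \<epsilon>"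
    and "\<bar>a\<bar> = \<infinity> \<Longrightarrow> \<exists>\<tau>>0. \<forall>s\<in>{0..1::real}. \<forall>t\<in>{0<..<\<tau>}. cmod (h (s, t)) > R"
proof -
  have ev: "\<exists>\<tau>>0. \<forall>s\<in>{0..1::real}. \<forall>t\<in>{0<..<\<tau>}. Q (h (s, t))" if "eventually Q (end_filter a)" for Q
  proof -
    have "eventually (\<lambda>x. Q (h x)) (principal {0..1} \<times>\<^sub>F at_right (0::real))"
      using assms that by (simp add: filterlim_iff)
    then obtain Pf Pg where *: "eventually Pf (principal {0..1::real})" "eventually Pg (at_right (0::real))" "\<And>x y. Pf x \<Longrightarrow> Pg y \<Longrightarrow> Q (h (x, y))"
      unfolding eventually_prod_filter by blast
    from *(2) obtain b where "b > 0" "\<And>y. y > 0 \<Longrightarrow> y < b \<Longrightarrow> Pg y" unfolding eventually_at_right_field by blast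
    then show ?thesis using *(1,3) by (intro exI[of _ b]) (auto simp: eventually_principal)
  qed
  show "\<exists>\<tau>>0. \<forall>s\<in>{0..1::real}. \<forall>t\<in>{0<..<\<tau>}. cmod (h (s, t) - complex_of_real (real_of_ereal a)) < \<epsilon>" if "\<bar>a\<bar> \<noteq> \<infinity>" "\<epsilon> > 0"
  proof (rule ev)
    show "\<forall>\<^sub>F w in end_filter a. cmod (w - complex_of_real (real_of_ereal a)) < \<epsilon>"
      using that eventually_nhds_metric[of "\<lambda>w. cmod (w - complex_of_real (real_of_ereal a)) < \<epsilon>"]
      by (auto simp: end_filter_def dist_norm)
  qed
  show "\<exists>\<tau>>0. \<forall>s\<in>{0..1::real}. \<forall>t\<in>{0<..<\<tau>}. cmod (h (s, t)) > R" if "\<bar>a\<bar> = \<infinity>"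
  proof (rule ev)
    show "\<forall>\<^sub>F w in end_filter a. cmod w > R"
      using that by (auto simp: end_filter_def eventually_at_infinity intro!: exI[of _ "R + 1"])
  qed
qed

lemma filterlim_end_filter_flip:
  fixes h :: "real \<times> real \<Rightarrow> complex"
  assumes "filterlim h F (principal {0..1} \<times>\<^sub>F at_left (1::real))"
  shows "filterlim (\<lambda>(s, t). h (s, 1 - t)) F (principal {0..1} \<times>\<^sub>F at_right 0)"
  unfolding filterlim_iff
proof (intro allI impI)
  fix Q assume "eventually Q F"
  then have "eventually (\<lambda>x. Q (h x)) (principal {0..1} \<times>\<^sub>F at_left (1::real))"
    using assms by (simp add: filterlim_iff)
  then obtain Pf Pg where *: "eventually Pf (principal {0..1::real})" "eventually Pg (at_left (1::real))" "\<And>x y. Pf x \<Longrightarrow> Pg y \<Longrightarrow> Q (h (x, y))"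
    unfolding eventually_prod_filter by blast
  then show "eventually (\<lambda>x. Q (case x of (s, t) \<Rightarrow> h (s, 1 - t))) (principal {0..1} \<times>\<^sub>F at_right 0)"
    unfolding eventually_prod_filter using eventually_at_left_one_iff[of Pg]
    by (intro exI[of _ Pf] exI[of _ "\<lambda>t. Pg (1 - t)"]) auto
qed

text \<open>\<open>N\<close> stands for \<open>\<parallel>K'(w)\<parallel> / (1 + |w|)\<close>.\<close>

lemma homotopy_end_estimate:
  fixes h :: "real \<times> real \<Rightarrow> complex"
  assumes P: "prim_along F h P ({0..1} \<times> {0<..t1})" and t1: "t1 > 0"
    and D: "open D" and \<Phi>: "\<And>w. w \<in> D \<Longrightarrow> (\<Phi> has_field_derivative F w) (at w)"
    and hD: "\<And>s t. s \<in> {0<..1} \<Longrightarrow> t \<in> {0<..t1} \<Longrightarrow> h (s, t) \<in> D \<and> P (s, t) = \<Phi> (h (s, t))"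
    and hI: "\<And>t. t \<in> {0<..t1} \<Longrightarrow> h (0, t) \<in> I"
    and lim: "filterlim h (end_filter a) (principal {0..1} \<times>\<^sub>F at_right 0)"
    and fin: "\<bar>a\<bar> \<noteq> \<infinity> \<Longrightarrow> complex_of_real (real_of_ereal a) \<notin> D \<union> I"
      "\<bar>a\<bar> \<noteq> \<infinity> \<Longrightarrow> \<exists>r>0. \<exists>M. \<forall>w\<in>D \<union> I. cmod (w - complex_of_real (real_of_ereal a)) < r \<longrightarrow> cmod (F w) \<le> M"
      "\<bar>a\<bar> \<noteq> \<infinity> \<Longrightarrow> \<exists>t1>0. \<exists>L. length_le (\<lambda>t. h (0, t)) {0<..t1} L"
      "\<bar>a\<bar> \<noteq> \<infinity> \<Longrightarrow> \<exists>t1>0. \<exists>L. length_le (\<lambda>t. h (1, t)) {0<..t1} L"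
    and inf: "\<bar>a\<bar> = \<infinity> \<Longrightarrow> \<exists>R. \<exists>C\<ge>0. \<forall>w\<in>D \<union> I. cmod w > R \<longrightarrow> cmod (F w) \<le> C * N w"
      "\<And>e. \<bar>a\<bar> = \<infinity> \<Longrightarrow> e > 0 \<Longrightarrow> \<exists>\<^sub>F t in at_right 0. \<exists>I<e. has_RS_integral (\<lambda>s u v. dist (h (u, t)) (h (v, t)) * N (h (s, t))) I 0 1"
    and e: "e > 0"
  shows "\<exists>\<^sub>F t in at_right 0. cmod (P (1, t) - P (0, t)) < e"
proof (cases "\<bar>a\<bar> = \<infinity>")
  case True
  obtain R C where RC: "C \<ge> 0" "\<And>w. w \<in> D \<union> I \<Longrightarrow> cmod w > R \<Longrightarrow> cmod (F w) \<le> C * N w" using inf(1)[OF True] by blast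
  obtain \<tau> where \<tau>: "\<tau> > 0" "\<And>s t. s \<in> {0..1} \<Longrightarrow> t \<in> {0<..<\<tau>} \<Longrightarrow> cmod (h (s, t)) > R"
    using filterlim_end_filter_right(2)[OF lim True, of R] by blast
  have ev: "\<forall>\<^sub>F t in at_right 0. t \<in> {0<..<min t1 \<tau>}" using t1 \<tau> by (intro eventually_at_right_real) auto
  show ?thesis
  proof (rule prim_along_infinite_end[where F = F and C = C and T = "{0<..t1}" and N = "\<lambda>x. N (h x)"])
    fix t assume t: "t \<in> {0<..t1}"
    have "prim_along F (h \<circ> (\<lambda>s. (s, t))) (P \<circ> (\<lambda>s. (s, t))) {0..1}"
      using t by (intro prim_along_compose[OF P] continuous_intros) auto
    then show "prim_along F (\<lambda>s. h (s, t)) (\<lambda>s. P (s, t)) {0..1}" by (simp add: o_def)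
  next
    show "\<forall>\<^sub>F t in at_right 0. t \<in> {0<..t1}" using ev by eventually_elim auto
    show "\<forall>\<^sub>F t in at_right 0. \<forall>s\<in>{0..1}. cmod (F (h (s, t))) \<le> C * N (h (s, t))"
      using ev
    proof eventually_elim
      case (elim t)
      show ?case
      proof
        fix s :: real assume s: "s \<in> {0..1}"
        have "h (s, t) \<in> D \<union> I" using hD[of s t] hI[of t] s elim by (cases "s = 0") auto
        then show "cmod (F (h (s, t))) \<le> C * N (h (s, t))" using RC(2) \<tau>(2)[of s t] s elim by auto
      qed
    qed
  qed (use inf(2)[OF True] RC(1) e in auto)
next
  case False
  define p where "p = complex_of_real (real_of_ereal a)"
  obtain r M where M: "r > 0" "\<And>w. w \<in> D \<union> I \<Longrightarrow> cmod (w - p) < r \<Longrightarrow> cmod (F w) \<le> M" using fin(2)[OF False] p_def by blast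
  obtain u0 L0 where L0: "u0 > 0" "length_le (\<lambda>t. h (0, t)) {0<..u0} L0" using fin(3)[OF False] by blast
  obtain u1 L1 where L1: "u1 > 0" "length_le (\<lambda>t. h (1, t)) {0<..u1} L1" using fin(4)[OF False] by blast
  define t2 where "t2 = min t1 (min u0 u1)"
  have t2: "t2 > 0" "t2 \<le> t1" "t2 \<le> u0" "t2 \<le> u1" using t1 L0 L1 by (auto simp: t2_def)
  have "\<exists>\<tau>>0. \<tau> \<le> t2 \<and> (\<forall>t\<in>{0<..<\<tau>}. cmod (P (1, t) - P (0, t)) < e)"
  proof (rule prim_along_finite_end[where F = F and h = h and D = D and \<Phi> = \<Phi> and p = p and M = M and ?L0.0 = L0 and ?L1.0 = L1])
    show "prim_along F h P ({0..1} \<times> {0<..t2})" using P by (rule prim_along_subset) (use t2 in auto)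
    show "h (s, t) \<in> D \<and> P (s, t) = \<Phi> (h (s, t))" if "s \<in> {0<..1}" "t \<in> {0<..t2}" for s t using hD that t2 by auto
    show "h (s, t) \<noteq> p" if "s \<in> {0..1}" "t \<in> {0<..t2}" for s t
    proof -
      have "h (s, t) \<in> D \<union> I" using hD[of s t] hI[of t] that t2 by (cases "s = 0") auto
      then show ?thesis using fin(1)[OF False] by (auto simp: p_def)
    qed
    show "cmod (F (h (0, t))) \<le> M" if "t \<in> {0<..t2}" "cmod (h (0, t) - p) < r" for t using M(2) hI[of t] that t2 by auto
    show "\<exists>\<tau>>0. \<forall>s\<in>{0..1}. \<forall>t\<in>{0<..<\<tau>}. cmod (h (s, t) - p) < \<epsilon>" if "\<epsilon> > 0" for \<epsilon>
      unfolding p_def by (rule filterlim_end_filter_right(1)[OF lim False that])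
    show "length_le (\<lambda>t. h (0, t)) {0<..t2} L0" using L0(2) by (rule length_le_subset) (use t2 in auto)
    show "length_le (\<lambda>t. h (1, t)) {0<..t2} L1" using L1(2) by (rule length_le_subset) (use t2 in auto)
  qed (use M t2 D \<Phi> e in auto)
  then obtain \<tau> where "\<tau> > 0" "\<And>t. t \<in> {0<..<\<tau>} \<Longrightarrow> cmod (P (1, t) - P (0, t)) < e" by blast
  then have "\<forall>\<^sub>F t in at_right 0. cmod (P (1, t) - P (0, t)) < e"
    unfolding eventually_at_right_field by auto
  then show ?thesis by (rule eventually_frequently[rotated]) simp
qed

section \<open>The matrix operator\<close>

locale matrix_setting = spectral_operator E0 A0
  for E0 :: "real set \<Rightarrow> ('h0::chilbert_space \<Rightarrow>\<^sub>L 'h0)" and A0 :: "'h0 lop" +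
  fixes A1 :: "'h1::chilbert_space lop" and B01 :: "'h1 \<Rightarrow>\<^sub>L 'h0" and B10 :: "'h0 \<Rightarrow>\<^sub>L 'h1"
    and m :: nat and \<mu>1 \<mu>2 :: "nat \<Rightarrow> ereal"
    and Dm :: "nat \<Rightarrow> complex set" and K' :: "nat \<Rightarrow> complex \<Rightarrow> ('h1 \<Rightarrow>\<^sub>L 'h1)"
    and l :: "nat \<Rightarrow> int" and \<Gamma> :: "nat \<Rightarrow> real \<Rightarrow> complex"
    and X :: "'h1 \<Rightarrow>\<^sub>L 'h1" and H1 :: "'h1 lop" and d0 :: real and V0 :: ennreal
  assumes A1: "self_adjoint A1"
    and B01: "clinear_op B01" and B10: "is_adjoint B01 B10"
    and spectral: "spectral_assumptions A0 A1 m \<mu>1 \<mu>2"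
    and analyticity: "analyticity_assumptions (K_B B10 E0 B01) m \<mu>1 \<mu>2 Dm K'"
    and contour: "is_contour A0 m \<mu>1 \<mu>2 Dm K' l \<Gamma>"
    and V0: "V0 = modified_variation A0 E0 B01 B10 m \<mu>1 \<mu>2 K' \<Gamma>"
    and d0: "d0 = dist0 A0 A1 m \<mu>1 \<mu>2 \<Gamma>"
    and K_B_bounded: "V0 < \<infinity>"
    and small: "V0 < ennreal (d0\<^sup>2 / 4)"
    and X: "clinear_op X"
      "has_V1 A0 E0 B01 B10 m \<mu>1 \<mu>2 K' \<Gamma> (op_plus A1 X) X"
      "norm X \<le> d0 / 2 - sqrt (d0\<^sup>2 / 4 - enn2real V0)"
    and H1: "H1 = op_plus A1 X"
begin

abbreviation \<Delta> :: "nat \<Rightarrow> real set" where "\<Delta> \<equiv> Delta \<mu>1 \<mu>2"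
abbreviation \<sigma>' :: "real set" where "\<sigma>' \<equiv> sigma' A0 m \<mu>1 \<mu>2"
definition v :: real where "v = enn2real V0"
definition Z :: "complex set" where "Z = complex_of_real ` \<sigma>' \<union> contour_image m \<Gamma>"
text \<open>Conjugates are included because the density on the contour involves the resolvent
  vectors at w and at cnj w; for the self-adjoint A1 both points have the same distance from the
  spectrum. The closure brings in the finite end points of the intervals.\<close>

definition Zc :: "complex set" where "Zc = {w. w \<in> closure Z \<or> cnj w \<in> closure Z}"
definition eigval :: "real \<Rightarrow> bool" where "eigval lam \<longleftrightarrow> eigenspace H1 (complex_of_real lam) \<noteq> {0}"
definition fw :: "real set \<Rightarrow> (real \<Rightarrow> 'h1) \<Rightarrow> complex \<Rightarrow> 'h1"
  where "fw \<Lambda> \<phi> w = (\<Sum>l\<in>\<Lambda>. (1 / (complex_of_real l - w)) *\<^sub>C \<phi> l)"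

lemma v: "V0 = ennreal v" "v \<ge> 0" "v < d0\<^sup>2 / 4"
proof -
  have fin: "V0 < top" using K_B_bounded by (simp only: infinity_ennreal_def)
  show *: "V0 = ennreal v" unfolding v_def by (rule ennreal_enn2real[OF fin, symmetric])
  show v0: "v \<ge> 0" unfolding v_def by (rule enn2real_nonneg)
  have "ennreal v < ennreal (d0\<^sup>2 / 4)" using small * by (simp only:)
  then show "v < d0\<^sup>2 / 4" using ennreal_less_iff[OF v0] by blast
qed

lemma d0_pos: "d0 > 0"
proof -
  have "d0 \<ge> 0" unfolding d0 dist0_def by (rule setdist_pos_le)
  moreover have "d0 \<noteq> 0" using v(2,3) by auto
  ultimately show ?thesis by simp
qed

lemma norm_X: "norm X \<le> d0 / 2"
proof -
  have "sqrt (d0\<^sup>2 / 4 - enn2real V0) \<ge> 0" using v(3) by (simp add: v_def)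
  then show ?thesis using X(3) by linarith
qed

lemma dom_H1: "op_dom H1 = op_dom A1" "op_app H1 u = op_app A1 u + X u"
  by (simp_all add: H1 op_plus_def)

text \<open>A1 - z is bounded below by d0, and X takes away at most d0 / 2.\<close>

lemma H1_lower:
  assumes u: "u \<in> op_dom A1" and z: "z \<in> Zc"
  shows "d0 / 2 * norm u \<le> norm (op_app H1 u - z *\<^sub>C u)"
proof -
  have *: "d0 * norm u \<le> norm (op_app A1 u - z *\<^sub>C u)" if "z \<in> closure Z" for z
  proof (rule self_adjoint_lower_bound[OF A1 _ u])
    fix w assume w: "w \<in> spectrum A1"
    have "setdist (spectrum A1) (closure Z) = d0"
      unfolding d0 dist0_def Z_def[symmetric] by (rule setdist_closure_2)
    then show "d0 \<le> dist w z" using setdist_le_dist[OF w that] by simp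
  qed
  have "d0 * norm u \<le> norm (op_app A1 u - z *\<^sub>C u)"
    using z *[of z] *[of "cnj z"] self_adjoint_shift_norm_cnj[OF A1 u, of z] by (auto simp: Zc_def)
  moreover have "norm (X u) \<le> d0 / 2 * norm u"
    using norm_blinfun[of X u] mult_right_mono[OF norm_X, of "norm u"] by simp
  moreover have "norm (op_app A1 u - z *\<^sub>C u) \<le> norm (op_app H1 u - z *\<^sub>C u) + norm (X u)"
    using norm_triangle_ineq4[of "op_app H1 u - z *\<^sub>C u" "X u"] by (simp add: dom_H1)
  ultimately show ?thesis by (simp add: field_simps)
qed

lemma H1_scale: "u \<in> op_dom A1 \<Longrightarrow> op_app H1 (c *\<^sub>C u) = c *\<^sub>C op_app H1 u"
  using X(1) by (simp add: dom_H1 self_adjoint_scale[OF A1] clinear_op_def scaleC_add_right)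

lemma H1_sum: "(\<And>i. i \<in> F \<Longrightarrow> x i \<in> op_dom A1) \<Longrightarrow> op_app H1 (\<Sum>i\<in>F. x i) = (\<Sum>i\<in>F. op_app H1 (x i))"
  by (simp add: dom_H1 self_adjoint_sum[OF A1] sum.distrib blinfun.sum_right)

lemma eig: "\<phi> \<in> eigenspace H1 z \<Longrightarrow> \<phi> \<in> op_dom A1 \<and> op_app H1 \<phi> = z *\<^sub>C \<phi>"
  by (simp add: eigenspace_def dom_H1)

lemma csubspace_eigenspace: "csubspace (eigenspace H1 z)"
proof (rule cvs.subspaceI)
  note D = self_adjoint_csubspace[OF A1]
  have "op_app H1 0 = 0" using H1_sum[of "{}"] by simp
  then show "0 \<in> eigenspace H1 z" using cvs.subspace_0[OF D] by (simp add: eigenspace_def dom_H1(1))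
  fix x y assume xy: "x \<in> eigenspace H1 z" "y \<in> eigenspace H1 z"
  have d: "x \<in> op_dom A1" "y \<in> op_dom A1" using eig xy by auto
  have "op_app H1 (x + y) = op_app H1 x + op_app H1 y"
    by (simp add: dom_H1 self_adjoint_add[OF A1 d] blinfun.add_right)
  then show "x + y \<in> eigenspace H1 z"
    using eig[OF xy(1)] eig[OF xy(2)] cvs.subspace_add[OF D] by (simp add: eigenspace_def dom_H1(1) scaleC_add_right)
next
  note D = self_adjoint_csubspace[OF A1]
  fix c x assume x: "x \<in> eigenspace H1 z"
  then show "c *\<^sub>C x \<in> eigenspace H1 z"
    using eig[OF x] H1_scale[of x c] cvs.subspace_scale[OF D] by (simp add: eigenspace_def dom_H1(1) scaleC_scaleC mult.commute)
qed

lemma eigval_dist: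
  assumes "eigval lam" "w \<in> Zc"
  shows "d0 / 2 \<le> cmod (complex_of_real lam - w)"
proof -
  have "0 \<in> eigenspace H1 (complex_of_real lam)" using csubspace_eigenspace cvs.subspace_0 by blast
  then obtain \<phi> where \<phi>: "\<phi> \<in> eigenspace H1 (complex_of_real lam)" "\<phi> \<noteq> 0" using assms(1) by (auto simp: eigval_def)
  have "d0 / 2 * norm \<phi> \<le> norm (op_app H1 \<phi> - w *\<^sub>C \<phi>)" using eig[OF \<phi>(1)] assms(2) by (intro H1_lower) auto
  also have "\<dots> = cmod (complex_of_real lam - w) * norm \<phi>"
    using eig[OF \<phi>(1)] by (simp add: norm_scaleC flip: cvs.scale_left_diff_distrib)
  finally show ?thesis using \<phi>(2) by simp
qed

lemma closure_Z_subset: "closure Z \<subseteq> Zc" "cnj ` closure Z \<subseteq> Zc" "Z \<subseteq> Zc"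
  using closure_subset[of Z] by (auto simp: Zc_def)

lemma sigma'_Zc: "t \<in> \<sigma>' \<Longrightarrow> complex_of_real t \<in> Zc"
  using closure_Z_subset(3) by (auto simp: Z_def)

text \<open>For eigenvectors \<open>\<phi> l\<close> of \<open>H1\<close>, \<open>fw \<Lambda> \<phi> w\<close> is \<open>(H1 - w)\<^sup>-\<^sup>1\<close> applied to their sum, so that
  its norm is controlled by the distance of \<open>w\<close> to the spectrum of \<open>A1\<close>.\<close>

lemma fw_bound:
  assumes \<phi>: "\<And>l. l \<in> \<Lambda> \<Longrightarrow> \<phi> l \<in> eigenspace H1 (complex_of_real l)" "\<And>l. l \<in> \<Lambda> \<Longrightarrow> eigval l" and w: "w \<in> Zc"
  shows "norm (fw \<Lambda> \<phi> w) \<le> 2 / d0 * norm (\<Sum>l\<in>\<Lambda>. \<phi> l)"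
proof -
  have nz: "complex_of_real l - w \<noteq> 0" if "l \<in> \<Lambda>" for l using eigval_dist[OF \<phi>(2)[OF that] w] d0_pos by auto
  have D: "(1 / (complex_of_real l - w)) *\<^sub>C \<phi> l \<in> op_dom A1" if "l \<in> \<Lambda>" for l
    using eig[OF \<phi>(1)[OF that]] cvs.subspace_scale[OF self_adjoint_csubspace[OF A1]] by blast
  have "op_app H1 (fw \<Lambda> \<phi> w) - w *\<^sub>C fw \<Lambda> \<phi> w = (\<Sum>l\<in>\<Lambda>. op_app H1 ((1 / (complex_of_real l - w)) *\<^sub>C \<phi> l) - w *\<^sub>C ((1 / (complex_of_real l - w)) *\<^sub>C \<phi> l))"
    unfolding fw_def by (simp add: H1_sum[OF D] cvs.scale_sum_right sum_subtractf)
  also have "\<dots> = (\<Sum>l\<in>\<Lambda>. \<phi> l)"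
  proof (rule sum.cong[OF refl])
    fix l assume l: "l \<in> \<Lambda>"
    have "op_app H1 ((1 / (complex_of_real l - w)) *\<^sub>C \<phi> l) - w *\<^sub>C ((1 / (complex_of_real l - w)) *\<^sub>C \<phi> l)
       = ((1 / (complex_of_real l - w)) * (complex_of_real l - w)) *\<^sub>C \<phi> l"
      using eig[OF \<phi>(1)[OF l]] H1_scale[of "\<phi> l"]
      by (simp add: scaleC_scaleC right_diff_distrib cvs.scale_left_diff_distrib diff_divide_distrib)
    then show "op_app H1 ((1 / (complex_of_real l - w)) *\<^sub>C \<phi> l) - w *\<^sub>C ((1 / (complex_of_real l - w)) *\<^sub>C \<phi> l) = \<phi> l"
      using nz[OF l] by simp
  qed
  finally have eq: "op_app H1 (fw \<Lambda> \<phi> w) - w *\<^sub>C fw \<Lambda> \<phi> w = (\<Sum>l\<in>\<Lambda>. \<phi> l)" .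
  have "fw \<Lambda> \<phi> w \<in> op_dom A1" unfolding fw_def using D by (intro cvs.subspace_sum self_adjoint_csubspace[OF A1]) auto
  then have "d0 / 2 * norm (fw \<Lambda> \<phi> w) \<le> norm (\<Sum>l\<in>\<Lambda>. \<phi> l)" using H1_lower[OF _ w] eq by metis
  then show ?thesis using d0_pos by (simp add: field_simps)
qed

lemma Delta_spectrum: "k \<in> {1..m} \<Longrightarrow> \<Delta> k \<subseteq> real_spectrum A0"
proof -
  assume "k \<in> {1..m}"
  then have "complex_of_real ` \<Delta> k \<subseteq> continuous_spectrum A0" using spectral unfolding spectral_assumptions_def by blast
  then show ?thesis by (auto simp: real_spectrum_def continuous_spectrum_def)
qed

lemma Delta_no_eigenvalue: "k \<in> {1..m} \<Longrightarrow> \<mu> \<in> \<Delta> k \<Longrightarrow> eigenspace A0 (complex_of_real \<mu>) = {0}"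
proof -
  assume "k \<in> {1..m}" and \<mu>: "\<mu> \<in> \<Delta> k"
  then have "complex_of_real ` \<Delta> k \<subseteq> continuous_spectrum A0" using spectral unfolding spectral_assumptions_def by blast
  then show ?thesis using \<mu> by (auto simp: continuous_spectrum_def)
qed

lemma Delta_disjoint: "j \<in> {1..m} \<Longrightarrow> k \<in> {1..m} \<Longrightarrow> j \<noteq> k \<Longrightarrow> \<Delta> j \<inter> \<Delta> k = {}"
  using spectral unfolding spectral_assumptions_def disjoint_family_on_def by blast

lemma Delta_open: "open (\<Delta> k)"
proof -
  have "\<Delta> k = ereal -` {\<mu>1 k<..<\<mu>2 k}" by (auto simp: Delta_def)
  moreover have "open (ereal -` {\<mu>1 k<..<\<mu>2 k})"
    by (intro continuous_open_vimage) (auto intro: continuous_on_ereal continuous_on_id simp: continuous_on_eq_continuous_at[symmetric])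
  ultimately show ?thesis by simp
qed

lemma Delta_Icc: "a \<in> \<Delta> k \<Longrightarrow> b \<in> \<Delta> k \<Longrightarrow> {a..b} \<subseteq> \<Delta> k"
proof
  fix x assume ab: "a \<in> \<Delta> k" "b \<in> \<Delta> k" and "x \<in> {a..b}"
  then have "ereal a \<le> ereal x" "ereal x \<le> ereal b" by auto
  then show "x \<in> \<Delta> k" using ab by (auto simp: Delta_def simp del: ereal_less_eq intro: less_le_trans le_less_trans)
qed

lemma Delta_borel: "\<Delta> k \<in> sets borel"
  using Delta_open by simp

lemma sigma'_borel: "\<sigma>' \<in> sets borel"
  unfolding sigma'_def using real_spectrum_closed Delta_borel by (intro sets.Diff sets.finite_UN) auto

lemma eigval_position:
  assumes "eigval lam" "lam \<in> real_spectrum A0"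
  obtains k where "k \<in> {1..m}" "lam \<in> \<Delta> k"
proof -
  have "lam \<notin> \<sigma>'"
  proof
    assume "lam \<in> \<sigma>'"
    then show False using eigval_dist[OF assms(1) sigma'_Zc[of lam]] d0_pos by simp
  qed
  then show thesis using assms(2) that by (auto simp: sigma'_def)
qed

lemma variation_part:
  assumes d: "range d \<subseteq> sets borel" "disjoint_family (d :: nat \<Rightarrow> real set)" "(\<Union>n. d n) = \<sigma>'"
  shows "(\<Sum>n. ennreal (norm (B10 o\<^sub>L E0 (d n) o\<^sub>L B01))) \<le> ennreal v"
proof -
  \<comment> \<open>The variation is a supremum over partitions of the whole spectrum. The union of
    the intervals, put in front, completes the given partition of \<sigma>'; intersected with
    \<sigma>' it is empty.\<close>
  define d' where "d' n = (case n of 0 \<Rightarrow> (\<Union>k\<in>{1..m}. \<Delta> k) | Suc n \<Rightarrow> d n)" for n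
  let ?f = "\<lambda>d. \<lambda>n. ennreal (norm (B10 o\<^sub>L E0 (d n \<inter> \<sigma>') o\<^sub>L B01))"
  have dis: "(\<Union>k\<in>{1..m}. \<Delta> k) \<inter> \<sigma>' = {}" by (auto simp: sigma'_def)
  have dn: "d n \<inter> \<sigma>' = d n" "d n \<subseteq> \<sigma>'" for n using d(3) by auto
  have m': "range d' \<subseteq> sets borel"
    using d(1) Delta_borel by (auto simp: d'_def split: nat.splits)
  have dd: "disjoint_family d'"
    unfolding disjoint_family_on_def
  proof (intro ballI impI)
    fix i j :: nat assume ij: "i \<noteq> j"
    have dis0: "(\<Union>k\<in>{1..m}. \<Delta> k) \<inter> d n = {}" for n using dis dn(2) by blast
    show "d' i \<inter> d' j = {}"
    proof (cases i)
      case 0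
      then obtain j' where "j = Suc j'" using ij by (cases j) auto
      then show ?thesis using 0 dis0[of j'] by (simp add: d'_def)
    next
      case (Suc i')
      show ?thesis
      proof (cases j)
        case 0
        then show ?thesis using Suc dis0[of i'] by (simp add: d'_def Int_commute)
      next
        case (Suc j')
        then show ?thesis using \<open>i = Suc i'\<close> ij d(2) by (simp add: d'_def disjoint_family_on_def)
      qed
    qed
  qed
  have "(\<Union>n. d' n) = d' 0 \<union> (\<Union>n. d' (Suc n))"
  proof
    show "(\<Union>n. d' n) \<subseteq> d' 0 \<union> (\<Union>n. d' (Suc n))"
    proof
      fix x assume "x \<in> (\<Union>n. d' n)"
      then obtain n where "x \<in> d' n" by blast
      then show "x \<in> d' 0 \<union> (\<Union>n. d' (Suc n))" by (cases n) auto
    qed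
  qed blast
  also have "\<dots> = (\<Union>k\<in>{1..m}. \<Delta> k) \<union> \<sigma>'" using d(3) by (simp add: d'_def)
  also have "\<dots> = real_spectrum A0" using Delta_spectrum unfolding sigma'_def by blast
  finally have un: "(\<Union>n. d' n) = real_spectrum A0" .
  have e0: "B10 o\<^sub>L E0 {} o\<^sub>L B01 = 0" by (rule blinfun_eqI) (simp add: empty blinfun.zero_right)
  have "(\<Sum>n. ennreal (norm (B10 o\<^sub>L E0 (d n) o\<^sub>L B01))) = (\<Sum>n. ?f d' (n + 1))" by (simp add: d'_def dn)
  also have "\<dots> \<le> (\<Sum>n. ?f d' n)" by (subst (2) suminf_offset[of _ 1]) auto
  also have "\<dots> \<le> (SUP d \<in> {d :: nat \<Rightarrow> real set. range d \<subseteq> sets borel \<and> disjoint_family d \<and> (\<Union>n. d n) = real_spectrum A0}. \<Sum>n. ?f d n)"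
  proof (rule SUP_upper)
    show "d' \<in> {d :: nat \<Rightarrow> real set. range d \<subseteq> sets borel \<and> disjoint_family d \<and> (\<Union>n. d n) = real_spectrum A0}"
      using m' dd un by blast
  qed
  also have "\<dots> \<le> V0" unfolding V0 modified_variation_def by simp
  finally show ?thesis using v(1) by simp
qed

lemma arc_part:
  assumes "k \<in> {1..m}"
  shows "arc_length_integral (\<Gamma> k) (\<lambda>\<mu>. norm (K' k \<mu>)) \<le> ennreal v"
proof -
  have "arc_length_integral (\<Gamma> k) (\<lambda>\<mu>. norm (K' k \<mu>)) \<le> (\<Sum>k\<in>{1..m}. arc_length_integral (\<Gamma> k) (\<lambda>\<mu>. norm (K' k \<mu>)))"
    using assms by (intro member_le_sum) auto
  also have "\<dots> \<le> V0" unfolding V0 modified_variation_def by simp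
  finally show ?thesis using v(1) by simp
qed

lemma sigma'_bound:
  assumes \<Lambda>: "finite \<Lambda>" and \<phi>: "\<And>l. l \<in> \<Lambda> \<Longrightarrow> \<phi> l \<in> eigenspace H1 (complex_of_real l)" "\<And>l. l \<in> \<Lambda> \<Longrightarrow> eigval l"
    and x: "\<And>l. l \<in> \<Lambda> \<Longrightarrow> x l \<in> op_dom A0" "\<And>l. l \<in> \<Lambda> \<Longrightarrow> shift l (x l) = B01 (\<phi> l)"
  shows "(norm (E0 \<sigma>' (\<Sum>l\<in>\<Lambda>. x l)))\<^sup>2 \<le> 2 * (2 / d0 * norm (\<Sum>l\<in>\<Lambda>. \<phi> l))\<^sup>2 * v"
proof (rule norm_bound_by_variation[OF sigma'_borel \<Lambda> _ _ B01 B10 x])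
  show "d0 / 2 > 0" using d0_pos by simp
  show "d0 / 2 \<le> \<bar>l - t\<bar>" if "t \<in> \<sigma>'" "l \<in> \<Lambda>" for t l
    using eigval_dist[OF \<phi>(2)[OF that(2)] sigma'_Zc[OF that(1)]] by (metis norm_of_real of_real_diff)
  show "norm (\<Sum>l\<in>\<Lambda>. (1 / complex_of_real (l - t)) *\<^sub>C \<phi> l) \<le> 2 / d0 * norm (\<Sum>l\<in>\<Lambda>. \<phi> l)" if "t \<in> \<sigma>'" for t
    using fw_bound[OF \<phi> sigma'_Zc[OF that]] by (simp add: fw_def)
qed (use v variation_part in auto)

subsection \<open>The derivative of \<open>K\<^sub>B\<close>\<close>

lemma K_B_inner: "cinner (K_B B10 E0 B01 \<mu> x) y = cinner (E0 {..<\<mu>} (B01 x)) (B01 y)"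
proof -
  have "cinner y (B10 z) = cinner (B01 y) z" for z using B10 by (simp add: is_adjoint_def)
  then have "cinner (B10 z) y = cinner z (B01 y)" for z using cinner_commute by metis
  then show ?thesis by (simp add: K_B_def)
qed

lemma K'_vector_derivative:
  assumes k: "k \<in> {1..m}" "\<mu> \<in> \<Delta> k"
  shows "((\<lambda>\<sigma>. cinner (E0 {..<\<sigma>} (B01 x)) (B01 y)) has_vector_derivative cinner (K' k (complex_of_real \<mu>) x) y) (at \<mu>)"
proof -
  have "(K_B B10 E0 B01 has_vector_derivative K' k (complex_of_real \<mu>)) (at \<mu>)"
    using analyticity k by (simp add: analyticity_assumptions_def)
  moreover have "bounded_linear (\<lambda>T :: 'h1 \<Rightarrow>\<^sub>L 'h1. cinner (T x) y)"
    by (rule bounded_linear_compose[OF bounded_bilinear.bounded_linear_left[OF bounded_bilinear_cinner] blinfun.bounded_linear_left])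
  ultimately have "((\<lambda>\<sigma>. cinner (K_B B10 E0 B01 \<sigma> x) y) has_vector_derivative cinner (K' k (complex_of_real \<mu>) x) y) (at \<mu>)"
    by (rule bounded_linear.has_vector_derivative[rotated])
  then show ?thesis by (simp add: K_B_inner)
qed

lemma K'_norm_derivative:
  assumes "k \<in> {1..m}" "\<mu> \<in> \<Delta> k"
  shows "((\<lambda>\<sigma>. (norm (E0 {..<\<sigma>} (B01 x)))\<^sup>2) has_real_derivative Re (cinner (K' k (complex_of_real \<mu>) x) x)) (at \<mu>)"
proof -
  have "((\<lambda>\<sigma>. Re (cinner (E0 {..<\<sigma>} (B01 x)) (B01 x))) has_vector_derivative Re (cinner (K' k (complex_of_real \<mu>) x) x)) (at \<mu>)"
    by (rule bounded_linear.has_vector_derivative[OF bounded_linear_Re K'_vector_derivative[OF assms]])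
  then show ?thesis by (simp add: norm_sq has_real_derivative_iff_has_vector_derivative)
qed

lemma K'_symmetric:
  assumes "k \<in> {1..m}" "\<mu> \<in> \<Delta> k"
  shows "cinner (K' k (complex_of_real \<mu>) x) y = cnj (cinner (K' k (complex_of_real \<mu>) y) x)"
proof -
  have "((\<lambda>\<sigma>. cnj (cinner (E0 {..<\<sigma>} (B01 y)) (B01 x))) has_vector_derivative cnj (cinner (K' k (complex_of_real \<mu>) y) x)) (at \<mu>)"
    by (rule bounded_linear.has_vector_derivative[OF bounded_linear_cnj K'_vector_derivative[OF assms]])
  moreover have "cnj (cinner (E0 {..<\<sigma>} (B01 y)) (B01 x)) = cinner (E0 {..<\<sigma>} (B01 x)) (B01 y)" for \<sigma>
    unfolding sym[of "{..<\<sigma>}" "B01 x" "B01 y", simplified] by (rule cinner_commute[symmetric])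
  ultimately have "((\<lambda>\<sigma>. cinner (E0 {..<\<sigma>} (B01 x)) (B01 y)) has_vector_derivative cnj (cinner (K' k (complex_of_real \<mu>) y) x)) (at \<mu>)"
    by (simp only:)
  then show ?thesis by (rule vector_derivative_unique_at[OF K'_vector_derivative[OF assms, of x y]])
qed

lemma K'_nonneg:
  assumes "k \<in> {1..m}" "\<mu> \<in> \<Delta> k"
  shows "0 \<le> Re (cinner (K' k (complex_of_real \<mu>) x) x)"
proof (rule mono_on_imp_deriv_nonneg[OF _ K'_norm_derivative[OF assms]])
  show "mono_on UNIV (\<lambda>\<sigma>. (norm (E0 {..<\<sigma>} (B01 x)))\<^sup>2)"
    by (intro mono_onI power_mono norm_mono) auto
qed simp

text \<open>The type of K' only provides real linearity. On the interval the form is symmetric, and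
  its conjugate linearity in the second argument carries over to linearity in the first.\<close>

lemma K'_clinear_real:
  assumes "k \<in> {1..m}" "\<mu> \<in> \<Delta> k"
  shows "cinner (K' k (complex_of_real \<mu>) (c *\<^sub>C x)) y = c * cinner (K' k (complex_of_real \<mu>) x) y"
  using K'_symmetric[OF assms, of "c *\<^sub>C x" y] K'_symmetric[OF assms, of x y] by (simp add: cinner_scaleC_right)

text \<open>Cauchy-Schwarz for a nonnegative form, obtained from a real variation x + s y; the
  imaginary part follows with \<i> y.\<close>

lemma K'_null:
  assumes k: "k \<in> {1..m}" "\<mu> \<in> \<Delta> k" and z: "Re (cinner (K' k (complex_of_real \<mu>) x) x) = 0"
  shows "cinner (K' k (complex_of_real \<mu>) x) y = 0"
proof -
  let ?T = "K' k (complex_of_real \<mu>)"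
  have re: "Re (cinner (?T x) y) = 0" for y
  proof (rule ccontr)
    assume ne: "Re (cinner (?T x) y) \<noteq> 0"
    define a where "a = Re (cinner (?T x) y)"
    define b where "b = Re (cinner (?T y) y)"
    have b: "b \<ge> 0" unfolding b_def by (rule K'_nonneg[OF k])
    \<comment> \<open>The minimiser - a / b is undefined for b = 0; with b + 1 the value is still
      negative.\<close>
    define s where "s = - a / (b + 1)"
    have "0 \<le> Re (cinner (?T (x + s *\<^sub>R y)) (x + s *\<^sub>R y))" by (rule K'_nonneg[OF k])
    also have "\<dots> = 2 * s * a + s * s * b"
    proof -
      have "Re (cinner (?T y) x) = a" unfolding a_def using arg_cong[OF K'_symmetric[OF k, of y x], of Re] by simp
      then show ?thesis using z unfolding Re_cinner
        by (simp add: blinfun.add_right blinfun.scaleR_right inner_add_left inner_add_right a_def b_def algebra_simps Re_cinner)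
    qed
    also have "\<dots> < 0"
    proof -
      have "2 * s * a + s * s * b = - (a\<^sup>2 / (b + 1) * (2 - b / (b + 1)))"
        by (simp add: s_def power2_eq_square algebra_simps)
      moreover have "a\<^sup>2 / (b + 1) > 0" using ne b by (simp add: a_def)
      moreover have "b / (b + 1) \<le> 1" using b by (simp add: pos_divide_le_eq)
      then have "2 - b / (b + 1) > 0" by simp
      ultimately show ?thesis using mult_pos_pos[of "a\<^sup>2 / (b + 1)" "2 - b / (b + 1)"] by linarith
    qed
    finally show False by simp
  qed
  have "Re (cinner (?T x) (\<i> *\<^sub>C y)) = 0" by (rule re)
  then show ?thesis using re[of y] by (simp add: cinner_scaleC_right complex_eq_iff)
qed

text \<open>An open set containing \<Delta> k and both reflected domains, on which K' k is complex
  differentiable; it is needed to work across the real axis.\<close>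

definition U :: "nat \<Rightarrow> complex set"
  where "U k = \<Union>{ball z e | z e. e > 0 \<and> (\<forall>w\<in>ball z e. \<exists>D. (K' k has_derivative (\<lambda>h. cscale_op h D)) (at w))}"

lemma U_open: "open (U k)"
  by (auto simp: U_def)

lemma U_superset: "k \<in> {1..m} \<Longrightarrow> Dm k \<union> complex_of_real ` \<Delta> k \<union> cnj ` Dm k \<subseteq> U k"
proof
  fix z assume k: "k \<in> {1..m}" and z: "z \<in> Dm k \<union> complex_of_real ` \<Delta> k \<union> cnj ` Dm k"
  then obtain e where e: "e > 0" "\<forall>w\<in>ball z e. \<exists>D. (K' k has_derivative (\<lambda>h. cscale_op h D)) (at w)"
    using analyticity unfolding analyticity_assumptions_def op_analytic_on_def by blast
  then have "ball z e \<subseteq> U k" by (auto simp: U_def)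
  then show "z \<in> U k" using e(1) by auto
qed

lemma U_derivative: "w \<in> U k \<Longrightarrow> \<exists>D. (K' k has_derivative (\<lambda>h. cscale_op h D)) (at w)"
  by (auto simp: U_def)

lemma K'_isCont: "w \<in> U k \<Longrightarrow> isCont (K' k) w"
  using U_derivative has_derivative_continuous by blast

lemma K'_holomorphic: "(\<lambda>w. cinner (K' k w x) y) holomorphic_on U k"
  unfolding holomorphic_on_open[OF U_open]
proof
  fix w assume "w \<in> U k"
  then obtain D where D: "(K' k has_derivative (\<lambda>h. cscale_op h D)) (at w)" using U_derivative by blast
  have bl: "bounded_linear (\<lambda>T :: 'h1 \<Rightarrow>\<^sub>L 'h1. cinner (T x) y)"
    by (rule bounded_linear_compose[OF bounded_bilinear.bounded_linear_left[OF bounded_bilinear_cinner] blinfun.bounded_linear_left])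
  have "((\<lambda>w. cinner (K' k w x) y) has_derivative (\<lambda>h. cinner (cscale_op h D x) y)) (at w)"
    by (rule bounded_linear.has_derivative[OF bl D])
  then have "((\<lambda>w. cinner (K' k w x) y) has_field_derivative cinner (D x) y) (at w)"
    unfolding has_field_derivative_def cscale_op_apply cinner_scaleC_left mult.commute[of _ "cinner (D x) y"] .
  then show "\<exists>f'. ((\<lambda>w. cinner (K' k w x) y) has_field_derivative f') (at w)" by blast
qed

end

lemma length_le_flip:
  assumes "length_le g S L"
  shows "length_le (\<lambda>t. g (1 - t)) ((\<lambda>t. 1 - t) ` S) L"
  unfolding length_le_def
proof (intro allI impI)
  fix n and t :: "nat \<Rightarrow> real" assume t: "\<forall>i\<le>n. t i \<in> (\<lambda>t. 1 - t) ` S" "\<forall>i<n. t i \<le> t (Suc i)"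
  define u where "u i = 1 - t (n - i)" for i
  have u: "\<forall>i\<le>n. u i \<in> S" using t(1) by (auto simp: u_def image_iff) (metis diff_diff_eq2 diff_le_self add_diff_cancel_left')
  have "u i \<le> u (Suc i)" if "i < n" for i
  proof -
    have "Suc (n - Suc i) = n - i" "n - Suc i < n" using that by auto
    then show ?thesis using t(2)[rule_format, of "n - Suc i"] by (simp add: u_def)
  qed
  then have "(\<Sum>i<n. dist (g (u i)) (g (u (Suc i)))) \<le> L" using assms u unfolding length_le_def by blast
  moreover have "(\<Sum>i<n. dist (g (u i)) (g (u (Suc i)))) = (\<Sum>i<n. dist (g (1 - t i)) (g (1 - t (Suc i))))"
  proof -
    have "(\<Sum>i<n. dist (g (u i)) (g (u (Suc i)))) = (\<Sum>i<n. dist (g (u (n - Suc i))) (g (u (Suc (n - Suc i)))))"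
      by (rule sum.nat_diff_reindex[symmetric])
    also have "\<dots> = (\<Sum>i<n. dist (g (1 - t i)) (g (1 - t (Suc i))))"
    proof (rule sum.cong[OF refl])
      fix i assume "i \<in> {..<n}"
      then have "n - (n - Suc i) = Suc i" "Suc (n - Suc i) = n - i" "n - (n - i) = i" by auto
      then show "dist (g (u (n - Suc i))) (g (u (Suc (n - Suc i)))) = dist (g (1 - t i)) (g (1 - t (Suc i)))"
        by (simp add: u_def dist_commute)
    qed
    finally show ?thesis .
  qed
  ultimately show "(\<Sum>i<n. dist (g (1 - t i)) (g (1 - t (Suc i)))) \<le> L" by simp
qed

lemma length_le_mono_real:
  assumes p: "\<And>s t. s \<in> S \<Longrightarrow> t \<in> S \<Longrightarrow> s \<le> t \<Longrightarrow> p s \<le> p t" and B: "\<And>s t. s \<in> S \<Longrightarrow> t \<in> S \<Longrightarrow> p t - p s \<le> B"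
  shows "length_le (\<lambda>t. complex_of_real (p t)) S B"
  unfolding length_le_def
proof (intro allI impI)
  fix n and t :: "nat \<Rightarrow> real" assume t: "\<forall>i\<le>n. t i \<in> S" "\<forall>i<n. t i \<le> t (Suc i)"
  have "(\<Sum>i<n. dist (complex_of_real (p (t i))) (complex_of_real (p (t (Suc i))))) = (\<Sum>i<n. p (t (Suc i)) - p (t i))"
  proof (rule sum.cong[OF refl])
    fix i assume "i \<in> {..<n}"
    then have "p (t i) \<le> p (t (Suc i))" using t p by auto
    then show "dist (complex_of_real (p (t i))) (complex_of_real (p (t (Suc i)))) = p (t (Suc i)) - p (t i)"
      by (simp add: dist_norm flip: of_real_diff)
  qed
  also have "\<dots> = p (t n) - p (t 0)" by (rule sum_lessThan_telescope)
  also have "\<dots> \<le> B" using t(1) by (intro B) auto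
  finally show "(\<Sum>i<n. dist (complex_of_real (p (t i))) (complex_of_real (p (t (Suc i))))) \<le> B" .
qed

lemma length_le_cong:
  assumes "length_le f S L" "\<And>t. t \<in> S \<Longrightarrow> f t = g t"
  shows "length_le g S L"
  unfolding length_le_def
proof (intro allI impI)
  fix n and t :: "nat \<Rightarrow> real" assume t: "\<forall>i\<le>n. t i \<in> S" "\<forall>i<n. t i \<le> t (Suc i)"
  have "(\<Sum>i<n. dist (f (t i)) (f (t (Suc i)))) \<le> L" using assms(1) t unfolding length_le_def by blast
  moreover have "(\<Sum>i<n. dist (f (t i)) (f (t (Suc i)))) = (\<Sum>i<n. dist (g (t i)) (g (t (Suc i))))"
    using assms(2) t(1) by (intro sum.cong) auto
  ultimately show "(\<Sum>i<n. dist (g (t i)) (g (t (Suc i)))) \<le> L" by simp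
qed

lemma cnj_image_eq_vimage: "cnj ` S = cnj -` S"
  by (auto simp: image_iff) (metis complex_cnj_cnj)

context matrix_setting
begin

subsection \<open>Deformation of the intervals into the contour\<close>

definition Dk :: "nat \<Rightarrow> complex set" where "Dk k = D_sheet Dm l k"
definition sg :: "nat \<Rightarrow> real" where "sg k = (if l k = 1 then 1 else -1)"

lemma Dm_facts:
  assumes "k \<in> {1..m}"
  shows "open (Dm k)" "simply_connected (Dm k)" "connected (Dm k)" "Dm k \<subseteq> {z. Im z < 0}"
  using analyticity assms by (auto simp: analyticity_assumptions_def)

lemma Dk_open: "k \<in> {1..m} \<Longrightarrow> open (Dk k)"
  using Dm_facts[of k] by (auto simp: Dk_def D_sheet_def cnj_image_eq_vimage intro!: open_vimage continuous_intros)

lemma Dk_simply_connected: "k \<in> {1..m} \<Longrightarrow> simply_connected (Dk k)"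
proof -
  assume k: "k \<in> {1..m}"
  have "inj cnj" by (rule injI) simp
  then have "Dm k homeomorphic cnj ` Dm k"
    using bounded_linear.linear[OF bounded_linear_cnj] homeomorphic_sym linear_homeomorphic_image by blast
  then show ?thesis using Dm_facts(2)[OF k] homeomorphic_simply_connected by (auto simp: Dk_def D_sheet_def)
qed

lemma Dk_connected: "k \<in> {1..m} \<Longrightarrow> connected (Dk k)"
  using Dk_simply_connected simply_connected_imp_connected by blast

lemma Dk_U: "k \<in> {1..m} \<Longrightarrow> Dk k \<subseteq> U k" "k \<in> {1..m} \<Longrightarrow> complex_of_real ` \<Delta> k \<subseteq> U k"
  using U_superset[of k] by (auto simp: Dk_def D_sheet_def)

lemma Dk_side: "k \<in> {1..m} \<Longrightarrow> w \<in> Dk k \<Longrightarrow> 0 < sg k * Im w"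
  using Dm_facts(4)[of k] by (auto simp: Dk_def D_sheet_def sg_def split: if_splits)

lemma Dk_not_real: "k \<in> {1..m} \<Longrightarrow> w \<in> Dk k \<Longrightarrow> w \<noteq> complex_of_real x"
  using Dk_side[of k w] by auto

lemma Dk_primitive:
  assumes "k \<in> {1..m}" "F holomorphic_on Dk k"
  obtains \<Phi> where "\<And>w. w \<in> Dk k \<Longrightarrow> (\<Phi> has_field_derivative F w) (at w)"
  using Dk_simply_connected[OF assms(1)] assms(2) simply_connected_eq_global_primitive[OF Dk_open[OF assms(1)]] by blast

definition homot :: "nat \<Rightarrow> (real \<times> real \<Rightarrow> complex) \<Rightarrow> (real \<Rightarrow> real) \<Rightarrow> bool"
  where "homot k h p \<longleftrightarrow> k \<in> {1..m} \<and> continuous_on ({0..1} \<times> {0<..<1}) h \<and>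
    strict_mono_on {0<..<1} p \<and> p ` {0<..<1} = \<Delta> k \<and>
    (\<forall>t\<in>{0<..<1}. h (0, t) = complex_of_real (p t)) \<and> (\<forall>t\<in>{0<..<1}. h (1, t) = \<Gamma> k t) \<and>
    (\<forall>s\<in>{0<..1}. \<forall>t\<in>{0<..<1}. h (s, t) \<in> Dk k) \<and>
    filterlim h (end_filter (\<mu>1 k)) (principal {0..1} \<times>\<^sub>F at_right 0) \<and>
    filterlim h (end_filter (\<mu>2 k)) (principal {0..1} \<times>\<^sub>F at_left 1) \<and>
    (\<bar>\<mu>1 k\<bar> = \<infinity> \<longrightarrow> negligible_transversals (K' k) h (at_right 0)) \<and>
    (\<bar>\<mu>2 k\<bar> = \<infinity> \<longrightarrow> negligible_transversals (K' k) h (at_left 1))"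

lemma homot_exists:
  assumes k: "k \<in> {1..m}"
  obtains h p where "homot k h p"
proof -
  have "deformation_of (K' k) (\<mu>1 k) (\<mu>2 k) (D_sheet Dm l k) (\<Gamma> k)" using contour k by (simp add: is_contour_def)
  then have "\<exists>h p. homot k h p" using k unfolding deformation_of_def homot_def Dk_def Delta_def by simp
  then show thesis using that by blast
qed

lemma homotD:
  assumes "homot k h p"
  shows "k \<in> {1..m}" "continuous_on ({0..1} \<times> {0<..<1}) h" "strict_mono_on {0<..<1} p" "p ` {0<..<1} = \<Delta> k"
    "\<And>t. t \<in> {0<..<1} \<Longrightarrow> h (0, t) = complex_of_real (p t)" "\<And>t. t \<in> {0<..<1} \<Longrightarrow> h (1, t) = \<Gamma> k t"
    "\<And>s t. s \<in> {0<..1} \<Longrightarrow> t \<in> {0<..<1} \<Longrightarrow> h (s, t) \<in> Dk k"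
    "filterlim h (end_filter (\<mu>1 k)) (principal {0..1} \<times>\<^sub>F at_right 0)"
    "filterlim h (end_filter (\<mu>2 k)) (principal {0..1} \<times>\<^sub>F at_left 1)"
    "\<bar>\<mu>1 k\<bar> = \<infinity> \<Longrightarrow> negligible_transversals (K' k) h (at_right 0)"
    "\<bar>\<mu>2 k\<bar> = \<infinity> \<Longrightarrow> negligible_transversals (K' k) h (at_left 1)"
  using assms[unfolded homot_def] by simp_all

lemma homot_to_real:
  assumes H: "homot k h p" and t: "t \<in> {0<..<1}"
  shows "((\<lambda>s. h (s, t)) \<longlongrightarrow> complex_of_real (p t)) (at_right 0)" "\<forall>\<^sub>F s in at_right 0. h (s, t) \<in> Dk k"
    "p t \<in> \<Delta> k"
proof -
  have "continuous_on {0..1} (\<lambda>s. h (s, t))"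
    using t by (intro continuous_on_compose2[OF homotD(2)[OF H]] continuous_intros) auto
  then have "((\<lambda>s. h (s, t)) \<longlongrightarrow> h (0, t)) (at 0 within {0..1})" by (simp add: continuous_on)
  then show "((\<lambda>s. h (s, t)) \<longlongrightarrow> complex_of_real (p t)) (at_right 0)"
    using homotD(5)[OF H t] by (simp add: at_within_Icc_at_right)
  have "\<forall>\<^sub>F s in at_right 0. s \<in> {0<..<1::real}" by (rule eventually_at_right_real) simp
  then show "\<forall>\<^sub>F s in at_right 0. h (s, t) \<in> Dk k" by eventually_elim (use homotD(7)[OF H _ t] in auto)
  show "p t \<in> \<Delta> k" using homotD(4)[OF H] t by blast
qed

lemma Gamma_in_Dk: "k \<in> {1..m} \<Longrightarrow> t \<in> {0<..<1} \<Longrightarrow> \<Gamma> k t \<in> Dk k"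
proof -
  assume k: "k \<in> {1..m}" and t: "t \<in> {0<..<1}"
  obtain h p where H: "homot k h p" using homot_exists[OF k] .
  show ?thesis using homotD(6)[OF H t] homotD(7)[OF H _ t, of 1] by simp
qed

lemma Gamma_in_Z: "k \<in> {1..m} \<Longrightarrow> t \<in> {0<..<1} \<Longrightarrow> \<Gamma> k t \<in> Z"
  unfolding Z_def contour_image_def arc_image_def by blast

lemma Gamma_facts:
  assumes "k \<in> {1..m}"
  shows "continuous_on {0<..<1} (\<Gamma> k)" "rectifiable_arc (\<Gamma> k)"
  using contour assms by (auto simp: is_contour_def)

lemma Gamma_length:
  assumes k: "k \<in> {1..m}" and ab: "0 < a" "b < 1"
  obtains L where "length_le (\<Gamma> k) {a..b} L"
proof -
  have sub: "{a..b} \<subseteq> {0<..<1}" using ab by auto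
  then have "compact (\<Gamma> k ` {a..b})"
    using Gamma_facts(1)[OF k] by (intro compact_continuous_image) (auto intro: continuous_on_subset)
  then show thesis using Gamma_facts(2)[OF k] sub compact_imp_bounded that unfolding rectifiable_arc_def by blast
qed

text \<open>A finite end point is a limit of points of the contour. Hence eigenvalues keep the
  distance d0 / 2 from it, and the resolvent factors stay bounded near the ends.\<close>

lemma finite_end_in_Zc:
  assumes k: "k \<in> {1..m}" and a: "a \<in> {\<mu>1 k, \<mu>2 k}" "\<bar>a\<bar> \<noteq> \<infinity>"
  shows "complex_of_real (real_of_ereal a) \<in> Zc"
proof -
  obtain h p where H: "homot k h p" using homot_exists[OF k] .
  define q where "q = complex_of_real (real_of_ereal a)"
  have "\<exists>w\<in>Z. dist w q < \<epsilon>" if \<epsilon>: "\<epsilon> > 0" for \<epsilon>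
  proof -
    have "\<exists>h'. (\<exists>t\<in>{0<..<1}. h' = h (1, t)) \<and> cmod (h' - q) < \<epsilon>"
    proof (cases "a = \<mu>1 k")
      case True
      obtain \<tau> where \<tau>: "\<tau> > 0" "\<And>s t. s \<in> {0..1} \<Longrightarrow> t \<in> {0<..<\<tau>} \<Longrightarrow> cmod (h (s, t) - q) < \<epsilon>"
        using filterlim_end_filter_right(1)[OF homotD(8)[OF H] a(2)[unfolded True] \<epsilon>] unfolding q_def True by blast
      define t where "t = min \<tau> 1 / 2"
      have "t \<in> {0<..<1}" "t \<in> {0<..<\<tau>}" using \<tau>(1) by (auto simp: t_def)
      then show ?thesis using \<tau>(2)[of 1 t] by (intro exI[of _ "h (1, t)"] conjI bexI[of _ t]) auto
    next
      case False
      then have a2: "a = \<mu>2 k" using a(1) by simp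
      obtain \<tau> where \<tau>: "\<tau> > 0" "\<And>s t. s \<in> {0..1} \<Longrightarrow> t \<in> {0<..<\<tau>} \<Longrightarrow> cmod ((case (s, t) of (s, t) \<Rightarrow> h (s, 1 - t)) - q) < \<epsilon>"
        using filterlim_end_filter_right(1)[OF filterlim_end_filter_flip[OF homotD(9)[OF H]] a(2)[unfolded a2] \<epsilon>] unfolding q_def a2 by blast
      define t where "t = min \<tau> 1 / 2"
      have t: "t \<in> {0<..<1}" "t \<in> {0<..<\<tau>}" using \<tau>(1) by (auto simp: t_def)
      then have "1 - t \<in> {0<..<1}" by auto
      then show ?thesis using \<tau>(2)[of 1 t] t by (intro exI[of _ "h (1, 1 - t)"] conjI bexI[of _ "1 - t"]) auto
    qed
    then obtain t where "t \<in> {0<..<1}" "cmod (h (1, t) - q) < \<epsilon>" by blast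
    then show ?thesis using Gamma_in_Z[OF k, of t] homotD(6)[OF H, of t] by (auto simp: dist_norm)
  qed
  then have "q \<in> closure Z" unfolding closure_approachable by blast
  then show ?thesis using closure_Z_subset by (auto simp: q_def)
qed

text \<open>By the identity theorem complex linearity spreads from the interval to a ball around a
  real point and from there to \<open>Dk k\<close>. The ball meets \<open>Dk k\<close> because the
  homotopy enters it when s tends to 0.\<close>

lemma K'_clinear:
  assumes k: "k \<in> {1..m}" and w: "w \<in> Dk k"
  shows "cinner (K' k w (c *\<^sub>C x)) y = c * cinner (K' k w x) y"
proof -
  obtain h p where H: "homot k h p" using homot_exists[OF k] .
  define g where "g w = cinner (K' k w (c *\<^sub>C x)) y - c * cinner (K' k w x) y" for w
  have g: "g holomorphic_on U k" unfolding g_def by (intro holomorphic_intros K'_holomorphic)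
  define x0 where "x0 = p (1 / 2)"
  have x0: "x0 \<in> \<Delta> k" using homot_to_real(3)[OF H, of "1 / 2"] by (simp add: x0_def)
  then have "complex_of_real x0 \<in> U k" using Dk_U(2)[OF k] by blast
  then obtain r where r: "r > 0" "ball (complex_of_real x0) r \<subseteq> U k" using U_open open_contains_ball by metis
  obtain r1 where r1: "r1 > 0" "ball x0 r1 \<subseteq> \<Delta> k" using Delta_open x0 open_contains_ball by metis
  let ?B = "ball (complex_of_real x0) r"
  let ?R = "complex_of_real ` ball x0 (min r r1)"
  have zero_ball: "g w = 0" if "w \<in> ?B" for w
  proof (rule analytic_continuation[where f = g and S = ?B and U = ?R and \<xi> = "complex_of_real x0"])
    show "g holomorphic_on ?B" using g r(2) holomorphic_on_subset by blast
    show "?R \<subseteq> ?B" by auto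
    show "complex_of_real x0 islimpt ?R"
      unfolding islimpt_approachable
    proof (intro allI impI)
      fix e :: real assume e: "e > 0"
      define d where "d = min e (min r r1) / 2"
      have d: "d > 0" "d < e" "d < min r r1" using e r(1) r1(1) by (auto simp: d_def)
      have "complex_of_real (x0 + d) \<in> ?R" using d by (intro imageI) (auto simp: dist_real_def)
      moreover have "dist (complex_of_real (x0 + d)) (complex_of_real x0) < e" using d by (simp add: dist_norm)
      ultimately show "\<exists>x'\<in>?R. x' \<noteq> complex_of_real x0 \<and> dist x' (complex_of_real x0) < e"
        using d by (intro bexI[of _ "complex_of_real (x0 + d)"]) auto
    qed
    show "g z = 0" if zR: "z \<in> ?R" for z
    proof -
      obtain t where t: "z = complex_of_real t" "t \<in> ball x0 (min r r1)" using zR by (rule imageE)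
      then have "t \<in> \<Delta> k" using r1(2) by auto
      with t(1) show ?thesis using K'_clinear_real[OF k] by (simp add: g_def)
    qed
  qed (use r that in auto)
  have "\<forall>\<^sub>F s in at_right 0. dist (h (s, 1 / 2)) (complex_of_real x0) < r"
    using tendstoD[OF homot_to_real(1)[OF H, of "1 / 2"] r(1)] by (simp add: x0_def)
  then have "\<forall>\<^sub>F s in at_right (0::real). h (s, 1 / 2) \<in> Dk k \<inter> ?B"
    using homot_to_real(2)[OF H, of "1 / 2", simplified] by eventually_elim (auto simp: dist_commute)
  then obtain s where s: "h (s, 1 / 2) \<in> Dk k \<inter> ?B" using eventually_happens'[of "at_right (0::real)"] by auto
  have opn: "open (Dk k \<inter> ?B)" using Dk_open[OF k] by auto
  have "g w = 0"
  proof (rule analytic_continuation[where f = g and S = "Dk k" and U = "Dk k \<inter> ?B" and \<xi> = "h (s, 1 / 2)"])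
    show "g holomorphic_on Dk k" using g Dk_U(1)[OF k] holomorphic_on_subset by blast
    show "h (s, 1 / 2) islimpt Dk k \<inter> ?B" 
    proof (rule interior_limit_point)
      show "h (s, 1 / 2) \<in> interior (Dk k \<inter> ?B)" using s by (simp only: interior_open[OF opn])
    qed
  qed (use Dk_open[OF k] Dk_connected[OF k] s w zero_ball in auto)
  then show ?thesis by (simp add: g_def)
qed

text \<open>The Hoelder condition is stated off the real axis only; points of the interval are
  reached as limits along the homotopy.\<close>

lemma K'_bounded_end:
  assumes k: "k \<in> {1..m}" and a: "a \<in> {\<mu>1 k, \<mu>2 k}" "\<bar>a\<bar> \<noteq> \<infinity>"
  obtains M where "\<And>w. w \<in> Dk k \<union> complex_of_real ` \<Delta> k \<Longrightarrow> cmod (w - complex_of_real (real_of_ereal a)) < 1 \<Longrightarrow> norm (K' k w) \<le> M"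
proof -
  define q where "q = real_of_ereal a"
  have "ereal q \<in> {\<mu>1 k, \<mu>2 k}" using a by (auto simp: q_def ereal_real)
  moreover have "\<forall>p. ereal p \<in> {\<mu>1 k, \<mu>2 k} \<longrightarrow> (\<exists>C>0. \<exists>\<gamma>>0. \<forall>\<mu>\<in>Dm k \<union> cnj ` Dm k.
      norm (K' k \<mu> - K' k (complex_of_real p)) \<le> C * cmod (\<mu> - complex_of_real p) powr \<gamma>)"
    using bspec[OF conjunct2[OF analyticity[unfolded analyticity_assumptions_def]] k] by (elim conjE)
  ultimately obtain C \<gamma> where C: "C > 0" "\<gamma> > 0" "\<And>w. w \<in> Dm k \<union> cnj ` Dm k \<Longrightarrow> norm (K' k w - K' k (complex_of_real q)) \<le> C * cmod (w - complex_of_real q) powr \<gamma>"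
    by blast
  define M where "M = norm (K' k (complex_of_real q)) + C"
  have D: "norm (K' k w) \<le> M" if w: "w \<in> Dk k" "cmod (w - complex_of_real q) < 1" for w
  proof -
    have "w \<in> Dm k \<union> cnj ` Dm k" using w(1) by (auto simp: Dk_def D_sheet_def split: if_splits)
    then have "norm (K' k w - K' k (complex_of_real q)) \<le> C * cmod (w - complex_of_real q) powr \<gamma>" by (rule C(3))
    also have "\<dots> \<le> C * 1" using C(1,2) w(2) by (intro mult_left_mono powr_le1) auto
    finally show ?thesis using norm_triangle_ineq2[of "K' k w" "K' k (complex_of_real q)"] by (simp add: M_def)
  qed
  obtain h p where H: "homot k h p" using homot_exists[OF k] .
  have R: "norm (K' k (complex_of_real x)) \<le> M" if x: "x \<in> \<Delta> k" "cmod (complex_of_real x - complex_of_real q) < 1" for x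
  proof -
    obtain t where t: "t \<in> {0<..<1}" "x = p t" using x(1) homotD(4)[OF H] by (metis imageE)
    have "isCont (K' k) (complex_of_real x)" using K'_isCont Dk_U(2)[OF k] x(1) by blast
    then have "((\<lambda>s. norm (K' k (h (s, t)))) \<longlongrightarrow> norm (K' k (complex_of_real x))) (at_right 0)"
      using homot_to_real(1)[OF H t(1)] t(2) by (intro tendsto_norm isCont_tendsto_compose[where g = "K' k"]) auto
    moreover have "((\<lambda>s. cmod (h (s, t) - complex_of_real q)) \<longlongrightarrow> cmod (complex_of_real x - complex_of_real q)) (at_right 0)"
      using homot_to_real(1)[OF H t(1)] t(2) by (intro tendsto_intros) auto
    then have "\<forall>\<^sub>F s in at_right 0. cmod (h (s, t) - complex_of_real q) < 1" using x(2) by (rule order_tendstoD)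
    then have "\<forall>\<^sub>F s in at_right 0. norm (K' k (h (s, t))) \<le> M"
      using homot_to_real(2)[OF H t(1)] by eventually_elim (use D in auto)
    ultimately show ?thesis by (rule tendsto_upperbound) simp
  qed
  show thesis by (rule that[of M]) (use D R in \<open>auto simp: q_def\<close>)
qed

lemma end_estimate:
  assumes k: "k \<in> {1..m}" and a: "a \<in> {\<mu>1 k, \<mu>2 k}"
    and P: "prim_along F h P ({0..1} \<times> {0<..t1})" and t1: "t1 > 0"
    and \<Phi>: "\<And>w. w \<in> Dk k \<Longrightarrow> (\<Phi> has_field_derivative F w) (at w)"
    and hD: "\<And>s t. s \<in> {0<..1} \<Longrightarrow> t \<in> {0<..t1} \<Longrightarrow> h (s, t) \<in> Dk k \<and> P (s, t) = \<Phi> (h (s, t))"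
    and hI: "\<And>t. t \<in> {0<..t1} \<Longrightarrow> h (0, t) \<in> complex_of_real ` \<Delta> k"
    and lim: "filterlim h (end_filter a) (principal {0..1} \<times>\<^sub>F at_right 0)"
    and neg: "\<bar>a\<bar> = \<infinity> \<Longrightarrow> negligible_transversals (K' k) h (at_right 0)"
    and len0: "\<bar>a\<bar> \<noteq> \<infinity> \<Longrightarrow> \<exists>t1>0. \<exists>L. length_le (\<lambda>t. h (0, t)) {0<..t1} L"
    and len1: "\<bar>a\<bar> \<noteq> \<infinity> \<Longrightarrow> \<exists>t1>0. \<exists>L. length_le (\<lambda>t. h (1, t)) {0<..t1} L"
    and C: "C \<ge> 0"
    and bfin: "\<bar>a\<bar> \<noteq> \<infinity> \<Longrightarrow> \<exists>r>0. \<forall>w\<in>Dk k \<union> complex_of_real ` \<Delta> k. cmod (w - complex_of_real (real_of_ereal a)) < r \<longrightarrow> cmod (F w) \<le> C * norm (K' k w)"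
    and binf: "\<bar>a\<bar> = \<infinity> \<Longrightarrow> \<exists>R. \<forall>w\<in>Dk k \<union> complex_of_real ` \<Delta> k. cmod w > R \<longrightarrow> cmod (F w) \<le> C * (norm (K' k w) / (1 + cmod w))"
    and e: "e > 0"
  shows "\<exists>\<^sub>F t in at_right 0. cmod (P (1, t) - P (0, t)) < e"
proof (rule homotopy_end_estimate[where I = "complex_of_real ` \<Delta> k" and N = "\<lambda>w. norm (K' k w) / (1 + cmod w)", OF P t1 Dk_open[OF k] \<Phi> hD hI lim _ _ len0 len1 _ _ e])
  assume fin: "\<bar>a\<bar> \<noteq> \<infinity>"
  obtain r where r: "a = ereal r" using fin by (cases a) auto
  show "complex_of_real (real_of_ereal a) \<notin> Dk k \<union> complex_of_real ` \<Delta> k"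
    using Dk_not_real[OF k, of _ r] a unfolding r by (auto simp: Delta_def)
  obtain M where M: "\<And>w. w \<in> Dk k \<union> complex_of_real ` \<Delta> k \<Longrightarrow> cmod (w - complex_of_real (real_of_ereal a)) < 1 \<Longrightarrow> norm (K' k w) \<le> M"
    using K'_bounded_end[OF k a fin] by blast
  obtain r where r: "r > 0" "\<And>w. w \<in> Dk k \<union> complex_of_real ` \<Delta> k \<Longrightarrow> cmod (w - complex_of_real (real_of_ereal a)) < r \<Longrightarrow> cmod (F w) \<le> C * norm (K' k w)"
    using bfin[OF fin] by blast
  have "cmod (F w) \<le> C * M" if w: "w \<in> Dk k \<union> complex_of_real ` \<Delta> k" "cmod (w - complex_of_real (real_of_ereal a)) < min r 1" for w
  proof -
    have "cmod (F w) \<le> C * norm (K' k w)" using r(2)[OF w(1)] w(2) by simp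
    also have "\<dots> \<le> C * M" using M[OF w(1)] w(2) C by (intro mult_left_mono) auto
    finally show ?thesis .
  qed
  then show "\<exists>r>0. \<exists>M. \<forall>w\<in>Dk k \<union> complex_of_real ` \<Delta> k. cmod (w - complex_of_real (real_of_ereal a)) < r \<longrightarrow> cmod (F w) \<le> M"
    using r(1) by (intro exI[of _ "min r 1"]) auto
next
  assume "\<bar>a\<bar> = \<infinity>"
  then show "\<exists>R. \<exists>C\<ge>0. \<forall>w\<in>Dk k \<union> complex_of_real ` \<Delta> k. cmod w > R \<longrightarrow> cmod (F w) \<le> C * (norm (K' k w) / (1 + cmod w))"
  proof -
    obtain R where R: "\<forall>w\<in>Dk k \<union> complex_of_real ` \<Delta> k. cmod w > R \<longrightarrow> cmod (F w) \<le> C * (norm (K' k w) / (1 + cmod w))"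
      using binf[OF \<open>\<bar>a\<bar> = \<infinity>\<close>] by (rule exE)
    show ?thesis by (rule exI[of _ R], rule exI[of _ C], rule conjI[OF C R])
  qed
next
  fix e' :: real assume inf: "\<bar>a\<bar> = \<infinity>" and e': "e' > 0"
  show "\<exists>\<^sub>F t in at_right 0. \<exists>I<e'. has_RS_integral (\<lambda>s u v. dist (h (u, t)) (h (v, t)) * (norm (K' k (h (s, t))) / (1 + cmod (h (s, t))))) I 0 1"
    by (rule neg[OF inf, unfolded negligible_transversals_def, rule_format, OF e'])
qed auto

lemma rectifiable_near_end:
  assumes g: "rectifiable_arc g" and \<tau>: "\<tau> > 0" "\<And>t. t \<in> {0<..<\<tau>} \<Longrightarrow> cmod (g t - q) < 1"
  shows "\<exists>t1>0. \<exists>L. length_le g {0<..t1} L"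
proof -
  define t1 where "t1 = min \<tau> 1 / 2"
  have t1: "t1 > 0" "t1 < \<tau>" "t1 < 1" using \<tau>(1) by (auto simp: t1_def)
  have "g ` {0<..t1} \<subseteq> ball q 1" using \<tau>(2) t1 by (auto simp: dist_norm norm_minus_commute)
  then have "bounded (g ` {0<..t1})" using bounded_ball bounded_subset by blast
  moreover have "{0<..t1} \<subseteq> {0<..<1}" using t1 by auto
  ultimately show ?thesis using g t1(1) unfolding rectifiable_arc_def by blast
qed

text \<open>P is a primitive along the homotopy only near the two ends, since F may have a pole at
  an interior point of the interval. It is enough that P (1, t) and P (0, t) are close for
  parameters t arbitrarily near each end.\<close>

lemma end_estimates:
  assumes H: "homot k h p" and \<Phi>: "\<And>w. w \<in> Dk k \<Longrightarrow> (\<Phi> has_field_derivative F w) (at w)"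
    and t1: "t1 \<in> {0<..<1}" and P1: "prim_along F h P ({0..1} \<times> {0<..t1})"
    and t2: "t2 \<in> {0<..<1}" and P2: "prim_along F h P ({0..1} \<times> {t2..<1})"
    and P\<Phi>: "\<And>s t. s \<in> {0<..1} \<Longrightarrow> t \<in> {0<..<1} \<Longrightarrow> P (s, t) = \<Phi> (h (s, t))"
    and C: "C \<ge> 0"
    and bfin: "\<And>a. a \<in> {\<mu>1 k, \<mu>2 k} \<Longrightarrow> \<bar>a\<bar> \<noteq> \<infinity> \<Longrightarrow> \<exists>r>0. \<forall>w\<in>Dk k \<union> complex_of_real ` \<Delta> k. cmod (w - complex_of_real (real_of_ereal a)) < r \<longrightarrow> cmod (F w) \<le> C * norm (K' k w)"
    and binf: "\<exists>R. \<forall>w\<in>Dk k \<union> complex_of_real ` \<Delta> k. cmod w > R \<longrightarrow> cmod (F w) \<le> C * (norm (K' k w) / (1 + cmod w))"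
    and e: "e > 0"
  shows "\<exists>\<^sub>F t in at_right 0. cmod (P (1, t) - P (0, t)) < e" "\<exists>\<^sub>F t in at_left 1. cmod (P (1, t) - P (0, t)) < e"
proof -
  note k = homotD(1)[OF H]
  have mono: "p s \<le> p t" if "s \<in> {0<..<1}" "t \<in> {0<..<1}" "s \<le> t" for s t
    using strict_mono_on_leD[OF homotD(3)[OF H] that] .
  show "\<exists>\<^sub>F t in at_right 0. cmod (P (1, t) - P (0, t)) < e"
  proof (rule end_estimate[OF k _ P1 _ \<Phi> _ _ homotD(8)[OF H] homotD(10)[OF H] _ _ C bfin binf e])
    show "h (s, t) \<in> Dk k \<and> P (s, t) = \<Phi> (h (s, t))" if "s \<in> {0<..1}" "t \<in> {0<..t1}" for s t
      using homotD(7)[OF H] P\<Phi> that t1 by auto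
    show "h (0, t) \<in> complex_of_real ` \<Delta> k" if "t \<in> {0<..t1}" for t
      using homotD(5)[OF H, of t] homot_to_real(3)[OF H, of t] that t1 by auto
    assume fin: "\<bar>\<mu>1 k\<bar> \<noteq> \<infinity>"
    obtain \<tau> where \<tau>: "\<tau> > 0" "\<And>s t. s \<in> {0..1} \<Longrightarrow> t \<in> {0<..<\<tau>} \<Longrightarrow> cmod (h (s, t) - complex_of_real (real_of_ereal (\<mu>1 k))) < 1"
      using filterlim_end_filter_right(1)[OF homotD(8)[OF H] fin, of 1] by auto
    define t0 where "t0 = min \<tau> 1 / 2"
    have t0: "t0 > 0" "t0 < \<tau>" "t0 < 1" using \<tau>(1) by (auto simp: t0_def)
    have "p t - p s \<le> p t0 - real_of_ereal (\<mu>1 k)" if "s \<in> {0<..t0}" "t \<in> {0<..t0}" for s t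
    proof -
      have "p t \<le> p t0" using that t0 by (intro mono) auto
      moreover have "p s \<in> \<Delta> k" using homot_to_real(3)[OF H, of s] that t0 by auto
      then have "real_of_ereal (\<mu>1 k) \<le> p s" using fin by (cases "\<mu>1 k") (auto simp: Delta_def)
      ultimately show ?thesis by simp
    qed
    then have "length_le (\<lambda>t. complex_of_real (p t)) {0<..t0} (p t0 - real_of_ereal (\<mu>1 k))"
      using t0 by (intro length_le_mono_real mono) auto
    then have "length_le (\<lambda>t. h (0, t)) {0<..t0} (p t0 - real_of_ereal (\<mu>1 k))"
      by (rule length_le_cong) (use homotD(5)[OF H] t0 in auto)
    then show "\<exists>t1>0. \<exists>L. length_le (\<lambda>t. h (0, t)) {0<..t1} L" using t0 by blast
    have "cmod (\<Gamma> k t - complex_of_real (real_of_ereal (\<mu>1 k))) < 1" if "t \<in> {0<..<min \<tau> 1}" for t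
      using \<tau>(2)[of 1 t] homotD(6)[OF H, of t] that by auto
    then obtain u L where u: "u > 0" "length_le (\<Gamma> k) {0<..u} L"
      using rectifiable_near_end[OF Gamma_facts(2)[OF k], of "min \<tau> 1"] \<tau>(1) by (metis min_less_iff_conj zero_less_one)
    have "length_le (\<lambda>t. h (1, t)) {0<..min u (1 / 2)} L"
      by (rule length_le_cong[OF length_le_subset[OF u(2)]]) (use homotD(6)[OF H] in auto)
    then show "\<exists>t1>0. \<exists>L. length_le (\<lambda>t. h (1, t)) {0<..t1} L" using u(1) by (intro exI[of _ "min u (1 / 2)"]) auto
  qed (use t1 in auto)
  \<comment> \<open>The right end is reflected to the left one; the lengths of the arcs and the
    transversals are reflected with it.\<close>
  define h' where "h' = (\<lambda>(s, t). h (s, 1 - t))"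
  define P' where "P' = (\<lambda>(s, t). P (s, 1 - t))"
  have "\<exists>\<^sub>F t in at_right 0. cmod (P' (1, t) - P' (0, t)) < e"
  proof (rule end_estimate[OF k _ _ _ \<Phi> _ _ _ _ _ _ C bfin binf e, where h = h' and a = "\<mu>2 k" and ?t1.0 = "1 - t2"])
    have "prim_along F (h \<circ> (\<lambda>x. (fst x, 1 - snd x))) (P \<circ> (\<lambda>x. (fst x, 1 - snd x))) ({0..1} \<times> {0<..1 - t2})"
      using t2 by (intro prim_along_compose[OF P2] continuous_intros) auto
    then show "prim_along F h' P' ({0..1} \<times> {0<..1 - t2})" by (simp add: h'_def P'_def o_def case_prod_unfold)
    show "h' (s, t) \<in> Dk k \<and> P' (s, t) = \<Phi> (h' (s, t))" if "s \<in> {0<..1}" "t \<in> {0<..1 - t2}" for s t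
      using homotD(7)[OF H, of s "1 - t"] P\<Phi>[of s "1 - t"] that t2 by (auto simp: h'_def P'_def)
    show "h' (0, t) \<in> complex_of_real ` \<Delta> k" if "t \<in> {0<..1 - t2}" for t
      using homotD(5)[OF H, of "1 - t"] homot_to_real(3)[OF H, of "1 - t"] that t2 by (auto simp: h'_def)
    show lim': "filterlim h' (end_filter (\<mu>2 k)) (principal {0..1} \<times>\<^sub>F at_right 0)"
      unfolding h'_def by (rule filterlim_end_filter_flip[OF homotD(9)[OF H]])
    show "negligible_transversals (K' k) h' (at_right 0)" if "\<bar>\<mu>2 k\<bar> = \<infinity>"
      using homotD(11)[OF H that] unfolding negligible_transversals_def frequently_at_left_one_iff by (simp add: h'_def)
    assume fin: "\<bar>\<mu>2 k\<bar> \<noteq> \<infinity>"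
    obtain \<tau> where \<tau>: "\<tau> > 0" "\<And>s t. s \<in> {0..1} \<Longrightarrow> t \<in> {0<..<\<tau>} \<Longrightarrow> cmod (h' (s, t) - complex_of_real (real_of_ereal (\<mu>2 k))) < 1"
      using filterlim_end_filter_right(1)[OF lim' fin, of 1] by auto
    define t0 where "t0 = min \<tau> 1 / 2"
    have t0: "t0 > 0" "t0 < \<tau>" "t0 < 1" using \<tau>(1) by (auto simp: t0_def)
    have im: "(\<lambda>t. 1 - t) ` {1 - u..<1} = {0<..u::real}" for u
    proof (intro equalityI subsetI)
      fix x assume "x \<in> {0<..u}"
      then show "x \<in> (\<lambda>t. 1 - t) ` {1 - u..<1}" by (intro image_eqI[of _ _ "1 - x"]) auto
    qed auto
    have "p t - p s \<le> real_of_ereal (\<mu>2 k) - p (1 - t0)" if "s \<in> {1 - t0..<1}" "t \<in> {1 - t0..<1}" for s t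
    proof -
      have "p (1 - t0) \<le> p s" using that t0 by (intro mono) auto
      moreover have "p t \<in> \<Delta> k" using homot_to_real(3)[OF H, of t] that t0 by auto
      then have "p t \<le> real_of_ereal (\<mu>2 k)" using fin by (cases "\<mu>2 k") (auto simp: Delta_def)
      ultimately show ?thesis by simp
    qed
    then have "length_le (\<lambda>t. complex_of_real (p t)) {1 - t0..<1} (real_of_ereal (\<mu>2 k) - p (1 - t0))"
      using t0 by (intro length_le_mono_real mono) auto
    then have "length_le (\<lambda>t. complex_of_real (p (1 - t))) {0<..t0} (real_of_ereal (\<mu>2 k) - p (1 - t0))"
      using length_le_flip[of "\<lambda>t. complex_of_real (p t)" "{1 - t0..<1}"] unfolding im[of t0] by blast
    then have "length_le (\<lambda>t. h' (0, t)) {0<..t0} (real_of_ereal (\<mu>2 k) - p (1 - t0))"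
      by (rule length_le_cong) (use homotD(5)[OF H] t0 in \<open>auto simp: h'_def\<close>)
    then show "\<exists>t1>0. \<exists>L. length_le (\<lambda>t. h' (0, t)) {0<..t1} L" using t0 by blast
    have bd: "cmod (\<Gamma> k t - complex_of_real (real_of_ereal (\<mu>2 k))) < 1" if "t \<in> {1 - t0..<1}" for t
      using \<tau>(2)[of 1 "1 - t"] homotD(6)[OF H, of t] that t0 by (auto simp: h'_def)
    then have "\<Gamma> k ` {1 - t0..<1} \<subseteq> ball (complex_of_real (real_of_ereal (\<mu>2 k))) 1" by (auto simp: dist_norm norm_minus_commute)
    then have "bounded (\<Gamma> k ` {1 - t0..<1})" using bounded_ball bounded_subset by blast
    moreover have "{1 - t0..<1} \<subseteq> {0<..<1}" using t0 by auto
    ultimately obtain L where "length_le (\<Gamma> k) {1 - t0..<1} L" using Gamma_facts(2)[OF k] unfolding rectifiable_arc_def by blast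
    then have "length_le (\<lambda>t. \<Gamma> k (1 - t)) {0<..t0} L" using length_le_flip[of "\<Gamma> k" "{1 - t0..<1}" L] unfolding im[of t0] by blast
    then have "length_le (\<lambda>t. h' (1, t)) {0<..t0} L"
      by (rule length_le_cong) (use homotD(6)[OF H] t0 in \<open>auto simp: h'_def\<close>)
    then show "\<exists>t1>0. \<exists>L. length_le (\<lambda>t. h' (1, t)) {0<..t1} L" using t0 by blast
  qed (use t2 in auto)
  then show "\<exists>\<^sub>F t in at_left 1. cmod (P (1, t) - P (0, t)) < e"
    unfolding frequently_at_left_one_iff by (simp add: P'_def)
qed

end

section \<open>Contour integrals over the arcs and half residues\<close>

lemma prim_along_of_primitive:
  assumes c: "continuous_on S c" "c ` S \<subseteq> D" and D: "open D" and \<Phi>: "\<And>w. w \<in> D \<Longrightarrow> (\<Phi> has_field_derivative F w) (at w)"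
  shows "prim_along F c (\<lambda>x. \<Phi> (c x)) S"
  unfolding prim_along_def
proof (intro conjI ballI c(1))
  fix x assume x: "x \<in> S"
  then obtain r where r: "r > 0" "ball (c x) r \<subseteq> D" using c(2) D open_contains_ball by blast
  show "\<exists>r>0. \<exists>\<Phi>'. (\<forall>w\<in>ball (c x) r. (\<Phi>' has_field_derivative F w) (at w)) \<and>
        (\<exists>d>0. \<forall>y\<in>S. dist y x < d \<longrightarrow> \<Phi> (c y) = \<Phi>' (c y))"
  proof (rule exI[of _ r], rule conjI[OF r(1)], rule exI[of _ \<Phi>], rule conjI)
    show "\<forall>w\<in>ball (c x) r. (\<Phi> has_field_derivative F w) (at w)" using \<Phi> r(2) by blast
    show "\<exists>d>0. \<forall>y\<in>S. dist y x < d \<longrightarrow> \<Phi> (c y) = \<Phi> (c y)" by (rule exI[of _ 1]) simp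
  qed
qed

lemma prim_along_cong:
  assumes "prim_along F c P S" "\<And>x. x \<in> S \<Longrightarrow> c x = c' x" "\<And>x. x \<in> S \<Longrightarrow> P x = P' x"
  shows "prim_along F c' P' S"
proof -
  have "continuous_on S c' \<longleftrightarrow> continuous_on S c" using assms(2) by (intro continuous_on_cong) auto
  then show ?thesis using assms unfolding prim_along_def by simp
qed

lemma resolvent_apply:
  assumes z: "z \<notin> spectrum A" and x: "x \<in> op_dom A" "op_app A x - z *\<^sub>C x = y"
  shows "resolvent A z y = x"
proof -
  obtain R where R: "is_resolvent A z R" using z by (auto simp: spectrum_def)
  have "R' = R" if "is_resolvent A z R'" for R'
  proof (rule blinfun_eqI)
    fix u
    have "R' u \<in> op_dom A" "op_app A (R' u) - z *\<^sub>C R' u = u" using that by (auto simp: is_resolvent_def)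
    then show "R' u = R u" using R unfolding is_resolvent_def by metis
  qed
  then have "resolvent A z = R" unfolding resolvent_def using R by blast
  then show ?thesis using R x by (auto simp: is_resolvent_def)
qed

lemma norm_diff_add_le: "cmod (x - y + z) \<le> cmod x + cmod y + cmod z"
  using norm_triangle_ineq[of "x - y" z] norm_triangle_ineq4[of x y] by linarith

lemma Im_Ln_imaginary:
  assumes "y \<noteq> 0"
  shows "Im (Ln (\<i> * complex_of_real y)) = sgn y * pi / 2"
proof (cases "y > 0")
  case True
  then show ?thesis using Im_Ln_eq_pi_half[of "\<i> * complex_of_real y"] by auto
next
  case False
  then have y: "y < 0" using assms by simp
  have "Im (Ln (\<i> * complex_of_real (- y))) = pi / 2" using Im_Ln_eq_pi_half[of "\<i> * complex_of_real (- y)"] y by auto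
  moreover have "\<i> * complex_of_real (- y) \<notin> \<real>\<^sub>\<le>\<^sub>0" using y by (auto simp: complex_nonpos_Reals_iff)
  then have "cnj (Ln (\<i> * complex_of_real (- y))) = Ln (cnj (\<i> * complex_of_real (- y)))" by (rule cnj_Ln)
  from arg_cong[OF this, of Im] have "- Im (Ln (\<i> * complex_of_real (- y))) = Im (Ln (\<i> * complex_of_real y))" by simp
  ultimately show ?thesis using y by (simp add: sgn_if del: of_real_minus mult_minus_right)
qed

context matrix_setting
begin

lemma bounded_linear_form: "bounded_linear (\<lambda>T :: 'h1 \<Rightarrow>\<^sub>L 'h1. cinner (T x) y)"
  by (rule bounded_linear_compose[OF bounded_bilinear.bounded_linear_left[OF bounded_bilinear_cinner] blinfun.bounded_linear_left])

lemma form_bound: "cmod (cinner ((T :: 'h1 \<Rightarrow>\<^sub>L 'h1) x) y) \<le> norm T * norm x * norm y"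
proof -
  have "cmod (cinner (T x) y) \<le> norm (T x) * norm y" by (rule cmod_cinner_le)
  also have "\<dots> \<le> norm T * norm x * norm y" by (intro mult_right_mono norm_blinfun) auto
  finally show ?thesis .
qed

text \<open>From the distance d0 / 2 between the eigenvalue and the end point, a ball of radius d0 /
  4 leaves d0 / 4.\<close>

lemma inverse_near_end:
  assumes k: "k \<in> {1..m}" and a: "a \<in> {\<mu>1 k, \<mu>2 k}" "\<bar>a\<bar> \<noteq> \<infinity>" and lam: "eigval lam"
    and w: "cmod (w - complex_of_real (real_of_ereal a)) < d0 / 4"
  shows "cmod (1 / (complex_of_real lam - w)) \<le> 4 / d0"
proof -
  have "d0 / 2 \<le> cmod (complex_of_real lam - complex_of_real (real_of_ereal a))"
    using eigval_dist[OF lam finite_end_in_Zc[OF k a]] .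
  also have "\<dots> \<le> cmod (complex_of_real lam - w) + cmod (w - complex_of_real (real_of_ereal a))"
    using norm_triangle_ineq[of "complex_of_real lam - w" "w - complex_of_real (real_of_ereal a)"] by simp
  finally have "d0 / 4 \<le> cmod (complex_of_real lam - w)" using w by linarith
  then have "1 / cmod (complex_of_real lam - w) \<le> 1 / (d0 / 4)" using d0_pos by (intro divide_left_mono mult_pos_pos) auto
  then show ?thesis by (simp add: norm_divide)
qed

text \<open>The bound has the form of the weight 1 / (1 + cmod w) that occurs in the condition on
  the transversals at infinity.\<close>

lemma inverse_near_infinity:
  assumes "cmod w > 2 * \<bar>lam\<bar> + 1"
  shows "cmod (1 / (complex_of_real lam - w)) \<le> 4 / (1 + cmod w)"
proof -
  have "cmod w \<le> cmod (complex_of_real lam - w) + \<bar>lam\<bar>"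
    using norm_triangle_ineq4[of "complex_of_real lam" "complex_of_real lam - w"] by simp
  then have *: "(1 + cmod w) / 4 \<le> cmod (complex_of_real lam - w)" using assms
    by (cases "lam \<ge> 0") (simp_all add: field_simps)
  have "1 + cmod w > 0" by (simp add: add_pos_nonneg)
  then have "1 / cmod (complex_of_real lam - w) \<le> 1 / ((1 + cmod w) / 4)" using * by (intro divide_left_mono mult_pos_pos) auto
  then show ?thesis by (simp add: norm_divide)
qed

lemma Z_resolvent: "w \<in> Z \<Longrightarrow> w \<notin> spectrum H1"
proof
  assume w: "w \<in> Z" "w \<in> spectrum H1"
  obtain r where "r > 0" "\<forall>z\<in>spectrum H1. \<forall>w\<in>Z. r \<le> dist z w"
    using X(2) unfolding has_V1_def Z_def H1 by blast
  then show False using w by fastforce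
qed

lemma resolvent_eigenvector:
  assumes \<phi>: "\<phi> \<in> eigenspace H1 (complex_of_real lam)" "eigval lam" and w: "w \<in> Z"
  shows "resolvent H1 w \<phi> = (1 / (complex_of_real lam - w)) *\<^sub>C \<phi>"
proof (rule resolvent_apply[OF Z_resolvent[OF w]])
  have nz: "complex_of_real lam - w \<noteq> 0" using eigval_dist[OF \<phi>(2), of w] closure_Z_subset(3) w d0_pos by auto
  show "(1 / (complex_of_real lam - w)) *\<^sub>C \<phi> \<in> op_dom H1"
    using eig[OF \<phi>(1)] cvs.subspace_scale[OF self_adjoint_csubspace[OF A1]] by (simp add: dom_H1(1))
  have "op_app H1 ((1 / (complex_of_real lam - w)) *\<^sub>C \<phi>) - w *\<^sub>C ((1 / (complex_of_real lam - w)) *\<^sub>C \<phi>)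
       = ((1 / (complex_of_real lam - w)) * (complex_of_real lam - w)) *\<^sub>C \<phi>"
    using eig[OF \<phi>(1)] H1_scale[of \<phi>]
    by (simp add: scaleC_scaleC right_diff_distrib cvs.scale_left_diff_distrib diff_divide_distrib)
  then show "op_app H1 ((1 / (complex_of_real lam - w)) *\<^sub>C \<phi>) - w *\<^sub>C ((1 / (complex_of_real lam - w)) *\<^sub>C \<phi>) = \<phi>"
    using nz by simp
qed

lemma homot_real_primitive:
  assumes H: "homot k h p" and P: "prim_along F h P ({0..1} \<times> {0<..<1})"
  obtains \<beta> where "\<And>t. t \<in> {0<..<1} \<Longrightarrow> \<beta> (p t) = P (0, t)"
    "\<And>x. x \<in> \<Delta> k \<Longrightarrow> (\<beta> has_vector_derivative F (complex_of_real x)) (at x)"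
proof -
  have "prim_along F (h \<circ> (\<lambda>t. (0, t))) (P \<circ> (\<lambda>t. (0, t))) {0<..<1}"
    by (rule prim_along_compose[OF P]) (auto intro!: continuous_intros)
  then have "prim_along F (\<lambda>t. complex_of_real (p t)) (\<lambda>t. P (0, t)) {0<..<1}"
    by (rule prim_along_cong) (use homotD(5)[OF H] in auto)
  then obtain \<beta> where \<beta>: "\<And>t. t \<in> {0<..<1} \<Longrightarrow> \<beta> (p t) = P (0, t)"
    "\<And>t. t \<in> {0<..<1} \<Longrightarrow> p ` {0<..<1} = \<Delta> k \<Longrightarrow> open (\<Delta> k) \<Longrightarrow> (\<beta> has_vector_derivative F (complex_of_real (p t))) (at (p t))"
    by (rule prim_along_real_parametrization[OF _ homotD(3)[OF H]]) blast
  have "(\<beta> has_vector_derivative F (complex_of_real x)) (at x)" if "x \<in> \<Delta> k" for x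
  proof -
    have "x \<in> p ` {0<..<1}" using that homotD(4)[OF H] by simp
    then obtain t where "t \<in> {0<..<1}" "x = p t" by (rule imageE) simp
    then show ?thesis using \<beta>(2) homotD(4)[OF H] Delta_open by simp
  qed
  with \<beta>(1) show thesis by (rule that)
qed

text \<open>The imaginary part of the contour integral is the half residue at \<open>lam\<close> picked up when
  the contour is pushed back to the real axis.\<close>

lemma arc_integral_Im:
  assumes k: "k \<in> {1..m}" and \<phi>: "\<phi> \<in> eigenspace H1 (complex_of_real lam)" and lam: "eigval lam"
    and T: "has_arc_integral (\<Gamma> k) (\<lambda>\<mu>. K' k \<mu> o\<^sub>L resolvent H1 \<mu>) T"
  shows "Im (cinner (T \<phi>) \<phi>) = sg k * pi * (if lam \<in> \<Delta> k then Re (cinner (K' k (complex_of_real lam) \<phi>) \<phi>) else 0)"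
proof -
  obtain h p where H: "homot k h p" using homot_exists[OF k] .
  \<comment> \<open>On \<Delta> k the function q is real, so that F has at most a simple pole at
    lam, with residue - \<kappa>; off \<Delta> k the value 0 makes the two cases uniform.\<close>
  define \<kappa> where "\<kappa> = (if lam \<in> \<Delta> k then Re (cinner (K' k (complex_of_real lam) \<phi>) \<phi>) else 0)"
  define q where "q w = cinner (K' k w \<phi>) \<phi>" for w
  have qU: "q holomorphic_on U k" unfolding q_def by (rule K'_holomorphic)
  have q_real: "Im (q (complex_of_real x)) = 0" if "x \<in> \<Delta> k" for x
    unfolding q_def by (rule Im_zero_if_cnj_eq, rule K'_symmetric[OF k that])
  define F where "F w = q w / (complex_of_real lam - w)" for w
  \<comment> \<open>F2 is F with its principal part removed; it is holomorphic across the interval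
    and can be moved through the homotopy. The principal part is integrated separately by a
    logarithm.\<close>
  have "\<exists>W F2. open W \<and> W \<subseteq> U k \<and> Dk k \<subseteq> W \<and> complex_of_real ` \<Delta> k \<subseteq> W \<and> F2 holomorphic_on W \<and>
      (\<forall>w\<in>W. w \<noteq> complex_of_real lam \<longrightarrow> F2 w = F w + complex_of_real \<kappa> / (w - complex_of_real lam))"
  proof (cases "lam \<in> \<Delta> k")
    case True
    have qk: "q (complex_of_real lam) = complex_of_real \<kappa>" using q_real[OF True] True by (simp add: \<kappa>_def q_def complex_eq_iff)
    let ?G = "\<lambda>w. - (if w = complex_of_real lam then deriv q (complex_of_real lam) else (q w - q (complex_of_real lam)) / (w - complex_of_real lam))"
    have "?G holomorphic_on U k" by (intro holomorphic_on_minus pole_lemma_open[OF qU U_open])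
    moreover have "?G w = F w + complex_of_real \<kappa> / (w - complex_of_real lam)" if "w \<noteq> complex_of_real lam" for w
    proof -
      have "complex_of_real lam - w = - (w - complex_of_real lam)" by simp
      then have "F w = - q w / (w - complex_of_real lam)" unfolding F_def by (metis divide_minus_right minus_divide_left)
      then show ?thesis using that qk by (simp add: diff_divide_distrib)
    qed
    ultimately show ?thesis using U_open Dk_U[OF k] by (intro exI[of _ "U k"] exI[of _ ?G]) auto
  next
    case False
    have "F holomorphic_on U k - {complex_of_real lam}" unfolding F_def
      by (intro holomorphic_intros holomorphic_on_subset[OF qU]) auto
    moreover have "open (U k - {complex_of_real lam})" using U_open by (intro open_Diff) auto
    moreover have "Dk k \<subseteq> U k - {complex_of_real lam}" using Dk_U(1)[OF k] Dk_not_real[OF k] by auto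
    moreover have "complex_of_real ` \<Delta> k \<subseteq> U k - {complex_of_real lam}" using Dk_U(2)[OF k] False by auto
    moreover have "\<kappa> = 0" using False by (simp add: \<kappa>_def)
    ultimately show ?thesis by (intro exI[of _ "U k - {complex_of_real lam}"] exI[of _ F]) auto
  qed
  then obtain W F2 where W: "open W" "Dk k \<subseteq> W" "complex_of_real ` \<Delta> k \<subseteq> W" "F2 holomorphic_on W"
    and F2: "\<And>w. w \<in> W \<Longrightarrow> w \<noteq> complex_of_real lam \<Longrightarrow> F2 w = F w + complex_of_real \<kappa> / (w - complex_of_real lam)" by blast
  obtain \<Phi>2 where \<Phi>2: "\<And>w. w \<in> Dk k \<Longrightarrow> (\<Phi>2 has_field_derivative F2 w) (at w)"
    using Dk_primitive[OF k holomorphic_on_subset[OF W(4,2)]] by blast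
  have h0W: "h (0, t) \<in> W" if "t \<in> {0<..<1}" for t
    using homotD(5)[OF H that] homot_to_real(3)[OF H that] W(3) by auto
  obtain P2 where P2: "prim_along F2 h P2 ({0..1} \<times> {0<..<1})"
    "\<And>s t. s \<in> {0<..1} \<Longrightarrow> t \<in> {0<..<1} \<Longrightarrow> P2 (s, t) = \<Phi>2 (h (s, t))"
    using prim_along_homotopy[OF W(1) Dk_open[OF k] W(2,4) homotD(2)[OF H] homotD(7)[OF H] h0W \<Phi>2] by blast
  \<comment> \<open>The logarithm is cut along the ray from lam into the half-plane opposite to
    \<open>Dk k\<close>. All of \<open>Dk k\<close> and the interval without lam remain in
    V.\<close>
  define V where "V = W \<inter> {w. - \<i> * complex_of_real (sg k) * (w - complex_of_real lam) \<notin> \<real>\<^sub>\<le>\<^sub>0}"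
  have "{w. - \<i> * complex_of_real (sg k) * (w - complex_of_real lam) \<notin> \<real>\<^sub>\<le>\<^sub>0} = (\<lambda>w. - \<i> * complex_of_real (sg k) * (w - complex_of_real lam)) -` (- \<real>\<^sub>\<le>\<^sub>0)" by auto
  moreover have "open ((\<lambda>w. - \<i> * complex_of_real (sg k) * (w - complex_of_real lam)) -` (- \<real>\<^sub>\<le>\<^sub>0))"
    by (intro open_vimage continuous_intros) (simp add: closed_nonpos_Reals_complex open_Compl)
  ultimately have V: "open V" using W(1) by (auto simp: V_def)
  have sg: "sg k = 1 \<or> sg k = -1" by (auto simp: sg_def)
  have DkV: "Dk k \<subseteq> V"
  proof
    fix w assume w: "w \<in> Dk k"
    have "Re (- \<i> * complex_of_real (sg k) * (w - complex_of_real lam)) = sg k * Im w" by simp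
    then show "w \<in> V" using Dk_side[OF k w] W(2) w by (auto simp: V_def complex_nonpos_Reals_iff)
  qed
  have realV: "complex_of_real x \<in> V" if "x \<in> \<Delta> k" "x \<noteq> lam" for x
    using W(3) that sg by (auto simp: V_def complex_nonpos_Reals_iff)
  \<comment> \<open>On the real axis the imaginary part of \<open>Lg\<close> jumps at lam by sg k *
    pi * \<kappa>; this jump is the half residue.\<close>
  define Lg where "Lg w = - complex_of_real \<kappa> * Ln (- \<i> * complex_of_real (sg k) * (w - complex_of_real lam))" for w
  have Lg: "(Lg has_field_derivative - complex_of_real \<kappa> / (w - complex_of_real lam)) (at w)" if "w \<in> V" for w
  proof -
    have n: "- \<i> * complex_of_real (sg k) * (w - complex_of_real lam) \<notin> \<real>\<^sub>\<le>\<^sub>0" using that by (simp add: V_def)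
    then have nz: "w - complex_of_real lam \<noteq> 0" by auto
    have "(Lg has_field_derivative - complex_of_real \<kappa> * (inverse (- \<i> * complex_of_real (sg k) * (w - complex_of_real lam)) * (- \<i> * complex_of_real (sg k)))) (at w)"
      unfolding Lg_def using n by (auto intro!: derivative_eq_intros)
    moreover have "- complex_of_real \<kappa> * (inverse (- \<i> * complex_of_real (sg k) * (w - complex_of_real lam)) * (- \<i> * complex_of_real (sg k))) = - complex_of_real \<kappa> / (w - complex_of_real lam)"
      using nz sg by (auto simp: field_simps)
    ultimately show ?thesis by simp
  qed
  have VF: "F w = F2 w + (- complex_of_real \<kappa> / (w - complex_of_real lam))" if "w \<in> V" for w
  proof -
    have "w \<in> W" "w \<noteq> complex_of_real lam" using that by (auto simp: V_def)
    then show ?thesis using F2 by simp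
  qed
  define P where "P x = P2 x + Lg (h x)" for x
  define \<Phi> where "\<Phi> w = \<Phi>2 w + Lg w" for w
  have \<Phi>: "(\<Phi> has_field_derivative F w) (at w)" if w: "w \<in> Dk k" for w
    unfolding \<Phi>_def[abs_def] using DERIV_add[OF \<Phi>2[OF w] Lg] VF DkV w by auto
  have P\<Phi>: "P (s, t) = \<Phi> (h (s, t))" if "s \<in> {0<..1}" "t \<in> {0<..<1}" for s t
    using P2(2)[OF that] by (simp add: P_def \<Phi>_def)
  have Ppa: "prim_along F h P ({0..1} \<times> T)" if T: "T \<subseteq> {0<..<1}" "\<And>t. t \<in> T \<Longrightarrow> p t \<noteq> lam" for T
    unfolding P_def
  proof (rule prim_along_add[OF prim_along_subset[OF P2(1)] V _ Lg VF])
    show "h ` ({0..1} \<times> T) \<subseteq> V"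
    proof
      fix z assume "z \<in> h ` ({0..1} \<times> T)"
      then obtain s t where st: "s \<in> {0..1}" "t \<in> T" "z = h (s, t)" by auto
      then have t: "t \<in> {0<..<1}" using T(1) by blast
      show "z \<in> V"
      proof (cases "s = 0")
        case True
        then show ?thesis using realV[OF homot_to_real(3)[OF H t] T(2)[OF st(2)]] homotD(5)[OF H t] st(3) by simp
      next
        case False
        then show ?thesis using homotD(7)[OF H _ t, of s] st DkV by auto
      qed
    qed
  qed (use T(1) in auto)
  \<comment> \<open>Before t1 and after t2 the real side of the homotopy avoids lam, on its left and
    on its right, so the full primitive P is available near both ends.\<close>
  obtain t1 t2 where t12: "t1 \<in> {0<..<1}" "t2 \<in> {0<..<1}" "t1 \<le> t2"
    "\<And>t. t \<in> {0<..t1} \<Longrightarrow> lam \<in> \<Delta> k \<Longrightarrow> p t < lam" "\<And>t. t \<in> {t2..<1} \<Longrightarrow> lam \<in> \<Delta> k \<Longrightarrow> lam < p t"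
  proof (cases "lam \<in> \<Delta> k")
    case True
    then have "lam \<in> p ` {0<..<1}" using homotD(4)[OF H] by simp
    then obtain u where u: "u \<in> {0<..<1}" "lam = p u" by (rule imageE) simp
    have lt: "p s < p t" if "s \<in> {0<..<1}" "t \<in> {0<..<1}" "s < t" for s t
      using homotD(3)[OF H] that unfolding strict_mono_on_def by blast
    show thesis
    proof (rule that[of "u / 2" "(u + 1) / 2"])
      show "p t < lam" if "t \<in> {0<..u / 2}" for t unfolding u(2) using that u(1) by (intro lt) auto
      show "lam < p t" if "t \<in> {(u + 1) / 2..<1}" for t unfolding u(2) using that u(1) by (intro lt) auto
    qed (use u in auto)
  next
    case False
    show thesis by (rule that[of "1/2" "1/2"]) (use False in auto)
  qed
  have pne: "p t \<noteq> lam" if "t \<in> {0<..<1}" "t \<le> t1 \<or> t2 \<le> t" for t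
    using t12(4)[of t] t12(5)[of t] homot_to_real(3)[OF H that(1)] that by (cases "lam \<in> \<Delta> k") auto
  define C where "C = (norm \<phi>)\<^sup>2 * (4 / d0 + 4)"
  have C0: "C \<ge> 0" using d0_pos by (simp add: C_def)
  have Fle: "cmod (F w) \<le> norm (K' k w) * ((norm \<phi>)\<^sup>2 * cmod (1 / (complex_of_real lam - w)))" for w
  proof -
    have "cmod (F w) = cmod (q w) * cmod (1 / (complex_of_real lam - w))" by (simp add: F_def norm_divide)
    also have "\<dots> \<le> (norm (K' k w) * norm \<phi> * norm \<phi>) * cmod (1 / (complex_of_real lam - w))"
      unfolding q_def by (intro mult_right_mono form_bound) auto
    finally show ?thesis by (simp add: power2_eq_square mult_ac)
  qed
  have bfin: "\<exists>r>0. \<forall>w\<in>Dk k \<union> complex_of_real ` \<Delta> k. cmod (w - complex_of_real (real_of_ereal a)) < r \<longrightarrow> cmod (F w) \<le> C * norm (K' k w)"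
    if a: "a \<in> {\<mu>1 k, \<mu>2 k}" "\<bar>a\<bar> \<noteq> \<infinity>" for a
  proof (rule exI[of _ "d0 / 4"], intro conjI ballI impI)
    fix w assume "cmod (w - complex_of_real (real_of_ereal a)) < d0 / 4"
    then have "cmod (1 / (complex_of_real lam - w)) \<le> 4 / d0 + 4" using inverse_near_end[OF k a lam] by fastforce
    then have "norm (K' k w) * ((norm \<phi>)\<^sup>2 * cmod (1 / (complex_of_real lam - w))) \<le> norm (K' k w) * ((norm \<phi>)\<^sup>2 * (4 / d0 + 4))"
      by (intro mult_left_mono) auto
    then show "cmod (F w) \<le> C * norm (K' k w)" using Fle[of w] unfolding C_def by (simp only: mult.commute)
  qed (use d0_pos in simp)
  have binf: "\<exists>R. \<forall>w\<in>Dk k \<union> complex_of_real ` \<Delta> k. cmod w > R \<longrightarrow> cmod (F w) \<le> C * (norm (K' k w) / (1 + cmod w))"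
  proof (rule exI[of _ "2 * \<bar>lam\<bar> + 1"], intro ballI impI)
    fix w assume w: "cmod w > 2 * \<bar>lam\<bar> + 1"
    have "cmod (1 / (complex_of_real lam - w)) \<le> 4 / (1 + cmod w)" by (rule inverse_near_infinity[OF w])
    also have "\<dots> \<le> (4 / d0 + 4) / (1 + cmod w)" using d0_pos by (intro divide_right_mono) auto
    finally have "norm (K' k w) * ((norm \<phi>)\<^sup>2 * cmod (1 / (complex_of_real lam - w))) \<le> norm (K' k w) * ((norm \<phi>)\<^sup>2 * ((4 / d0 + 4) / (1 + cmod w)))"
      by (intro mult_left_mono) auto
    also have "\<dots> = C * (norm (K' k w) / (1 + cmod w))" by (simp add: C_def)
    finally show "cmod (F w) \<le> C * (norm (K' k w) / (1 + cmod w))" using Fle[of w] by simp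
  qed
  have T1: "prim_along F h P ({0..1} \<times> {0<..t1})" using t12(1) pne by (intro Ppa) auto
  have T2: "prim_along F h P ({0..1} \<times> {t2..<1})" using t12(2) pne by (intro Ppa) auto
  note ends0 = end_estimates[OF H \<Phi> t12(1) T1 t12(2) T2 P\<Phi> C0 bfin binf]
  have ends: "\<exists>\<^sub>F t in at_right 0. cmod (P (1, t) - P (0, t)) < e" "\<exists>\<^sub>F t in at_left 1. cmod (P (1, t) - P (0, t)) < e" if "e > 0" for e
    by (rule ends0(1); simp add: that) (rule ends0(2); simp add: that)
  obtain Q where Q: "\<And>a b. 0 < a \<Longrightarrow> a < b \<Longrightarrow> b < 1 \<Longrightarrow>
      has_RS_integral (\<lambda>t u v. cscale_op (\<Gamma> k v - \<Gamma> k u) (K' k (\<Gamma> k t) o\<^sub>L resolvent H1 (\<Gamma> k t))) (Q a b) a b"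
    "((\<lambda>(a, b). Q a b) \<longlongrightarrow> T) (at_right 0 \<times>\<^sub>F at_left 1)"
    using T unfolding has_arc_integral_def by blast
  have Qval: "cinner (Q a b \<phi>) \<phi> = P (1, b) - P (1, a)" if ab: "0 < a" "a < b" "b < 1" for a b
  proof -
    have sub: "{a..b} \<subseteq> {0<..<1}" using ab by auto
    have RS: "has_RS_integral (\<lambda>t u v. (\<Gamma> k v - \<Gamma> k u) * F (\<Gamma> k t)) (cinner (Q a b \<phi>) \<phi>) a b"
    proof (rule has_RS_integral_bounded_linear[OF Q(1)[OF ab] bounded_linear_form[of \<phi> \<phi>]])
      fix t u v assume "t \<in> {a..b}"
      then have t: "t \<in> {0<..<1}" using sub by blast
      have "cinner (K' k (\<Gamma> k t) ((1 / (complex_of_real lam - \<Gamma> k t)) *\<^sub>C \<phi>)) \<phi> = F (\<Gamma> k t)"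
        unfolding K'_clinear[OF k Gamma_in_Dk[OF k t]] by (simp add: F_def q_def)
      then show "(\<Gamma> k v - \<Gamma> k u) * F (\<Gamma> k t) = cinner (cscale_op (\<Gamma> k v - \<Gamma> k u) (K' k (\<Gamma> k t) o\<^sub>L resolvent H1 (\<Gamma> k t)) \<phi>) \<phi>"
        by (simp add: cscale_op_apply cinner_scaleC_left resolvent_eigenvector[OF \<phi> lam Gamma_in_Z[OF k t]])
    qed
    obtain L where L: "length_le (\<Gamma> k) {a..b} L" using Gamma_length[OF k ab(1,3)] .
    have "prim_along F (\<Gamma> k) (\<lambda>t. \<Phi> (\<Gamma> k t)) {a..b}"
      using Gamma_facts(1)[OF k] Gamma_in_Dk[OF k] sub by (intro prim_along_of_primitive[OF _ _ Dk_open[OF k] \<Phi>]) (auto intro: continuous_on_subset)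
    from prim_along_RS_integral[OF this L ab(2) RS]
    have "cinner (Q a b \<phi>) \<phi> = \<Phi> (\<Gamma> k b) - \<Phi> (\<Gamma> k a)" .
    then show ?thesis using P\<Phi>[of 1 a] P\<Phi>[of 1 b] homotD(6)[OF H, of a] homotD(6)[OF H, of b] ab by simp
  qed
  have Plim: "((\<lambda>(a, b). cinner (Q a b \<phi>) \<phi>) \<longlongrightarrow> cinner (T \<phi>) \<phi>) (at_right 0 \<times>\<^sub>F at_left 1)"
    using bounded_linear.tendsto[OF bounded_linear_form[of \<phi> \<phi>] Q(2)] by (simp add: case_prod_unfold)
  \<comment> \<open>F2 is real on the interval, except perhaps at lam, so the regular part does not
    contribute to the imaginary part along the real side.\<close>
  have P2real: "Im (P2 (0, b)) = Im (P2 (0, a))" if ab: "a \<in> {0<..<1}" "b \<in> {0<..<1}" "a < b" for a b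
  proof -
    obtain \<beta> where \<beta>: "\<And>t. t \<in> {0<..<1} \<Longrightarrow> \<beta> (p t) = P2 (0, t)"
      "\<And>x. x \<in> \<Delta> k \<Longrightarrow> (\<beta> has_vector_derivative F2 (complex_of_real x)) (at x)"
      using homot_real_primitive[OF H P2(1)] by blast
    note \<beta>d = \<beta>(2)
    have sub: "{p a..p b} \<subseteq> \<Delta> k" using Delta_Icc homot_to_real(3)[OF H] ab by blast
    have le: "p a < p b" using homotD(3)[OF H] ab unfolding strict_mono_on_def by blast
    have "Im (\<beta> (p b)) = Im (\<beta> (p a))"
    proof (rule has_derivative_zero_unique_strong_interval[of "{lam}" "p a" "p b" "\<lambda>x. Im (\<beta> x)"])
      show "continuous_on {p a..p b} (\<lambda>x. Im (\<beta> x))"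
      proof (intro continuous_intros)
        show "continuous_on {p a..p b} \<beta>"
          using \<beta>d sub by (intro continuous_at_imp_continuous_on ballI has_vector_derivative_continuous) blast
      qed
      fix x assume x: "x \<in> {p a..p b} - {lam}"
      then have xD: "x \<in> \<Delta> k" using sub by blast
      then have "complex_of_real x \<in> W" using W(3) by blast
      then have "F2 (complex_of_real x) = q (complex_of_real x) / complex_of_real (lam - x) + complex_of_real (\<kappa> / (x - lam))"
        using F2[of "complex_of_real x"] x by (simp add: F_def)
      then have "Im (F2 (complex_of_real x)) = 0" using q_real[OF xD] by (simp add: Im_divide_of_real)
      then have "((\<lambda>x. Im (\<beta> x)) has_vector_derivative 0) (at x)"
        using bounded_linear.has_vector_derivative[OF bounded_linear_Im \<beta>d[OF xD]] by simp
      then show "((\<lambda>x. Im (\<beta> x)) has_derivative (\<lambda>h. 0)) (at x within {p a..p b})"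
        unfolding has_vector_derivative_def by (auto intro: has_derivative_at_withinI)
    qed (use le in auto)
    then show ?thesis using \<beta>(1) ab by simp
  qed
  have ImLg: "Im (Lg (complex_of_real x)) = \<kappa> * sg k * sgn (x - lam) * pi / 2" if "x \<noteq> lam" for x
  proof -
    have "- \<i> * complex_of_real (sg k) * (complex_of_real x - complex_of_real lam) = \<i> * complex_of_real (- sg k * (x - lam))" by simp
    then have "Im (Ln (- \<i> * complex_of_real (sg k) * (complex_of_real x - complex_of_real lam))) = sgn (- sg k * (x - lam)) * pi / 2"
      using Im_Ln_imaginary[of "- sg k * (x - lam)"] that sg by (simp only:) auto
    then show ?thesis using sg by (auto simp: Lg_def sgn_mult)
  qed
  \<comment> \<open>One third of e for the limit that defines the arc integral, one third for
    crossing the homotopy at each end.\<close>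
  have "\<bar>Im (cinner (T \<phi>) \<phi>) - sg k * pi * \<kappa>\<bar> \<le> e" if e: "e > 0" for e
  proof -
    have e3: "e / 3 > 0" using e by simp
    have "\<forall>\<^sub>F x in at_right 0 \<times>\<^sub>F at_left 1. dist ((\<lambda>(a, b). cinner (Q a b \<phi>) \<phi>) x) (cinner (T \<phi>) \<phi>) < e / 3"
      using tendstoD[OF Plim e3] .
    then obtain Pf Pg where PP: "eventually Pf (at_right (0::real))" "eventually Pg (at_left (1::real))"
      "\<And>a b. Pf a \<Longrightarrow> Pg b \<Longrightarrow> dist (cinner (Q a b \<phi>) \<phi>) (cinner (T \<phi>) \<phi>) < e / 3"
      unfolding eventually_prod_filter by auto
    have "\<forall>\<^sub>F t in at_right 0. t \<in> {0<..<t1}" using t12(1) by (intro eventually_at_right_real) auto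
    then have "\<forall>\<^sub>F t in at_right 0. Pf t \<and> t \<in> {0<..<t1}" using PP(1) by eventually_elim auto
    from frequently_ex[OF frequently_eventually_frequently[OF ends(1)[OF e3] this]]
    obtain a where a: "cmod (P (1, a) - P (0, a)) < e / 3" "Pf a" "a \<in> {0<..<t1}" by blast
    have "\<forall>\<^sub>F t in at_left 1. t \<in> {t2<..<1}" using t12(2) by (intro eventually_at_left_real) auto
    then have "\<forall>\<^sub>F t in at_left 1. Pg t \<and> t \<in> {t2<..<1}" using PP(2) by eventually_elim auto
    from frequently_ex[OF frequently_eventually_frequently[OF ends(2)[OF e3] this]]
    obtain b where b: "cmod (P (1, b) - P (0, b)) < e / 3" "Pg b" "b \<in> {t2<..<1}" by blast
    have ab: "0 < a" "a < b" "b < 1" "a \<in> {0<..<1}" "b \<in> {0<..<1}" using a(3) b(3) t12 by auto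
    have "cmod (P (1, b) - P (1, a) - cinner (T \<phi>) \<phi>) < e / 3"
      using PP(3)[OF a(2) b(2)] Qval[OF ab(1,2,3)] by (simp add: dist_norm)
    moreover have "P (0, b) - P (0, a) - cinner (T \<phi>) \<phi> = (P (1, b) - P (1, a) - cinner (T \<phi>) \<phi>) - (P (1, b) - P (0, b)) + (P (1, a) - P (0, a))" by simp
    then have "cmod (P (0, b) - P (0, a) - cinner (T \<phi>) \<phi>) \<le> cmod (P (1, b) - P (1, a) - cinner (T \<phi>) \<phi>) + cmod (P (1, b) - P (0, b)) + cmod (P (1, a) - P (0, a))"
      using norm_diff_add_le by (simp only:)
    ultimately have "cmod (P (0, b) - P (0, a) - cinner (T \<phi>) \<phi>) < e" using a(1) b(1) by linarith
    then have "\<bar>Im (P (0, b) - P (0, a) - cinner (T \<phi>) \<phi>)\<bar> < e" using abs_Im_le_cmod order_le_less_trans by blast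
    moreover have "Im (P (0, b) - P (0, a)) = sg k * pi * \<kappa>"
    proof -
      have "Im (P (0, b) - P (0, a)) = Im (Lg (complex_of_real (p b))) - Im (Lg (complex_of_real (p a)))"
        using P2real[OF ab(4,5,2)] homotD(5)[OF H ab(4)] homotD(5)[OF H ab(5)] by (simp add: P_def)
      also have "\<dots> = sg k * pi * \<kappa>"
      proof (cases "lam \<in> \<Delta> k")
        case True
        then have "p a < lam" "lam < p b" using t12(4)[of a] t12(5)[of b] a(3) b(3) by auto
        then have A: "Im (Lg (complex_of_real (p b))) = \<kappa> * sg k * pi / 2" "Im (Lg (complex_of_real (p a))) = - (\<kappa> * sg k * pi / 2)"
          using ImLg[of "p a"] ImLg[of "p b"] by auto
        show ?thesis unfolding A by (simp add: mult_ac)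
      next
        case False
        then show ?thesis by (simp add: \<kappa>_def Lg_def)
      qed
      finally show ?thesis .
    qed
    ultimately show ?thesis by simp
  qed
  then have "\<bar>Im (cinner (T \<phi>) \<phi>) - sg k * pi * \<kappa>\<bar> \<le> 0" by (rule field_le_epsilon) simp
  then show ?thesis by (simp add: \<kappa>_def)
qed

end

section \<open>Vanishing of K' on eigenvectors and removal of the poles\<close>

lemma (in spectral_operator) norm_lessThan_continuous_on:
  assumes "\<And>t. t \<in> T \<Longrightarrow> E {t} x = 0"
  shows "continuous_on T (\<lambda>\<sigma>. (norm (E {..<\<sigma>} x))\<^sup>2)"
proof -
  have "continuous_on T (cdf (\<nu> x))" using norm_lessThan_continuous(1)[OF assms] by (intro continuous_at_imp_continuous_on) auto
  moreover have "continuous_on T (cdf (\<nu> x)) \<longleftrightarrow> continuous_on T (\<lambda>\<sigma>. (norm (E {..<\<sigma>} x))\<^sup>2)"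
    using norm_lessThan_continuous(2)[OF assms] by (intro continuous_on_cong) auto
  ultimately show ?thesis by blast
qed

lemma (in spectral_operator) norm_interval_le_derivative:
  assumes ab: "a \<le> b" and atoms: "\<And>t. t \<in> {a..b} \<Longrightarrow> E {t} x = 0"
    and D: "\<And>t. t \<in> {a<..<b} \<Longrightarrow> ((\<lambda>\<sigma>. (norm (E {..<\<sigma>} x))\<^sup>2) has_real_derivative L t) (at t)"
    and L: "\<And>t. t \<in> {a<..<b} \<Longrightarrow> L t \<le> C"
  shows "(norm (E {a..<b} x))\<^sup>2 \<le> C * (b - a)"
proof (cases "a < b")
  case True
  have "\<exists>l z. a < z \<and> z < b \<and> ((\<lambda>\<sigma>. (norm (E {..<\<sigma>} x))\<^sup>2) has_real_derivative l) (at z) \<and>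
      (norm (E {..<b} x))\<^sup>2 - (norm (E {..<a} x))\<^sup>2 = (b - a) * l"
    using D by (intro MVT[OF True norm_lessThan_continuous_on[OF atoms]]) (auto simp: real_differentiable_def)
  then obtain l z where z: "a < z" "z < b" "((\<lambda>\<sigma>. (norm (E {..<\<sigma>} x))\<^sup>2) has_real_derivative l) (at z)"
    "(norm (E {a..<b} x))\<^sup>2 = (b - a) * l" using norm_interval[OF ab] by auto
  have "l \<le> C" using DERIV_unique[OF z(3) D] L z(1,2) by auto
  then show ?thesis using z(4) True by (simp add: mult.commute mult_left_mono)
qed (use ab in \<open>simp add: empty\<close>)

lemma deriv_zero_at_real_minimum:
  assumes q: "q holomorphic_on U" "open U" and x: "complex_of_real x \<in> U" and d: "d > 0"
    and re: "\<And>y. \<bar>x - y\<bar> < d \<Longrightarrow> Re (q (complex_of_real x)) \<le> Re (q (complex_of_real y))"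
    and im: "\<And>y. \<bar>x - y\<bar> < d \<Longrightarrow> Im (q (complex_of_real y)) = 0"
  shows "deriv q (complex_of_real x) = 0"
proof -
  define D where "D = deriv q (complex_of_real x)"
  have "(q has_field_derivative D) (at (complex_of_real x))"
    unfolding D_def by (rule holomorphic_derivI[OF q x])
  then have v: "((\<lambda>y. q (complex_of_real y)) has_vector_derivative D) (at x)"
    by (rule has_vector_derivative_real_field)
  have "((\<lambda>y. Re (q (complex_of_real y))) has_real_derivative Re D) (at x)"
    using bounded_linear.has_vector_derivative[OF bounded_linear_Re v] by (simp add: has_real_derivative_iff_has_vector_derivative)
  then have "Re D = 0" using d re by (intro DERIV_local_min) auto
  moreover have "((\<lambda>y. Im (q (complex_of_real y))) has_real_derivative Im D) (at x)"
    using bounded_linear.has_vector_derivative[OF bounded_linear_Im v] by (simp add: has_real_derivative_iff_has_vector_derivative)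
  then have "Im D = 0" using d im by (intro DERIV_local_min[where d = d]) auto
  ultimately show ?thesis by (simp add: D_def complex_eq_iff)
qed

context matrix_setting
begin

lemma B10_inner: "cinner (B10 z) y = cinner z (B01 y)"
proof -
  have "cinner (B01 y) z = cinner y (B10 z)" using B10 unfolding is_adjoint_def by (elim allE)
  then have "cnj (cinner y (B10 z)) = cnj (cinner (B01 y) z)" by (simp only:)
  then show ?thesis unfolding cinner_commute[symmetric] .
qed

text \<open>Every Riemann sum is real at an eigenvector: the resolvent acts as the real number 1 /
  (lam - \<xi>), and E0 d is a projection.\<close>

lemma measure_integral_Im:
  assumes \<phi>: "\<phi> \<in> eigenspace H1 (complex_of_real lam)" and lam: "eigval lam"
    and T: "has_measure_integral (\<lambda>d. B10 o\<^sub>L E0 d o\<^sub>L B01) (\<lambda>\<mu>. resolvent H1 (complex_of_real \<mu>)) T \<sigma>'"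
  shows "Im (cinner (T \<phi>) \<phi>) = 0"
proof -
  have "\<bar>Im (cinner (T \<phi>) \<phi>)\<bar> \<le> e" if e: "e > 0" for e
  proof -
    define e' where "e' = e / ((norm \<phi>)\<^sup>2 + 1)"
    have "(norm \<phi>)\<^sup>2 + 1 > 0" by (simp add: add_nonneg_pos)
    then have e': "e' > 0" "e' * ((norm \<phi>)\<^sup>2 + 1) = e" using e by (auto simp: e'_def)
    obtain r where r: "r > 0" "\<forall>(d :: nat \<Rightarrow> real set) \<xi>. range d \<subseteq> sets borel \<longrightarrow> disjoint_family d \<longrightarrow> (\<Union>n. d n) = \<sigma>' \<longrightarrow>
       (\<forall>n. \<forall>x\<in>d n. \<forall>y\<in>d n. dist x y < r) \<longrightarrow> (\<forall>n. d n \<noteq> {} \<longrightarrow> \<xi> n \<in> d n) \<longrightarrow>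
       (\<exists>V. (\<lambda>n. (B10 o\<^sub>L E0 (d n) o\<^sub>L B01) o\<^sub>L resolvent H1 (complex_of_real (\<xi> n))) sums V \<and> norm (V - T) < e')"
      using mp[OF HOL.spec[OF T[unfolded has_measure_integral_def], of e'] e'(1)] by (elim exE conjE) (rule that)
    define d where "d n = \<sigma>' \<inter> grid_cell r n" for n
    define \<xi> where "\<xi> n = (SOME t. t \<in> d n)" for n
    note g = grid_cell[OF r(1)]
    have \<xi>: "d n \<noteq> {} \<Longrightarrow> \<xi> n \<in> d n" for n unfolding \<xi>_def by (rule some_in_eq[THEN iffD2])
    have d: "d n \<in> sets borel" for n unfolding d_def using g(1) sigma'_borel by blast
    obtain V where V: "(\<lambda>n. (B10 o\<^sub>L E0 (d n) o\<^sub>L B01) o\<^sub>L resolvent H1 (complex_of_real (\<xi> n))) sums V" "norm (V - T) < e'"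
    proof -
      have P1: "range d \<subseteq> sets borel" using d by blast
      have P2: "disjoint_family d" using g(2) unfolding d_def disjoint_family_on_def by blast
      have P3: "(\<Union>n. d n) = \<sigma>'" using g(3) unfolding d_def by blast
      have P4: "\<forall>n. \<forall>x\<in>d n. \<forall>y\<in>d n. dist x y < r" using g(4) unfolding d_def dist_real_def by blast
      have P5: "\<forall>n. d n \<noteq> {} \<longrightarrow> \<xi> n \<in> d n" using \<xi> by blast
      note mp[OF mp[OF mp[OF mp[OF mp[OF HOL.spec[OF HOL.spec[OF r(2), of d], of \<xi>] P1] P2] P3] P4] P5]
      then show thesis by (elim exE conjE) (rule that)
    qed
    have "Im (cinner (((B10 o\<^sub>L E0 (d n) o\<^sub>L B01) o\<^sub>L resolvent H1 (complex_of_real (\<xi> n))) \<phi>) \<phi>) = 0" for n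
    proof (cases "d n = {}")
      case True
      then show ?thesis by (simp add: empty blinfun.zero_right)
    next
      case False
      then have "\<xi> n \<in> \<sigma>'" using \<xi> by (auto simp: d_def)
      then have "complex_of_real (\<xi> n) \<in> Z" by (simp add: Z_def)
      then have "resolvent H1 (complex_of_real (\<xi> n)) \<phi> = complex_of_real (1 / (lam - \<xi> n)) *\<^sub>C \<phi>"
        using resolvent_eigenvector[OF \<phi> lam] by simp
      then have "cinner (((B10 o\<^sub>L E0 (d n) o\<^sub>L B01) o\<^sub>L resolvent H1 (complex_of_real (\<xi> n))) \<phi>) \<phi>
         = complex_of_real (1 / (lam - \<xi> n)) * cinner (E0 (d n) (B01 \<phi>)) (B01 \<phi>)"
        using B01 by (simp add: B10_inner clinear_op_def scaleC[OF d] cinner_scaleC_left del: of_real_divide of_real_diff)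
      also have "\<dots> = complex_of_real (1 / (lam - \<xi> n) * (norm (E0 (d n) (B01 \<phi>)))\<^sup>2)" by (simp add: norm_sq[OF d])
      finally show ?thesis by (simp only: Im_complex_of_real)
    qed
    moreover have "(\<lambda>n. Im (cinner (((B10 o\<^sub>L E0 (d n) o\<^sub>L B01) o\<^sub>L resolvent H1 (complex_of_real (\<xi> n))) \<phi>) \<phi>)) sums Im (cinner (V \<phi>) \<phi>)"
      by (intro bounded_linear.sums[OF bounded_linear_Im] bounded_linear.sums[OF bounded_linear_form] V(1))
    ultimately have "Im (cinner (V \<phi>) \<phi>) = 0" by (simp add: sums_iff)
    then have "Im (cinner (T \<phi>) \<phi>) = - Im (cinner ((V - T) \<phi>) \<phi>)" by (simp add: blinfun.diff_left cinner_diff_left)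
    then have "\<bar>Im (cinner (T \<phi>) \<phi>)\<bar> \<le> cmod (cinner ((V - T) \<phi>) \<phi>)" using abs_Im_le_cmod[of "cinner ((V - T) \<phi>) \<phi>"] by simp
    also have "\<dots> \<le> norm (V - T) * (norm \<phi>)\<^sup>2" using form_bound[of "V - T" \<phi> \<phi>] by (simp add: power2_eq_square mult_ac)
    also have "\<dots> \<le> e' * ((norm \<phi>)\<^sup>2 + 1)" using V(2) e'(1) by (intro mult_mono) auto
    finally show ?thesis using e'(2) by simp
  qed
  then have "\<bar>Im (cinner (T \<phi>) \<phi>)\<bar> \<le> 0" by (rule field_le_epsilon) simp
  then show ?thesis by simp
qed

text \<open>A1 is self-adjoint and lam is real, so the form of X at \<phi> is real. The intervals
  are disjoint, hence only the one containing lam has a half residue and the signs \<open>sg\<close>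
  cannot produce cancellation. A null vector of the nonnegative form K' lies in its kernel, and
  symmetry gives the kernel on the other side.\<close>

lemma K'_eigenvector_zero:
  assumes k: "k \<in> {1..m}" and lam: "lam \<in> \<Delta> k" "eigval lam" and \<phi>: "\<phi> \<in> eigenspace H1 (complex_of_real lam)"
  shows "cinner (K' k (complex_of_real lam) \<phi>) y = 0" "cinner (K' k (complex_of_real lam) y) \<phi> = 0"
proof -
  obtain T0 Tk where T: "has_measure_integral (\<lambda>d. B10 o\<^sub>L E0 d o\<^sub>L B01) (\<lambda>\<mu>. resolvent H1 (complex_of_real \<mu>)) T0 \<sigma>'"
    "\<And>j. j \<in> {1..m} \<Longrightarrow> has_arc_integral (\<Gamma> j) (\<lambda>\<mu>. K' j \<mu> o\<^sub>L resolvent H1 \<mu>) (Tk j)"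
    "X = T0 + (\<Sum>j\<in>{1..m}. Tk j)"
    using X(2) unfolding has_V1_def H1 by blast
  have \<phi>1: "\<phi> \<in> op_dom A1" using eig[OF \<phi>] by simp
  have "Im (cinner (op_app A1 \<phi>) \<phi>) = 0"
    by (rule Im_zero_if_cnj_eq) (use self_adjoint_symmetric[OF A1 \<phi>1 \<phi>1] cinner_commute[of \<phi> "op_app A1 \<phi>"] in simp)
  moreover have "X \<phi> = complex_of_real lam *\<^sub>C \<phi> - op_app A1 \<phi>" using eig[OF \<phi>] dom_H1(2)[of \<phi>] by (simp add: algebra_simps)
  then have "cinner (X \<phi>) \<phi> = complex_of_real (lam * (norm \<phi>)\<^sup>2) - cinner (op_app A1 \<phi>) \<phi>"
    by (simp add: cinner_diff_left cinner_scaleC_left cinner_self)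
  ultimately have X0: "Im (cinner (X \<phi>) \<phi>) = 0" by simp
  define \<kappa> where "\<kappa> j = (if lam \<in> \<Delta> j then Re (cinner (K' j (complex_of_real lam) \<phi>) \<phi>) else 0)" for j
  have "Im (cinner (X \<phi>) \<phi>) = Im (cinner (T0 \<phi>) \<phi>) + (\<Sum>j\<in>{1..m}. Im (cinner (Tk j \<phi>) \<phi>))"
    by (simp add: T(3) blinfun.add_left blinfun.sum_left cinner_add_left cinner_sum_left)
  also have "\<dots> = (\<Sum>j\<in>{1..m}. sg j * pi * \<kappa> j)"
    using measure_integral_Im[OF \<phi> lam(2) T(1)] arc_integral_Im[OF _ \<phi> lam(2) T(2)] by (simp add: \<kappa>_def)
  also have "\<dots> = (\<Sum>j\<in>{1..m}. if j = k then sg k * pi * \<kappa> k else 0)"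
  proof (rule sum.cong[OF refl])
    fix j assume j: "j \<in> {1..m}"
    show "sg j * pi * \<kappa> j = (if j = k then sg k * pi * \<kappa> k else 0)"
      using Delta_disjoint[OF j k] lam(1) by (auto simp: \<kappa>_def)
  qed
  also have "\<dots> = sg k * pi * \<kappa> k" using k by (simp add: sum.delta)
  finally have "\<kappa> k = 0" using X0 by (auto simp: sg_def split: if_splits)
  then have "Re (cinner (K' k (complex_of_real lam) \<phi>) \<phi>) = 0" using lam(1) by (simp add: \<kappa>_def)
  then show z: "cinner (K' k (complex_of_real lam) \<phi>) y = 0" for y by (rule K'_null[OF k lam(1)])
  show "cinner (K' k (complex_of_real lam) y) \<phi> = 0" using K'_symmetric[OF k lam(1), of y \<phi>] z by simp
qed

text \<open>On the interval and in \<open>Dk k\<close> this is the form of K' w at fw w and fw (cnj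
  w). Expanded, the conjugation of the second argument cancels and holomorphy in w becomes
  visible.\<close>

definition quad :: "nat \<Rightarrow> real set \<Rightarrow> (real \<Rightarrow> 'h1) \<Rightarrow> complex \<Rightarrow> complex"
  where "quad k \<Lambda> \<phi> w = (\<Sum>l\<in>\<Lambda>. \<Sum>l'\<in>\<Lambda>. cinner (K' k w (\<phi> l)) (\<phi> l') / ((complex_of_real l - w) * (complex_of_real l' - w)))"

text \<open>A mixed term has simple poles, cancelled by the zeros of K' on the two eigenvectors. A
  diagonal term has a double pole; its numerator is real and nonnegative on the interval and zero at
  the eigenvalue, so its derivative vanishes there as well.\<close>

lemma quad_extension:
  assumes k: "k \<in> {1..m}" and \<Lambda>: "finite \<Lambda>"
    and \<phi>: "\<And>l. l \<in> \<Lambda> \<Longrightarrow> \<phi> l \<in> eigenspace H1 (complex_of_real l)" "\<And>l. l \<in> \<Lambda> \<Longrightarrow> eigval l"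
  obtains W G where "open W" "Dk k \<subseteq> W" "complex_of_real ` \<Delta> k \<subseteq> W" "G holomorphic_on W"
    "\<And>w. w \<in> W \<Longrightarrow> w \<notin> complex_of_real ` \<Lambda> \<Longrightarrow> G w = quad k \<Lambda> \<phi> w"
proof -
  \<comment> \<open>\<open>U k\<close> may contain eigenvalues outside the interval, where K' has
    not been shown to annihilate the eigenvector; they are cut out.\<close>
  define W where "W = U k - complex_of_real ` (\<Lambda> - \<Delta> k)"
  have "Dk k \<subseteq> W" using Dk_U(1)[OF k] Dk_not_real[OF k] unfolding W_def by blast
  moreover have "complex_of_real ` \<Delta> k \<subseteq> W" using Dk_U(2)[OF k] by (auto simp: W_def)
  moreover have "open W" using \<Lambda> unfolding W_def by (intro open_Diff U_open finite_imp_closed) auto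
  ultimately have W: "open W" "Dk k \<subseteq> W" "complex_of_real ` \<Delta> k \<subseteq> W" by blast+
  have "\<exists>g. g holomorphic_on W \<and> (\<forall>w\<in>W. w \<notin> complex_of_real ` \<Lambda> \<longrightarrow>
      g w = cinner (K' k w (\<phi> (fst x))) (\<phi> (snd x)) / ((complex_of_real (fst x) - w) * (complex_of_real (snd x) - w)))"
    if x: "x \<in> \<Lambda> \<times> \<Lambda>" for x
  proof -
    obtain a b where ab: "x = (a, b)" "a \<in> \<Lambda>" "b \<in> \<Lambda>" using x by blast
    let ?q = "\<lambda>w. cinner (K' k w (\<phi> a)) (\<phi> b)"
    have q: "?q holomorphic_on W" using K'_holomorphic by (rule holomorphic_on_subset) (auto simp: W_def)
    have inD: "c \<in> \<Delta> k" if "c \<in> \<Lambda>" "complex_of_real c \<in> W" for c using that by (auto simp: W_def)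
    obtain g where g: "g holomorphic_on W" "\<And>w. w \<in> W \<Longrightarrow> w \<noteq> complex_of_real a \<Longrightarrow> w \<noteq> complex_of_real b \<Longrightarrow>
        g w = ?q w / ((complex_of_real a - w) * (complex_of_real b - w))"
    proof (rule holomorphic_divide_two_zeros[OF q W(1)])
      show "?q (complex_of_real a) = 0" if "complex_of_real a \<in> W"
        using K'_eigenvector_zero(1)[OF k inD[OF ab(2) that]] \<phi> ab(2) by blast
      show "?q (complex_of_real b) = 0" if "complex_of_real b \<in> W"
        using K'_eigenvector_zero(2)[OF k inD[OF ab(3) that]] \<phi> ab(3) by blast
      assume eq: "complex_of_real a = complex_of_real b" and aW: "complex_of_real a \<in> W"
      have aD: "a \<in> \<Delta> k" by (rule inD[OF ab(2) aW])
      obtain d where d: "d > 0" "ball a d \<subseteq> \<Delta> k" using Delta_open aD open_contains_ball by metis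
      show "deriv ?q (complex_of_real a) = 0"
      proof (rule deriv_zero_at_real_minimum[OF q W(1) aW d(1)])
        fix y assume "\<bar>a - y\<bar> < d"
        then have y: "y \<in> \<Delta> k" using d(2) by (auto simp: dist_real_def)
        have "?q (complex_of_real a) = 0" using K'_eigenvector_zero(1)[OF k aD] \<phi> ab(2) by blast
        then show "Re (?q (complex_of_real a)) \<le> Re (?q (complex_of_real y))" using K'_nonneg[OF k y] eq by simp
        have "Im (cinner (K' k (complex_of_real y) (\<phi> a)) (\<phi> a)) = 0" by (rule Im_zero_if_cnj_eq, rule K'_symmetric[OF k y])
        then show "Im (?q (complex_of_real y)) = 0" using eq by simp
      qed
    qed blast
    show ?thesis
    proof (intro exI[of _ g] conjI ballI impI g(1))
      fix w assume "w \<in> W" "w \<notin> complex_of_real ` \<Lambda>"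
      then show "g w = cinner (K' k w (\<phi> (fst x))) (\<phi> (snd x)) / ((complex_of_real (fst x) - w) * (complex_of_real (snd x) - w))"
        using g(2)[of w] ab by auto
    qed
  qed
  then obtain g where g: "\<And>x. x \<in> \<Lambda> \<times> \<Lambda> \<Longrightarrow> g x holomorphic_on W"
    "\<And>x w. x \<in> \<Lambda> \<times> \<Lambda> \<Longrightarrow> w \<in> W \<Longrightarrow> w \<notin> complex_of_real ` \<Lambda> \<Longrightarrow>
      g x w = cinner (K' k w (\<phi> (fst x))) (\<phi> (snd x)) / ((complex_of_real (fst x) - w) * (complex_of_real (snd x) - w))"
    by metis
  show thesis
  proof (rule that[of W "\<lambda>w. \<Sum>l\<in>\<Lambda>. \<Sum>l'\<in>\<Lambda>. g (l, l') w"])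
    show "(\<lambda>w. \<Sum>l\<in>\<Lambda>. \<Sum>l'\<in>\<Lambda>. g (l, l') w) holomorphic_on W" using g(1) by (intro holomorphic_intros) auto
    show "(\<Sum>l\<in>\<Lambda>. \<Sum>l'\<in>\<Lambda>. g (l, l') w) = quad k \<Lambda> \<phi> w" if "w \<in> W" "w \<notin> complex_of_real ` \<Lambda>" for w
      unfolding quad_def using g(2) that by (intro sum.cong refl) auto
  qed (use W in auto)
qed

lemma quad_eq:
  assumes "\<And>c x y. cinner (K' k w (c *\<^sub>C x)) y = c * cinner (K' k w x) y"
  shows "quad k \<Lambda> \<phi> w = cinner (K' k w (fw \<Lambda> \<phi> w)) (fw \<Lambda> \<phi> (cnj w))"
  unfolding fw_def quad_def blinfun.sum_right cinner_sum_left
  by (intro sum.cong refl) (simp add: cinner_sum_right cinner_scaleC_right assms sum_distrib_left mult_ac)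

lemma quad_bound:
  assumes c: "c \<ge> 0" "\<And>l. l \<in> \<Lambda> \<Longrightarrow> cmod (1 / (complex_of_real l - w)) \<le> c"
  shows "cmod (quad k \<Lambda> \<phi> w) \<le> norm (K' k w) * ((\<Sum>l\<in>\<Lambda>. norm (\<phi> l))\<^sup>2 * c\<^sup>2)"
proof -
  have "cmod (quad k \<Lambda> \<phi> w) \<le> (\<Sum>l\<in>\<Lambda>. \<Sum>l'\<in>\<Lambda>. norm (K' k w) * norm (\<phi> l) * norm (\<phi> l') * c\<^sup>2)"
    unfolding quad_def
  proof (intro sum_norm_le)
    fix l l' assume l: "l \<in> \<Lambda>" "l' \<in> \<Lambda>"
    have "cmod (cinner (K' k w (\<phi> l)) (\<phi> l') / ((complex_of_real l - w) * (complex_of_real l' - w)))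
       = cmod (cinner (K' k w (\<phi> l)) (\<phi> l')) * (cmod (1 / (complex_of_real l - w)) * cmod (1 / (complex_of_real l' - w)))"
      by (simp add: norm_divide norm_mult)
    also have "\<dots> \<le> (norm (K' k w) * norm (\<phi> l) * norm (\<phi> l')) * (c * c)"
      using c l by (intro mult_mono form_bound) auto
    finally show "cmod (cinner (K' k w (\<phi> l)) (\<phi> l') / ((complex_of_real l - w) * (complex_of_real l' - w))) \<le> norm (K' k w) * norm (\<phi> l) * norm (\<phi> l') * c\<^sup>2"
      by (simp add: power2_eq_square)
  qed
  also have "\<dots> = norm (K' k w) * ((\<Sum>l\<in>\<Lambda>. norm (\<phi> l))\<^sup>2 * c\<^sup>2)"
    by (simp add: power2_eq_square sum_product sum_distrib_left sum_distrib_right mult_ac)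
  finally show ?thesis .
qed

lemma quad_real:
  assumes "k \<in> {1..m}" "\<tau> \<in> \<Delta> k"
  shows "quad k \<Lambda> \<phi> (complex_of_real \<tau>) = cinner (K' k (complex_of_real \<tau>) (fw \<Lambda> \<phi> (complex_of_real \<tau>))) (fw \<Lambda> \<phi> (complex_of_real \<tau>))"
  using quad_eq[of k "complex_of_real \<tau>" \<Lambda> \<phi>, OF K'_clinear_real[OF assms]] by simp

section \<open>Spectral density of the solutions, and their existence\<close>

lemma spectral_density:
  assumes k: "k \<in> {1..m}" "\<tau> \<in> \<Delta> k" and \<Lambda>: "finite \<Lambda>" "\<tau> \<notin> \<Lambda>" and \<tau>: "\<alpha> < \<tau>" "\<tau> < \<beta>"
    and x: "\<And>l. l \<in> \<Lambda> \<Longrightarrow> x l \<in> op_dom A0" "\<And>l. l \<in> \<Lambda> \<Longrightarrow> E0 {\<alpha><..<\<beta>} (shift l (x l)) = E0 {\<alpha><..<\<beta>} (B01 (\<phi> l))"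
  shows "((\<lambda>\<sigma>. (norm (E0 {..<\<sigma>} (\<Sum>l\<in>\<Lambda>. x l)))\<^sup>2) has_real_derivative Re (quad k \<Lambda> \<phi> (complex_of_real \<tau>))) (at \<tau>)"
proof (rule norm_lessThan_derivative[OF \<Lambda> \<tau> x])
  have "(\<Sum>l\<in>\<Lambda>. (1 / complex_of_real (l - \<tau>)) *\<^sub>C B01 (\<phi> l)) = B01 (fw \<Lambda> \<phi> (complex_of_real \<tau>))"
    using clinear_op_sum[OF B01, of "\<lambda>l. 1 / complex_of_real (l - \<tau>)" \<phi> \<Lambda>] by (simp add: fw_def)
  then show "((\<lambda>\<sigma>. (norm (E0 {..<\<sigma>} (\<Sum>l\<in>\<Lambda>. (1 / complex_of_real (l - \<tau>)) *\<^sub>C B01 (\<phi> l))))\<^sup>2) has_real_derivative Re (quad k \<Lambda> \<phi> (complex_of_real \<tau>))) (at \<tau>)"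
    using K'_norm_derivative[OF k, of "fw \<Lambda> \<phi> (complex_of_real \<tau>)"] by (simp only: quad_real[OF k])
qed

lemma Delta_no_atom: "k \<in> {1..m} \<Longrightarrow> t \<in> \<Delta> k \<Longrightarrow> E0 {t} x = 0"
  by (rule no_atom[OF Delta_no_eigenvalue])


text \<open>After removal of the double pole the density is continuous at lam. Its bound controls
  the truncated solutions uniformly in the size of the gap.\<close>

lemma quad_bounded_near_eigenvalue:
  assumes k: "k \<in> {1..m}" and lam: "lam \<in> \<Delta> k" "eigval lam" and \<phi>: "\<phi> \<in> eigenspace H1 (complex_of_real lam)"
  obtains C \<rho> where "\<rho> > 0" "C \<ge> 0" "\<And>\<tau>. \<bar>\<tau> - lam\<bar> < \<rho> \<Longrightarrow> \<tau> \<in> \<Delta> k"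
    "\<And>\<tau>. \<bar>\<tau> - lam\<bar> < \<rho> \<Longrightarrow> \<tau> \<noteq> lam \<Longrightarrow> Re (quad k {lam} (\<lambda>_. \<phi>) (complex_of_real \<tau>)) \<le> C"
proof -
  have F: "finite {lam}" by simp
  obtain W G where W: "open W" "Dk k \<subseteq> W" "complex_of_real ` \<Delta> k \<subseteq> W" "G holomorphic_on W"
    "\<And>w. w \<in> W \<Longrightarrow> w \<notin> complex_of_real ` {lam} \<Longrightarrow> G w = quad k {lam} (\<lambda>_. \<phi>) w"
    using quad_extension[OF k F, of "\<lambda>_. \<phi>"] lam(2) \<phi> by (metis singletonD)
  have "complex_of_real lam \<in> W" using W(3) lam(1) by blast
  then have "isCont G (complex_of_real lam)"
    using holomorphic_on_imp_continuous_on[OF W(4)] W(1) continuous_on_eq_continuous_at by blast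
  then obtain d where d: "d > 0" "\<And>w. dist w (complex_of_real lam) < d \<Longrightarrow> dist (G w) (G (complex_of_real lam)) < 1"
    unfolding continuous_at_eps_delta by (metis zero_less_one)
  obtain r where r: "r > 0" "ball lam r \<subseteq> \<Delta> k" using Delta_open lam(1) open_contains_ball by metis
  show thesis
  proof (rule that[of "min d r" "cmod (G (complex_of_real lam)) + 1"])
    show D: "\<tau> \<in> \<Delta> k" if "\<bar>\<tau> - lam\<bar> < min d r" for \<tau> using that r(2) by (auto simp: dist_real_def abs_minus_commute)
    fix \<tau> assume \<tau>: "\<bar>\<tau> - lam\<bar> < min d r" "\<tau> \<noteq> lam"
    have "complex_of_real \<tau> \<in> W" using D[OF \<tau>(1)] W(3) by blast
    then have "quad k {lam} (\<lambda>_. \<phi>) (complex_of_real \<tau>) = G (complex_of_real \<tau>)" using W(5) \<tau>(2) by simp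
    moreover have "dist (complex_of_real \<tau>) (complex_of_real lam) < d" using \<tau>(1) by (simp add: dist_norm flip: of_real_diff)
    then have "cmod (G (complex_of_real \<tau>) - G (complex_of_real lam)) < 1" using d(2) by (simp add: dist_norm)
    then have "cmod (G (complex_of_real \<tau>)) \<le> cmod (G (complex_of_real lam)) + 1"
      using norm_triangle_ineq2[of "G (complex_of_real \<tau>)" "G (complex_of_real lam)"] by linarith
    ultimately show "Re (quad k {lam} (\<lambda>_. \<phi>) (complex_of_real \<tau>)) \<le> cmod (G (complex_of_real lam)) + 1"
      using complex_Re_le_cmod[of "G (complex_of_real \<tau>)"] by simp
  qed (use d r in auto)
qed

text \<open>On both sides of the gap the mass of x has density at most C, over a total length of at
  most 2 * r0. The gap carries no mass since x lies in the range of E0 S, and its boundary points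
  are no atoms.\<close>

lemma truncated_solution_bound:
  assumes k: "k \<in> {1..m}" and \<rho>: "\<And>\<tau>. \<bar>\<tau> - lam\<bar> < \<rho> \<Longrightarrow> \<tau> \<in> \<Delta> k"
    and C: "C \<ge> 0" "\<And>\<tau>. \<bar>\<tau> - lam\<bar> < \<rho> \<Longrightarrow> \<tau> \<noteq> lam \<Longrightarrow> Re (quad k {lam} (\<lambda>_. \<phi>) (complex_of_real \<tau>)) \<le> C"
    and r: "0 < r" "r \<le> r0" "r0 < \<rho>" and S: "S = - {lam - r<..<lam + r}"
    and x: "x \<in> op_dom A0" "E0 S x = x" "shift lam x = E0 S (B01 \<phi>)"
  shows "(norm (E0 {lam - r0<..<lam + r0} x))\<^sup>2 \<le> 2 * C * r0"
proof -
  have Sm: "S \<in> sets borel" by (simp add: S)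
  have D: "((\<lambda>\<sigma>. (norm (E0 {..<\<sigma>} x))\<^sup>2) has_real_derivative Re (quad k {lam} (\<lambda>_. \<phi>) (complex_of_real \<tau>))) (at \<tau>)"
    if \<tau>: "\<bar>\<tau> - lam\<bar> < \<rho>" "\<alpha> < \<tau>" "\<tau> < \<beta>" "{\<alpha><..<\<beta>} \<subseteq> S" for \<tau> \<alpha> \<beta>
  proof -
    have "\<tau> \<in> S" using \<tau>(2,3,4) by auto
    then have ne: "\<tau> \<notin> {lam}" using r(1) by (auto simp: S)
    have "E0 {\<alpha><..<\<beta>} (shift lam x) = E0 {\<alpha><..<\<beta>} (B01 \<phi>)"
      unfolding x(3) using \<tau>(4) Sm by (simp add: Int inf_absorb1)
    then show ?thesis using spectral_density[OF k \<rho>[OF \<tau>(1)] _ ne \<tau>(2,3), of "\<lambda>_. x" "\<lambda>_. \<phi>"] x(1) by simp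
  qed
  have atom: "E0 {t} x = 0" if "\<bar>t - lam\<bar> \<le> r0" for t using that r by (intro Delta_no_atom[OF k] \<rho>) simp
  have "(norm (E0 {lam - r0..<lam - r} x))\<^sup>2 \<le> C * ((lam - r) - (lam - r0))"
  proof (rule norm_interval_le_derivative)
    fix t assume t: "t \<in> {lam - r0<..<lam - r}"
    then have b: "\<bar>t - lam\<bar> < \<rho>" "t \<noteq> lam" using r by auto
    show "((\<lambda>\<sigma>. (norm (E0 {..<\<sigma>} x))\<^sup>2) has_real_derivative Re (quad k {lam} (\<lambda>_. \<phi>) (complex_of_real t))) (at t)"
      using t by (intro D[OF b(1), of "t - 1" "lam - r"]) (auto simp: S)
    show "Re (quad k {lam} (\<lambda>_. \<phi>) (complex_of_real t)) \<le> C" by (rule C(2)[OF b])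
  qed (use r atom in auto)
  moreover have "(norm (E0 {lam + r..<lam + r0} x))\<^sup>2 \<le> C * ((lam + r0) - (lam + r))"
  proof (rule norm_interval_le_derivative)
    fix t assume t: "t \<in> {lam + r<..<lam + r0}"
    then have b: "\<bar>t - lam\<bar> < \<rho>" "t \<noteq> lam" using r by auto
    show "((\<lambda>\<sigma>. (norm (E0 {..<\<sigma>} x))\<^sup>2) has_real_derivative Re (quad k {lam} (\<lambda>_. \<phi>) (complex_of_real t))) (at t)"
      using t by (intro D[OF b(1), of "lam + r" "t + 1"]) (auto simp: S)
    show "Re (quad k {lam} (\<lambda>_. \<phi>) (complex_of_real t)) \<le> C" by (rule C(2)[OF b])
  qed (use r atom in auto)
  moreover have "E0 {lam - r<..<lam + r} x = 0"
  proof -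
    have "{lam - r<..<lam + r} \<inter> S = {}" by (auto simp: S)
    then have "E0 {lam - r<..<lam + r} (E0 S x) = 0" using Sm by (intro disjoint_zero) auto
    then show ?thesis by (simp only: x(2))
  qed
  moreover have "E0 {lam - r} x = 0" using r by (intro atom) simp
  moreover have "(norm (E0 ({lam - r0..<lam - r} \<union> ({lam - r} \<union> ({lam - r<..<lam + r} \<union> {lam + r..<lam + r0}))) x))\<^sup>2
     = (norm (E0 {lam - r0..<lam - r} x))\<^sup>2 + (norm (E0 ({lam - r} \<union> ({lam - r<..<lam + r} \<union> {lam + r..<lam + r0})) x))\<^sup>2"
    by (rule norm_sq_Un) (use r(1) in auto)
  moreover have "(norm (E0 ({lam - r} \<union> ({lam - r<..<lam + r} \<union> {lam + r..<lam + r0})) x))\<^sup>2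
     = (norm (E0 {lam - r} x))\<^sup>2 + (norm (E0 ({lam - r<..<lam + r} \<union> {lam + r..<lam + r0}) x))\<^sup>2"
    by (rule norm_sq_Un) (use r(1) in auto)
  moreover have "(norm (E0 ({lam - r<..<lam + r} \<union> {lam + r..<lam + r0}) x))\<^sup>2
     = (norm (E0 {lam - r<..<lam + r} x))\<^sup>2 + (norm (E0 {lam + r..<lam + r0} x))\<^sup>2"
    by (rule norm_sq_Un) auto
  ultimately have "(norm (E0 ({lam - r0..<lam - r} \<union> ({lam - r} \<union> ({lam - r<..<lam + r} \<union> {lam + r..<lam + r0}))) x))\<^sup>2
    \<le> C * (r0 - r) + C * (r0 - r)" by (simp del: Un_insert_left)
  also have "\<dots> \<le> 2 * C * r0"
  proof -
    have "C * (r0 - r) \<le> C * r0" using C(1) r(1) by (intro mult_left_mono) auto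
    then show ?thesis by simp
  qed
  finally have "(norm (E0 ({lam - r0..<lam - r} \<union> ({lam - r} \<union> ({lam - r<..<lam + r} \<union> {lam + r..<lam + r0}))) x))\<^sup>2 \<le> 2 * C * r0" .
  moreover have "norm (E0 {lam - r0<..<lam + r0} x) \<le> norm (E0 ({lam - r0..<lam - r} \<union> ({lam - r} \<union> ({lam - r<..<lam + r} \<union> {lam + r..<lam + r0}))) x)"
    by (rule norm_mono) auto
  ultimately show ?thesis by (meson norm_ge_zero order_trans power_mono)
qed

text \<open>Here lam belongs to the continuous spectrum and A0 - lam need not be onto. The equation
  is solved off shrinking gaps around lam; the bounded density makes the truncated solutions a
  Cauchy sequence, and A0 is closed.\<close>

lemma solution_in_interval:
  assumes k: "k \<in> {1..m}" and lam: "lam \<in> \<Delta> k" "eigval lam" and \<phi>: "\<phi> \<in> eigenspace H1 (complex_of_real lam)"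
  obtains x where "x \<in> op_dom A0" "shift lam x = B01 \<phi>"
proof -
  obtain C \<rho> where \<rho>: "\<rho> > 0" "C \<ge> 0" "\<And>\<tau>. \<bar>\<tau> - lam\<bar> < \<rho> \<Longrightarrow> \<tau> \<in> \<Delta> k"
    and C: "\<And>\<tau>. \<bar>\<tau> - lam\<bar> < \<rho> \<Longrightarrow> \<tau> \<noteq> lam \<Longrightarrow> Re (quad k {lam} (\<lambda>_. \<phi>) (complex_of_real \<tau>)) \<le> C"
    by (rule quad_bounded_near_eigenvalue[OF k lam \<phi>]) (rule that)
  define u where "u = B01 \<phi>"
  \<comment> \<open>The double successor gives r n < \<rho> already for n = 0.\<close>
  define r where "r n = \<rho> * inverse (real (Suc (Suc n)))" for n
  define S where "S n = - {lam - r n<..<lam + r n}" for n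
  have r: "r n > 0" "r n < \<rho>" for n
    using \<rho>(1) by (auto simp: r_def inverse_eq_divide pos_divide_less_eq)
  have r_mono: "r j \<le> r n" if "n \<le> j" for n j
    using \<rho>(1) that unfolding r_def by (intro mult_left_mono le_imp_inverse_le) auto
  have r0: "r \<longlonglongrightarrow> 0"
    using tendsto_mult_right_zero[OF LIMSEQ_Suc[OF LIMSEQ_inverse_real_of_nat], of \<rho>] by (simp only: r_def[abs_def])
  have Sm: "S n \<in> sets borel" for n by (simp add: S_def)
  have "\<exists>v. v \<in> op_dom A0 \<and> E0 (S n) v = v \<and> shift lam v = E0 (S n) u" for n
    using shift_solve[OF r(1)[of n] S_def[of n], of u] by blast
  then obtain x where x: "\<And>n. x n \<in> op_dom A0" "\<And>n. E0 (S n) (x n) = x n" "\<And>n. shift lam (x n) = E0 (S n) u" by metis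
  \<comment> \<open>On the range of E0 (S n) the solution is unique by the lower bound r n, so the
    truncations are consistent.\<close>
  have restr: "E0 (S n) (x j) = x n" if "n \<le> j" for n j
  proof -
    define z where "z = E0 (S n) (x j) - x n"
    have d: "E0 (S n) (x j) \<in> op_dom A0" by (rule restrict_dom[OF Sm x(1)])
    have zd: "z \<in> op_dom A0" unfolding z_def by (rule cvs.subspace_diff[OF dom_sub d x(1)])
    have zE: "E0 (S n) z = z" by (simp add: z_def blinfun.diff_right idem[OF Sm] x(2))
    have sub: "S n \<inter> S j = S n" using r_mono[OF that] by (auto simp: S_def)
    have "shift lam z = E0 (S n) (shift lam (x j)) - shift lam (x n)"
      unfolding z_def shift_diff[where a = lam, OF d x(1)] shift_commutes[where a = lam, OF Sm x(1)] ..
    also have "\<dots> = 0" unfolding x(3) Int[OF Sm Sm] sub by simp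
    finally have "r n * norm z \<le> 0"
      using shift_lower_bound[where a = lam, OF Sm _ zd zE, of "r n"] by (simp add: S_def) linarith
    then have "z = 0" using r(1)[of n] by (simp add: mult_le_0_iff)
    then show ?thesis by (simp add: z_def)
  qed
  have diff: "norm (x j - x n) \<le> sqrt (2 * C * r n)" if "n \<le> j" for n j
  proof (rule real_le_rsqrt)
    have "x j - x n = E0 (- S n) (x j)" using Compl_add[OF Sm, of n "x j"] restr[OF that] by (simp add: algebra_simps)
    moreover have "- S n = {lam - r n<..<lam + r n}" by (simp add: S_def)
    ultimately show "(norm (x j - x n))\<^sup>2 \<le> 2 * C * r n"
      using truncated_solution_bound[OF k \<rho>(3) \<rho>(2) C r(1)[of j] r_mono[OF that] r(2) S_def x(1,2) x(3)[unfolded u_def]] by simp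
  qed
  have "(\<lambda>n. sqrt (2 * C * r n)) \<longlonglongrightarrow> sqrt (2 * C * 0)" using r0 by (intro tendsto_intros)
  then have lim0: "(\<lambda>n. sqrt (2 * C * r n)) \<longlonglongrightarrow> 0" by simp
  have "Cauchy x"
    unfolding Cauchy_altdef2
  proof (intro allI impI)
    fix e :: real assume e: "e > 0"
    obtain N where "sqrt (2 * C * r N) < e"
      using order_tendstoD(2)[OF lim0 e] eventually_happens'[OF sequentially_bot] by blast
    then show "\<exists>N. \<forall>n\<ge>N. dist (x n) (x N) < e" using order_le_less_trans[OF diff] by (auto simp: dist_norm intro!: exI[of _ N])
  qed
  then obtain y where y: "x \<longlonglongrightarrow> y" using Cauchy_convergent convergent_def by blast
  \<comment> \<open>No part of u is lost at lam: its distribution function is differentiable there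
    by the assumption on K_B, hence continuous.\<close>
  have Elim: "(\<lambda>n. E0 (S n) u) \<longlonglongrightarrow> u"
  proof -
    let ?H = "\<lambda>\<sigma>. (norm (E0 {..<\<sigma>} u))\<^sup>2"
    have H: "isCont ?H lam" unfolding u_def by (rule DERIV_isCont[OF K'_norm_derivative[OF k lam(1)]])
    have "(\<lambda>n. lam + r n) \<longlonglongrightarrow> lam + 0" "(\<lambda>n. lam - r n) \<longlonglongrightarrow> lam - 0" by (intro tendsto_intros r0)+
    then have "(\<lambda>n. lam + r n) \<longlonglongrightarrow> lam" "(\<lambda>n. lam - r n) \<longlonglongrightarrow> lam" by simp_all
    from this[THEN isCont_tendsto_compose[OF H]]
    have "(\<lambda>n. sqrt (?H (lam + r n) - ?H (lam - r n))) \<longlonglongrightarrow> sqrt (?H lam - ?H lam)"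
      by (intro tendsto_real_sqrt tendsto_diff)
    then have lim: "(\<lambda>n. sqrt (?H (lam + r n) - ?H (lam - r n))) \<longlonglongrightarrow> 0" by simp
    have "norm (E0 (S n) u - u) \<le> sqrt (?H (lam + r n) - ?H (lam - r n))" for n
    proof (rule real_le_rsqrt)
      have "E0 (S n) u - u = - E0 (- S n) u" using Compl_add[OF Sm, of n u] by (simp add: algebra_simps)
      then have "norm (E0 (S n) u - u) = norm (E0 {lam - r n<..<lam + r n} u)" by (simp add: S_def)
      also have "\<dots> \<le> norm (E0 {lam - r n..<lam + r n} u)" by (intro norm_mono) auto
      finally have "(norm (E0 (S n) u - u))\<^sup>2 \<le> (norm (E0 {lam - r n..<lam + r n} u))\<^sup>2" by (intro power_mono) auto
      also have "\<dots> = ?H (lam + r n) - ?H (lam - r n)" using r(1)[of n] by (intro norm_interval[symmetric]) simp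
      finally show "(norm (E0 (S n) u - u))\<^sup>2 \<le> ?H (lam + r n) - ?H (lam - r n)" .
    qed
    then have "(\<lambda>n. E0 (S n) u - u) \<longlonglongrightarrow> 0" by (intro Lim_null_comparison[OF _ lim] always_eventually) blast
    then show ?thesis by (simp add: LIM_zero_iff)
  qed
  have "(\<lambda>n. E0 (S n) u + complex_of_real lam *\<^sub>C x n) \<longlonglongrightarrow> u + complex_of_real lam *\<^sub>C y"
    by (intro tendsto_add Elim bounded_linear.tendsto[OF bounded_linear_scaleC] y)
  moreover have "E0 (S n) u + complex_of_real lam *\<^sub>C x n = op_app A0 (x n)" for n using x(3)[of n, symmetric] by simp
  ultimately have "(\<lambda>n. op_app A0 (x n)) \<longlonglongrightarrow> u + complex_of_real lam *\<^sub>C y" by simp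
  note cl = self_adjoint_closed[OF sa x(1) y this]
  show thesis by (rule that[OF cl(1)]) (simp add: cl(2) u_def)
qed

lemma solution_exists:
  assumes lam: "eigval lam" and \<phi>: "\<phi> \<in> eigenspace H1 (complex_of_real lam)"
  obtains x where "x \<in> op_dom A0" "shift lam x = B01 \<phi>"
proof (cases "lam \<in> real_spectrum A0")
  case True
  obtain k where k: "k \<in> {1..m}" "lam \<in> \<Delta> k" using eigval_position[OF lam True] .
  show thesis using solution_in_interval[OF k lam \<phi>] that by blast
next
  case False
  then obtain R where "is_resolvent A0 (complex_of_real lam) R" by (auto simp: real_spectrum_def spectrum_def)
  then show thesis using that[of "R (B01 \<phi>)"] by (simp add: is_resolvent_def)
qed

lemma eigval_no_eigenvector:
  assumes "eigval lam"
  shows "eigenspace A0 (complex_of_real lam) = {0}"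
proof (cases "lam \<in> real_spectrum A0")
  case True
  obtain k where k: "k \<in> {1..m}" "lam \<in> \<Delta> k" using eigval_position[OF assms True] .
  show ?thesis by (rule Delta_no_eigenvalue[OF k])
next
  case False
  then obtain R where R: "is_resolvent A0 (complex_of_real lam) R" by (auto simp: real_spectrum_def spectrum_def)
  have "x = 0" if "x \<in> eigenspace A0 (complex_of_real lam)" for x
  proof -
    have "x \<in> op_dom A0" "shift lam x = 0" using that by (auto simp: eigenspace_def)
    then have "R 0 = x" using R unfolding is_resolvent_def by metis
    then show ?thesis by (simp add: blinfun.zero_right)
  qed
  moreover have "R 0 \<in> op_dom A0" "shift lam (R 0) = 0" using R unfolding is_resolvent_def by blast+
  then have "R 0 \<in> eigenspace A0 (complex_of_real lam)" by (simp add: eigenspace_def)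
  ultimately show ?thesis by (auto simp: blinfun.zero_right)
qed

text \<open>\<open>inverse_apply\<close> is a definite description; existence comes from the
  truncated solutions or from the resolvent, uniqueness from the absence of eigenvectors of
  A0.\<close>

lemma inverse_apply_solution:
  assumes lam: "eigval lam" and \<phi>: "\<phi> \<in> eigenspace H1 (complex_of_real lam)"
  shows "inverse_apply A0 (complex_of_real lam) (B01 \<phi>) \<in> op_dom A0"
    "shift lam (inverse_apply A0 (complex_of_real lam) (B01 \<phi>)) = B01 \<phi>"
proof -
  obtain x where x: "x \<in> op_dom A0" "shift lam x = B01 \<phi>" using solution_exists[OF assms] .
  have "inverse_apply A0 (complex_of_real lam) (B01 \<phi>) = x"
    unfolding inverse_apply_def
  proof (rule the_equality)
    fix y assume y: "y \<in> op_dom A0 \<and> shift lam y = B01 \<phi>"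
    have "shift lam (y - x) = 0" using shift_diff[where a = lam, of y x] x y by simp
    moreover have "y - x \<in> op_dom A0" using cvs.subspace_diff[OF dom_sub] x y by blast
    ultimately have "y - x \<in> eigenspace A0 (complex_of_real lam)" by (simp add: eigenspace_def)
    then show "y = x" using eigval_no_eigenvector[OF lam] by simp
  qed (use x in simp)
  with x show "inverse_apply A0 (complex_of_real lam) (B01 \<phi>) \<in> op_dom A0"
    "shift lam (inverse_apply A0 (complex_of_real lam) (B01 \<phi>)) = B01 \<phi>" by simp_all
qed


section \<open>The mass over an interval, moved to the contour\<close>

lemma quad_Gamma_bound:
  assumes k: "k \<in> {1..m}" and t: "t \<in> {0<..<1}"
    and \<phi>: "\<And>l. l \<in> \<Lambda> \<Longrightarrow> \<phi> l \<in> eigenspace H1 (complex_of_real l)" "\<And>l. l \<in> \<Lambda> \<Longrightarrow> eigval l"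
  shows "cmod (quad k \<Lambda> \<phi> (\<Gamma> k t)) \<le> (2 / d0 * norm (\<Sum>l\<in>\<Lambda>. \<phi> l))\<^sup>2 * norm (K' k (\<Gamma> k t))"
proof -
  let ?w = "\<Gamma> k t"
  let ?\<kappa> = "2 / d0 * norm (\<Sum>l\<in>\<Lambda>. \<phi> l)"
  have Z: "?w \<in> Zc" "cnj ?w \<in> Zc" using Gamma_in_Z[OF k t] closure_subset[of Z] by (auto simp: Zc_def)
  have "quad k \<Lambda> \<phi> ?w = cinner (K' k ?w (fw \<Lambda> \<phi> ?w)) (fw \<Lambda> \<phi> (cnj ?w))"
    by (rule quad_eq) (rule K'_clinear[OF k Gamma_in_Dk[OF k t]])
  then have "cmod (quad k \<Lambda> \<phi> ?w) \<le> norm (K' k ?w) * norm (fw \<Lambda> \<phi> ?w) * norm (fw \<Lambda> \<phi> (cnj ?w))"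
    using form_bound[of "K' k ?w"] by simp
  also have "\<dots> \<le> norm (K' k ?w) * ?\<kappa> * ?\<kappa>"
    using fw_bound[OF \<phi> Z(1)] fw_bound[OF \<phi> Z(2)] d0_pos by (intro mult_mono mult_left_mono mult_nonneg_nonneg) auto
  finally show ?thesis by (simp only: power2_eq_square mult_ac)
qed

text \<open>Both sides have the same derivative off the finite set \<Lambda>. At its points
  continuity suffices: the mass is continuous because there are no atoms, the antiderivative because
  the poles were removed.\<close>

lemma Delta_mass_increment:
  assumes k: "k \<in> {1..m}" and \<Lambda>: "finite \<Lambda>"
    and x: "\<And>l. l \<in> \<Lambda> \<Longrightarrow> x l \<in> op_dom A0" "\<And>l. l \<in> \<Lambda> \<Longrightarrow> shift l (x l) = B01 (\<phi> l)"
    and G: "\<And>\<tau>. \<tau> \<in> \<Delta> k \<Longrightarrow> \<tau> \<notin> \<Lambda> \<Longrightarrow> G (complex_of_real \<tau>) = quad k \<Lambda> \<phi> (complex_of_real \<tau>)"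
    and \<beta>: "\<And>\<tau>. \<tau> \<in> \<Delta> k \<Longrightarrow> (\<beta> has_vector_derivative G (complex_of_real \<tau>)) (at \<tau>)"
    and ab: "a \<in> \<Delta> k" "b \<in> \<Delta> k" "a \<le> b"
  shows "(norm (E0 {a..<b} (\<Sum>l\<in>\<Lambda>. x l)))\<^sup>2 = Re (\<beta> b - \<beta> a)"
proof -
  define H where "H \<sigma> = (norm (E0 {..<\<sigma>} (\<Sum>l\<in>\<Lambda>. x l)))\<^sup>2" for \<sigma>
  have sub: "{a..b} \<subseteq> \<Delta> k" by (rule Delta_Icc[OF ab(1,2)])
  have "H b - Re (\<beta> b) = H a - Re (\<beta> a)"
  proof (rule has_derivative_zero_unique_strong_interval[of \<Lambda> a b "\<lambda>\<sigma>. H \<sigma> - Re (\<beta> \<sigma>)"])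
    have "continuous_on {a..b} H"
      unfolding H_def using sub by (intro norm_lessThan_continuous_on Delta_no_atom[OF k]) blast
    moreover have "continuous_on {a..b} \<beta>"
      using \<beta> sub by (intro continuous_at_imp_continuous_on ballI has_vector_derivative_continuous) blast
    ultimately show "continuous_on {a..b} (\<lambda>\<sigma>. H \<sigma> - Re (\<beta> \<sigma>))" by (intro continuous_intros)
    fix \<tau> assume \<tau>: "\<tau> \<in> {a..b} - \<Lambda>"
    then have \<tau>D: "\<tau> \<in> \<Delta> k" using sub by blast
    have "(H has_real_derivative Re (quad k \<Lambda> \<phi> (complex_of_real \<tau>))) (at \<tau>)"
      unfolding H_def using \<tau> x by (intro spectral_density[OF k \<tau>D \<Lambda>, of "\<tau> - 1" "\<tau> + 1"]) auto
    moreover have "((\<lambda>\<sigma>. Re (\<beta> \<sigma>)) has_real_derivative Re (quad k \<Lambda> \<phi> (complex_of_real \<tau>))) (at \<tau>)"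
      using bounded_linear.has_vector_derivative[OF bounded_linear_Re \<beta>[OF \<tau>D]] G[OF \<tau>D] \<tau>
      by (simp add: has_real_derivative_iff_has_vector_derivative)
    ultimately have "((\<lambda>\<sigma>. H \<sigma> - Re (\<beta> \<sigma>)) has_real_derivative 0) (at \<tau>)" using DERIV_diff by fastforce
    then show "((\<lambda>\<sigma>. H \<sigma> - Re (\<beta> \<sigma>)) has_derivative (\<lambda>h. 0)) (at \<tau> within {a..b})"
      unfolding has_field_derivative_def mult_zero_left[abs_def] by (rule has_derivative_at_withinI)
  qed (use ab \<Lambda> in auto)
  then show ?thesis using norm_interval[OF ab(3), of "\<Sum>l\<in>\<Lambda>. x l"] by (simp add: H_def)
qed

text \<open>Two resolvent factors, each at most 4 / d0 near a finite end or 4 / (1 + cmod w) near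
  infinity, give the constant 16; the sum in C covers both cases. At infinity one of the two
  decaying factors is kept as the weight and the other is bounded by a constant.\<close>

lemma quad_end_bounds:
  assumes k: "k \<in> {1..m}" and \<Lambda>: "finite \<Lambda>" "\<And>l. l \<in> \<Lambda> \<Longrightarrow> eigval l"
    and G: "\<And>w. w \<in> Dk k \<union> complex_of_real ` \<Delta> k \<Longrightarrow> w \<notin> complex_of_real ` \<Lambda> \<Longrightarrow> G w = quad k \<Lambda> \<phi> w"
    and C: "C = (\<Sum>l\<in>\<Lambda>. norm (\<phi> l))\<^sup>2 * (16 / d0\<^sup>2 + 16)"
  shows "a \<in> {\<mu>1 k, \<mu>2 k} \<Longrightarrow> \<bar>a\<bar> \<noteq> \<infinity> \<Longrightarrow> \<exists>r>0. \<forall>w\<in>Dk k \<union> complex_of_real ` \<Delta> k. cmod (w - complex_of_real (real_of_ereal a)) < r \<longrightarrow> cmod (G w) \<le> C * norm (K' k w)"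
    and "\<exists>R. \<forall>w\<in>Dk k \<union> complex_of_real ` \<Delta> k. cmod w > R \<longrightarrow> cmod (G w) \<le> C * (norm (K' k w) / (1 + cmod w))"
proof -
  let ?S = "(\<Sum>l\<in>\<Lambda>. norm (\<phi> l))\<^sup>2"
  show "\<exists>r>0. \<forall>w\<in>Dk k \<union> complex_of_real ` \<Delta> k. cmod (w - complex_of_real (real_of_ereal a)) < r \<longrightarrow> cmod (G w) \<le> C * norm (K' k w)"
    if a: "a \<in> {\<mu>1 k, \<mu>2 k}" "\<bar>a\<bar> \<noteq> \<infinity>"
  proof (rule exI[of _ "d0 / 4"], intro conjI ballI impI)
    fix w assume w: "w \<in> Dk k \<union> complex_of_real ` \<Delta> k" "cmod (w - complex_of_real (real_of_ereal a)) < d0 / 4"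
    have "w \<notin> complex_of_real ` \<Lambda>"
    proof
      assume "w \<in> complex_of_real ` \<Lambda>"
      then obtain l where l: "w = complex_of_real l" "l \<in> \<Lambda>" by blast
      then show False using eigval_dist[OF \<Lambda>(2)[OF l(2)] finite_end_in_Zc[OF k a]] w(2) d0_pos by simp
    qed
    then have "G w = quad k \<Lambda> \<phi> w" by (rule G[OF w(1)])
    moreover have "cmod (quad k \<Lambda> \<phi> w) \<le> norm (K' k w) * (?S * (4 / d0)\<^sup>2)"
      using d0_pos by (intro quad_bound inverse_near_end[OF k a \<Lambda>(2) w(2)]) auto
    moreover have "norm (K' k w) * (?S * (4 / d0)\<^sup>2) \<le> norm (K' k w) * (?S * (16 / d0\<^sup>2 + 16))"
      by (intro mult_left_mono) (auto simp: power_divide)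
    ultimately show "cmod (G w) \<le> C * norm (K' k w)" unfolding C by (simp only: mult_ac)
  qed (use d0_pos in simp)
  define R where "R = (\<Sum>l\<in>\<Lambda>. 2 * \<bar>l\<bar>) + 1"
  show "\<exists>R. \<forall>w\<in>Dk k \<union> complex_of_real ` \<Delta> k. cmod w > R \<longrightarrow> cmod (G w) \<le> C * (norm (K' k w) / (1 + cmod w))"
  proof (rule exI[of _ R], intro ballI impI)
    fix w assume w: "w \<in> Dk k \<union> complex_of_real ` \<Delta> k" "cmod w > R"
    have l: "cmod w > 2 * \<bar>l\<bar> + 1" if "l \<in> \<Lambda>" for l
    proof -
      have "2 * \<bar>l\<bar> \<le> (\<Sum>l\<in>\<Lambda>. 2 * \<bar>l\<bar>)" using that \<Lambda>(1) by (intro member_le_sum) auto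
      then show ?thesis using w(2) by (simp add: R_def)
    qed
    have "w \<notin> complex_of_real ` \<Lambda>"
    proof
      assume "w \<in> complex_of_real ` \<Lambda>"
      then obtain l where "w = complex_of_real l" "l \<in> \<Lambda>" by blast
      then show False using l[of l] by simp
    qed
    then have "G w = quad k \<Lambda> \<phi> w" by (rule G[OF w(1)])
    moreover have "cmod (quad k \<Lambda> \<phi> w) \<le> norm (K' k w) * (?S * (4 / (1 + cmod w))\<^sup>2)"
      using l by (intro quad_bound inverse_near_infinity) auto
    moreover have "norm (K' k w) * (?S * (4 / (1 + cmod w))\<^sup>2) \<le> norm (K' k w) * (?S * ((16 / d0\<^sup>2 + 16) * (1 / (1 + cmod w))))"
    proof (intro mult_left_mono)
      have p: "0 \<le> 1 / (1 + cmod w)" "1 / (1 + cmod w) \<le> 1" using norm_ge_zero[of w] by (auto simp: divide_le_eq_1 add_pos_nonneg)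
      have "(4 / (1 + cmod w))\<^sup>2 = 16 * (1 / (1 + cmod w)) * (1 / (1 + cmod w))" by (simp add: power2_eq_square)
      also have "\<dots> \<le> 16 * 1 * (1 / (1 + cmod w))" using p by (intro mult_right_mono mult_left_mono) auto
      also have "\<dots> \<le> (16 / d0\<^sup>2 + 16) * (1 / (1 + cmod w))" using p by (intro mult_right_mono) auto
      finally show "(4 / (1 + cmod w))\<^sup>2 \<le> (16 / d0\<^sup>2 + 16) * (1 / (1 + cmod w))" .
    qed auto
    moreover have "norm (K' k w) * (?S * ((16 / d0\<^sup>2 + 16) * (1 / (1 + cmod w)))) = C * (norm (K' k w) / (1 + cmod w))"
      unfolding C by simp
    ultimately show "cmod (G w) \<le> C * (norm (K' k w) / (1 + cmod w))" by (simp only:)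
  qed
qed

text \<open>The mass of \<open>{p a..<p b}\<close> is the increment of P along s = 0, which is close
  to its increment along s = 1. The latter is a contour integral, where both resolvent vectors are
  controlled by d0; the arc part of the variation bounds it by the square of 2 / d0 * norm f, times
  v.\<close>

lemma Delta_bound:
  assumes k: "k \<in> {1..m}" and \<Lambda>: "finite \<Lambda>"
    and \<phi>: "\<And>l. l \<in> \<Lambda> \<Longrightarrow> \<phi> l \<in> eigenspace H1 (complex_of_real l)" "\<And>l. l \<in> \<Lambda> \<Longrightarrow> eigval l"
    and x: "\<And>l. l \<in> \<Lambda> \<Longrightarrow> x l \<in> op_dom A0" "\<And>l. l \<in> \<Lambda> \<Longrightarrow> shift l (x l) = B01 (\<phi> l)"
  shows "(norm (E0 (\<Delta> k) (\<Sum>l\<in>\<Lambda>. x l)))\<^sup>2 \<le> (2 / d0 * norm (\<Sum>l\<in>\<Lambda>. \<phi> l))\<^sup>2 * v"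
proof -
  define \<kappa> where "\<kappa> = (2 / d0 * norm (\<Sum>l\<in>\<Lambda>. \<phi> l))\<^sup>2"
  define y where "y = (\<Sum>l\<in>\<Lambda>. x l)"
  obtain h p where H: "homot k h p" using homot_exists[OF k] .
  obtain W G where W: "open W" "Dk k \<subseteq> W" "complex_of_real ` \<Delta> k \<subseteq> W" "G holomorphic_on W"
    and G: "\<And>w. w \<in> W \<Longrightarrow> w \<notin> complex_of_real ` \<Lambda> \<Longrightarrow> G w = quad k \<Lambda> \<phi> w"
    using quad_extension[OF k \<Lambda> \<phi>] by blast
  obtain \<Phi> where \<Phi>: "\<And>w. w \<in> Dk k \<Longrightarrow> (\<Phi> has_field_derivative G w) (at w)"
    using Dk_primitive[OF k holomorphic_on_subset[OF W(4,2)]] by blast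
  have h0W: "h (0, t) \<in> W" if "t \<in> {0<..<1}" for t
    using homotD(5)[OF H that] homot_to_real(3)[OF H that] W(3) by auto
  obtain P where P: "prim_along G h P ({0..1} \<times> {0<..<1})"
    and P\<Phi>: "\<And>s t. s \<in> {0<..1} \<Longrightarrow> t \<in> {0<..<1} \<Longrightarrow> P (s, t) = \<Phi> (h (s, t))"
    using prim_along_homotopy[OF W(1) Dk_open[OF k] W(2,4) homotD(2)[OF H] homotD(7)[OF H] h0W \<Phi>] by blast
  obtain \<beta> where \<beta>: "\<And>t. t \<in> {0<..<1} \<Longrightarrow> \<beta> (p t) = P (0, t)"
    "\<And>\<tau>. \<tau> \<in> \<Delta> k \<Longrightarrow> (\<beta> has_vector_derivative G (complex_of_real \<tau>)) (at \<tau>)"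
    using homot_real_primitive[OF H P] by blast
  have GR: "G (complex_of_real \<tau>) = quad k \<Lambda> \<phi> (complex_of_real \<tau>)" if "\<tau> \<in> \<Delta> k" "\<tau> \<notin> \<Lambda>" for \<tau>
  proof (rule G)
    show "complex_of_real \<tau> \<in> W" using that(1) W(3) by blast
    show "complex_of_real \<tau> \<notin> complex_of_real ` \<Lambda>" using that(2) by (auto dest: of_real_eq_iff[THEN iffD1])
  qed
  have GD: "G w = quad k \<Lambda> \<phi> w" if "w \<in> Dk k \<union> complex_of_real ` \<Delta> k" "w \<notin> complex_of_real ` \<Lambda>" for w
    using G[of w] that W(2,3) by blast
  define C where "C = (\<Sum>l\<in>\<Lambda>. norm (\<phi> l))\<^sup>2 * (16 / d0\<^sup>2 + 16)"
  have C0: "C \<ge> 0" by (simp add: C_def)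
  note qe = quad_end_bounds[OF k \<Lambda> \<phi>(2) GD C_def]
  have half: "(1 / 2 :: real) \<in> {0<..<1}" by simp
  have P1: "prim_along G h P ({0..1} \<times> {0<..1 / 2})" by (rule prim_along_subset[OF P]) auto
  have P2: "prim_along G h P ({0..1} \<times> {1 / 2..<1})" by (rule prim_along_subset[OF P]) auto
  have ends: "\<exists>\<^sub>F t in at_right 0. cmod (P (1, t) - P (0, t)) < e" "\<exists>\<^sub>F t in at_left 1. cmod (P (1, t) - P (0, t)) < e" if "e > 0" for e
    using end_estimates[OF H \<Phi> half P1 half P2 P\<Phi> C0 qe(1) qe(2) that] by simp_all
  have arc: "cmod (P (1, b) - P (1, a)) \<le> \<kappa> * v" if ab: "0 < a" "a < b" "b < 1" for a b
  proof -
    have sub: "{a..b} \<subseteq> {0<..<1}" using ab by auto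
    obtain L where L: "length_le (\<Gamma> k) {a..b} L" using Gamma_length[OF k ab(1,3)] .
    have \<Gamma>c: "continuous_on {a..b} (\<Gamma> k)" using Gamma_facts(1)[OF k] sub continuous_on_subset by blast
    have Kc: "continuous_on {a..b} (\<lambda>t. norm (K' k (\<Gamma> k t)))"
    proof (intro continuous_on_norm continuous_on_compose2[OF _ \<Gamma>c])
      show "continuous_on (Dk k) (K' k)" using K'_isCont Dk_U(1)[OF k] by (intro continuous_at_imp_continuous_on) blast
      show "\<Gamma> k ` {a..b} \<subseteq> Dk k" using Gamma_in_Dk[OF k] sub by blast
    qed
    obtain I where I: "has_RS_integral (\<lambda>t u v. dist (\<Gamma> k u) (\<Gamma> k v) * norm (K' k (\<Gamma> k t))) I a b"
      "ennreal I \<le> arc_length_integral (\<Gamma> k) (\<lambda>\<mu>. norm (K' k \<mu>))"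
      by (rule arc_length_integral_ge[OF L \<Gamma>c Kc ab])
    have Iv: "I \<le> v" using order_trans[OF I(2) arc_part[OF k]] v(2) by (simp add: ennreal_le_iff)
    have pa: "prim_along G (\<Gamma> k) (\<lambda>t. \<Phi> (\<Gamma> k t)) {a..b}"
      using Gamma_in_Dk[OF k] sub by (intro prim_along_of_primitive[OF \<Gamma>c _ Dk_open[OF k] \<Phi>]) auto
    have bd: "cmod (G (\<Gamma> k t)) \<le> \<kappa> * norm (K' k (\<Gamma> k t))" if "t \<in> {a..b}" for t
    proof -
      have t: "t \<in> {0<..<1}" using that sub by blast
      have "\<Gamma> k t \<notin> complex_of_real ` \<Lambda>" using Dk_not_real[OF k Gamma_in_Dk[OF k t]] by blast
      then have "G (\<Gamma> k t) = quad k \<Lambda> \<phi> (\<Gamma> k t)" using Gamma_in_Dk[OF k t] by (intro GD) auto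
      then show ?thesis using quad_Gamma_bound[OF k t \<phi>] by (simp add: \<kappa>_def)
    qed
    have "\<kappa> \<ge> 0" by (simp add: \<kappa>_def)
    have "cmod (\<Phi> (\<Gamma> k b) - \<Phi> (\<Gamma> k a)) \<le> \<kappa> * I"
      by (rule prim_along_bound_RS(1)[OF pa ab(2) I(1) bd \<open>\<kappa> \<ge> 0\<close> L])
    also have "\<dots> \<le> \<kappa> * v" using Iv by (intro mult_left_mono) (auto simp: \<kappa>_def)
    finally show ?thesis using P\<Phi>[of 1 a] P\<Phi>[of 1 b] homotD(6)[OF H, of a] homotD(6)[OF H, of b] ab by simp
  qed
  have mono: "p s \<le> p t" if "s \<in> {0<..<1}" "t \<in> {0<..<1}" "s \<le> t" for s t
    using strict_mono_on_leD[OF homotD(3)[OF H] that] .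
  \<comment> \<open>Closeness across the homotopy is known only for some parameters near the ends.
    Enlarging the interval to such parameters is harmless, as it only increases the mass.\<close>
  have piece: "(norm (E0 {p a0..<p b0} y))\<^sup>2 \<le> \<kappa> * v" if ab0: "a0 \<in> {0<..<1}" "b0 \<in> {0<..<1}" "a0 \<le> b0" for a0 b0
  proof (rule field_le_epsilon)
    fix e :: real assume e: "e > 0"
    have "\<forall>\<^sub>F t in at_right 0. t \<in> {0<..<a0}" using ab0 by (intro eventually_at_right_real) auto
    from frequently_ex[OF frequently_eventually_frequently[OF ends(1)[of "e / 2"] this]]
    obtain a where a: "cmod (P (1, a) - P (0, a)) < e / 2" "a \<in> {0<..<a0}" using e by auto
    have "\<forall>\<^sub>F t in at_left 1. t \<in> {b0<..<1}" using ab0 by (intro eventually_at_left_real) auto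
    from frequently_ex[OF frequently_eventually_frequently[OF ends(2)[of "e / 2"] this]]
    obtain b where b: "cmod (P (1, b) - P (0, b)) < e / 2" "b \<in> {b0<..<1}" using e by auto
    have ab: "0 < a" "a < b" "b < 1" "a \<in> {0<..<1}" "b \<in> {0<..<1}" using a(2) b(2) ab0 by auto
    have "{p a0..<p b0} \<subseteq> {p a..<p b}" using mono[of a a0] mono[of b0 b] a(2) b(2) ab0 by auto
    then have "norm (E0 {p a0..<p b0} y) \<le> norm (E0 {p a..<p b} y)" by (intro norm_mono) auto
    then have "(norm (E0 {p a0..<p b0} y))\<^sup>2 \<le> (norm (E0 {p a..<p b} y))\<^sup>2" by (intro power_mono) auto
    also have "\<dots> = Re (\<beta> (p b) - \<beta> (p a))"
      unfolding y_def using mono[of a b] ab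
      by (intro Delta_mass_increment[OF k \<Lambda> x GR \<beta>(2)] homot_to_real(3)[OF H]) auto
    also have "\<dots> = Re (P (0, b) - P (0, a))" using \<beta>(1) ab by simp
    also have "\<dots> \<le> cmod (P (0, b) - P (0, a))" by (rule complex_Re_le_cmod)
    also have "P (0, b) - P (0, a) = (P (1, b) - P (1, a)) - (P (1, b) - P (0, b)) + (P (1, a) - P (0, a))" by simp
    also have "cmod \<dots> \<le> cmod (P (1, b) - P (1, a)) + cmod (P (1, b) - P (0, b)) + cmod (P (1, a) - P (0, a))"
      by (rule norm_diff_add_le)
    finally show "(norm (E0 {p a0..<p b0} y))\<^sup>2 \<le> \<kappa> * v + e" using arc[OF ab(1,2,3)] a(1) b(1) by linarith
  qed
  \<comment> \<open>Starting at 1 / 2 ensures c n <= 1 - c n; the intervals S n increase to \<Delta>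
    k.\<close>
  define c where "c n = inverse (real (Suc (Suc n)))" for n
  have c: "c n \<in> {0<..<1}" "1 - c n \<in> {0<..<1}" "c n \<le> 1 - c n" "c (Suc n) \<le> c n" for n
    by (auto simp: c_def field_simps)
  have clim: "c \<longlonglongrightarrow> 0" unfolding c_def[abs_def] by (rule LIMSEQ_Suc[OF LIMSEQ_inverse_real_of_nat])
  define S where "S n = {p (c n)..<p (1 - c n)}" for n
  have lt: "p s < p t" if "s \<in> {0<..<1}" "t \<in> {0<..<1}" "s < t" for s t
    using homotD(3)[OF H] that unfolding strict_mono_on_def by blast
  have un: "(\<Union>n. S n) = \<Delta> k"
  proof (intro equalityI subsetI)
    fix \<tau> assume "\<tau> \<in> (\<Union>n. S n)"
    then obtain n where n: "\<tau> \<in> S n" by blast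
    have "p (c n) \<in> \<Delta> k" "p (1 - c n) \<in> \<Delta> k" using homot_to_real(3)[OF H] c by blast+
    then show "\<tau> \<in> \<Delta> k" using Delta_Icc[of "p (c n)" k "p (1 - c n)"] n by (auto simp: S_def)
  next
    fix \<tau> assume "\<tau> \<in> \<Delta> k"
    then have "\<tau> \<in> p ` {0<..<1}" using homotD(4)[OF H] by simp
    then obtain t where t: "t \<in> {0<..<1}" "\<tau> = p t" by (rule imageE) simp
    have "\<forall>\<^sub>F n in sequentially. c n < min t (1 - t)" using t(1) by (intro order_tendstoD(2)[OF clim]) auto
    then obtain n where n: "c n < min t (1 - t)" using eventually_happens'[OF sequentially_bot] by blast
    have "p (c n) < p t" "p t < p (1 - c n)" using n t(1) c[of n] by (auto intro!: lt)
    then show "\<tau> \<in> (\<Union>n. S n)" using t(2) by (auto simp: S_def intro!: exI[of _ n])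
  qed
  have inc: "incseq S"
  proof (rule incseq_SucI)
    fix n show "S n \<subseteq> S (Suc n)"
      using mono[OF c(1) c(1) c(4), of n] mono[OF c(2) c(2), of n "Suc n"] c(4)[of n] unfolding S_def by auto
  qed
  interpret N: finite_measure "\<nu> y" by (rule finite_nu)
  have "(\<lambda>n. measure (\<nu> y) (S n)) \<longlonglongrightarrow> measure (\<nu> y) (\<Union>n. S n)"
    by (rule N.finite_Lim_measure_incseq[OF _ inc]) (auto simp: S_def)
  moreover have "measure (\<nu> y) (S n) = (norm (E0 (S n) y))\<^sup>2" for n by (rule measure_nu) (simp add: S_def)
  moreover have "measure (\<nu> y) (\<Delta> k) = (norm (E0 (\<Delta> k) y))\<^sup>2" by (rule measure_nu[OF Delta_borel])
  ultimately have "(\<lambda>n. (norm (E0 (S n) y))\<^sup>2) \<longlonglongrightarrow> (norm (E0 (\<Delta> k) y))\<^sup>2" by (simp only: un)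
  then have "(norm (E0 (\<Delta> k) y))\<^sup>2 \<le> \<kappa> * v"
    by (rule LIMSEQ_le_const2) (use piece[OF c(1,2,3)] in \<open>auto simp: S_def\<close>)
  then show ?thesis by (simp add: \<kappa>_def y_def)
qed

text \<open>Each of the m intervals contributes at most \<kappa> * v, the set \<sigma>' at most
  twice that, and the complement of the spectrum nothing; this is the factor m + 2.\<close>

lemma solution_sum_bound:
  assumes \<Lambda>: "finite \<Lambda>"
    and \<phi>: "\<And>l. l \<in> \<Lambda> \<Longrightarrow> \<phi> l \<in> eigenspace H1 (complex_of_real l)" "\<And>l. l \<in> \<Lambda> \<Longrightarrow> eigval l"
    and x: "\<And>l. l \<in> \<Lambda> \<Longrightarrow> x l \<in> op_dom A0" "\<And>l. l \<in> \<Lambda> \<Longrightarrow> shift l (x l) = B01 (\<phi> l)"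
  shows "(norm (\<Sum>l\<in>\<Lambda>. x l))\<^sup>2 \<le> (real m + 2) * (2 / d0)\<^sup>2 * v * (norm (\<Sum>l\<in>\<Lambda>. \<phi> l))\<^sup>2"
proof -
  define \<kappa> where "\<kappa> = (2 / d0 * norm (\<Sum>l\<in>\<Lambda>. \<phi> l))\<^sup>2"
  define y where "y = (\<Sum>l\<in>\<Lambda>. x l)"
  interpret N: finite_measure "\<nu> y" by (rule finite_nu)
  let ?D = "\<Union>k\<in>{1..m}. \<Delta> k"
  let ?N = "- real_spectrum A0"
  have Dm: "?D \<in> sets borel" using Delta_borel by auto
  have Nm: "?N \<in> sets borel" using real_spectrum_closed by auto
  have mD: "measure (\<nu> y) ?D \<le> (\<Sum>k\<in>{1..m}. measure (\<nu> y) (\<Delta> k))"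
    by (rule N.finite_measure_subadditive_finite) (auto simp: Delta_borel)
  also have "\<dots> \<le> (\<Sum>k\<in>{1..m}. \<kappa> * v)"
  proof (rule sum_mono)
    fix k assume k: "k \<in> {1..m}"
    show "measure (\<nu> y) (\<Delta> k) \<le> \<kappa> * v"
      using Delta_bound[OF k \<Lambda> \<phi> x] by (simp add: measure_nu[OF Delta_borel] \<kappa>_def y_def)
  qed
  finally have D: "measure (\<nu> y) ?D \<le> real m * (\<kappa> * v)" by simp
  have S: "measure (\<nu> y) \<sigma>' \<le> 2 * \<kappa> * v"
    using sigma'_bound[OF \<Lambda> \<phi> x] by (simp add: measure_nu[OF sigma'_borel] \<kappa>_def y_def)
  have N: "measure (\<nu> y) ?N = 0" by (simp add: measure_nu[OF Nm] off_spectrum_zero)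
  have "UNIV = (\<sigma>' \<union> ?D) \<union> ?N" using Delta_spectrum unfolding sigma'_def by blast
  then have "measure (\<nu> y) UNIV = measure (\<nu> y) ((\<sigma>' \<union> ?D) \<union> ?N)" by (simp only:)
  also have "\<dots> \<le> measure (\<nu> y) (\<sigma>' \<union> ?D) + measure (\<nu> y) ?N" using sigma'_borel Dm Nm by (intro measure_Un_le) auto
  also have "\<dots> \<le> (measure (\<nu> y) \<sigma>' + measure (\<nu> y) ?D) + measure (\<nu> y) ?N"
    using sigma'_borel Dm by (intro add_right_mono measure_Un_le) auto
  also have "\<dots> \<le> 2 * \<kappa> * v + real m * (\<kappa> * v)" using S D N by linarith
  also have "\<dots> = (real m + 2) * (2 / d0)\<^sup>2 * v * (norm (\<Sum>l\<in>\<Lambda>. \<phi> l))\<^sup>2"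
    by (simp only: \<kappa>_def power_mult_distrib) (simp add: algebra_simps)
  finally show ?thesis using measure_nu[of UNIV y] by (simp add: UNIV_id y_def)
qed

end

section \<open>From orthonormality in the sum space to the Riesz basis\<close>

theorem theorem7:
  fixes A0 :: "'h0::chilbert_space lop" and A1 :: "'h1::chilbert_space lop"
    and B01 :: "'h1 \<Rightarrow>\<^sub>L 'h0" and B10 :: "'h0 \<Rightarrow>\<^sub>L 'h1"
    and E0 :: "real set \<Rightarrow> ('h0 \<Rightarrow>\<^sub>L 'h0)"
    and m :: nat and \<mu>1 \<mu>2 :: "nat \<Rightarrow> ereal"
    and Dm :: "nat \<Rightarrow> complex set" and K' :: "nat \<Rightarrow> complex \<Rightarrow> ('h1 \<Rightarrow>\<^sub>L 'h1)"
    and l :: "nat \<Rightarrow> int" and \<Gamma> :: "nat \<Rightarrow> real \<Rightarrow> complex"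
    and X :: "'h1 \<Rightarrow>\<^sub>L 'h1" and H1 :: "'h1 lop" and d0 :: real and V0 :: ennreal
    and \<psi> :: "real \<Rightarrow> nat \<Rightarrow> 'h1"
  assumes separable: "separable_space (euclidean :: 'h0 topology)"
      "separable_space (euclidean :: 'h1 topology)"
    and A0: "self_adjoint A0" and A1: "self_adjoint A1"
    and B01: "clinear_op B01" and B10: "is_adjoint B01 B10"
    and E0: "spectral_measure_of A0 E0"
    and spectral: "spectral_assumptions A0 A1 m \<mu>1 \<mu>2"
    and analyticity: "analyticity_assumptions (K_B B10 E0 B01) m \<mu>1 \<mu>2 Dm K'"
    and l: "\<forall>k\<in>{1..m}. l k \<in> {1, -1}"
    and contour: "is_contour A0 m \<mu>1 \<mu>2 Dm K' l \<Gamma>"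
    and V0: "V0 = modified_variation A0 E0 B01 B10 m \<mu>1 \<mu>2 K' \<Gamma>"
    and d0: "d0 = dist0 A0 A1 m \<mu>1 \<mu>2 \<Gamma>"
    and K_B_bounded: "V0 < \<infinity>"
    and small: "V0 < ennreal (d0\<^sup>2 / 4)"
    and X: "clinear_op X"
      "has_V1 A0 E0 B01 B10 m \<mu>1 \<mu>2 K' \<Gamma> (op_plus A1 X) X"
      "norm X \<le> d0 / 2 - sqrt (d0\<^sup>2 / 4 - enn2real V0)"
    and H1: "H1 = op_plus A1 X"
    and eigenvectors: "\<forall>lam\<in>sigma_pri H1.
      (\<forall>j\<in>mult_index H1 lam. \<psi> lam j \<noteq> 0 \<and> \<psi> lam j \<in> eigenspace H1 (complex_of_real lam)) \<and>
      closure (cspan (\<psi> lam ` mult_index H1 lam)) = eigenspace H1 (complex_of_real lam)"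
    and orthonormal: "orthonormal_on (SIGMA lam:sigma_pri H1. mult_index H1 lam)
      (\<lambda>(lam, j). lift_vector A0 B01 lam (\<psi> lam j))"
  shows "riesz_basis_of (SIGMA lam:sigma_pri H1. mult_index H1 lam)
    (\<lambda>(lam, j). \<psi> lam j)
    (closure (cspan {\<psi> lam j | lam j. lam \<in> sigma_pri H1 \<and> j \<in> mult_index H1 lam}))"
proof -
  interpret M: matrix_setting E0 A0 A1 B01 B10 m \<mu>1 \<mu>2 Dm K' l \<Gamma> X H1 d0 V0
    by (unfold_locales; (fact | use E0 in \<open>simp add: spectral_measure_of_def\<close>))
  define I where "I = (SIGMA lam:sigma_pri H1. mult_index H1 lam)"
  define f where "f = (\<lambda>(lam, j). \<psi> lam j)"
  define g where "g i = inverse_apply A0 (complex_of_real (fst i)) (B01 (f i))" for i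
  \<comment> \<open>The constant of the bound for the solutions; it does not involve the finite
    subset F, so the norm comparison is uniform.\<close>
  define C where "C = (real m + 2) * (2 / d0)\<^sup>2 * M.v"
  have C: "C \<ge> 0" using M.v(2) by (simp add: C_def)
  have f: "f i \<in> eigenspace H1 (complex_of_real (fst i))" "M.eigval (fst i)" if "i \<in> I" for i
    using eigenvectors that by (auto simp: I_def f_def M.eigval_def sigma_pri_def)
  note g = M.inverse_apply_solution[OF f(2,1), folded g_def]
  have bounds: "(\<Sum>i\<in>F. (cmod (a i))\<^sup>2) \<le> (1 + C) * (norm (\<Sum>i\<in>F. a i *\<^sub>C f i))\<^sup>2"
    "(norm (\<Sum>i\<in>F. a i *\<^sub>C f i))\<^sup>2 \<le> 1 * (\<Sum>i\<in>F. (cmod (a i))\<^sup>2)" if F: "finite F" "F \<subseteq> I" for F a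
  proof -
    \<comment> \<open>The bound for the solutions takes one vector per eigenvalue, so the terms are
      grouped: each group lies in one eigenspace, and the same combination of the g i solves its
      equation.\<close>
    define \<phi> where "\<phi> lam = (\<Sum>i | i \<in> F \<and> fst i = lam. a i *\<^sub>C f i)" for lam
    define x where "x lam = (\<Sum>i | i \<in> F \<and> fst i = lam. a i *\<^sub>C g i)" for lam
    have sums: "(\<Sum>i\<in>F. a i *\<^sub>C f i) = (\<Sum>lam\<in>fst ` F. \<phi> lam)" "(\<Sum>i\<in>F. a i *\<^sub>C g i) = (\<Sum>lam\<in>fst ` F. x lam)"
      unfolding \<phi>_def x_def by (rule sum.image_gen[OF F(1)])+
    have gd: "a i *\<^sub>C g i \<in> op_dom A0" if "i \<in> F" for i
      using that F(2) g(1) by (intro cvs.subspace_scale[OF M.dom_sub]) blast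
    have "(norm (\<Sum>lam\<in>fst ` F. x lam))\<^sup>2 \<le> (real m + 2) * (2 / d0)\<^sup>2 * M.v * (norm (\<Sum>lam\<in>fst ` F. \<phi> lam))\<^sup>2"
    proof (rule M.solution_sum_bound)
      fix lam assume "lam \<in> fst ` F"
      then show "M.eigval lam" using f(2) F(2) by auto
      show "\<phi> lam \<in> eigenspace H1 (complex_of_real lam)"
        unfolding \<phi>_def using f(1) F(2) by (intro cvs.subspace_sum cvs.subspace_scale M.csubspace_eigenspace) auto
      show "x lam \<in> op_dom A0" unfolding x_def using gd by (intro cvs.subspace_sum[OF M.dom_sub]) auto
      have "op_app A0 (x lam) = (\<Sum>i | i \<in> F \<and> fst i = lam. op_app A0 (a i *\<^sub>C g i))"
        unfolding x_def using gd by (intro self_adjoint_sum[OF A0]) auto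
      then have "op_app A0 (x lam) - complex_of_real lam *\<^sub>C x lam
         = (\<Sum>i | i \<in> F \<and> fst i = lam. op_app A0 (a i *\<^sub>C g i) - complex_of_real lam *\<^sub>C (a i *\<^sub>C g i))"
        by (simp add: x_def cvs.scale_sum_right sum_subtractf)
      also have "\<dots> = (\<Sum>i | i \<in> F \<and> fst i = lam. a i *\<^sub>C B01 (f i))"
      proof (rule sum.cong[OF refl])
        fix i assume i: "i \<in> {i \<in> F. fst i = lam}"
        then have iI: "i \<in> I" using F(2) by blast
        show "op_app A0 (a i *\<^sub>C g i) - complex_of_real lam *\<^sub>C (a i *\<^sub>C g i) = a i *\<^sub>C B01 (f i)"
          using M.shift_scale[where a = lam and c = "a i", OF g(1)[OF iI]] g(2)[OF iI] i iI by simp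
      qed
      also have "\<dots> = B01 (\<phi> lam)" unfolding \<phi>_def by (rule clinear_op_sum[OF B01, symmetric])
      finally show "op_app A0 (x lam) - complex_of_real lam *\<^sub>C x lam = B01 (\<phi> lam)" .
    qed (use F in simp)
    then have le: "(norm (\<Sum>i\<in>F. a i *\<^sub>C g i))\<^sup>2 \<le> C * (norm (\<Sum>i\<in>F. a i *\<^sub>C f i))\<^sup>2" by (simp add: sums C_def)
    \<comment> \<open>Pythagoras in the sum space: the coefficient norm is the sum of the two
      component norms. Dropping the first component gives the upper bound with constant 1,
      estimating it by the second gives the lower bound with 1 + C.\<close>
    have "(\<Sum>i\<in>F. a i *\<^sub>C (- g i, f i)) = (- (\<Sum>i\<in>F. a i *\<^sub>C g i), \<Sum>i\<in>F. a i *\<^sub>C f i)"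
      by (rule prod_eqI) (simp_all add: fst_sum snd_sum scaleC_prod_def sum_negf)
    then have "(norm (\<Sum>i\<in>F. a i *\<^sub>C (- g i, f i)))\<^sup>2 = (norm (\<Sum>i\<in>F. a i *\<^sub>C g i))\<^sup>2 + (norm (\<Sum>i\<in>F. a i *\<^sub>C f i))\<^sup>2"
      by (simp add: norm_prod_def)
    moreover have "(norm (\<Sum>i\<in>F. a i *\<^sub>C (- g i, f i)))\<^sup>2 = (\<Sum>i\<in>F. (cmod (a i))\<^sup>2)"
    proof (rule norm_orthonormal_sum[OF F(1)])
      fix i j assume "i \<in> F" "j \<in> F"
      then have "i \<in> I" "j \<in> I" using F(2) by auto
      then show "cinner (- g i, f i) (- g j, f j) = (if i = j then 1 else 0)"
        using orthonormal unfolding orthonormal_on_def I_def[symmetric] lift_vector_def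
        by (force simp: g_def f_def case_prod_unfold)
    qed
    ultimately have eq: "(\<Sum>i\<in>F. (cmod (a i))\<^sup>2) = (norm (\<Sum>i\<in>F. a i *\<^sub>C g i))\<^sup>2 + (norm (\<Sum>i\<in>F. a i *\<^sub>C f i))\<^sup>2" by simp
    show "(\<Sum>i\<in>F. (cmod (a i))\<^sup>2) \<le> (1 + C) * (norm (\<Sum>i\<in>F. a i *\<^sub>C f i))\<^sup>2"
      using le by (simp add: eq distrib_right)
    show "(norm (\<Sum>i\<in>F. a i *\<^sub>C f i))\<^sup>2 \<le> 1 * (\<Sum>i\<in>F. (cmod (a i))\<^sup>2)" by (simp add: eq)
  qed
  have "riesz_basis_of I f (closure (cspan (f ` I)))"
    by (rule riesz_basis_of_bounds[where c = "1 + C" and C = 1]) (use C bounds in auto)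
  moreover have "f ` I = {\<psi> lam j | lam j. lam \<in> sigma_pri H1 \<and> j \<in> mult_index H1 lam}"
    unfolding f_def I_def by force
  ultimately show ?thesis unfolding I_def f_def by simp
qed

end
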